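(* Let $d\ge 1$ and let $U\in C^2(\mathbb{R}^d)$ with $U(x)\to\infty$ as $|x|\to\infty$. Let $\mu(\mathrm{d}x\,\mathrm{d}v)=Z^{-1}e^{-U(x)-|v|^2/2}\,\mathrm{d}x\,\mathrm{d}v$ be the Gibbs probability measure on $\mathbb{R}^{2d}$, and let $\mu_x(\mathrm{d}x)\propto e^{-U(x)}\,\mathrm{d}x$ be its position marginal. Assume: (i) $\mu_x$ satisfies the Poincaré inequality with constant $m>0$: $\|g\|_{L^2(\mu_x)}^2\le \frac1m\|\nabla_x g\|_{L^2(\mu_x)}^2$ for all $g\in L^2(\mu_x)$ with $\int g\,\mathrm{d}\mu_x=0$ and $\nabla_x g\in L^2(\mu_x)$; (ii) $\nabla^2U(x)\ge -K\,\mathrm{Id}$ for all $x\in\mathbb{R}^d$, for some $K\ge 0$. For a friction coefficient $\gamma>0$ let $$\mathcal{L}f=(v\cdot\nabla_x-\nabla_xU\cdot\nabla_v)f+\gamma(-v\cdot\nabla_v+\Delta_v)f,$$ and let $(e^{t\mathcal{L}})_{t\ge0}$ be the strongly continuous contraction semigroup on $L^2_0(\mu)$ generated by the closure of $\mathcal{L}$ defined on $C_c^\infty(\mathbb{R}^{2d})\cap L^2_0(\mu)$. For $f_0\in L^2_0(\mu)$ set $f(t)=e^{t\mathcal{L}}f_0$. If $\gamma=\sqrt{16m+2K}$, then for all $t\ge0$, $$\|f(t)\|_{L^2(\mu)}\le\sqrt3\,e^{-\Lambda t}\|f_0\|_{L^2(\mu)},\qquad \Lambda=\frac16\,\frac{\sqrt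 m}{\sqrt{2+\frac{K}{2m}}+\sqrt{4+\frac{K}{2m}}}.$$ In particular, when $U$ is convex ($K=0$), the choice $\gamma=4\sqrt m$ yields the rate $\Lambda=\frac{2-\sqrt2}{12}\sqrt m$.
   Context: $L^2(\pi)$ denotes the real Hilbert space with inner product $\langle f,g\rangle_{L^2(\pi)}=\int fg\,\mathrm{d}\pi$, and $L^2_0(\pi)=\{f\in L^2(\pi):\int f\,\mathrm{d}\pi=0\}$. The operator $\mathcal{L}$ is the generator of the underdamped Langevin dynamics $\mathrm{d}X_t=V_t\,\mathrm{d}t$, $\mathrm{d}V_t=-\nabla U(X_t)\mathrm{d}t-\gamma V_t\mathrm{d}t+\sqrt{2\gamma}\,\mathrm{d}W_t$, i.e. $f(t)$ solves the backward Kolmogorov equation $\partial_tf=\mathcal{L}f$. *)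

theory Defs
  imports "HOL-Analysis.Analysis"
begin

fun dderiv :: "('a::real_normed_vector \<Rightarrow> real) \<Rightarrow> 'a list \<Rightarrow> 'a \<Rightarrow> real" where
  "dderiv f [] = f"
| "dderiv f (e # es) = (\<lambda>z. frechet_derivative (dderiv f es) (at z) e)"

definition Ck :: "nat \<Rightarrow> ('a::euclidean_space \<Rightarrow> real) \<Rightarrow> bool" where
  "Ck k f \<longleftrightarrow>
     (\<forall>es. set es \<subseteq> Basis \<and> length es < k \<longrightarrow> (\<forall>z. dderiv f es differentiable (at z))) \<and>
     (\<forall>es. set es \<subseteq> Basis \<and> length es \<le> k \<longrightarrow> continuous_on UNIV (dderiv f es))"

definition smooth :: "('a::euclidean_space \<Rightarrow> real) \<Rightarrow> bool" where
  "smooth f \<longleftrightarrow> (\<forall>k. Ck k f)"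

definition Cc_infty :: "('a::euclidean_space \<Rightarrow> real) set" where
  "Cc_infty = {f. smooth f \<and> compact (closure {z. f z \<noteq> 0})}"

definition gibbs :: "('a::euclidean_space \<Rightarrow> real) \<Rightarrow> ('a \<times> 'a) measure" where
  "gibbs U = density lborel (\<lambda>(x, v). ennreal (exp (- U x - (norm v)\<^sup>2 / 2) /
      (\<integral>(y, w::'a). exp (- U y - (norm w)\<^sup>2 / 2) \<partial>lborel)))"

definition gibbs_x :: "('a::euclidean_space \<Rightarrow> real) \<Rightarrow> 'a measure" where
  "gibbs_x U = density lborel (\<lambda>x. ennreal (exp (- U x) / (\<integral>y. exp (- U y) \<partial>lborel)))"

section \<open>L^2 and L^2_0 (on functions, i.e. up to null sets via the seminorm)\<close>

definition L2 :: "'b measure \<Rightarrow> ('b \<Rightarrow> real) set" where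
  "L2 M = {f. f \<in> borel_measurable M \<and> integrable M (\<lambda>z. (f z)\<^sup>2)}"

definition L2_0 :: "'b measure \<Rightarrow> ('b \<Rightarrow> real) set" where
  "L2_0 M = {f \<in> L2 M. integral\<^sup>L M f = 0}"

definition l2norm :: "'b measure \<Rightarrow> ('b \<Rightarrow> real) \<Rightarrow> real" where
  "l2norm M f = sqrt (\<integral>z. (f z)\<^sup>2 \<partial>M)"

definition langevin_op ::
  "('a::euclidean_space \<Rightarrow> real) \<Rightarrow> real \<Rightarrow> ('a \<times> 'a \<Rightarrow> real) \<Rightarrow> ('a \<times> 'a \<Rightarrow> real)" where
  "langevin_op U \<gamma> f = (\<lambda>(x, v).
      frechet_derivative f (at (x, v)) (v, 0)
    - (\<Sum>i\<in>Basis. frechet_derivative U (at x) i * frechet_derivative f (at (x, v)) (0, i))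
    - \<gamma> * frechet_derivative f (at (x, v)) (0, v)
    + \<gamma> * (\<Sum>i\<in>Basis. dderiv f [(0, i), (0, i)] (x, v)))"

definition contraction_semigroup_L2_0 ::
  "'b measure \<Rightarrow> (real \<Rightarrow> ('b \<Rightarrow> real) \<Rightarrow> ('b \<Rightarrow> real)) \<Rightarrow> bool" where
  "contraction_semigroup_L2_0 M T \<longleftrightarrow>
     (\<forall>t f. 0 \<le> t \<and> f \<in> L2_0 M \<longrightarrow> T t f \<in> L2_0 M) \<and>
     (\<forall>f\<in>L2_0 M. l2norm M (\<lambda>z. T 0 f z - f z) = 0) \<and>
     (\<forall>s t f. 0 \<le> s \<and> 0 \<le> t \<and> f \<in> L2_0 M \<longrightarrow>
         l2norm M (\<lambda>z. T (s + t) f z - T s (T t f) z) = 0) \<and>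
     (\<forall>t f g a b. 0 \<le> t \<and> f \<in> L2_0 M \<and> g \<in> L2_0 M \<longrightarrow>
         l2norm M (\<lambda>z. T t (\<lambda>y. a * f y + b * g y) z - (a * T t f z + b * T t g z)) = 0) \<and>
     (\<forall>t f. 0 \<le> t \<and> f \<in> L2_0 M \<longrightarrow> l2norm M (T t f) \<le> l2norm M f) \<and>
     (\<forall>f\<in>L2_0 M. ((\<lambda>t. l2norm M (\<lambda>z. T t f z - f z)) \<longlongrightarrow> 0) (at_right 0))"

definition sg_generator_graph ::
  "'b measure \<Rightarrow> (real \<Rightarrow> ('b \<Rightarrow> real) \<Rightarrow> ('b \<Rightarrow> real)) \<Rightarrow> ('b \<Rightarrow> real) \<Rightarrow> ('b \<Rightarrow> real) \<Rightarrow> bool" where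
  "sg_generator_graph M T f g \<longleftrightarrow> f \<in> L2_0 M \<and> g \<in> L2_0 M \<and>
     ((\<lambda>t. l2norm M (\<lambda>z. (T t f z - f z) / t - g z)) \<longlongrightarrow> 0) (at_right 0)"

definition closure_graph ::
  "'b measure \<Rightarrow> ('b \<Rightarrow> real) set \<Rightarrow> (('b \<Rightarrow> real) \<Rightarrow> ('b \<Rightarrow> real)) \<Rightarrow> ('b \<Rightarrow> real) \<Rightarrow> ('b \<Rightarrow> real) \<Rightarrow> bool" where
  "closure_graph M D A f g \<longleftrightarrow> f \<in> L2_0 M \<and> g \<in> L2_0 M \<and>
     (\<exists>\<phi>. (\<forall>n. \<phi> n \<in> D) \<and>
          (\<lambda>n. l2norm M (\<lambda>z. \<phi> n z - f z)) \<longlonglongrightarrow> 0 \<and>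
          (\<lambda>n. l2norm M (\<lambda>z. A (\<phi> n) z - g z)) \<longlonglongrightarrow> 0)"

end

(* Write T phi = v . grad_x phi, and for the position marginal p of f solve (m + grad^* grad) phi = p
   in L^2(mu_x). The modified energy E(f) = |f|^2 / 2 - eps <f, T phi> with eps = 2 m / gamma satisfies
   |f|^2 / 4 <= E(f) <= 3 |f|^2 / 4, whence the factor sqrt 3. The friction dissipates the part of f
   orthogonal to functions of x by the Gaussian Poincare inequality; the correction term dissipates
   the marginal p, where the Poincare inequality for mu_x enters as a lower bound for the spectrum of
   grad^* grad, and Bochner's formula with Hess U >= -K bounds the second derivatives of phi. For
   gamma^2 = 16 m + 2 K this gives dissipation of E at rate 2 m / (3 gamma) >= 2 Lambda on smooth
   compactly supported f. To stay within such functions, the resolvent equation is solved only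
   approximately: the range of m + grad^* grad on C^3_c is dense, because a mollified weak solution of
   the homogeneous equation, tested against its own cut-off, vanishes. The core property and an
   explicit Euler scheme transfer the decay from smooth functions to the semigroup. *)
theory Submission
  imports Defs "HOL-Probability.Distributions"
begin

section \<open>Partial derivatives and smooth bumps\<close>

text \<open>\<open>U\<close> is only twice continuously differentiable and its Hessian has no upper
  bound, so an exact solution of the resolvent equation need be neither compactly supported nor
  regular enough for Bochner's formula. Every identity is therefore proved for \<open>\<phi>\<close>
  in \<open>Cck 3\<close>, and only inequalities into which the residual enters through its L2 norm
  pass to the limit. The shift is the Poincare constant because on mean zero functions the spectrum
  of \<open>X.H\<close> starts at \<open>m\<close>: there m + \<open>X.H\<close> is at most twice
  \<open>X.H\<close>, while (m + s)^2 >= 4 m s bounds the gradient of the solution by the marginal.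
  The choice of friction amounts to K = \<gamma>^2 / 2 - 8 m, which turns the Hessian bound into a
  multiple of \<gamma>^2; with the given \<open>\<epsilon>\<close> the second-order terms then cost
  less than three quarters of the friction. The norm decays at rate m / (3 \<gamma>), which
  dominates the stated rate. Elements of L2 are functions and not classes, so equality in the
  Hilbert space is a vanishing \<open>l2norm\<close> of a difference.\<close>

definition pd :: "('a::real_normed_vector \<Rightarrow> real) \<Rightarrow> 'a \<Rightarrow> 'a \<Rightarrow> real" where
  "pd f e = (\<lambda>z. frechet_derivative f (at z) e)"

text \<open>The head of the list is differentiated last, so the derivative taken first sits at the
  end. Peeling it off there moves it into the function and makes induction on the order
  possible.\<close>

lemma dderiv_snoc: "dderiv f (es @ [e]) = dderiv (pd f e) es"
  by (induction es) (auto simp: pd_def)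

lemma Ck_0: "Ck 0 f \<longleftrightarrow> continuous_on UNIV f"
  by (auto simp: Ck_def)

text \<open>Replaces the quantification over lists of directions by a recursion on the order,
  through which the closure properties of \<open>Ck\<close> are proved. Continuity of
  \<open>f\<close> itself comes from differentiability.\<close>

lemma Ck_Suc:
  fixes f :: "'a::euclidean_space \<Rightarrow> real"
  shows "Ck (Suc k) f \<longleftrightarrow> (\<forall>z. f differentiable at z) \<and> (\<forall>e\<in>Basis. Ck k (pd f e))"
proof
  assume L: "Ck (Suc k) f"
  have "f differentiable at z" for z
    using L[unfolded Ck_def, THEN conjunct1, rule_format, of "[]"] by auto
  moreover have "Ck k (pd f e)" if "e \<in> Basis" for e
    unfolding Ck_def
  proof (intro conjI allI impI)
    fix es :: "'a list" and z assume "set es \<subseteq> Basis \<and> length es < k"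
    then show "dderiv (pd f e) es differentiable at z"
      using L[unfolded Ck_def, THEN conjunct1, rule_format, of "es @ [e]"] that
      by (auto simp: dderiv_snoc)
  next
    fix es :: "'a list" assume "set es \<subseteq> Basis \<and> length es \<le> k"
    then show "continuous_on UNIV (dderiv (pd f e) es)"
      using L[unfolded Ck_def, THEN conjunct2, rule_format, of "es @ [e]"] that
      by (auto simp: dderiv_snoc)
  qed
  ultimately show "(\<forall>z. f differentiable at z) \<and> (\<forall>e\<in>Basis. Ck k (pd f e))" by auto
next
  assume R: "(\<forall>z. f differentiable at z) \<and> (\<forall>e\<in>Basis. Ck k (pd f e))"
  have c: "continuous_on UNIV f"
    using R by (auto simp: continuous_on_eq_continuous_at differentiable_imp_continuous_within)
  show "Ck (Suc k) f"
    unfolding Ck_def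
  proof (intro conjI allI impI)
    fix es :: "'a list" and z assume *: "set es \<subseteq> Basis \<and> length es < Suc k"
    show "dderiv f es differentiable at z"
    proof (cases es rule: rev_cases)
      case Nil then show ?thesis using R by auto
    next
      case (snoc ys y)
      then show ?thesis using * R unfolding Ck_def by (auto simp: dderiv_snoc)
    qed
  next
    fix es :: "'a list" assume *: "set es \<subseteq> Basis \<and> length es \<le> Suc k"
    show "continuous_on UNIV (dderiv f es)"
    proof (cases es rule: rev_cases)
      case Nil then show ?thesis using c by auto
    next
      case (snoc ys y)
      then show ?thesis using * R unfolding Ck_def by (auto simp: dderiv_snoc)
    qed
  qed
qed

lemma Ck_mono: "Ck k f \<Longrightarrow> j \<le> k \<Longrightarrow> Ck j f"
  unfolding Ck_def by (meson le_trans less_le_trans)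

lemma Ck_continuous: "Ck k f \<Longrightarrow> continuous_on UNIV f"
  using Ck_mono[of k f 0] by (simp add: Ck_0)

lemma Ck_differentiable: "Ck k f \<Longrightarrow> 0 < k \<Longrightarrow> f differentiable at z"
  by (cases k) (auto simp: Ck_Suc)

lemma Ck_pd: "Ck (Suc k) f \<Longrightarrow> e \<in> Basis \<Longrightarrow> Ck k (pd f e)"
  by (auto simp: Ck_Suc)

lemma differentiable_has_derivative:
  "f differentiable at z \<Longrightarrow> (f has_derivative (\<lambda>h. pd f h z)) (at z)"
  by (simp add: pd_def frechet_derivative_works eta_contract_eq)

lemma has_derivative_pd: "(f has_derivative f') (at z) \<Longrightarrow> pd f h z = f' h"
  by (metis frechet_derivative_at pd_def)

lemma pd_expand:
  fixes f :: "'a::euclidean_space \<Rightarrow> real"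
  assumes "f differentiable at z"
  shows "pd f h z = (\<Sum>i\<in>Basis. (h \<bullet> i) * pd f i z)"
proof -
  interpret bounded_linear "\<lambda>h. pd f h z"
    using differentiable_has_derivative[OF assms] by (rule has_derivative_bounded_linear)
  have "pd f h z = pd f (\<Sum>i\<in>Basis. (h \<bullet> i) *\<^sub>R i) z" by (simp add: euclidean_representation)
  also have "\<dots> = (\<Sum>i\<in>Basis. (h \<bullet> i) * pd f i z)" by (simp add: sum scaleR)
  finally show ?thesis .
qed

lemma pd_const [simp]: "pd (\<lambda>z. c) h = (\<lambda>z. 0)"
  by (auto simp: pd_def)

lemma pd_add: "f differentiable at z \<Longrightarrow> g differentiable at z \<Longrightarrow> pd (\<lambda>z. f z + g z) h z = pd f h z + pd g h z"
  by (rule has_derivative_pd) (auto intro!: derivative_eq_intros differentiable_has_derivative)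

lemma pd_diff: "f differentiable at z \<Longrightarrow> g differentiable at z \<Longrightarrow> pd (\<lambda>z. f z - g z) h z = pd f h z - pd g h z"
  by (rule has_derivative_pd) (auto intro!: derivative_eq_intros differentiable_has_derivative)

lemma pd_mult:
  "f differentiable at z \<Longrightarrow> g differentiable at z \<Longrightarrow>
    pd (\<lambda>z. f z * g z) h z = pd f h z * g z + f z * pd g h z"
  by (rule has_derivative_pd) (auto intro!: derivative_eq_intros differentiable_has_derivative)

lemma pd_cmult: "f differentiable at z \<Longrightarrow> pd (\<lambda>z. c * f z) h z = c * pd f h z"
  by (rule has_derivative_pd) (auto intro!: derivative_eq_intros differentiable_has_derivative)

lemma pd_sum:
  "(\<And>i. i \<in> I \<Longrightarrow> f i differentiable at z) \<Longrightarrow> pd (\<lambda>z. \<Sum>i\<in>I. f i z) h z = (\<Sum>i\<in>I. pd (f i) h z)"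
  by (rule has_derivative_pd) (auto intro!: derivative_eq_intros differentiable_has_derivative)

lemma pd_compose:
  fixes g :: "real \<Rightarrow> real"
  assumes "g differentiable at (f z)" "f differentiable at z"
  shows "pd (\<lambda>z. g (f z)) h z = pd g 1 (f z) * pd f h z"
proof (rule has_derivative_pd)
  have "((\<lambda>z. g (f z)) has_derivative (\<lambda>h. pd g (pd f h z) (f z))) (at z)"
    using has_derivative_compose[OF differentiable_has_derivative[OF assms(2)]
        differentiable_has_derivative[OF assms(1)]] .
  moreover have "(\<lambda>h. pd g (pd f h z) (f z)) = (\<lambda>h. pd g 1 (f z) * pd f h z)"
    by (rule ext, subst pd_expand[OF assms(1)]) simp
  ultimately show "((\<lambda>z. g (f z)) has_derivative (\<lambda>h. pd g 1 (f z) * pd f h z)) (at z)"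
    by metis
qed

lemma Ck_const [simp]: "Ck k (\<lambda>z. c)"
  by (induction k arbitrary: c) (auto simp: Ck_0 Ck_Suc)

lemma Ck_add: "Ck k f \<Longrightarrow> Ck k g \<Longrightarrow> Ck k (\<lambda>z. f z + g z)"
proof (induction k arbitrary: f g)
  case 0 then show ?case by (auto simp: Ck_0 intro!: continuous_on_add continuous_on_mult)
next
  case (Suc k)
  then have "pd (\<lambda>z. f z + g z) e = (\<lambda>z. pd f e z + pd g e z)" for e
    by (auto simp: Ck_Suc intro!: ext pd_add)
  with Suc show ?case by (auto simp: Ck_Suc)
qed

lemma Ck_mult: "Ck k f \<Longrightarrow> Ck k g \<Longrightarrow> Ck k (\<lambda>z. f z * g z)"
proof (induction k arbitrary: f g)
  case 0 then show ?case by (auto simp: Ck_0 intro!: continuous_on_add continuous_on_mult)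
next
  case (Suc k)
  then have *: "pd (\<lambda>z. f z * g z) e = (\<lambda>z. pd f e z * g z + f z * pd g e z)" for e
    by (auto simp: Ck_Suc intro!: ext pd_mult)
  have "Ck k f" "Ck k g" using Suc.prems by (auto intro: Ck_mono)
  with Suc * show ?case by (auto simp: Ck_Suc intro!: Ck_add)
qed

lemma Ck_cmult: "Ck k f \<Longrightarrow> Ck k (\<lambda>z. c * f z)"
  by (rule Ck_mult) auto

lemma Ck_minus: "Ck k f \<Longrightarrow> Ck k (\<lambda>z. - f z)"
  using Ck_cmult[of k f "-1"] by simp

lemma Ck_diff: "Ck k f \<Longrightarrow> Ck k g \<Longrightarrow> Ck k (\<lambda>z. f z - g z)"
  using Ck_add[of k f "\<lambda>z. - g z"] by (auto intro: Ck_minus)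

lemma Ck_sum: "(\<And>i. i \<in> I \<Longrightarrow> Ck k (f i)) \<Longrightarrow> Ck k (\<lambda>z. \<Sum>i\<in>I. f i z)"
  by (induction I rule: infinite_finite_induct) (auto intro: Ck_add)

lemma Ck_compose:
  fixes g :: "real \<Rightarrow> real"
  shows "Ck k g \<Longrightarrow> Ck k f \<Longrightarrow> Ck k (\<lambda>z. g (f z))"
proof (induction k arbitrary: g)
  case 0 then show ?case by (simp add: Ck_0) (rule continuous_on_compose2[of UNIV g UNIV f], auto)
next
  case (Suc k)
  have *: "pd (\<lambda>z. g (f z)) e = (\<lambda>z. pd g 1 (f z) * pd f e z)" for e
    using Suc.prems by (auto simp: Ck_Suc intro!: ext pd_compose)
  have "Ck k f" using Suc.prems by (auto intro: Ck_mono)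
  moreover have "(\<lambda>z. g (f z)) differentiable at z" for z
    using Suc.prems differentiable_chain_at[of f z g] by (auto simp: Ck_Suc o_def)
  ultimately show ?case
    using Suc * by (auto simp: Ck_Suc intro!: Ck_mult)
qed

lemma Ck_inner [simp]: "Ck k (\<lambda>z. z \<bullet> a)" and pd_inner [simp]: "pd (\<lambda>z. z \<bullet> a) h = (\<lambda>z. h \<bullet> a)"
proof -
  show *: "pd (\<lambda>z. z \<bullet> a) h = (\<lambda>z. h \<bullet> a)" for h
    by (intro ext has_derivative_pd) (auto intro!: derivative_eq_intros)
  show "Ck k (\<lambda>z. z \<bullet> a)"
    by (cases k) (auto simp: Ck_0 Ck_Suc * intro!: continuous_intros)
qed

lemma Ck_norm_sq: "Ck k (\<lambda>z::'a::euclidean_space. (norm z)\<^sup>2)"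
proof -
  have "Ck k (\<lambda>z::'a. \<Sum>i\<in>Basis. (z \<bullet> i) * (z \<bullet> i))" by (intro Ck_sum Ck_mult Ck_inner)
  moreover have "(\<lambda>z::'a. (norm z)\<^sup>2) = (\<lambda>z. \<Sum>i\<in>Basis. (z \<bullet> i) * (z \<bullet> i))"
    by (simp add: power2_norm_eq_inner euclidean_inner[symmetric])
  ultimately show ?thesis by metis
qed

lemma pd_norm_sq: "pd (\<lambda>z::'a::euclidean_space. (norm z)\<^sup>2) h = (\<lambda>z. 2 * (z \<bullet> h))"
  by (intro ext has_derivative_pd) (auto simp: power2_norm_eq_inner inner_commute intro!: derivative_eq_intros)

text \<open>Affine substitutions treat projections, sections of phase space and reflected kernels in
  one statement.\<close>

lemma pd_chain_lin:
  fixes L :: "'b::real_normed_vector \<Rightarrow> 'c::real_normed_vector" and f :: "'c \<Rightarrow> real"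
  assumes "bounded_linear L" "f differentiable at (L z + a)"
  shows "pd (\<lambda>z. f (L z + a)) h z = pd f (L h) (L z + a)"
    and "(\<lambda>z. f (L z + a)) differentiable at z"
proof -
  have d: "((\<lambda>z. L z + a) has_derivative L) (at z)"
    using bounded_linear_imp_has_derivative[OF assms(1)] by (auto intro!: derivative_eq_intros)
  from has_derivative_compose[OF d differentiable_has_derivative[OF assms(2)]]
  have "((\<lambda>z. f (L z + a)) has_derivative (\<lambda>h. pd f (L h) (L z + a))) (at z)" .
  then show "pd (\<lambda>z. f (L z + a)) h z = pd f (L h) (L z + a)"
    and "(\<lambda>z. f (L z + a)) differentiable at z"
    by (auto simp: has_derivative_pd intro: differentiableI)
qed

lemma Ck_chain_lin:
  fixes L :: "'b::euclidean_space \<Rightarrow> 'c::euclidean_space" and f :: "'c \<Rightarrow> real"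
  assumes L: "bounded_linear L"
  shows "Ck k f \<Longrightarrow> Ck k (\<lambda>z. f (L z + a))"
proof (induction k arbitrary: f)
  case 0
  have "continuous_on UNIV L" using L by (rule linear_continuous_on)
  with 0 show ?case by (auto simp: Ck_0 intro!: continuous_on_compose2[of UNIV f] continuous_intros)
next
  case (Suc k)
  have d: "f differentiable at z" for z using Suc.prems by (auto simp: Ck_Suc)
  have "pd (\<lambda>z. f (L z + a)) e = (\<lambda>z. \<Sum>i\<in>Basis. (L e \<bullet> i) * pd f i (L z + a))" for e
    by (rule ext, subst pd_chain_lin(1)[OF L d], rule pd_expand[OF d])
  with Suc show ?case
    by (auto simp: Ck_Suc d intro!: Ck_sum Ck_cmult pd_chain_lin(2)[OF L])
qed

lemma Ck_fst: "Ck k f \<Longrightarrow> Ck k (\<lambda>z. f (fst z))"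
  using Ck_chain_lin[OF bounded_linear_fst, of k f 0] by simp

lemma Ck_snd: "Ck k f \<Longrightarrow> Ck k (\<lambda>z. f (snd z))"
  using Ck_chain_lin[OF bounded_linear_snd, of k f 0] by simp

lemma pd_fst: "f differentiable at (fst z) \<Longrightarrow> pd (\<lambda>z. f (fst z)) h z = pd f (fst h) (fst z)"
  using pd_chain_lin(1)[OF bounded_linear_fst, of f z 0 h] by simp

lemma pd_snd: "f differentiable at (snd z) \<Longrightarrow> pd (\<lambda>z. f (snd z)) h z = pd f (snd h) (snd z)"
  using pd_chain_lin(1)[OF bounded_linear_snd, of f z 0 h] by simp

lemma pd_0 [simp]: "f differentiable at z \<Longrightarrow> pd f 0 z = 0"
  using differentiable_has_derivative[of f z, THEN has_derivative_bounded_linear]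
  by (rule linear_simps(3))

section \<open>Derivatives along lines and symmetry of second derivatives\<close>

lemma has_real_derivative_pd_line:
  assumes "f differentiable at (z + t *\<^sub>R e)"
  shows "((\<lambda>s. f (z + s *\<^sub>R e)) has_real_derivative pd f e (z + t *\<^sub>R e)) (at t within S)"
proof -
  have d: "((\<lambda>s. z + s *\<^sub>R e) has_derivative (\<lambda>s. s *\<^sub>R e)) (at t within S)"
    by (auto intro!: derivative_eq_intros)
  have b: "bounded_linear (\<lambda>h. pd f h (z + t *\<^sub>R e))"
    using differentiable_has_derivative[OF assms] by (rule has_derivative_bounded_linear)
  have "((\<lambda>s. f (z + s *\<^sub>R e)) has_derivative (\<lambda>s. pd f (s *\<^sub>R e) (z + t *\<^sub>R e))) (at t within S)"
    using has_derivative_compose[OF d differentiable_has_derivative[OF assms]] .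
  moreover have "pd f (s *\<^sub>R e) (z + t *\<^sub>R e) = s * pd f e (z + t *\<^sub>R e)" for s
    using linear_simps(5)[OF b] by simp
  ultimately show ?thesis by (simp add: has_field_derivative_def mult.commute[of _ "pd f e (z + t *\<^sub>R e)"])
qed

text \<open>The mixed second difference is evaluated by the mean value theorem in both orders.\<close>

lemma second_difference_mvt:
  fixes f :: "'a::euclidean_space \<Rightarrow> real"
  assumes f: "Ck 2 f" and a: "a \<in> Basis" and t: "t > 0"
  shows "\<exists>x y. 0 < x \<and> x < t \<and> 0 < y \<and> y < t \<and>
    f (z + t *\<^sub>R a + t *\<^sub>R b) - f (z + t *\<^sub>R a) - f (z + t *\<^sub>R b) + f z
      = t * t * pd (pd f a) b (z + x *\<^sub>R a + y *\<^sub>R b)"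
proof -
  have d: "f differentiable at w" for w using f by (auto intro: Ck_differentiable)
  have d2: "pd f a differentiable at w" for w
    using Ck_pd[of 1 f a] f a by (auto simp: numeral_2_eq_2 intro: Ck_differentiable[of 1])
  define g where "g s = f ((z + t *\<^sub>R b) + s *\<^sub>R a) - f (z + s *\<^sub>R a)" for s
  have "(g has_real_derivative pd f a ((z + t *\<^sub>R b) + s *\<^sub>R a) - pd f a (z + s *\<^sub>R a)) (at s)" for s
    unfolding g_def by (intro derivative_intros has_real_derivative_pd_line d)
  from MVT2[OF t this] obtain x where x: "0 < x" "x < t"
    "g t - g 0 = t * (pd f a ((z + t *\<^sub>R b) + x *\<^sub>R a) - pd f a (z + x *\<^sub>R a))" by auto
  have "((\<lambda>s. pd f a ((z + x *\<^sub>R a) + s *\<^sub>R b)) has_real_derivative pd (pd f a) b ((z + x *\<^sub>R a) + s *\<^sub>R b)) (at s)" for s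
    by (intro has_real_derivative_pd_line d2)
  from MVT2[OF t this] obtain y where y: "0 < y" "y < t"
    "pd f a ((z + x *\<^sub>R a) + t *\<^sub>R b) - pd f a (z + x *\<^sub>R a) = t * pd (pd f a) b ((z + x *\<^sub>R a) + y *\<^sub>R b)" by auto
  have e: "(z + t *\<^sub>R b) + x *\<^sub>R a = (z + x *\<^sub>R a) + t *\<^sub>R b" by simp
  have "g t - g 0 = t * t * pd (pd f a) b (z + x *\<^sub>R a + y *\<^sub>R b)"
    using x(3) y(3) unfolding e by simp
  with x y show ?thesis unfolding g_def by (intro exI[of _ x] exI[of _ y]) (auto simp: algebra_simps)
qed

text \<open>Both mixed derivatives are limits of the same second difference quotient, which is
  symmetric in \<open>a\<close> and \<open>b\<close>. Continuity of the second derivatives pulls the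
  intermediate points of the mean value theorem back to \<open>z\<close>.\<close>

lemma pd_commute:
  fixes f :: "'a::euclidean_space \<Rightarrow> real"
  assumes f: "Ck 2 f" and ab: "a \<in> Basis" "b \<in> Basis"
  shows "pd (pd f a) b z = pd (pd f b) a z"
proof -
  define t where "t n = inverse (real (Suc n))" for n
  have t: "t n > 0" for n by (simp add: t_def)
  have t0: "t \<longlonglongrightarrow> 0" unfolding t_def by (rule LIMSEQ_inverse_real_of_nat)
  have key: "(\<lambda>n. (f (z + t n *\<^sub>R a + t n *\<^sub>R b) - f (z + t n *\<^sub>R a) - f (z + t n *\<^sub>R b) + f z) / (t n * t n)) \<longlonglongrightarrow> pd (pd f a) b z"
    if ab: "a \<in> Basis" "b \<in> Basis" for a b
  proof -
    have c: "continuous_on UNIV (pd (pd f a) b)"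
      using f ab by (auto simp: numeral_2_eq_2 Ck_Suc Ck_0)
    have "\<forall>n. \<exists>x y. 0 < x \<and> x < t n \<and> 0 < y \<and> y < t n \<and>
      f (z + t n *\<^sub>R a + t n *\<^sub>R b) - f (z + t n *\<^sub>R a) - f (z + t n *\<^sub>R b) + f z
      = t n * t n * pd (pd f a) b (z + x *\<^sub>R a + y *\<^sub>R b)"
      using second_difference_mvt[OF f that(1) t] by blast
    then obtain x y where xy: "\<And>n. 0 < x n \<and> x n < t n \<and> 0 < y n \<and> y n < t n \<and>
      f (z + t n *\<^sub>R a + t n *\<^sub>R b) - f (z + t n *\<^sub>R a) - f (z + t n *\<^sub>R b) + f z
      = t n * t n * pd (pd f a) b (z + x n *\<^sub>R a + y n *\<^sub>R b)"
      unfolding choice_iff by blast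
    have x0: "x \<longlonglongrightarrow> 0" and y0: "y \<longlonglongrightarrow> 0"
      by (rule tendsto_sandwich[OF _ _ tendsto_const t0]; use xy in \<open>auto intro!: always_eventually less_imp_le\<close>)+
    have "(\<lambda>n. z + x n *\<^sub>R a + y n *\<^sub>R b) \<longlonglongrightarrow> z + 0 *\<^sub>R a + 0 *\<^sub>R b"
      by (intro tendsto_intros x0 y0)
    then have "(\<lambda>n. pd (pd f a) b (z + x n *\<^sub>R a + y n *\<^sub>R b)) \<longlonglongrightarrow> pd (pd f a) b z"
      using c by (intro continuous_on_tendsto_compose[OF c]) auto
    moreover have "(f (z + t n *\<^sub>R a + t n *\<^sub>R b) - f (z + t n *\<^sub>R a) - f (z + t n *\<^sub>R b) + f z) / (t n * t n) = pd (pd f a) b (z + x n *\<^sub>R a + y n *\<^sub>R b)" for n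
      using xy[of n] t[of n] by (simp add: field_simps)
    ultimately show ?thesis by simp
  qed
  have "(\<lambda>n. (f (z + t n *\<^sub>R b + t n *\<^sub>R a) - f (z + t n *\<^sub>R b) - f (z + t n *\<^sub>R a) + f z) / (t n * t n)) \<longlonglongrightarrow> pd (pd f b) a z"
    using key ab by blast
  moreover have "f (z + t n *\<^sub>R b + t n *\<^sub>R a) - f (z + t n *\<^sub>R b) - f (z + t n *\<^sub>R a) + f z
     = f (z + t n *\<^sub>R a + t n *\<^sub>R b) - f (z + t n *\<^sub>R a) - f (z + t n *\<^sub>R b) + f z" for n
    by (simp add: algebra_simps)
  ultimately show ?thesis using key[OF ab] LIMSEQ_unique by (metis (no_types, lifting) ext)
qed

text \<open>The functions \<open>s \<mapsto> s\<^bsup>-n\<^esup> e\<^bsup>-1/s\<^esup>\<close> on the positive half line are closed under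
  differentiation up to linear combinations.\<close>

definition flat_exp :: "nat \<Rightarrow> real \<Rightarrow> real" where
  "flat_exp n s = (if 0 < s then exp (- inverse s) * inverse s ^ n else 0)"

lemma flat_exp_tendsto_0: "(flat_exp n \<longlongrightarrow> 0) (at 0)"
proof -
  have "((\<lambda>s::real. inverse s ^ n / exp (inverse s)) \<longlongrightarrow> 0) (at_right 0)"
    by (rule filterlim_compose[OF tendsto_power_div_exp_0 filterlim_inverse_at_top_right])
  then have r: "(flat_exp n \<longlongrightarrow> 0) (at_right 0)"
    by (rule Lim_transform_eventually)
      (auto simp: flat_exp_def exp_minus field_simps eventually_at_right_less intro!: eventually_at_rightI[of 0 1])
  have "(flat_exp n \<longlongrightarrow> 0) (at_left 0)"
    by (rule Lim_transform_eventually[OF tendsto_const])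
      (auto simp: flat_exp_def intro!: eventually_at_leftI[of "-1"])
  with r show ?thesis by (simp add: filterlim_at_split)
qed

lemma flat_exp_deriv:
  "(flat_exp n has_real_derivative (flat_exp (n + 2) s - n * flat_exp (n + 1) s)) (at s)"
proof (cases "s = 0")
  case True
  have "((\<lambda>s. (flat_exp n s - flat_exp n 0) / (s - 0)) \<longlongrightarrow> 0) (at 0)"
    using flat_exp_tendsto_0[of "Suc n"]
    by (rule Lim_transform_eventually)
      (auto simp: flat_exp_def field_simps intro!: always_eventually)
  then have "(flat_exp n has_real_derivative 0) (at 0)"
    by (simp add: has_field_derivative_iff)
  with True show ?thesis by (simp add: flat_exp_def)
next
  case False
  show ?thesis
  proof (cases "s > 0")
    case True
    have "((\<lambda>s. exp (- inverse s) * inverse s ^ n) has_real_derivative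
        (exp (- inverse s) * (inverse s)\<^sup>2 * inverse s ^ n - exp (- inverse s) * (n * inverse s ^ (n - 1) * (inverse s)\<^sup>2))) (at s)"
      using True by (auto intro!: derivative_eq_intros simp: power2_eq_square)
    moreover have "n * inverse s ^ (n - 1) * (inverse s)\<^sup>2 = n * (inverse s * inverse s ^ n)"
      by (cases n) (auto simp: power2_eq_square)
    ultimately have "((\<lambda>s. exp (- inverse s) * inverse s ^ n) has_real_derivative
       (flat_exp (n + 2) s - n * flat_exp (n + 1) s)) (at s)"
      using True by (simp only: flat_exp_def if_True power_add power2_eq_square) (simp add: algebra_simps)
    then show ?thesis
      by (rule has_field_derivative_transform_within_open[of _ _ _ "{0<..}"]) (use True in \<open>auto simp: flat_exp_def\<close>)
  next
    case neg: False
    have "((\<lambda>s. 0) has_real_derivative 0) (at s)" by simp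
    then have "(flat_exp n has_real_derivative 0) (at s)"
      by (rule has_field_derivative_transform_within_open[of _ _ _ "{..<0}"]) (use neg False in \<open>auto simp: flat_exp_def\<close>)
    then show ?thesis using neg by (simp add: flat_exp_def)
  qed
qed

lemma Ck_flat_exp: "Ck k (flat_exp n)"
proof (induction k arbitrary: n)
  case 0
  show ?case using DERIV_isCont[OF flat_exp_deriv] by (auto simp: Ck_0 continuous_on_eq_continuous_at)
next
  case (Suc k)
  have d: "(flat_exp n has_derivative (\<lambda>h. (flat_exp (n + 2) s - n * flat_exp (n + 1) s) * h)) (at s)" for s
    using flat_exp_deriv[of n s] by (simp add: has_field_derivative_def)
  have "pd (flat_exp n) 1 = (\<lambda>s. flat_exp (n + 2) s - n * flat_exp (n + 1) s)"
    using has_derivative_pd[OF d] by (auto simp: fun_eq_iff)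
  with Suc d show ?case by (auto simp: Ck_Suc intro!: Ck_diff Ck_cmult differentiableI)
qed

text \<open>Positive exactly where the squared norm is below 2 R^2, hence on the ball of radius
  \<open>R\<close>. Composing with the squared norm avoids the singularity of the norm at the
  origin.\<close>

definition bump :: "real \<Rightarrow> 'a::euclidean_space \<Rightarrow> real" where
  "bump R x = flat_exp 0 (2 - (norm x)\<^sup>2 / R\<^sup>2)"

lemma Ck_bump: "Ck k (bump R)"
proof -
  have "Ck k (\<lambda>x::'a. flat_exp 0 (2 - (1 / R\<^sup>2) * (norm x)\<^sup>2))"
    by (rule Ck_compose[OF Ck_flat_exp]) (intro Ck_diff Ck_const Ck_cmult Ck_norm_sq)
  then show ?thesis by (simp add: bump_def[abs_def])
qed

lemma bump_bounds: "0 \<le> bump R x" "bump R x \<le> 1"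
  by (auto simp: bump_def flat_exp_def)

lemma bump_pos: "norm x \<le> R \<Longrightarrow> 0 < R \<Longrightarrow> 0 < bump R x"
proof -
  assume "norm x \<le> R" "0 < R"
  then have "(norm x)\<^sup>2 / R\<^sup>2 \<le> 1" by (simp add: power_mono)
  then show ?thesis by (simp add: bump_def flat_exp_def)
qed

lemma bump_support: "bump R x \<noteq> 0 \<Longrightarrow> 0 < R \<Longrightarrow> norm x < 2 * R"
proof -
  assume "bump R x \<noteq> 0" and R: "0 < R"
  then have "(norm x)\<^sup>2 < 2 * R\<^sup>2" by (auto simp: bump_def flat_exp_def field_simps split: if_splits)
  also have "\<dots> \<le> (2 * R)\<^sup>2" by (simp add: power2_eq_square)
  finally show ?thesis using R power_less_imp_less_base[of "norm x" 2 "2 * R"] by simp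
qed

text \<open>The limit is \<open>exp (- 1/2)\<close> and not 1, since the bump is not normalised at
  the origin. A positive constant is enough for removing the cutoff.\<close>

lemma bump_tendsto: "(\<lambda>n. bump (real (Suc n)) x) \<longlonglongrightarrow> flat_exp 0 2"
proof -
  have l: "(\<lambda>n. 2 - (norm x)\<^sup>2 * (inverse (real (Suc n)))\<^sup>2) \<longlonglongrightarrow> 2 - (norm x)\<^sup>2 * 0\<^sup>2"
    by (intro tendsto_diff tendsto_const tendsto_mult tendsto_power LIMSEQ_inverse_real_of_nat)
  have "isCont (flat_exp 0) (2 - (norm x)\<^sup>2 * 0\<^sup>2)"
    by (rule DERIV_isCont[OF flat_exp_deriv])
  from isCont_tendsto_compose[OF this l] show ?thesis
    by (simp add: bump_def divide_inverse power_inverse)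
qed

text \<open>By scaling: the squared gradient is 4 |x|^2 / R^4 times the squared derivative of the
  profile, and |x|^2 <= 2 R^2 on the support, whence the factor 8. The decay in \<open>R\<close> is
  what makes cutoff errors vanish.\<close>

lemma bump_grad:
  obtains C where "C \<ge> 0" "\<And>R x::'a::euclidean_space. R > 0 \<Longrightarrow> (\<Sum>i\<in>Basis. (pd (bump R) i x)\<^sup>2) \<le> C / R\<^sup>2"
proof -
  have c: "continuous_on UNIV (pd (flat_exp 0) 1)"
    using Ck_pd[of 0 "flat_exp 0" 1] Ck_flat_exp[of 1 0] by (auto simp: Ck_0)
  have "compact (pd (flat_exp 0) 1 ` {0..2})"
    by (rule compact_continuous_image) (auto intro: continuous_on_subset[OF c])
  then obtain B where B: "\<And>s. s \<in> {0..2} \<Longrightarrow> \<bar>pd (flat_exp 0) 1 s\<bar> \<le> B"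
    by (meson bounded_real compact_imp_bounded imageI)
  \<comment> \<open>For nonpositive arguments the profile is flat, so the bound over the compact
    range [0, 2] of the remaining arguments holds everywhere.\<close>
  have z: "pd (flat_exp 0) 1 s = 0" if "s \<le> 0" for s
    using has_derivative_pd[OF flat_exp_deriv[unfolded has_field_derivative_def], of 0 1 s] that by (simp add: flat_exp_def)
  show ?thesis
  proof (rule that[of "8 * B\<^sup>2"])
    fix R :: real and x :: 'a assume R: "R > 0"
    let ?s = "2 - (1 / R\<^sup>2) * (norm x)\<^sup>2"
    have p: "pd (bump R) i x = pd (flat_exp 0) 1 ?s * (- (1 / R\<^sup>2) * (2 * (x \<bullet> i)))" for i
    proof -
      have d: "(\<lambda>x::'a. 2 - (1 / R\<^sup>2) * (norm x)\<^sup>2) differentiable at x"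
        by (intro Ck_differentiable[of 1] Ck_diff Ck_const Ck_cmult Ck_norm_sq) auto
      have "pd (bump R) i x = pd (flat_exp 0) 1 ?s * pd (\<lambda>x::'a. 2 - (1 / R\<^sup>2) * (norm x)\<^sup>2) i x"
        using pd_compose[OF Ck_differentiable[OF Ck_flat_exp, of 1] d, of 0 i]
        by (simp add: bump_def[abs_def])
      also have "pd (\<lambda>x::'a. 2 - (1 / R\<^sup>2) * (norm x)\<^sup>2) i x = - (1 / R\<^sup>2) * (2 * (x \<bullet> i))"
      proof -
        have dn: "(\<lambda>x::'a. (norm x)\<^sup>2) differentiable at x"
          by (rule Ck_differentiable[OF Ck_norm_sq[of 1]]) simp
        then have "(\<lambda>x::'a. (1 / R\<^sup>2) * (norm x)\<^sup>2) differentiable at x"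
          by (intro differentiable_mult differentiable_const)
        from pd_diff[OF differentiable_const this] show ?thesis
          by (simp only: pd_cmult[OF dn] pd_norm_sq pd_const)
      qed
      finally show ?thesis .
    qed
    have s: "(\<Sum>i\<in>Basis. (pd (bump R) i x)\<^sup>2) = (pd (flat_exp 0) 1 ?s)\<^sup>2 * (4 / R^4) * (norm x)\<^sup>2"
    proof -
      have nx: "(\<Sum>i\<in>Basis. (x \<bullet> i)\<^sup>2) = (norm x)\<^sup>2"
        by (subst power2_norm_eq_inner, subst euclidean_inner) (simp add: power2_eq_square)
      have "(a * (- (1 / R\<^sup>2) * (2 * b)))\<^sup>2 = a\<^sup>2 * (4 / R^4) * b\<^sup>2" for a b :: real
        by (simp add: power_mult_distrib power_divide)
      then have "(\<Sum>i\<in>Basis. (pd (bump R) i x)\<^sup>2) = (\<Sum>i\<in>Basis. (pd (flat_exp 0) 1 ?s)\<^sup>2 * (4 / R^4) * (x \<bullet> i)\<^sup>2)"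
        by (simp only: p)
      then show ?thesis by (simp only: sum_distrib_left[symmetric] nx)
    qed
    show "(\<Sum>i\<in>Basis. (pd (bump R) i x)\<^sup>2) \<le> 8 * B\<^sup>2 / R\<^sup>2"
    proof (cases "?s \<le> 0")
      case True
      then show ?thesis using R unfolding s by (simp add: z)
    next
      case False
      then have n: "(norm x)\<^sup>2 \<le> 2 * R\<^sup>2" using R by (simp add: field_simps)
      have "(pd (flat_exp 0) 1 ?s)\<^sup>2 \<le> B\<^sup>2"
        using B[of ?s] False R by (subst abs_le_square_iff[symmetric]) auto
      then have "(pd (flat_exp 0) 1 ?s)\<^sup>2 * (4 / R^4) * (norm x)\<^sup>2 \<le> B\<^sup>2 * (4 / R^4) * (2 * R\<^sup>2)"
        using n by (intro mult_mono) auto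
      also have "\<dots> = 8 * B\<^sup>2 / R\<^sup>2" using R by (simp add: field_simps power4_eq_xxxx power2_eq_square)
      finally show ?thesis unfolding s .
    qed
  qed simp
qed

section \<open>Integrals of derivatives, and functions of bounded support\<close>

lemma integral_lborel_translate:
  fixes f :: "'a::euclidean_space \<Rightarrow> real"
  assumes "f \<in> borel_measurable borel"
  shows "integral\<^sup>L lborel (\<lambda>x. f (x + a)) = integral\<^sup>L lborel f"
    and "integrable lborel (\<lambda>x. f (x + a)) \<longleftrightarrow> integrable lborel f"
proof -
  have "integral\<^sup>L lborel f = integral\<^sup>L (distr lborel borel ((+) a)) f"
    by (simp add: lborel_distr_plus)
  also have "\<dots> = integral\<^sup>L lborel (\<lambda>x. f (a + x))"
    using assms by (subst integral_distr) auto
  finally show "integral\<^sup>L lborel (\<lambda>x. f (x + a)) = integral\<^sup>L lborel f"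
    by (simp add: add.commute)
  have "integrable lborel f \<longleftrightarrow> integrable (distr lborel borel ((+) a)) f"
    by (simp add: lborel_distr_plus)
  also have "\<dots> \<longleftrightarrow> integrable lborel (\<lambda>x. f (a + x))"
    using assms by (subst integrable_distr_eq) auto
  finally show "integrable lborel (\<lambda>x. f (x + a)) \<longleftrightarrow> integrable lborel f"
    by (simp add: add.commute)
qed

text \<open>The integral of \<open>\<partial>\<^sub>e F (x + t e)\<close> over \<open>(t, x) \<in> [0, 1] \<times> \<real>\<^sup>n\<close> is evaluated in both orders.\<close>

lemma integral_pd_eq_0:
  fixes F :: "'a::euclidean_space \<Rightarrow> real"
  assumes d: "\<And>z. F differentiable at z" and c: "continuous_on UNIV (pd F e)"
    and iF: "integrable lborel F" and iP: "integrable lborel (pd F e)"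
  shows "integral\<^sup>L lborel (pd F e) = 0"
proof -
  have mP[measurable]: "pd F e \<in> borel_measurable borel"
    using c by (rule borel_measurable_continuous_onI)
  have mF[measurable]: "F \<in> borel_measurable borel" using iF by simp
  define f where "f t x = indicator {0..1} t * pd F e (x + t *\<^sub>R e)" for t :: real and x
  have mf: "case_prod f \<in> borel_measurable (lborel \<Otimes>\<^sub>M lborel)"
    unfolding f_def by measurable
  have n: "integral\<^sup>L lborel (\<lambda>x. norm (pd F e (x + t *\<^sub>R e))) = integral\<^sup>L lborel (\<lambda>x. norm (pd F e x))" for t
    by (rule integral_lborel_translate) auto
  have "integrable (lborel \<Otimes>\<^sub>M lborel) (case_prod f)"
  proof (rule lborel_pair.Fubini_integrable[OF mf])
    have "(\<lambda>t. \<integral>x. norm (case_prod f (t, x)) \<partial>lborel) = (\<lambda>t. indicator {0..1} t * integral\<^sup>L lborel (\<lambda>x. norm (pd F e x)))"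
      by (auto simp: f_def abs_mult n[simplified] indicator_def)
    then show "integrable lborel (\<lambda>t. \<integral>x. norm (case_prod f (t, x)) \<partial>lborel)" by simp
    show "AE t in lborel. integrable lborel (\<lambda>x. case_prod f (t, x))"
      using iP by (auto simp: f_def integral_lborel_translate)
  qed
  from lborel_pair.Fubini_integral[OF this]
  have "(\<integral>x. (\<integral>t. f t x \<partial>lborel) \<partial>lborel) = (\<integral>t. (\<integral>x. f t x \<partial>lborel) \<partial>lborel)" .
  also have "\<dots> = (\<integral>t. indicator {0..1::real} t * integral\<^sup>L lborel (pd F e) \<partial>lborel)"
    by (simp add: f_def integral_lborel_translate)
  also have "\<dots> = integral\<^sup>L lborel (pd F e)" by simp
  also have "(\<integral>x. (\<integral>t. f t x \<partial>lborel) \<partial>lborel) = (\<integral>x. F (x + e) - F x \<partial>lborel)"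
  proof (rule Bochner_Integration.integral_cong)
    fix x
    have "(\<integral>t. pd F e (x + t *\<^sub>R e) * indicator {0..1} t \<partial>lborel) = F (x + 1 *\<^sub>R e) - F (x + 0 *\<^sub>R e)"
    proof (rule integral_FTC_Icc_real)
      fix t :: real
      show "((\<lambda>t. F (x + t *\<^sub>R e)) has_real_derivative pd F e (x + t *\<^sub>R e)) (at t)"
        by (rule has_real_derivative_pd_line[OF d])
      have 1: "isCont (pd F e) (x + t *\<^sub>R e)" using c by (simp add: continuous_on_eq_continuous_at)
      have 2: "isCont (\<lambda>t. x + t *\<^sub>R e) t" by simp
      show "isCont (\<lambda>t. pd F e (x + t *\<^sub>R e)) t"
        by (rule isCont_o2[OF 2 1])
    qed simp
    then show "(\<integral>t. f t x \<partial>lborel) = F (x + e) - F x" by (simp add: f_def mult.commute)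
  qed simp
  also have "\<dots> = 0"
    using iF by (simp add: integral_lborel_translate)
  finally show ?thesis by simp
qed

text \<open>Stated without closures so that it passes through pointwise operations by logic alone;
  compactness of the closed support is recovered in \<open>Cc_infty_iff\<close>.\<close>

definition bsupp :: "('a::real_normed_vector \<Rightarrow> real) \<Rightarrow> bool" where
  "bsupp f \<longleftrightarrow> (\<exists>R>0. \<forall>z. f z \<noteq> 0 \<longrightarrow> norm z \<le> R)"

lemma bsuppI: "(\<And>z. f z \<noteq> 0 \<Longrightarrow> norm z \<le> R) \<Longrightarrow> bsupp f"
  unfolding bsupp_def by (rule exI[of _ "max R 1"]) force

lemma bsupp_subset: "bsupp f \<Longrightarrow> (\<And>z. f z = 0 \<Longrightarrow> g z = 0) \<Longrightarrow> bsupp g"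
  unfolding bsupp_def by blast

lemma bsupp_mult1: "bsupp f \<Longrightarrow> bsupp (\<lambda>z. f z * g z)"
  by (erule bsupp_subset) auto

lemma bsupp_mult2: "bsupp g \<Longrightarrow> bsupp (\<lambda>z. f z * g z)"
  by (erule bsupp_subset) auto

lemma bsupp_add: "bsupp f \<Longrightarrow> bsupp g \<Longrightarrow> bsupp (\<lambda>z. f z + g z)"
proof -
  assume "bsupp f" "bsupp g"
  then obtain R R' where "\<And>z. f z \<noteq> 0 \<Longrightarrow> norm z \<le> R" "\<And>z. g z \<noteq> 0 \<Longrightarrow> norm z \<le> R'"
    unfolding bsupp_def by blast
  moreover have "f z \<noteq> 0 \<or> g z \<noteq> 0" if "f z + g z \<noteq> 0" for z using that by auto
  ultimately show ?thesis by (intro bsuppI[of _ "max R R'"]) (meson le_max_iff_disj)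
qed

lemma bsupp_0 [simp]: "bsupp (\<lambda>z. 0)"
  by (rule bsuppI[of _ 0]) auto

lemma bsupp_sum: "(\<And>i. i \<in> I \<Longrightarrow> bsupp (f i)) \<Longrightarrow> bsupp (\<lambda>z. \<Sum>i\<in>I. f i z)"
  by (induction I rule: infinite_finite_induct) (auto intro: bsupp_add)

lemma bsupp_minus: "bsupp f \<Longrightarrow> bsupp (\<lambda>z. - f z)"
  by (erule bsupp_subset) auto

lemma bsupp_diff: "bsupp f \<Longrightarrow> bsupp g \<Longrightarrow> bsupp (\<lambda>z. f z - g z)"
  using bsupp_add[of f "\<lambda>z. - g z"] by (auto intro: bsupp_minus)

text \<open>\<open>frechet_derivative\<close> is an arbitrary choice where \<open>f\<close> is not
  differentiable, but off the closed ball \<open>f\<close> vanishes on an open set, so it is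
  differentiable there with derivative 0.\<close>

lemma bsupp_pd:
  assumes "bsupp f" shows "bsupp (pd f e)"
proof -
  from assms obtain R where R: "\<And>z. f z \<noteq> 0 \<Longrightarrow> norm z \<le> R" unfolding bsupp_def by blast
  have "pd f e z = 0" if z: "norm z > R" for z
  proof -
    have "((\<lambda>z. 0) has_derivative (\<lambda>h. 0)) (at z)" by simp
    then have "(f has_derivative (\<lambda>h. 0)) (at z)"
    proof (rule has_derivative_transform_within_open)
      show "open (- cball 0 R)" by (simp add: open_Compl)
    qed (use z R in \<open>force\<close>)+
    then show ?thesis by (rule has_derivative_pd)
  qed
  then show ?thesis by (intro bsuppI[of _ R]) (meson not_le)
qed

lemma bsupp_bump: "0 < R \<Longrightarrow> bsupp (bump R)"
  by (rule bsuppI[of _ "2 * R"]) (auto dest: bump_support)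

lemmas bsupp_intros = bsupp_mult1 bsupp_mult2 bsupp_add bsupp_sum bsupp_minus bsupp_diff bsupp_pd

lemma integrable_lborel_bsupp:
  fixes f :: "'a::euclidean_space \<Rightarrow> real"
  assumes c: "continuous_on UNIV f" and b: "bsupp f"
  shows "integrable lborel f"
proof -
  from b obtain R where R: "\<And>z. f z \<noteq> 0 \<Longrightarrow> norm z \<le> R" unfolding bsupp_def by blast
  have "integrable lborel (\<lambda>x. indicator (cball 0 R) x *\<^sub>R f x)"
    by (rule borel_integrable_compact) (auto intro: continuous_on_subset[OF c])
  also have "(\<lambda>x. indicator (cball 0 R) x *\<^sub>R f x) = f"
    using R by (force simp: indicator_def)
  finally show ?thesis .
qed

lemma bounded_bsupp:
  fixes f :: "'a::euclidean_space \<Rightarrow> real"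
  assumes c: "continuous_on UNIV f" and b: "bsupp f"
  obtains B where "B > 0" "\<And>z. \<bar>f z\<bar> \<le> B"
proof -
  from b obtain R where R: "\<And>z. f z \<noteq> 0 \<Longrightarrow> norm z \<le> R" unfolding bsupp_def by blast
  have "compact (f ` cball 0 R)"
    by (rule compact_continuous_image) (auto intro: continuous_on_subset[OF c])
  then obtain B where B: "\<And>z. z \<in> cball 0 R \<Longrightarrow> \<bar>f z\<bar> \<le> B"
    by (meson bounded_real compact_imp_bounded imageI)
  show ?thesis
  proof (rule that[of "max B 1"])
    fix z show "\<bar>f z\<bar> \<le> max B 1" using R[of z] B[of z] by (cases "f z = 0") (auto simp: max_def)
  qed simp
qed

text \<open>The order stays a parameter because products with derivatives of the potential have only
  finite smoothness, however smooth the other factor is.\<close>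

definition Cck :: "nat \<Rightarrow> ('a::euclidean_space \<Rightarrow> real) set" where
  "Cck k = {f. Ck k f \<and> bsupp f}"

lemma CckD: "f \<in> Cck k \<Longrightarrow> Ck k f" "f \<in> Cck k \<Longrightarrow> bsupp f"
  by (auto simp: Cck_def)

lemma Cck_mono: "f \<in> Cck k \<Longrightarrow> j \<le> k \<Longrightarrow> f \<in> Cck j"
  by (auto simp: Cck_def intro: Ck_mono)

lemma Cck_pd: "f \<in> Cck (Suc k) \<Longrightarrow> e \<in> Basis \<Longrightarrow> pd f e \<in> Cck k"
  by (auto simp: Cck_def intro: Ck_pd bsupp_pd)

lemma Cck_add: "f \<in> Cck k \<Longrightarrow> g \<in> Cck k \<Longrightarrow> (\<lambda>z. f z + g z) \<in> Cck k"
  by (auto simp: Cck_def intro: Ck_add bsupp_add)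

lemma Cck_diff: "f \<in> Cck k \<Longrightarrow> g \<in> Cck k \<Longrightarrow> (\<lambda>z. f z - g z) \<in> Cck k"
  by (auto simp: Cck_def intro: Ck_diff bsupp_diff)

lemma Cck_sum: "(\<And>i. i \<in> I \<Longrightarrow> f i \<in> Cck k) \<Longrightarrow> (\<lambda>z. \<Sum>i\<in>I. f i z) \<in> Cck k"
  by (auto simp: Cck_def intro: Ck_sum bsupp_sum)

lemma Cck_mult1: "f \<in> Cck k \<Longrightarrow> Ck k g \<Longrightarrow> (\<lambda>z. f z * g z) \<in> Cck k"
  by (auto simp: Cck_def intro: Ck_mult bsupp_mult1)

lemma Cck_mult2: "Ck k f \<Longrightarrow> g \<in> Cck k \<Longrightarrow> (\<lambda>z. f z * g z) \<in> Cck k"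
  by (auto simp: Cck_def intro: Ck_mult bsupp_mult2)

lemma Cck_cmult: "f \<in> Cck k \<Longrightarrow> (\<lambda>z. c * f z) \<in> Cck k"
  by (rule Cck_mult2) auto

lemma Cc_infty_iff: "f \<in> Cc_infty \<longleftrightarrow> (\<forall>k. f \<in> Cck k)"
proof -
  have "compact (closure {z. f z \<noteq> 0}) \<longleftrightarrow> bsupp f"
    by (auto simp: compact_closure bsupp_def bounded_pos)
  then show ?thesis by (auto simp: Cc_infty_def Cck_def smooth_def)
qed

lemma bump_Cck: "0 < R \<Longrightarrow> bump R \<in> Cck k"
  by (simp add: Cck_def Ck_bump bsupp_bump)

lemma integrable_lborel_Cck: "f \<in> Cck k \<Longrightarrow> integrable lborel f"
  by (auto simp: Cck_def intro: integrable_lborel_bsupp Ck_continuous)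

lemma integral_pd_Cck:
  fixes F :: "'a::euclidean_space \<Rightarrow> real"
  assumes "F \<in> Cck 1" "e \<in> Basis" shows "integral\<^sup>L lborel (pd F e) = 0"
proof (rule integral_pd_eq_0)
  have p: "pd F e \<in> Cck 0" using assms by (intro Cck_pd) auto
  show "F differentiable at z" for z using assms by (auto simp: Cck_def intro: Ck_differentiable)
  show "continuous_on UNIV (pd F e)" using p by (auto simp: Cck_def Ck_0)
  show "integrable lborel F" "integrable lborel (pd F e)"
    using assms p by (auto intro: integrable_lborel_Cck)
qed

section \<open>Gibbs measures\<close>

text \<open>One normalised weight for three measures: \<open>U\<close> gives the position law,
  \<open>nsq\<close> the velocity law and their sum \<open>UU\<close> the Gibbs measure, so that a
  single locale serves all of them.\<close>

definition gm :: "('a::euclidean_space \<Rightarrow> real) \<Rightarrow> 'a measure" where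
  "gm V = density lborel (\<lambda>z. ennreal (exp (- V z) / (\<integral>y. exp (- V y) \<partial>lborel)))"

lemma sets_gm [simp, measurable_cong]: "sets (gm V) = sets borel"
  and space_gm [simp]: "space (gm V) = UNIV"
  by (auto simp: gm_def)

locale gibbs_weight =
  fixes V :: "'a::euclidean_space \<Rightarrow> real"
  assumes V_C1: "Ck 1 V" and V_int: "integrable lborel (\<lambda>x. exp (- V x))"
begin

definition Z :: real where "Z = (\<integral>y. exp (- V y) \<partial>lborel)"

lemma V_cont: "continuous_on UNIV V" using V_C1 by (rule Ck_continuous)

lemma V_measurable [measurable]: "V \<in> borel_measurable borel"
  using V_cont by (rule borel_measurable_continuous_onI)

lemma Z_pos: "Z > 0"
proof -
  have "Z \<noteq> 0"
  proof
    assume "Z = 0"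
    then have "AE x in lborel. exp (- V x) = 0"
      unfolding Z_def by (subst (asm) integral_nonneg_eq_0_iff_AE[OF V_int]) auto
    then have "AE x in (lborel :: 'a measure). False" by simp
    then show False by (simp add: trivial_limit_def[symmetric] ae_filter_eq_bot_iff)
  qed
  moreover have "Z \<ge> 0" unfolding Z_def by simp
  ultimately show ?thesis by simp
qed

lemma gm_eq: "gm V = density lborel (\<lambda>z. ennreal (exp (- V z) / Z))"
  by (simp add: gm_def Z_def)

lemma integral_gm:
  fixes f :: "'a \<Rightarrow> real"
  assumes [measurable]: "f \<in> borel_measurable borel"
  shows "integral\<^sup>L (gm V) f = (\<integral>x. exp (- V x) * f x \<partial>lborel) / Z"
    and "integrable (gm V) f \<longleftrightarrow> integrable lborel (\<lambda>x. exp (- V x) * f x)"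
proof -
  show "integral\<^sup>L (gm V) f = (\<integral>x. exp (- V x) * f x \<partial>lborel) / Z"
    unfolding gm_eq using Z_pos by (subst integral_density) auto
  have "integrable (gm V) f \<longleftrightarrow> integrable lborel (\<lambda>x. (1 / Z) * (exp (- V x) * f x))"
    unfolding gm_eq using Z_pos by (subst integrable_density) auto
  also have "\<dots> \<longleftrightarrow> integrable lborel (\<lambda>x. exp (- V x) * f x)"
    using Z_pos by (subst integrable_mult_left_iff) auto
  finally show "integrable (gm V) f \<longleftrightarrow> integrable lborel (\<lambda>x. exp (- V x) * f x)" .
qed

lemma AE_gm: "(AE x in gm V. P x) \<longleftrightarrow> (AE x in lborel. P x)"
  unfolding gm_eq using Z_pos by (subst AE_density) auto

sublocale prob_space "gm V"
proof
  have "emeasure (gm V) (space (gm V)) = (\<integral>\<^sup>+x. ennreal (exp (- V x) / Z) \<partial>lborel)"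
    unfolding gm_eq by (simp add: emeasure_density)
  also have "\<dots> = ennreal (\<integral>x. exp (- V x) / Z \<partial>lborel)"
    using Z_pos V_int by (intro nn_integral_eq_integral) auto
  also have "\<dots> = 1" using Z_pos by (simp add: Z_def[symmetric])
  finally show "emeasure (gm V) (space (gm V)) = 1" .
qed

lemma integrable_Cck: "f \<in> Cck k \<Longrightarrow> integrable (gm V) f"
proof -
  assume "f \<in> Cck k"
  then have f: "continuous_on UNIV f" "bsupp f" by (auto simp: Cck_def intro: Ck_continuous)
  then have [measurable]: "f \<in> borel_measurable borel" by (auto intro: borel_measurable_continuous_onI)
  show ?thesis
    by (subst integral_gm) (auto intro!: integrable_lborel_bsupp bsupp_mult2 f continuous_intros V_cont)
qed

text \<open>Multiplied by the weight, the integrand is the derivative of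
  \<open>exp (- V z) * F z\<close>. Integrability replaces bounded support so that polynomials can
  be inserted for the Gaussian moments.\<close>

lemma integral_pd_weight:
  assumes F: "Ck 1 F" and e: "e \<in> Basis"
    and i: "integrable (gm V) F" "integrable (gm V) (\<lambda>z. pd F e z - F z * pd V e z)"
  shows "(\<integral>z. pd F e z - F z * pd V e z \<partial>gm V) = 0"
proof -
  have dF: "F differentiable at z" and dV: "V differentiable at z" for z
    using F V_C1 by (auto intro: Ck_differentiable)
  have cF: "continuous_on UNIV F" "continuous_on UNIV (pd F e)" "continuous_on UNIV (pd V e)"
    using F V_C1 Ck_pd[of 0 F e] Ck_pd[of 0 V e] e by (auto simp: Ck_0 intro: Ck_continuous)
  have m: "F \<in> borel_measurable borel" "(\<lambda>z. pd F e z - F z * pd V e z) \<in> borel_measurable borel"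
    by (auto intro!: borel_measurable_continuous_onI continuous_intros cF)
  have dexp: "((\<lambda>z. exp (- V z)) has_derivative (\<lambda>h. - exp (- V z) * pd V h z)) (at z)" for z
    using differentiable_has_derivative[OF dV] by (auto intro!: derivative_eq_intros)
  have p: "pd (\<lambda>z. exp (- V z) * F z) e = (\<lambda>z. exp (- V z) * (pd F e z - F z * pd V e z))"
  proof
    fix z
    show "pd (\<lambda>z. exp (- V z) * F z) e z = exp (- V z) * (pd F e z - F z * pd V e z)"
      using pd_mult[OF differentiableI[OF dexp] dF] has_derivative_pd[OF dexp]
      by (simp add: algebra_simps)
  qed
  have "integral\<^sup>L lborel (pd (\<lambda>z. exp (- V z) * F z) e) = 0"
  proof (rule integral_pd_eq_0)
    show "(\<lambda>z. exp (- V z) * F z) differentiable at z" for z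
      by (intro differentiable_mult differentiableI[OF dexp] dF)
    show "continuous_on UNIV (pd (\<lambda>z. exp (- V z) * F z) e)"
      unfolding p by (intro continuous_intros cF V_cont)
    show "integrable lborel (\<lambda>z. exp (- V z) * F z)"
      using i(1) integral_gm(2)[OF m(1)] by simp
    show "integrable lborel (pd (\<lambda>z. exp (- V z) * F z) e)"
      unfolding p using i(2) integral_gm(2)[OF m(2)] by simp
  qed
  then show ?thesis unfolding p by (subst integral_gm[OF m(2)]) simp
qed

lemma integral_by_parts:
  assumes F: "F \<in> Cck 1" and e: "e \<in> Basis"
  shows "(\<integral>z. pd F e z \<partial>gm V) = (\<integral>z. F z * pd V e z \<partial>gm V)"
proof -
  have 1: "pd F e \<in> Cck 0" using F e by (intro Cck_pd) auto
  have 2: "(\<lambda>z. F z * pd V e z) \<in> Cck 0"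
    using Ck_pd[of 0 V e] V_C1 e F by (intro Cck_mult1) (auto intro: Cck_mono)
  have "(\<integral>z. pd F e z - F z * pd V e z \<partial>gm V) = 0"
    using F e by (intro integral_pd_weight integrable_Cck[OF F] integrable_Cck[OF Cck_diff[OF 1 2]]) (auto simp: Cck_def)
  then show ?thesis
    using integrable_Cck[OF 1] integrable_Cck[OF 2] by simp
qed

end

section \<open>The space of square integrable functions\<close>

definition ip :: "'b measure \<Rightarrow> ('b \<Rightarrow> real) \<Rightarrow> ('b \<Rightarrow> real) \<Rightarrow> real" where
  "ip M f g = (\<integral>z. f z * g z \<partial>M)"

lemma L2_measurable: "f \<in> L2 M \<Longrightarrow> f \<in> borel_measurable M"
  by (simp add: L2_def)

lemma L2_integrable_sq: "f \<in> L2 M \<Longrightarrow> integrable M (\<lambda>z. (f z)\<^sup>2)"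
  by (simp add: L2_def)

lemma L2_integrable_mult:
  assumes "f \<in> L2 M" "g \<in> L2 M" shows "integrable M (\<lambda>z. f z * g z)"
proof (rule Bochner_Integration.integrable_bound)
  show "integrable M (\<lambda>z. (f z)\<^sup>2 + (g z)\<^sup>2)" using assms by (simp add: L2_def)
  show "(\<lambda>z. f z * g z) \<in> borel_measurable M"
    using assms by (intro borel_measurable_times L2_measurable)
  have "\<bar>a * b\<bar> \<le> a\<^sup>2 + b\<^sup>2" for a b :: real
  proof -
    have "2 * (\<bar>a\<bar> * \<bar>b\<bar>) \<le> a\<^sup>2 + b\<^sup>2"
      using sum_squares_bound[of "\<bar>a\<bar>" "\<bar>b\<bar>"] by simp
    moreover have "0 \<le> \<bar>a\<bar> * \<bar>b\<bar>" by simp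
    ultimately have "\<bar>a\<bar> * \<bar>b\<bar> \<le> a\<^sup>2 + b\<^sup>2" by linarith
    then show ?thesis by (simp add: abs_mult)
  qed
  then show "AE z in M. norm (f z * g z) \<le> norm ((f z)\<^sup>2 + (g z)\<^sup>2)" by simp
qed

lemma L2_cmult: "f \<in> L2 M \<Longrightarrow> (\<lambda>z. c * f z) \<in> L2 M"
  by (auto simp: L2_def power_mult_distrib)

lemma L2_add:
  assumes "f \<in> L2 M" "g \<in> L2 M" shows "(\<lambda>z. f z + g z) \<in> L2 M"
proof -
  have "integrable M (\<lambda>z. (f z)\<^sup>2 + (g z)\<^sup>2 + 2 * (f z * g z))"
    using assms L2_integrable_mult[OF assms] by (simp add: L2_def)
  then show ?thesis using assms by (auto simp: L2_def power2_sum mult.assoc)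
qed

lemma L2_diff: "f \<in> L2 M \<Longrightarrow> g \<in> L2 M \<Longrightarrow> (\<lambda>z. f z - g z) \<in> L2 M"
  using L2_add[of f M "\<lambda>z. -1 * g z"] L2_cmult[of g M "-1"] by simp

lemma L2_mult_bounded:
  assumes f: "f \<in> L2 M" and g: "g \<in> borel_measurable M" "\<And>z. \<bar>g z\<bar> \<le> B"
  shows "(\<lambda>z. g z * f z) \<in> L2 M"
proof -
  have "integrable M (\<lambda>z. (g z * f z)\<^sup>2)"
  proof (rule Bochner_Integration.integrable_bound)
    show "integrable M (\<lambda>z. B\<^sup>2 * (f z)\<^sup>2)" using f by (simp add: L2_def)
    show "(\<lambda>z. (g z * f z)\<^sup>2) \<in> borel_measurable M" using f g by (auto simp: L2_def)
    have "(g z)\<^sup>2 \<le> B\<^sup>2" for z using g(2)[of z] by (simp add: abs_le_square_iff[symmetric])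
    then show "AE z in M. norm ((g z * f z)\<^sup>2) \<le> norm (B\<^sup>2 * (f z)\<^sup>2)"
      by (simp add: power_mult_distrib mult_right_mono)
  qed
  then show ?thesis using f g by (auto simp: L2_def)
qed

lemma ip_commute: "ip M f g = ip M g f"
  by (simp add: ip_def mult.commute)

lemma ip_add_left: "f \<in> L2 M \<Longrightarrow> g \<in> L2 M \<Longrightarrow> h \<in> L2 M \<Longrightarrow> ip M (\<lambda>z. f z + g z) h = ip M f h + ip M g h"
  by (simp add: ip_def distrib_right L2_integrable_mult)

lemma ip_add_right: "f \<in> L2 M \<Longrightarrow> g \<in> L2 M \<Longrightarrow> h \<in> L2 M \<Longrightarrow> ip M h (\<lambda>z. f z + g z) = ip M h f + ip M h g"
  by (simp add: ip_def distrib_left L2_integrable_mult)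

lemma ip_diff_left: "f \<in> L2 M \<Longrightarrow> g \<in> L2 M \<Longrightarrow> h \<in> L2 M \<Longrightarrow> ip M (\<lambda>z. f z - g z) h = ip M f h - ip M g h"
  by (simp add: ip_def left_diff_distrib L2_integrable_mult)

lemma ip_diff_right: "f \<in> L2 M \<Longrightarrow> g \<in> L2 M \<Longrightarrow> h \<in> L2 M \<Longrightarrow> ip M h (\<lambda>z. f z - g z) = ip M h f - ip M h g"
  by (simp add: ip_def right_diff_distrib L2_integrable_mult)

lemma ip_cmult_left: "ip M (\<lambda>z. c * f z) h = c * ip M f h"
  by (simp add: ip_def mult.assoc)

lemma ip_cmult_right: "ip M h (\<lambda>z. c * f z) = c * ip M h f"
  by (simp add: ip_def mult.left_commute)

lemma ip_self_nonneg: "0 \<le> ip M f f"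
  by (simp add: ip_def)

lemma l2norm_eq_ip: "l2norm M f = sqrt (ip M f f)"
  by (simp add: ip_def l2norm_def power2_eq_square)

lemma l2norm_nonneg [simp]: "0 \<le> l2norm M f"
  by (simp add: l2norm_def)

lemma l2norm_sq: "(l2norm M f)\<^sup>2 = ip M f f"
  by (simp add: l2norm_eq_ip ip_self_nonneg)

lemma l2norm_cmult: "l2norm M (\<lambda>z. c * f z) = \<bar>c\<bar> * l2norm M f"
  by (simp add: l2norm_eq_ip ip_cmult_left ip_cmult_right real_sqrt_mult mult.assoc[symmetric])

lemma l2norm_minus_commute: "l2norm M (\<lambda>z. f z - g z) = l2norm M (\<lambda>z. g z - f z)"
  by (simp add: l2norm_def power2_commute)

lemma l2norm_0 [simp]: "l2norm M (\<lambda>z. 0) = 0"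
  by (simp add: l2norm_def)

lemma ip_quad:
  assumes "f \<in> L2 M" "g \<in> L2 M"
  shows "ip M (\<lambda>z. f z + t * g z) (\<lambda>z. f z + t * g z) = ip M f f + 2 * t * ip M f g + t\<^sup>2 * ip M g g"
  using assms L2_cmult[OF assms(2), of t] L2_add[OF assms(1) L2_cmult[OF assms(2), of t]]
  by (simp add: ip_add_left ip_add_right ip_cmult_left ip_cmult_right ip_commute[of M g f] power2_eq_square algebra_simps)

lemma ip_CS:
  assumes "f \<in> L2 M" "g \<in> L2 M"
  shows "\<bar>ip M f g\<bar> \<le> l2norm M f * l2norm M g"
proof -
  have q: "0 \<le> ip M f f + 2 * t * ip M f g + t\<^sup>2 * ip M g g" for t
    using ip_quad[OF assms, of t] ip_self_nonneg[of M "\<lambda>z. f z + t * g z"] by simp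
  have "(ip M f g)\<^sup>2 \<le> ip M f f * ip M g g"
  proof (cases "ip M g g = 0")
    case True
    have "ip M f g = 0"
    proof (rule ccontr)
      assume n: "ip M f g \<noteq> 0"
      \<comment> \<open>The quadratic has become affine in \<open>t\<close>, and this
        \<open>t\<close> gives it the value -1.\<close>
      show False using q[of "- (ip M f f + 1) / (2 * ip M f g)"] n True by (simp add: field_simps)
    qed
    then show ?thesis using True by simp
  next
    case False
    then have pos: "ip M g g > 0" using ip_self_nonneg[of M g] by simp
    show ?thesis using q[of "- ip M f g / ip M g g"] pos
      by (simp add: field_simps power2_eq_square)
  qed
  then have "sqrt ((ip M f g)\<^sup>2) \<le> sqrt (ip M f f * ip M g g)" by (rule real_sqrt_le_mono)
  then show ?thesis by (simp add: l2norm_eq_ip real_sqrt_mult)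
qed

lemma ip_le: "f \<in> L2 M \<Longrightarrow> g \<in> L2 M \<Longrightarrow> ip M f g \<le> l2norm M f * l2norm M g"
  using ip_CS[of f M g] by simp

lemma l2norm_triangle:
  assumes "f \<in> L2 M" "g \<in> L2 M"
  shows "l2norm M (\<lambda>z. f z + g z) \<le> l2norm M f + l2norm M g"
proof -
  have "(l2norm M (\<lambda>z. f z + g z))\<^sup>2 = (l2norm M f)\<^sup>2 + 2 * ip M f g + (l2norm M g)\<^sup>2"
    using ip_quad[OF assms, of 1] by (simp add: l2norm_sq)
  also have "\<dots> \<le> (l2norm M f + l2norm M g)\<^sup>2"
    using ip_CS[OF assms] by (simp add: power2_sum)
  finally show ?thesis by (rule power2_le_imp_le) simp
qed

lemma l2norm_triangle3:
  assumes "f \<in> L2 M" "g \<in> L2 M" "h \<in> L2 M"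
  shows "l2norm M (\<lambda>z. f z - g z) \<le> l2norm M (\<lambda>z. f z - h z) + l2norm M (\<lambda>z. h z - g z)"
  using l2norm_triangle[OF L2_diff[OF assms(1,3)] L2_diff[OF assms(3,2)]] by simp

lemma l2norm_diff_le:
  assumes "f \<in> L2 M" "g \<in> L2 M"
  shows "\<bar>l2norm M f - l2norm M g\<bar> \<le> l2norm M (\<lambda>z. f z - g z)"
  using l2norm_triangle[OF L2_diff[OF assms] assms(2)]
    l2norm_triangle[OF L2_diff[OF assms(2,1)] assms(1)] l2norm_minus_commute[of M f g] by simp

text \<open>Membership in \<open>L2\<close> is included because the Bochner integral of a
  non-integrable square is 0, so a small \<open>l2norm\<close> alone says nothing.\<close>

definition L2_tendsto :: "'b measure \<Rightarrow> (nat \<Rightarrow> 'b \<Rightarrow> real) \<Rightarrow> ('b \<Rightarrow> real) \<Rightarrow> bool" where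
  "L2_tendsto M f g \<longleftrightarrow> (\<forall>n. f n \<in> L2 M) \<and> g \<in> L2 M \<and> (\<lambda>n. l2norm M (\<lambda>z. f n z - g z)) \<longlonglongrightarrow> 0"

lemma L2_tendstoI:
  "(\<And>n. f n \<in> L2 M) \<Longrightarrow> g \<in> L2 M \<Longrightarrow> (\<lambda>n. l2norm M (\<lambda>z. f n z - g z)) \<longlonglongrightarrow> 0 \<Longrightarrow> L2_tendsto M f g"
  by (simp add: L2_tendsto_def)

lemma L2_tendsto_L2: "L2_tendsto M f g \<Longrightarrow> f n \<in> L2 M" "L2_tendsto M f g \<Longrightarrow> g \<in> L2 M"
  by (simp_all add: L2_tendsto_def)

lemma L2_tendsto_const: "f \<in> L2 M \<Longrightarrow> L2_tendsto M (\<lambda>n. f) f"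
  by (simp add: L2_tendsto_def)

lemma L2_tendsto_norm:
  assumes "L2_tendsto M f g"
  shows "(\<lambda>n. l2norm M (f n)) \<longlonglongrightarrow> l2norm M g"
proof -
  have "(\<lambda>n. l2norm M (f n) - l2norm M g) \<longlonglongrightarrow> 0"
  proof (rule Lim_null_comparison)
    show "(\<lambda>n. l2norm M (\<lambda>z. f n z - g z)) \<longlonglongrightarrow> 0" using assms by (simp add: L2_tendsto_def)
    show "\<forall>\<^sub>F n in sequentially. norm (l2norm M (f n) - l2norm M g) \<le> l2norm M (\<lambda>z. f n z - g z)"
      using assms by (auto simp: L2_tendsto_def intro!: always_eventually l2norm_diff_le)
  qed
  then show ?thesis by (simp add: LIM_zero_iff)
qed

lemma L2_tendsto_ip:
  assumes f: "L2_tendsto M f f'" and g: "L2_tendsto M g g'"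
  shows "(\<lambda>n. ip M (f n) (g n)) \<longlonglongrightarrow> ip M f' g'"
proof -
  have m: "f n \<in> L2 M" "f' \<in> L2 M" "g n \<in> L2 M" "g' \<in> L2 M" for n
    using f g by (auto simp: L2_tendsto_def)
  have "(\<lambda>n. ip M (f n) (g n) - ip M f' g') \<longlonglongrightarrow> 0"
  proof (rule Lim_null_comparison)
    have "(\<lambda>n. l2norm M (\<lambda>z. f n z - f' z) * l2norm M (g n) + l2norm M f' * l2norm M (\<lambda>z. g n z - g' z)) \<longlonglongrightarrow> 0 * l2norm M g' + l2norm M f' * 0"
      using f g by (intro tendsto_add tendsto_mult tendsto_const L2_tendsto_norm) (auto simp: L2_tendsto_def)
    then show "(\<lambda>n. l2norm M (\<lambda>z. f n z - f' z) * l2norm M (g n) + l2norm M f' * l2norm M (\<lambda>z. g n z - g' z)) \<longlonglongrightarrow> 0"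
      by simp
    have "\<bar>ip M (f n) (g n) - ip M f' g'\<bar> \<le> l2norm M (\<lambda>z. f n z - f' z) * l2norm M (g n) + l2norm M f' * l2norm M (\<lambda>z. g n z - g' z)" for n
    proof -
      have "ip M (f n) (g n) - ip M f' g' = ip M (\<lambda>z. f n z - f' z) (g n) + ip M f' (\<lambda>z. g n z - g' z)"
        using m by (simp add: ip_diff_left ip_diff_right)
      then show ?thesis
        using ip_CS[OF L2_diff[OF m(1,2)] m(3), of n n] ip_CS[OF m(2) L2_diff[OF m(3,4)], of n] by linarith
    qed
    then show "\<forall>\<^sub>F n in sequentially. norm (ip M (f n) (g n) - ip M f' g') \<le> l2norm M (\<lambda>z. f n z - f' z) * l2norm M (g n) + l2norm M f' * l2norm M (\<lambda>z. g n z - g' z)"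
      by simp
  qed
  then show ?thesis by (simp add: LIM_zero_iff)
qed

lemma L2_tendsto_lincomb:
  assumes f: "L2_tendsto M f f'" and g: "L2_tendsto M g g'"
  shows "L2_tendsto M (\<lambda>n z. f n z + c * g n z) (\<lambda>z. f' z + c * g' z)"
proof (rule L2_tendstoI)
  have m: "f n \<in> L2 M" "f' \<in> L2 M" "g n \<in> L2 M" "g' \<in> L2 M" for n
    using f g by (auto simp: L2_tendsto_def)
  show "(\<lambda>z. f n z + c * g n z) \<in> L2 M" "(\<lambda>z. f' z + c * g' z) \<in> L2 M" for n
    using m by (auto intro!: L2_add L2_cmult)
  show "(\<lambda>n. l2norm M (\<lambda>z. f n z + c * g n z - (f' z + c * g' z))) \<longlonglongrightarrow> 0"
  proof (rule Lim_null_comparison)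
    have "(\<lambda>n. l2norm M (\<lambda>z. f n z - f' z) + \<bar>c\<bar> * l2norm M (\<lambda>z. g n z - g' z)) \<longlonglongrightarrow> 0 + \<bar>c\<bar> * 0"
      using f g by (intro tendsto_add tendsto_mult tendsto_const) (auto simp: L2_tendsto_def)
    then show "(\<lambda>n. l2norm M (\<lambda>z. f n z - f' z) + \<bar>c\<bar> * l2norm M (\<lambda>z. g n z - g' z)) \<longlonglongrightarrow> 0" by simp
    have "l2norm M (\<lambda>z. f n z + c * g n z - (f' z + c * g' z)) \<le> l2norm M (\<lambda>z. f n z - f' z) + \<bar>c\<bar> * l2norm M (\<lambda>z. g n z - g' z)" for n
    proof -
      have "(\<lambda>z. f n z + c * g n z - (f' z + c * g' z)) = (\<lambda>z. (f n z - f' z) + c * (g n z - g' z))"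
        by (simp add: algebra_simps)
      then show ?thesis
        using l2norm_triangle[OF L2_diff[OF m(1,2)] L2_cmult[OF L2_diff[OF m(3,4)], of c], of n n]
        by (simp add: l2norm_cmult)
    qed
    then show "\<forall>\<^sub>F n in sequentially. norm (l2norm M (\<lambda>z. f n z + c * g n z - (f' z + c * g' z))) \<le> l2norm M (\<lambda>z. f n z - f' z) + \<bar>c\<bar> * l2norm M (\<lambda>z. g n z - g' z)"
      by simp
  qed
qed

text \<open>The Riesz-Fischer argument. On a probability space L2 norms bound L1 norms, so a
  subsequence with geometrically decaying increments converges almost everywhere; Fatou's lemma
  upgrades this to L2 convergence of the whole sequence.\<close>

lemma L2_Cauchy_convergent:
  assumes M: "prob_space M" and f: "\<And>n. f n \<in> L2 M"
    and C: "\<And>e. 0 < e \<Longrightarrow> \<exists>N. \<forall>m\<ge>N. \<forall>n\<ge>N. l2norm M (\<lambda>z. f m z - f n z) < e"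
  shows "\<exists>g. L2_tendsto M f g"
proof -
  interpret prob_space M by fact
  have [measurable]: "f n \<in> borel_measurable M" for n using f by (simp add: L2_def)
  have one: "(\<lambda>z. 1) \<in> L2 M" by (simp add: L2_def)
  have "\<forall>k. \<exists>N. \<forall>m\<ge>N. \<forall>n\<ge>N. l2norm M (\<lambda>z. f m z - f n z) < (1/2) ^ k"
    using C by simp
  then obtain N where N: "\<And>k m n. N k \<le> m \<Longrightarrow> N k \<le> n \<Longrightarrow> l2norm M (\<lambda>z. f m z - f n z) < (1/2) ^ k"
    by metis
  \<comment> \<open>Partial sums instead of \<open>N\<close> itself make \<open>r k\<close> exceed
    \<open>N j\<close> for every \<open>j \<le> k\<close>, so later indices satisfy all earlier
    thresholds.\<close>
  define r where "r k = (\<Sum>i\<le>k. N i)" for k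
  have rN': "N j \<le> r k" if "j \<le> k" for j k
    unfolding r_def using that by (intro member_le_sum) auto
  have rN: "N k \<le> r k" "N k \<le> r (Suc k)" for k by (rule rN'; simp)+
  define d where "d k z = f (r (Suc k)) z - f (r k) z" for k z
  have dL: "d k \<in> L2 M" for k unfolding d_def by (intro L2_diff f)
  have [measurable]: "d k \<in> borel_measurable M" for k using dL by (simp add: L2_def)
  have d1: "(\<integral>\<^sup>+z. ennreal \<bar>d k z\<bar> \<partial>M) \<le> ennreal ((1/2) ^ k)" for k
  proof -
    have ai: "integrable M (\<lambda>z. \<bar>d k z\<bar>)" using L2_integrable_mult[OF dL one] by simp
    have abL: "(\<lambda>z. \<bar>d k z\<bar>) \<in> L2 M" using dL by (simp add: L2_def)
    have "(\<integral>z. \<bar>d k z\<bar> \<partial>M) = ip M (\<lambda>z. \<bar>d k z\<bar>) (\<lambda>z. 1)" by (simp add: ip_def)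
    also have "\<dots> \<le> l2norm M (\<lambda>z. \<bar>d k z\<bar>) * l2norm M (\<lambda>z. 1)" by (rule ip_le[OF abL one])
    also have "\<dots> = l2norm M (d k)" by (simp add: l2norm_def prob_space)
    also have "\<dots> \<le> (1/2) ^ k" using N[OF rN(2) rN(1), of k] by (simp add: d_def[abs_def] less_imp_le)
    finally show ?thesis using ai by (simp add: nn_integral_eq_integral)
  qed
  have "(\<integral>\<^sup>+z. (\<Sum>k. ennreal \<bar>d k z\<bar>) \<partial>M) = (\<Sum>k. \<integral>\<^sup>+z. ennreal \<bar>d k z\<bar> \<partial>M)"
    by (rule nn_integral_suminf) auto
  also have "\<dots> \<le> (\<Sum>k. ennreal ((1/2) ^ k))" by (intro suminf_le d1) auto
  also have "\<dots> = ennreal (\<Sum>k. (1/2) ^ k)" by (intro suminf_ennreal2) auto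
  finally have "(\<integral>\<^sup>+z. (\<Sum>k. ennreal \<bar>d k z\<bar>) \<partial>M) \<noteq> \<infinity>" by (auto simp: top_unique)
  then have "AE z in M. (\<Sum>k. ennreal \<bar>d k z\<bar>) \<noteq> \<infinity>"
    by (intro nn_integral_PInf_AE) auto
  then have conv: "AE z in M. convergent (\<lambda>k. f (r k) z)"
  proof (rule AE_mp, intro AE_I2 impI)
    fix z assume "(\<Sum>k. ennreal \<bar>d k z\<bar>) \<noteq> \<infinity>"
    then have "summable (\<lambda>k. \<bar>d k z\<bar>)" by (intro summable_suminf_not_top) auto
    then have s: "summable (\<lambda>k. d k z)" by (rule summable_rabs_cancel)
    have "(\<Sum>k<n. d k z) = f (r n) z - f (r 0) z" for n
      unfolding d_def by (rule sum_lessThan_telescope[of "\<lambda>k. f (r k) z"])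
    with summable_LIMSEQ[OF s] have "(\<lambda>n. f (r n) z - f (r 0) z) \<longlonglongrightarrow> (\<Sum>k. d k z)" by simp
    then have "(\<lambda>n. f (r n) z - f (r 0) z + f (r 0) z) \<longlonglongrightarrow> (\<Sum>k. d k z) + f (r 0) z"
      by (intro tendsto_intros)
    then show "convergent (\<lambda>k. f (r k) z)" by (auto simp: convergent_def)
  qed
  \<comment> \<open>\<open>lim\<close> is unspecified where the subsequence diverges, which by
    \<open>conv\<close> happens only on a null set.\<close>
  define g where "g z = lim (\<lambda>k. f (r k) z)" for z
  have [measurable]: "g \<in> borel_measurable M" unfolding g_def by measurable
  have nn: "(\<integral>\<^sup>+z. ennreal ((f m z - g z)\<^sup>2) \<partial>M) \<le> ennreal (((1/2) ^ j)\<^sup>2)" if m: "N j \<le> m" for m j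
  proof -
    have "(\<integral>\<^sup>+z. ennreal ((f m z - g z)\<^sup>2) \<partial>M) = (\<integral>\<^sup>+z. liminf (\<lambda>k. ennreal ((f m z - f (r k) z)\<^sup>2)) \<partial>M)"
    proof (rule nn_integral_cong_AE, use conv in eventually_elim)
      fix z assume "convergent (\<lambda>k. f (r k) z)"
      then have "(\<lambda>k. f (r k) z) \<longlonglongrightarrow> g z" by (simp add: g_def convergent_LIMSEQ_iff)
      then have "(\<lambda>k. ennreal ((f m z - f (r k) z)\<^sup>2)) \<longlonglongrightarrow> ennreal ((f m z - g z)\<^sup>2)"
        by (intro tendsto_ennrealI tendsto_intros)
      from lim_imp_Liminf[OF trivial_limit_sequentially this]
      show "ennreal ((f m z - g z)\<^sup>2) = liminf (\<lambda>k. ennreal ((f m z - f (r k) z)\<^sup>2))"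
        by (rule sym)
    qed
    also have "\<dots> \<le> liminf (\<lambda>k. \<integral>\<^sup>+z. ennreal ((f m z - f (r k) z)\<^sup>2) \<partial>M)"
      by (rule nn_integral_liminf) auto
    also have "\<dots> \<le> ennreal (((1/2) ^ j)\<^sup>2)"
    proof (rule Liminf_le)
      show "\<forall>\<^sub>F k in sequentially. (\<integral>\<^sup>+z. ennreal ((f m z - f (r k) z)\<^sup>2) \<partial>M) \<le> ennreal (((1/2) ^ j)\<^sup>2)"
        unfolding eventually_sequentially
      proof (intro exI[of _ j] allI impI)
        fix k assume "j \<le> k"
        have i: "integrable M (\<lambda>z. (f m z - f (r k) z)\<^sup>2)" by (intro L2_integrable_sq L2_diff f)
        have "l2norm M (\<lambda>z. f m z - f (r k) z) < (1/2) ^ j" by (rule N[OF m rN'[OF \<open>j \<le> k\<close>]])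
        then have "(l2norm M (\<lambda>z. f m z - f (r k) z))\<^sup>2 \<le> ((1/2) ^ j)\<^sup>2" by (intro power_mono) auto
        then have "(\<integral>z. (f m z - f (r k) z)\<^sup>2 \<partial>M) \<le> ((1/2) ^ j)\<^sup>2" by (simp add: l2norm_def)
        then show "(\<integral>\<^sup>+z. ennreal ((f m z - f (r k) z)\<^sup>2) \<partial>M) \<le> ennreal (((1/2) ^ j)\<^sup>2)"
          using i by (subst nn_integral_eq_integral) (auto intro: ennreal_leI)
      qed
    qed simp
    finally show ?thesis .
  qed
  have i: "integrable M (\<lambda>z. (f m z - g z)\<^sup>2)" if "N j \<le> m" for m j
    using nn[OF that] by (intro integrableI_bounded) (auto simp: top_unique less_top[symmetric])
  have dg: "(\<lambda>z. f m z - g z) \<in> L2 M" if "N j \<le> m" for m j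
    using i[OF that] by (simp add: L2_def)
  have gL: "g \<in> L2 M"
    using L2_diff[OF f dg[of 0 "N 0"], of "N 0"] by simp
  show ?thesis
  proof (rule exI[of _ g], intro L2_tendstoI f gL LIMSEQ_I)
    fix e :: real assume e: "0 < e"
    then obtain j where j: "(1/2) ^ j < e" using real_arch_pow_inv[of e "1/2"] by auto
    have "norm (l2norm M (\<lambda>z. f m z - g z) - 0) < e" if "N j \<le> m" for m
    proof -
      have "ennreal (\<integral>z. (f m z - g z)\<^sup>2 \<partial>M) \<le> ennreal (((1/2) ^ j)\<^sup>2)"
        using nn[OF that] i[OF that] by (simp add: nn_integral_eq_integral)
      then have "(\<integral>z. (f m z - g z)\<^sup>2 \<partial>M) \<le> ((1/2) ^ j)\<^sup>2" by (simp add: ennreal_le_iff)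
      then have "l2norm M (\<lambda>z. f m z - g z) \<le> (1/2) ^ j"
        unfolding l2norm_def by (rule real_le_lsqrt[rotated -1]) auto
      then show ?thesis using j by simp
    qed
    then show "\<exists>no. \<forall>n\<ge>no. norm (l2norm M (\<lambda>z. f n z - g z) - 0) < e" by blast
  qed
qed

text \<open>The residuals of a minimising sequence converge, by the parallelogram identity.\<close>

lemma L2_projection:
  assumes M: "prob_space M" and W: "W \<subseteq> L2 M" "W \<noteq> {}"
    and lin: "\<And>u v c. u \<in> W \<Longrightarrow> v \<in> W \<Longrightarrow> (\<lambda>z. u z + c * v z) \<in> W"
    and f: "f \<in> L2 M"
  shows "\<exists>r w. (\<forall>n. w n \<in> W) \<and> L2_tendsto M (\<lambda>n z. f z - w n z) r \<and> (\<forall>v\<in>W. ip M r v = 0)"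
proof -
  define N where "N w = l2norm M (\<lambda>z. f z - w z)" for w
  define d where "d = Inf (N ` W)"
  have bb: "bdd_below (N ` W)" by (rule bdd_belowI[of _ 0]) (auto simp: N_def)
  have dle: "d \<le> N w" if "w \<in> W" for w unfolding d_def using bb that by (intro cInf_lower) auto
  have d0: "0 \<le> d" unfolding d_def using W(2) by (intro cInf_greatest) (auto simp: N_def)
  have "\<exists>w\<in>W. N w < d + inverse (real (Suc n))" for n
  proof -
    have "Inf (N ` W) < d + inverse (real (Suc n))" by (simp add: d_def)
    then show ?thesis using W(2) bb by (subst (asm) cInf_less_iff) auto
  qed
  then obtain w where w: "\<And>n. w n \<in> W" "\<And>n. N (w n) < d + inverse (real (Suc n))" by metis
  have Nlim: "(\<lambda>n. N (w n)) \<longlonglongrightarrow> d"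
  proof (rule tendsto_sandwich[OF _ _ tendsto_const])
    show "(\<lambda>n. d + inverse (real (Suc n))) \<longlonglongrightarrow> d"
      using tendsto_add[OF tendsto_const[of d] LIMSEQ_inverse_real_of_nat] by simp
  qed (use dle w in \<open>auto intro!: always_eventually less_imp_le\<close>)
  define g where "g n z = f z - w n z" for n z
  have gL: "g n \<in> L2 M" for n unfolding g_def using W w f by (intro L2_diff) auto
  have par: "(l2norm M (\<lambda>z. g m z - g n z))\<^sup>2 \<le> 2 * (N (w m))\<^sup>2 + 2 * (N (w n))\<^sup>2 - 4 * d\<^sup>2" for m n
  proof -
    \<comment> \<open>The midpoint is built with \<open>lin\<close> alone: first
      \<open>w m - (1/2) * w m\<close>, then half of \<open>w n\<close> is added.\<close>
    have "(\<lambda>z. (1/2) * w m z + (1/2) * w n z) \<in> W"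
      using lin[OF lin[OF w(1)[of m] w(1)[of m], of "-1/2"] w(1)[of n], of "1/2"] by (simp add: field_simps)
    then have "d \<le> N (\<lambda>z. (1/2) * w m z + (1/2) * w n z)" by (rule dle)
    also have "\<dots> = l2norm M (\<lambda>z. (1/2) * (g m z + g n z))" by (simp add: N_def g_def field_simps)
    also have "\<dots> = (1/2) * l2norm M (\<lambda>z. g m z + g n z)" by (subst l2norm_cmult) simp
    finally have "2 * d \<le> l2norm M (\<lambda>z. g m z + g n z)" by simp
    then have "(2 * d)\<^sup>2 \<le> (l2norm M (\<lambda>z. g m z + g n z))\<^sup>2" using d0 by (intro power_mono) auto
    then have "4 * d\<^sup>2 \<le> ip M (g m) (g m) + 2 * ip M (g m) (g n) + ip M (g n) (g n)"
      using ip_quad[OF gL gL, of m 1 n] by (simp add: l2norm_sq power_mult_distrib)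
    moreover have "(l2norm M (\<lambda>z. g m z - g n z))\<^sup>2 = ip M (g m) (g m) - 2 * ip M (g m) (g n) + ip M (g n) (g n)"
      using ip_quad[OF gL gL, of m "-1" n] by (simp add: l2norm_sq)
    moreover have "(N (w k))\<^sup>2 = ip M (g k) (g k)" for k by (simp add: N_def l2norm_sq g_def[abs_def])
    ultimately show ?thesis by simp
  qed
  have "\<exists>r. L2_tendsto M g r"
  proof (rule L2_Cauchy_convergent[OF M gL])
    fix e :: real assume e: "0 < e"
    have "(\<lambda>n. (N (w n))\<^sup>2) \<longlonglongrightarrow> d\<^sup>2" by (intro tendsto_intros Nlim)
    from LIMSEQ_D[OF this, of "e\<^sup>2 / 4"] e obtain K where
      K: "\<And>n. n \<ge> K \<Longrightarrow> \<bar>(N (w n))\<^sup>2 - d\<^sup>2\<bar> < e\<^sup>2 / 4" by auto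
    show "\<exists>K. \<forall>m\<ge>K. \<forall>n\<ge>K. l2norm M (\<lambda>z. g m z - g n z) < e"
    proof (intro exI allI impI)
      fix m n assume "K \<le> m" "K \<le> n"
      then have "(l2norm M (\<lambda>z. g m z - g n z))\<^sup>2 < e\<^sup>2"
        using par[of m n] K[of m] K[of n] by linarith
      then show "l2norm M (\<lambda>z. g m z - g n z) < e" by (rule power_less_imp_less_base) (use e in auto)
    qed
  qed
  then obtain r where r: "L2_tendsto M g r" by blast
  then have rL: "r \<in> L2 M" by (rule L2_tendsto_L2)
  have "l2norm M r = d"
    using L2_tendsto_norm[OF r] Nlim LIMSEQ_unique unfolding N_def g_def by blast
  then have rr: "ip M r r = d\<^sup>2" using l2norm_sq by metis
  have orth: "ip M r v = 0" if v: "v \<in> W" for v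
  proof -
    have vL: "v \<in> L2 M" using v W by auto
    have q: "0 \<le> 2 * t * ip M r v + t\<^sup>2 * ip M v v" for t
    proof -
      have "L2_tendsto M (\<lambda>n z. g n z + t * v z) (\<lambda>z. r z + t * v z)"
        by (rule L2_tendsto_lincomb[OF r L2_tendsto_const[OF vL]])
      from L2_tendsto_norm[OF this]
      have "(\<lambda>n. l2norm M (\<lambda>z. g n z + t * v z)) \<longlonglongrightarrow> l2norm M (\<lambda>z. r z + t * v z)" .
      moreover have "d \<le> l2norm M (\<lambda>z. g n z + t * v z)" for n
        using dle[OF lin[OF w(1)[of n] v, of "- t"]] by (simp add: N_def g_def algebra_simps)
      ultimately have "d \<le> l2norm M (\<lambda>z. r z + t * v z)"
        by (intro LIMSEQ_le_const) auto
      then have "d\<^sup>2 \<le> (l2norm M (\<lambda>z. r z + t * v z))\<^sup>2" using d0 by (rule power_mono)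
      then show ?thesis using ip_quad[OF rL vL, of t] rr by (simp add: l2norm_sq)
    qed
    show ?thesis
    proof (rule ccontr)
      assume n: "ip M r v \<noteq> 0"
      have p: "0 \<le> ip M v v" by (rule ip_self_nonneg)
      \<comment> \<open>The minimiser of the quadratic in \<open>q\<close> with 1 added to the
        denominator, which makes it well defined even when \<open>v\<close> is null and still gives
        a negative value.\<close>
      define t where "t = - ip M r v / (ip M v v + 1)"
      have "2 * t * ip M r v + t\<^sup>2 * ip M v v = - ((ip M r v)\<^sup>2 / (ip M v v + 1)) * (2 - ip M v v / (ip M v v + 1))"
        using p by (simp add: t_def power2_eq_square divide_simps) (simp add: algebra_simps)
      also have "\<dots> < 0" using p n by (intro mult_neg_pos) (auto simp: divide_simps add_nonneg_pos)
      finally show False using q[of t] by simp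
    qed
  qed
  show ?thesis using w(1) r orth unfolding g_def by blast
qed

section \<open>Approximation in L2 by continuous functions of bounded support\<close>

lemma L2_of_bounded_support:
  assumes N: "sets N = sets borel" "\<And>R. emeasure N (cball 0 R) < \<infinity>"
    and f: "f \<in> borel_measurable borel" "\<And>x. \<bar>f x\<bar> \<le> B" "\<And>x::'a::euclidean_space. R < norm x \<Longrightarrow> f x = 0"
  shows "f \<in> L2 N"
proof -
  have m: "f \<in> borel_measurable N" using f(1) measurable_cong_sets[OF N(1) refl] by blast
  have "integrable N (\<lambda>x. (f x)\<^sup>2)"
  proof (rule Bochner_Integration.integrable_bound)
    show "integrable N (\<lambda>x. B\<^sup>2 * indicator (cball 0 R) x)"
      using N by (intro integrable_mult_right integrable_real_indicator) auto
    show "(\<lambda>x. (f x)\<^sup>2) \<in> borel_measurable N" using m by simp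
    have "(f x)\<^sup>2 \<le> B\<^sup>2 * indicator (cball 0 R) x" for x
    proof (cases "R < norm x")
      case False
      then show ?thesis using f(2)[of x] by (simp add: abs_le_square_iff[symmetric])
    qed (simp add: f(3))
    then show "AE x in N. norm ((f x)\<^sup>2) \<le> norm (B\<^sup>2 * indicator (cball 0 R) x :: real)" by simp
  qed
  with m show ?thesis by (simp add: L2_def)
qed

text \<open>First truncate; a bounded function of bounded support is then an a.e. limit of continuous
  functions, which are clamped and cut off to allow dominated convergence.\<close>

lemma Cc_dense_L2:
  fixes f :: "'a::euclidean_space \<Rightarrow> real"
  assumes N: "sets N = sets borel" "\<And>R. emeasure N (cball 0 R) < \<infinity>"
    and ac: "\<And>P. (AE x in lborel. P x) \<Longrightarrow> (AE x in N. P x)"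
    and f: "f \<in> L2 N" and e: "0 < e"
  shows "\<exists>g. continuous_on UNIV g \<and> bsupp g \<and> g \<in> L2 N \<and> l2norm N (\<lambda>x. f x - g x) < e"
proof -
  have mN: "h \<in> borel_measurable N \<longleftrightarrow> h \<in> borel_measurable borel" for h :: "'a \<Rightarrow> real"
    using measurable_cong_sets[OF N(1) refl] by blast
  have [measurable]: "f \<in> borel_measurable borel" using f mN by (simp add: L2_def)
  \<comment> \<open>The dominated convergence step shared by the truncation of \<open>f\<close> and
    the continuous approximation of the truncated function; each contributes half of
    \<open>e\<close>.\<close>
  have small: "\<exists>n. l2norm N (\<lambda>x. h x - s n x) < e / 2"
    if m: "h \<in> borel_measurable borel" "\<And>n. s n \<in> borel_measurable borel"
      and w: "integrable N w" and lim: "AE x in N. (\<lambda>n. s n x) \<longlonglongrightarrow> h x"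
      and dom: "\<And>n x. (h x - s n x)\<^sup>2 \<le> w x" for h w :: "'a \<Rightarrow> real" and s :: "nat \<Rightarrow> 'a \<Rightarrow> real"
  proof -
    have "(\<lambda>n. \<integral>x. (h x - s n x)\<^sup>2 \<partial>N) \<longlonglongrightarrow> (\<integral>x. 0 \<partial>N)"
    proof (rule integral_dominated_convergence[OF _ _ w])
      show "(\<lambda>x. (h x - s n x)\<^sup>2) \<in> borel_measurable N" for n unfolding mN using m by measurable
      show "AE x in N. (\<lambda>n. (h x - s n x)\<^sup>2) \<longlonglongrightarrow> 0"
      proof (use lim in eventually_elim)
        fix x assume "(\<lambda>n. s n x) \<longlonglongrightarrow> h x"
        then have "(\<lambda>n. (h x - s n x)\<^sup>2) \<longlonglongrightarrow> (h x - h x)\<^sup>2" by (intro tendsto_intros)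
        then show "(\<lambda>n. (h x - s n x)\<^sup>2) \<longlonglongrightarrow> 0" by simp
      qed
      show "AE x in N. norm ((h x - s n x)\<^sup>2) \<le> w x" for n using dom by simp
    qed simp
    then have "(\<lambda>n. \<integral>x. (h x - s n x)\<^sup>2 \<partial>N) \<longlonglongrightarrow> 0" by simp
    from LIMSEQ_D[OF this, of "(e/2)\<^sup>2"] e obtain n where "(\<integral>x. (h x - s n x)\<^sup>2 \<partial>N) < (e/2)\<^sup>2" by auto
    then have "l2norm N (\<lambda>x. h x - s n x) < e / 2"
      unfolding l2norm_def using e by (intro real_less_lsqrt) auto
    then show ?thesis ..
  qed
  define s where "s n x = (if norm x \<le> real n \<and> \<bar>f x\<bar> \<le> real n then f x else 0)" for n x
  have [measurable]: "s n \<in> borel_measurable borel" for n unfolding s_def by measurable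
  have "\<exists>n. l2norm N (\<lambda>x. f x - s n x) < e / 2"
  proof (rule small[of _ _ "\<lambda>x. (f x)\<^sup>2"])
    show "integrable N (\<lambda>x. (f x)\<^sup>2)" using f by (simp add: L2_def)
    show "(f x - s n x)\<^sup>2 \<le> (f x)\<^sup>2" for n x by (simp add: s_def)
    show "AE x in N. (\<lambda>n. s n x) \<longlonglongrightarrow> f x"
    proof (rule AE_I2)
      fix x
      obtain k where k: "max (norm x) \<bar>f x\<bar> \<le> real k" using real_arch_simple by blast
      have "\<forall>\<^sub>F n in sequentially. s n x = f x"
        unfolding eventually_sequentially using k by (intro exI[of _ k]) (auto simp: s_def)
      then show "(\<lambda>n. s n x) \<longlonglongrightarrow> f x" by (rule tendsto_eventually)
    qed
  qed measurable
  then obtain k where k: "l2norm N (\<lambda>x. f x - s k x) < e / 2" by blast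
  define h where "h = s k"
  define B where "B = real k"
  have hB: "\<bar>h x\<bar> \<le> B" and h0: "B < norm x \<Longrightarrow> h x = 0" for x by (auto simp: h_def s_def B_def)
  have B: "0 \<le> B" by (simp add: B_def)
  have [measurable]: "h \<in> borel_measurable borel" by (simp add: h_def)
  have hL: "h \<in> L2 N" by (rule L2_of_bounded_support[OF N _ hB h0]) auto
  \<comment> \<open>\<open>measurable_on\<close> provides continuous functions converging off a
    negligible set, and \<open>ac\<close> makes that set null for \<open>N\<close> as well.\<close>
  have "h measurable_on UNIV"
    by (rule lebesgue_measurable_imp_measurable_on) (auto intro: measurable_completion)
  then obtain Ns g where g: "negligible Ns" "\<And>n. continuous_on UNIV (g n)"
      "\<And>x. x \<notin> Ns \<Longrightarrow> (\<lambda>n. g n x) \<longlonglongrightarrow> h x"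
    unfolding measurable_on_def by auto
  have "AE x in lebesgue. x \<notin> Ns" using g(1) by (auto simp: negligible_iff_null_sets intro: AE_not_in)
  then have "AE x in lborel. x \<notin> Ns" by (simp add: AE_completion_iff)
  then have lim: "AE x in N. (\<lambda>n. g n x) \<longlonglongrightarrow> h x" by (rule ac[THEN AE_mp]) (auto intro: g(3))
  \<comment> \<open>Equal to 1 on the ball of radius \<open>B\<close>, where \<open>h\<close> lives,
    and to 0 beyond \<open>B + 1\<close>.\<close>
  define c where "c x = max 0 (min 1 (B + 1 - norm x))" for x :: 'a
  define G where "G n x = c x * max (- B) (min B (g n x))" for n x
  have c01: "0 \<le> c x" "c x \<le> 1" for x by (auto simp: c_def)
  have c0: "c x = 0" if "B + 1 < norm x" for x using that by (simp add: c_def)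
  have GB: "\<bar>G n x\<bar> \<le> B" for n x
  proof -
    have "\<bar>max (- B) (min B (g n x))\<bar> \<le> B" using B by (auto simp: max_def min_def)
    then have "\<bar>c x\<bar> * \<bar>max (- B) (min B (g n x))\<bar> \<le> 1 * B" using c01[of x] by (intro mult_mono) auto
    then show ?thesis by (simp add: G_def abs_mult)
  qed
  have Gc: "continuous_on UNIV (G n)" for n
    unfolding G_def c_def by (intro continuous_intros g(2))
  have [measurable]: "G n \<in> borel_measurable borel" for n
    using Gc by (rule borel_measurable_continuous_onI)
  have G0: "G n x = 0" if "B + 1 < norm x" for n x using c0[OF that] by (simp add: G_def)
  have "\<exists>n. l2norm N (\<lambda>x. h x - G n x) < e / 2"
  proof (rule small[of _ _ "\<lambda>x. (2 * B)\<^sup>2 * indicator (cball 0 (B + 1)) x"])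
    show "integrable N (\<lambda>x. (2 * B)\<^sup>2 * indicator (cball 0 (B + 1)) x)"
      using N by (intro integrable_mult_right integrable_real_indicator) auto
    show "AE x in N. (\<lambda>n. G n x) \<longlonglongrightarrow> h x"
    proof (use lim in eventually_elim)
      fix x assume "(\<lambda>n. g n x) \<longlonglongrightarrow> h x"
      then have "(\<lambda>n. G n x) \<longlonglongrightarrow> c x * max (- B) (min B (h x))"
        unfolding G_def by (intro tendsto_intros)
      also have "max (- B) (min B (h x)) = h x" using hB[of x] by (auto simp: max_def min_def abs_le_iff)
      also have "c x * h x = h x" using h0[of x] by (cases "B < norm x") (auto simp: c_def)
      finally show "(\<lambda>n. G n x) \<longlonglongrightarrow> h x" .
    qed
    show "(h x - G n x)\<^sup>2 \<le> (2 * B)\<^sup>2 * indicator (cball 0 (B + 1)) x" for n x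
    proof (cases "B + 1 < norm x")
      case True then show ?thesis using G0 h0 by simp
    next
      case False
      have "\<bar>h x - G n x\<bar> \<le> 2 * B" using hB[of x] GB[of n x] by linarith
      then have "(h x - G n x)\<^sup>2 \<le> (2 * B)\<^sup>2" using power_mono[of "\<bar>h x - G n x\<bar>" "2 * B" 2] by simp
      then show ?thesis using False by (simp add: indicator_def)
    qed
  qed measurable
  then obtain n where n: "l2norm N (\<lambda>x. h x - G n x) < e / 2" by blast
  have GL: "G n \<in> L2 N" by (rule L2_of_bounded_support[OF N _ GB G0]) auto
  have bs: "bsupp (G n)" by (rule bsuppI[of _ "B + 1"]) (use G0 in \<open>force simp: not_le[symmetric]\<close>)
  have "l2norm N (\<lambda>x. f x - G n x) \<le> l2norm N (\<lambda>x. f x - h x) + l2norm N (\<lambda>x. h x - G n x)"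
    by (rule l2norm_triangle3[OF f GL hL])
  also have "\<dots> < e" using k n unfolding h_def by simp
  finally show ?thesis using Gc bs GL by blast
qed

lemma emeasure_lborel_cball_finite': "emeasure lborel (cball (0::'a::euclidean_space) R) < \<infinity>"
  using emeasure_bounded_finite[OF bounded_cball] by blast

lemma L2_lborel_Cc:
  assumes "continuous_on UNIV f" "bsupp f"
  shows "f \<in> L2 (lborel :: 'a::euclidean_space measure)"
proof -
  obtain B where "\<And>z. \<bar>f z\<bar> \<le> B" using bounded_bsupp[OF assms] by blast
  moreover obtain R where "\<And>z. f z \<noteq> 0 \<Longrightarrow> norm z \<le> R" using assms(2) unfolding bsupp_def by blast
  ultimately show ?thesis
    using assms(1) by (intro L2_of_bounded_support[of _ _ B R] emeasure_lborel_cball_finite')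
      (auto intro: borel_measurable_continuous_onI simp: not_le[symmetric])
qed

text \<open>Displacements below 1 keep both points in the ball of radius \<open>R + 1\<close>
  whenever one of the two values is nonzero, and there compactness applies. The bound
  \<open>d \<le> 1\<close> is exported to control the supports of increments of kernels.\<close>

lemma bsupp_uniformly_continuous:
  fixes f :: "'a::euclidean_space \<Rightarrow> real"
  assumes c: "continuous_on UNIV f" and b: "bsupp f" and e: "0 < e"
  obtains d where "0 < d" "d \<le> 1" "\<And>z h. norm h < d \<Longrightarrow> \<bar>f (z + h) - f z\<bar> < e"
proof -
  obtain R where R: "\<And>z. f z \<noteq> 0 \<Longrightarrow> norm z \<le> R" using b unfolding bsupp_def by blast
  have "uniformly_continuous_on (cball 0 (R + 1)) f"
    by (rule compact_uniformly_continuous) (auto intro: continuous_on_subset[OF c])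
  then obtain d where d: "0 < d" "\<And>x y. x \<in> cball 0 (R + 1) \<Longrightarrow> y \<in> cball 0 (R + 1) \<Longrightarrow> dist y x < d \<Longrightarrow> dist (f y) (f x) < e"
    unfolding uniformly_continuous_on_def using e by metis
  show ?thesis
  proof (rule that[of "min d 1"])
    fix z h :: 'a assume h: "norm h < min d 1"
    show "\<bar>f (z + h) - f z\<bar> < e"
    proof (cases "f z = 0 \<and> f (z + h) = 0")
      case False
      then have "norm z \<le> R \<or> norm (z + h) \<le> R" using R by blast
      moreover have "norm (z + h) \<le> norm z + norm h" "norm z \<le> norm (z + h) + norm h"
        using norm_triangle_ineq[of z h] norm_triangle_ineq4[of "z + h" h] by auto
      ultimately have "norm z \<le> R + 1" "norm (z + h) \<le> R + 1" using h by auto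
      then have "z \<in> cball 0 (R + 1)" "z + h \<in> cball 0 (R + 1)" by (simp_all add: mem_cball_0)
      from d(2)[OF this] h show ?thesis by (simp add: dist_norm)
    qed (use e in auto)
  qed (use d in auto)
qed

text \<open>The mean value theorem on the segment together with uniform continuity of the partial
  derivatives. Uniformity in \<open>z\<close> is what lets a derivative pass under a convolution
  integral.\<close>

lemma uniformly_differentiable_Cck:
  fixes f :: "'a::euclidean_space \<Rightarrow> real"
  assumes f: "f \<in> Cck 1" and e: "0 < e"
  obtains d where "0 < d" "d \<le> 1" "\<And>z h. norm h < d \<Longrightarrow> \<bar>f (z + h) - f z - pd f h z\<bar> \<le> e * norm h"
proof -
  define e' where "e' = e / DIM('a)"
  have e': "0 < e'" using e by (simp add: e'_def)
  have df: "f differentiable at z" for z using f by (auto simp: Cck_def intro: Ck_differentiable)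
  have "\<exists>d>0. d \<le> 1 \<and> (\<forall>z h. norm h < d \<longrightarrow> \<bar>pd f i (z + h) - pd f i z\<bar> < e')" if "i \<in> Basis" for i
  proof -
    have "pd f i \<in> Cck 0" using f that by (intro Cck_pd) auto
    then show ?thesis using bsupp_uniformly_continuous[OF _ _ e', of "pd f i"] by (metis CckD Ck_0)
  qed
  then obtain d where d: "\<And>i. i \<in> Basis \<Longrightarrow> 0 < d i \<and> d i \<le> 1"
    "\<And>i z h. i \<in> Basis \<Longrightarrow> norm h < d i \<Longrightarrow> \<bar>pd f i (z + h) - pd f i z\<bar> < e'" by metis
  show ?thesis
  proof (rule that[of "Min (d ` Basis)"])
    show "0 < Min (d ` Basis)" using d by (subst Min_gr_iff) auto
    obtain i :: 'a where "i \<in> Basis" using nonempty_Basis by blast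
    then show "Min (d ` Basis) \<le> 1" using d(1)[of i] by (auto intro!: Min.coboundedI[THEN order_trans])
    fix z h :: 'a assume h: "norm h < Min (d ` Basis)"
    have "((\<lambda>s. f (z + s *\<^sub>R h)) has_real_derivative pd f h (z + s *\<^sub>R h)) (at s)" for s
      by (rule has_real_derivative_pd_line[OF df])
    from MVT2[of 0 1, OF zero_less_one this] obtain s where s: "0 < s" "s < 1"
      "f (z + h) - f z = pd f h (z + s *\<^sub>R h)" by auto
    have sh: "norm (s *\<^sub>R h) \<le> norm h" using s by (simp add: mult_left_le_one_le)
    have "f (z + h) - f z - pd f h z = (\<Sum>i\<in>Basis. (h \<bullet> i) * (pd f i (z + s *\<^sub>R h) - pd f i z))"
      unfolding s(3) pd_expand[OF df, of h] by (simp add: sum_subtractf right_diff_distrib)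
    also have "\<bar>\<dots>\<bar> \<le> (\<Sum>i\<in>Basis. \<bar>h \<bullet> i\<bar> * \<bar>pd f i (z + s *\<^sub>R h) - pd f i z\<bar>)"
      by (rule sum_abs[THEN order_trans]) (simp add: abs_mult)
    also have "\<dots> \<le> (\<Sum>i\<in>(Basis::'a set). norm h * e')"
    proof (rule sum_mono, rule mult_mono)
      fix i :: 'a assume i: "i \<in> Basis"
      show "\<bar>h \<bullet> i\<bar> \<le> norm h" using i by (rule Basis_le_norm)
      have "norm (s *\<^sub>R h) < d i" using sh h i by (auto intro: order.strict_trans1)
      then show "\<bar>pd f i (z + s *\<^sub>R h) - pd f i z\<bar> \<le> e'" using d(2)[OF i] by (simp add: less_imp_le)
    qed auto
    also have "\<dots> = e * norm h" by (simp add: e'_def)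
    finally show "\<bar>f (z + h) - f z - pd f h z\<bar> \<le> e * norm h" .
  qed
qed

section \<open>Mollification\<close>

text \<open>The integration variable is kept in \<open>w\<close>, so that all derivatives fall on
  \<open>\<eta>\<close> and \<open>w\<close> needs no regularity.\<close>

definition conv :: "('a::euclidean_space \<Rightarrow> real) \<Rightarrow> ('a \<Rightarrow> real) \<Rightarrow> 'a \<Rightarrow> real" where
  "conv w \<eta> x = (\<integral>y. w y * \<eta> (x - y) \<partial>lborel)"

lemma L2_lborel_reflect:
  assumes "continuous_on UNIV \<eta>" "bsupp \<eta>"
  shows "(\<lambda>y. \<eta> (x - y)) \<in> L2 (lborel :: 'a::euclidean_space measure)"
proof (rule L2_lborel_Cc)
  show "continuous_on UNIV (\<lambda>y. \<eta> (x - y))"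
    by (rule continuous_on_compose2[OF assms(1)]) (auto intro!: continuous_intros)
  obtain R where "\<And>z. \<eta> z \<noteq> 0 \<Longrightarrow> norm z \<le> R" using assms(2) unfolding bsupp_def by blast
  then show "bsupp (\<lambda>y. \<eta> (x - y))"
    by (intro bsuppI[of _ "norm x + R"]) (metis norm_triangle_sub add.commute add_le_cancel_left norm_minus_commute order_trans)
qed

lemma conv_integrable:
  assumes "w \<in> L2 lborel" "continuous_on UNIV \<eta>" "bsupp \<eta>"
  shows "integrable lborel (\<lambda>y. w y * \<eta> (x - y))"
  using assms by (intro L2_integrable_mult L2_lborel_reflect)

lemma L2_integrable_abs_cball:
  assumes "w \<in> L2 (lborel :: 'a::euclidean_space measure)"
  shows "integrable lborel (\<lambda>y. \<bar>w y\<bar> * indicator (cball x R) y)"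
proof (rule L2_integrable_mult)
  show "(\<lambda>y. \<bar>w y\<bar>) \<in> L2 lborel" using assms by (auto simp: L2_def)
  have "integrable lborel (indicator (cball x R) :: 'a \<Rightarrow> real)"
    by (rule integrable_real_indicator) (use emeasure_bounded_finite[OF bounded_cball] in auto)
  moreover have "(\<lambda>y. (indicator (cball x R) y)\<^sup>2) = (indicator (cball x R) :: 'a \<Rightarrow> real)"
    by (auto simp: indicator_def)
  ultimately show "indicator (cball x R) \<in> L2 (lborel :: 'a measure)" by (simp add: L2_def)
qed

lemma integral_mult_small:
  assumes w: "w \<in> L2 (lborel :: 'a::euclidean_space measure)"
    and r: "integrable lborel (\<lambda>y. w y * r y)"
    and c: "\<And>y. \<bar>r y\<bar> \<le> c" "\<And>y. y \<notin> cball x R \<Longrightarrow> r y = 0"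
  shows "\<bar>\<integral>y. w y * r y \<partial>lborel\<bar> \<le> c * (\<integral>y. \<bar>w y\<bar> * indicator (cball x R) y \<partial>lborel)"
proof -
  have "\<bar>\<integral>y. w y * r y \<partial>lborel\<bar> \<le> (\<integral>y. \<bar>w y * r y\<bar> \<partial>lborel)" by (rule integral_abs_bound)
  also have "\<dots> \<le> (\<integral>y. c * (\<bar>w y\<bar> * indicator (cball x R) y) \<partial>lborel)"
  proof (rule integral_mono)
    show "integrable lborel (\<lambda>y. \<bar>w y * r y\<bar>)" using r by simp
    show "integrable lborel (\<lambda>y. c * (\<bar>w y\<bar> * indicator (cball x R) y))"
      using L2_integrable_abs_cball[OF w] by (rule integrable_mult_right)
    fix y show "\<bar>w y * r y\<bar> \<le> c * (\<bar>w y\<bar> * indicator (cball x R) y)"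
      using c(1)[of y] c(2)[of y] by (cases "y \<in> cball x R") (auto simp: abs_mult mult.commute[of c] intro: mult_left_mono)
  qed
  finally show ?thesis by simp
qed

text \<open>Here \<open>r\<close> will be an increment or a Taylor remainder of a kernel: uniformly
  small and supported in a fixed ball, so only the local L1 norm of \<open>w\<close> around
  \<open>x\<close> enters.\<close>

lemma conv_increment:
  fixes \<eta> r :: "'a::euclidean_space \<Rightarrow> real"
  assumes w: "w \<in> L2 lborel" and r: "continuous_on UNIV r" "bsupp r"
    and c: "\<And>z. \<bar>r z\<bar> \<le> c" "\<And>z. r z \<noteq> 0 \<Longrightarrow> norm z \<le> R"
  shows "\<bar>conv w r x\<bar> \<le> c * (\<integral>y. \<bar>w y\<bar> * indicator (cball x R) y \<partial>lborel)"
  unfolding conv_def using c(2)[of "x - y" for y]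
  by (intro integral_mult_small[OF w conv_integrable[OF w r]] c(1)) (force simp: dist_norm)

lemma conv_diff:
  assumes "w \<in> L2 lborel" "continuous_on UNIV f" "bsupp f" "continuous_on UNIV g" "bsupp g"
  shows "conv w (\<lambda>z. f z - g z) x = conv w f x - conv w g x"
  unfolding conv_def using conv_integrable[OF assms(1,2,3)] conv_integrable[OF assms(1,4,5)]
  by (simp add: right_diff_distrib)

lemma conv_cmult: "conv w (\<lambda>z. c * f z) x = c * conv w f x"
  unfolding conv_def by (simp add: mult.left_commute)

lemma conv_sum:
  assumes "w \<in> L2 lborel" "\<And>i. i \<in> I \<Longrightarrow> continuous_on UNIV (f i)" "\<And>i. i \<in> I \<Longrightarrow> bsupp (f i)"
  shows "conv w (\<lambda>z. \<Sum>i\<in>I. f i z) x = (\<Sum>i\<in>I. conv w (f i) x)"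
  unfolding conv_def using conv_integrable[OF assms(1) assms(2,3)]
  by (simp add: sum_distrib_left Bochner_Integration.integral_sum)

lemma conv_shift: "conv w (\<lambda>z. f (z + h)) x = conv w f (x + h)"
  unfolding conv_def by (simp add: algebra_simps)

lemma continuous_shift: "continuous_on UNIV f \<Longrightarrow> continuous_on UNIV (\<lambda>z::'a::real_normed_vector. f (z + h))"
  by (rule continuous_on_compose2[of UNIV f]) (auto intro!: continuous_intros)

lemma bsupp_shift:
  assumes "bsupp f" shows "bsupp (\<lambda>z. f (z + h))"
proof -
  obtain R where R: "\<And>z. f z \<noteq> 0 \<Longrightarrow> norm z \<le> R" using assms unfolding bsupp_def by blast
  show ?thesis
  proof (rule bsuppI[of _ "R + norm h"])
    fix z assume "f (z + h) \<noteq> 0"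
    then show "norm z \<le> R + norm h" using R[of "z + h"] norm_triangle_ineq4[of "z + h" h] by simp
  qed
qed

lemma conv_continuous:
  assumes w: "w \<in> L2 lborel" and \<eta>: "continuous_on UNIV \<eta>" "bsupp \<eta>"
  shows "continuous_on UNIV (conv w \<eta>)"
proof -
  obtain R where R: "\<And>z. \<eta> z \<noteq> 0 \<Longrightarrow> norm z \<le> R" using \<eta>(2) unfolding bsupp_def by blast
  have "isCont (conv w \<eta>) x" for x
    unfolding continuous_at_eps_delta
  proof (intro allI impI)
    fix e :: real assume e: "0 < e"
    define A where "A = (\<integral>y. \<bar>w y\<bar> * indicator (cball x (R + 1)) y \<partial>lborel)"
    have A: "0 \<le> A" unfolding A_def by simp
    \<comment> \<open>Adding 1 to the denominator covers the case that \<open>w\<close> vanishes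
      near \<open>x\<close>.\<close>
    define e' where "e' = e / (A + 1)"
    have e': "0 < e'" using e A by (simp add: e'_def)
    obtain d where d: "0 < d" "d \<le> 1" "\<And>z h. norm h < d \<Longrightarrow> \<bar>\<eta> (z + h) - \<eta> z\<bar> < e'"
      using bsupp_uniformly_continuous[OF \<eta> e'] by blast
    show "\<exists>d>0. \<forall>x'. dist x' x < d \<longrightarrow> dist (conv w \<eta> x') (conv w \<eta> x) < e"
    proof (intro exI[of _ d] conjI allI impI d(1))
      fix x' assume x': "dist x' x < d"
      define h where "h = x' - x"
      have h: "norm h < d" using x' by (simp add: h_def dist_norm)
      have eq: "conv w \<eta> x' - conv w \<eta> x = conv w (\<lambda>z. \<eta> (z + h) - \<eta> z) x"
        by (subst conv_diff[OF w continuous_shift[OF \<eta>(1)] bsupp_shift[OF \<eta>(2)] \<eta>])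
          (simp add: conv_shift h_def)
      have "\<bar>conv w (\<lambda>z. \<eta> (z + h) - \<eta> z) x\<bar> \<le> e' * A"
        unfolding A_def
      proof (rule conv_increment[OF w])
        show "continuous_on UNIV (\<lambda>z. \<eta> (z + h) - \<eta> z)" "bsupp (\<lambda>z. \<eta> (z + h) - \<eta> z)"
          by (intro continuous_intros bsupp_intros continuous_shift bsupp_shift \<eta>)+
        show "\<bar>\<eta> (z + h) - \<eta> z\<bar> \<le> e'" for z using d(3)[OF h] by (simp add: less_imp_le)
        fix z assume "\<eta> (z + h) - \<eta> z \<noteq> 0"
        then have "norm z \<le> R \<or> norm (z + h) \<le> R" using R[of z] R[of "z + h"] by (cases "\<eta> z = 0") auto
        then show "norm z \<le> R + 1" using norm_triangle_ineq4[of "z + h" h] h d(2) by auto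
      qed
      also have "\<dots> < e" using A e by (simp add: e'_def field_simps)
      finally show "dist (conv w \<eta> x') (conv w \<eta> x) < e" by (simp add: dist_real_def eq)
    qed
  qed
  then show ?thesis by (simp add: continuous_on_eq_continuous_at)
qed

text \<open>The Taylor remainder of the kernel is small relative to the displacement, uniformly in
  the base point, and supported in a ball enlarged by 1. \<open>conv_increment\<close> turns this
  into a bound on the remainder of the convolution.\<close>

lemma conv_has_derivative:
  assumes w: "w \<in> L2 lborel" and \<eta>: "\<eta> \<in> Cck 1"
  shows "(conv w \<eta> has_derivative (\<lambda>h. \<Sum>i\<in>Basis. (h \<bullet> i) * conv w (pd \<eta> i) x)) (at x)"
  unfolding has_derivative_at_alt
proof (intro conjI allI impI)
  show "bounded_linear (\<lambda>h. \<Sum>i\<in>Basis. (h \<bullet> i) * conv w (pd \<eta> i) x)"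
    by (intro bounded_linear_sum bounded_linear_mult_const bounded_linear_inner_left)
  have c\<eta>: "continuous_on UNIV \<eta>" "bsupp \<eta>" using \<eta> by (auto simp: Cck_def intro: Ck_continuous)
  have d\<eta>: "\<eta> differentiable at z" for z using \<eta> by (auto simp: Cck_def intro: Ck_differentiable)
  have cp: "continuous_on UNIV (pd \<eta> i)" "bsupp (pd \<eta> i)" if "i \<in> Basis" for i
    using Cck_pd[of \<eta> 0 i] \<eta> that by (auto simp: Cck_def Ck_0)
  obtain R where R: "\<And>z. \<eta> z \<noteq> 0 \<Longrightarrow> norm z \<le> R" using c\<eta>(2) unfolding bsupp_def by blast
  have pR: "norm z \<le> R" if "pd \<eta> h z \<noteq> 0" for z h
  proof (rule ccontr)
    assume z: "\<not> norm z \<le> R"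
    have "(\<eta> has_derivative (\<lambda>h. 0)) (at z)"
    proof (rule has_derivative_transform_within_open[of "\<lambda>z. 0" "\<lambda>h. 0" z UNIV "- cball 0 R"])
      show "open (- cball (0::'a) R)" by (simp add: open_Compl)
    qed (use z R in \<open>force\<close>)+
    with that show False using has_derivative_pd by blast
  qed
  fix e :: real assume e: "0 < e"
  define A where "A = (\<integral>y. \<bar>w y\<bar> * indicator (cball x (R + 1)) y \<partial>lborel)"
  have A: "0 \<le> A" unfolding A_def by simp
  define e' where "e' = e / (A + 1)"
  have e': "0 < e'" using e A by (simp add: e'_def)
  obtain d where d: "0 < d" "d \<le> 1" "\<And>z h. norm h < d \<Longrightarrow> \<bar>\<eta> (z + h) - \<eta> z - pd \<eta> h z\<bar> \<le> e' * norm h"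
    using uniformly_differentiable_Cck[OF \<eta> e'] by blast
  show "\<exists>d>0. \<forall>y. norm (y - x) < d \<longrightarrow>
      norm (conv w \<eta> y - conv w \<eta> x - (\<Sum>i\<in>Basis. ((y - x) \<bullet> i) * conv w (pd \<eta> i) x)) \<le> e * norm (y - x)"
  proof (intro exI[of _ d] conjI allI impI d(1))
    fix y assume y: "norm (y - x) < d"
    define h where "h = y - x"
    have h: "norm h < d" using y by (simp add: h_def)
    have pe: "pd \<eta> h = (\<lambda>z. \<Sum>i\<in>Basis. (h \<bullet> i) * pd \<eta> i z)"
      by (rule ext, rule pd_expand[OF d\<eta>])
    have ch: "continuous_on UNIV (pd \<eta> h)" "bsupp (pd \<eta> h)"
      unfolding pe using cp by (auto intro!: continuous_intros bsupp_sum bsupp_mult2)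
    have c1: "continuous_on UNIV (\<lambda>z. \<eta> (z + h) - \<eta> z)" "bsupp (\<lambda>z. \<eta> (z + h) - \<eta> z)"
      by (intro continuous_intros bsupp_intros continuous_shift bsupp_shift c\<eta>)+
    have "conv w (pd \<eta> h) x = (\<Sum>i\<in>Basis. (h \<bullet> i) * conv w (pd \<eta> i) x)"
      unfolding pe using cp by (subst conv_sum[OF w]) (auto intro!: continuous_intros bsupp_mult2 simp: conv_cmult)
    then have eq: "conv w \<eta> y - conv w \<eta> x - (\<Sum>i\<in>Basis. (h \<bullet> i) * conv w (pd \<eta> i) x)
        = conv w (\<lambda>z. \<eta> (z + h) - \<eta> z - pd \<eta> h z) x"
      by (simp add: conv_diff[OF w c1 ch] conv_diff[OF w continuous_shift[OF c\<eta>(1)] bsupp_shift[OF c\<eta>(2)] c\<eta>])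
        (simp add: conv_shift h_def)
    have "\<bar>conv w (\<lambda>z. \<eta> (z + h) - \<eta> z - pd \<eta> h z) x\<bar> \<le> (e' * norm h) * A"
      unfolding A_def
    proof (rule conv_increment[OF w])
      show "continuous_on UNIV (\<lambda>z. \<eta> (z + h) - \<eta> z - pd \<eta> h z)" "bsupp (\<lambda>z. \<eta> (z + h) - \<eta> z - pd \<eta> h z)"
        by (intro continuous_on_diff bsupp_diff c1 ch)+
      show "\<bar>\<eta> (z + h) - \<eta> z - pd \<eta> h z\<bar> \<le> e' * norm h" for z using d(3)[OF h] .
      fix z assume "\<eta> (z + h) - \<eta> z - pd \<eta> h z \<noteq> 0"
      then have "norm z \<le> R \<or> norm (z + h) \<le> R" using R[of z] R[of "z + h"] pR[of h z] by force
      then show "norm z \<le> R + 1" using norm_triangle_ineq4[of "z + h" h] h d(2) by auto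
    qed
    also have "\<dots> \<le> e * norm h"
    proof -
      have "e' * A \<le> e" using A e by (simp add: e'_def field_simps)
      then have "e' * A * norm h \<le> e * norm h" by (intro mult_right_mono) auto
      then show ?thesis by (simp add: mult_ac)
    qed
    finally show "norm (conv w \<eta> y - conv w \<eta> x - (\<Sum>i\<in>Basis. ((y - x) \<bullet> i) * conv w (pd \<eta> i) x)) \<le> e * norm (y - x)"
      using eq by (simp add: h_def)
  qed
qed

lemma pd_conv:
  assumes "w \<in> L2 lborel" "\<eta> \<in> Cck 1" "i \<in> Basis"
  shows "pd (conv w \<eta>) i = conv w (pd \<eta> i)"
proof
  fix x
  have "pd (conv w \<eta>) i x = (\<Sum>j\<in>Basis. (i \<bullet> j) * conv w (pd \<eta> j) x)"
    by (rule has_derivative_pd[OF conv_has_derivative[OF assms(1,2)]])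
  also have "\<dots> = (\<Sum>j\<in>Basis. if j = i then conv w (pd \<eta> j) x else 0)"
    using assms(3) by (intro sum.cong) (auto simp: inner_Basis)
  also have "\<dots> = conv w (pd \<eta> i) x" using assms(3) by simp
  finally show "pd (conv w \<eta>) i x = conv w (pd \<eta> i) x" .
qed

lemma Ck_conv:
  assumes "w \<in> L2 lborel" shows "\<eta> \<in> Cck k \<Longrightarrow> Ck k (conv w \<eta>)"
proof (induction k arbitrary: \<eta>)
  case 0 then show ?case using conv_continuous[OF assms] by (auto simp: Cck_def Ck_0)
next
  case (Suc k)
  then have \<eta>1: "\<eta> \<in> Cck 1" by (auto intro: Cck_mono)
  show ?case
    using Suc pd_conv[OF assms \<eta>1] differentiableI[OF conv_has_derivative[OF assms \<eta>1]]
    by (auto simp: Ck_Suc intro: Cck_pd)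
qed

lemma integral_bump_pos:
  assumes R: "0 < R" shows "0 < (\<integral>x. bump R x \<partial>(lborel :: 'a::euclidean_space measure))"
proof -
  have "0 < exp (- 1) * measure lborel (cball (0::'a) R)" using R by (simp add: content_cball_pos)
  also have "\<dots> = (\<integral>x. exp (- 1) * indicator (cball (0::'a) R) x \<partial>lborel)" by simp
  also have "\<dots> \<le> (\<integral>x. bump R x \<partial>(lborel :: 'a measure))"
  proof (rule integral_mono)
    show "integrable lborel (\<lambda>x. exp (- 1) * indicator (cball (0::'a) R) x :: real)"
      using emeasure_bounded_finite[OF bounded_cball, of "0::'a" R]
      by (intro integrable_mult_right integrable_real_indicator) auto
    show "integrable lborel (bump R :: 'a \<Rightarrow> real)" by (rule integrable_lborel_Cck[OF bump_Cck[OF R, of 0]])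
    fix x :: 'a
    show "exp (- 1) * indicator (cball 0 R) x \<le> bump R x"
    proof (cases "norm x \<le> R")
      case True
      then have "(norm x)\<^sup>2 / R\<^sup>2 \<le> 1" using R by (simp add: power_mono)
      then have 1: "1 \<le> 2 - (norm x)\<^sup>2 / R\<^sup>2" by simp
      then have "inverse (2 - (norm x)\<^sup>2 / R\<^sup>2) \<le> 1" by (simp add: inverse_le_1_iff)
      then show ?thesis using True 1 by (simp add: bump_def flat_exp_def)
    qed (simp add: bump_bounds)
  qed
  finally show ?thesis .
qed

text \<open>The radius is halved because \<open>bump R\<close> is known to vanish outside radius
  \<open>2 * R\<close>; the support then lies within radius
  \<open>inverse (real (Suc n))\<close>.\<close>

definition moll :: "nat \<Rightarrow> 'a::euclidean_space \<Rightarrow> real" where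
  "moll n x = bump (inverse (real (Suc n)) / 2) x / (\<integral>y. bump (inverse (real (Suc n)) / 2) y \<partial>(lborel :: 'a measure))"

lemma moll_Cck: "moll n \<in> Cck k"
proof -
  have "(\<lambda>x. (1 / (\<integral>y. bump (inverse (real (Suc n)) / 2) y \<partial>lborel)) * bump (inverse (real (Suc n)) / 2) x) \<in> Cck k"
    by (intro Cck_cmult bump_Cck) simp
  then show ?thesis by (simp add: moll_def[abs_def])
qed

lemma moll_nonneg: "0 \<le> moll n x"
  unfolding moll_def using integral_bump_pos[of "inverse (real (Suc n)) / 2"] by (intro divide_nonneg_pos bump_bounds) simp

lemma moll_integral: "(\<integral>x. moll n x \<partial>lborel) = 1"
  unfolding moll_def using integral_bump_pos[of "inverse (real (Suc n)) / 2", where 'a='a] by simp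

lemma moll_support: "moll n x \<noteq> 0 \<Longrightarrow> norm x < inverse (real (Suc n))"
  using bump_support[of "inverse (real (Suc n)) / 2" x] by (auto simp: moll_def)

lemma Cck_continuous: "f \<in> Cck k \<Longrightarrow> continuous_on UNIV f"
  by (auto simp: Cck_def intro: Ck_continuous)

lemma Cck_measurable: "f \<in> Cck k \<Longrightarrow> f \<in> borel_measurable borel"
  by (auto intro: borel_measurable_continuous_onI Cck_continuous)

lemma integral_lborel_reflect:
  fixes f :: "'a::euclidean_space \<Rightarrow> real"
  assumes [measurable]: "f \<in> borel_measurable borel"
  shows "integral\<^sup>L lborel (\<lambda>y. f (x - y)) = integral\<^sup>L lborel f"
    and "integrable lborel (\<lambda>y. f (x - y)) \<longleftrightarrow> integrable lborel f"
proof -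
  have *: "lborel = distr lborel borel (\<lambda>y::'a. x - y)"
    using lborel_affine[of "-1" x] by (simp add: density_1)
  show "integral\<^sup>L lborel (\<lambda>y. f (x - y)) = integral\<^sup>L lborel f"
    by (subst (2) *, subst integral_distr) auto
  show "integrable lborel (\<lambda>y. f (x - y)) \<longleftrightarrow> integrable lborel f"
    by (subst (2) *, subst integrable_distr_eq) auto
qed

text \<open>By Jensen's inequality and Fubini's theorem.\<close>

lemma conv_L2:
  fixes w \<eta> :: "'a::euclidean_space \<Rightarrow> real"
  assumes w: "w \<in> L2 lborel" and \<eta>: "\<eta> \<in> Cck 0" "\<And>x. 0 \<le> \<eta> x" "integral\<^sup>L lborel \<eta> = 1"
  shows "conv w \<eta> \<in> L2 lborel" and "l2norm lborel (conv w \<eta>) \<le> l2norm lborel w"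
proof -
  have [measurable]: "w \<in> borel_measurable borel" using w by (simp add: L2_def)
  have [measurable]: "\<eta> \<in> borel_measurable borel" using \<eta>(1) by (rule Cck_measurable)
  have c: "continuous_on UNIV \<eta>" "bsupp \<eta>" using \<eta>(1) by (auto intro: Cck_continuous CckD)
  have [measurable]: "conv w \<eta> \<in> borel_measurable borel"
    using conv_continuous[OF w c] by (rule borel_measurable_continuous_onI)
  have i\<eta>: "integrable lborel \<eta>" using \<eta>(1) by (rule integrable_lborel_Cck)
  have J: "ennreal ((conv w \<eta> x)\<^sup>2) \<le> (\<integral>\<^sup>+y. ennreal ((w y)\<^sup>2) * ennreal (\<eta> (x - y)) \<partial>lborel)" for x
  proof -
    have L: "(\<lambda>y. sqrt (\<eta> (x - y))) \<in> L2 lborel"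
    proof (rule L2_lborel_reflect[of "\<lambda>z. sqrt (\<eta> z)"])
      show "continuous_on UNIV (\<lambda>z. sqrt (\<eta> z))" by (intro continuous_intros c)
      show "bsupp (\<lambda>z. sqrt (\<eta> z))" using c(2) by (rule bsupp_subset) simp
    qed
    obtain B where B: "\<And>z. \<bar>\<eta> z\<bar> \<le> B" using bounded_bsupp[OF c] by blast
    have L2: "(\<lambda>y. sqrt (\<eta> (x - y)) * w y) \<in> L2 lborel"
      by (rule L2_mult_bounded[OF w, of _ "sqrt B"]) (use B \<eta>(2) in \<open>auto intro: order_trans[OF abs_ge_self]\<close>)
    have "conv w \<eta> x = ip lborel (\<lambda>y. sqrt (\<eta> (x - y)) * w y) (\<lambda>y. sqrt (\<eta> (x - y)))"
      unfolding conv_def ip_def using \<eta>(2) by (intro Bochner_Integration.integral_cong) (auto simp: mult_ac)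
    then have "\<bar>conv w \<eta> x\<bar> \<le> l2norm lborel (\<lambda>y. sqrt (\<eta> (x - y)) * w y) * l2norm lborel (\<lambda>y. sqrt (\<eta> (x - y)))"
      using ip_CS[OF L2 L] by simp
    also have "l2norm lborel (\<lambda>y. sqrt (\<eta> (x - y))) = 1"
      using \<eta>(2,3) by (simp add: l2norm_def integral_lborel_reflect)
    finally have "\<bar>conv w \<eta> x\<bar> \<le> l2norm lborel (\<lambda>y. sqrt (\<eta> (x - y)) * w y)" by simp
    then have "\<bar>conv w \<eta> x\<bar>\<^sup>2 \<le> (l2norm lborel (\<lambda>y. sqrt (\<eta> (x - y)) * w y))\<^sup>2" by (intro power_mono) auto
    also have "\<dots> = (\<integral>y. (w y)\<^sup>2 * \<eta> (x - y) \<partial>lborel)"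
      using \<eta>(2) by (simp add: l2norm_def power_mult_distrib mult.commute)
    finally have le: "(conv w \<eta> x)\<^sup>2 \<le> (\<integral>y. (w y)\<^sup>2 * \<eta> (x - y) \<partial>lborel)" by simp
    have "integrable lborel (\<lambda>y. (sqrt (\<eta> (x - y)) * w y)\<^sup>2)" using L2 by (rule L2_integrable_sq)
    then have i: "integrable lborel (\<lambda>y. (w y)\<^sup>2 * \<eta> (x - y))"
      using \<eta>(2) by (simp add: power_mult_distrib mult.commute)
    have "ennreal ((conv w \<eta> x)\<^sup>2) \<le> (\<integral>\<^sup>+y. ennreal ((w y)\<^sup>2 * \<eta> (x - y)) \<partial>lborel)"
      using le i \<eta>(2) by (subst nn_integral_eq_integral) (auto intro: ennreal_leI)
    then show ?thesis using \<eta>(2) by (simp add: ennreal_mult)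
  qed
  have one: "(\<integral>\<^sup>+x. ennreal (\<eta> (x - y)) \<partial>lborel) = 1" for y
  proof -
    have "(\<integral>\<^sup>+x. ennreal (\<eta> (x - y)) \<partial>lborel) = ennreal (\<integral>x. \<eta> (x + (- y)) \<partial>lborel)"
      using integral_lborel_translate(2)[of \<eta> "- y"] i\<eta> \<eta>(2) by (subst nn_integral_eq_integral) auto
    also have "\<dots> = 1" using \<eta>(3) by (subst integral_lborel_translate(1)) auto
    finally show ?thesis .
  qed
  have "(\<integral>\<^sup>+x. ennreal ((conv w \<eta> x)\<^sup>2) \<partial>lborel) \<le> (\<integral>\<^sup>+x. (\<integral>\<^sup>+y. ennreal ((w y)\<^sup>2) * ennreal (\<eta> (x - y)) \<partial>lborel) \<partial>lborel)"
    by (intro nn_integral_mono J)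
  also have "\<dots> = (\<integral>\<^sup>+y. (\<integral>\<^sup>+x. ennreal ((w y)\<^sup>2) * ennreal (\<eta> (x - y)) \<partial>lborel) \<partial>lborel)"
    by (rule lborel_pair.Fubini') measurable
  also have "\<dots> = (\<integral>\<^sup>+y. ennreal ((w y)\<^sup>2) \<partial>lborel)"
    by (simp add: nn_integral_cmult one)
  also have "\<dots> = ennreal (\<integral>y. (w y)\<^sup>2 \<partial>lborel)"
    using w by (intro nn_integral_eq_integral) (auto simp: L2_def)
  finally have le: "(\<integral>\<^sup>+x. ennreal ((conv w \<eta> x)\<^sup>2) \<partial>lborel) \<le> ennreal (\<integral>y. (w y)\<^sup>2 \<partial>lborel)" .
  have i: "integrable lborel (\<lambda>x. (conv w \<eta> x)\<^sup>2)"
    using le by (intro integrableI_bounded) (auto intro: le_less_trans)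
  then show L: "conv w \<eta> \<in> L2 lborel" by (simp add: L2_def)
  have "(\<integral>x. (conv w \<eta> x)\<^sup>2 \<partial>lborel) \<le> (\<integral>y. (w y)\<^sup>2 \<partial>lborel)"
    using le i by (subst (asm) nn_integral_eq_integral) (auto simp: ennreal_le_iff)
  then show "l2norm lborel (conv w \<eta>) \<le> l2norm lborel w" by (simp add: l2norm_def)
qed

text \<open>Mollification averages \<open>g\<close> over a shrinking ball, so uniform continuity
  makes the error uniformly small. The error lives in one fixed ball, whose volume \<open>A\<close>
  converts the uniform bound into an L2 bound.\<close>

lemma conv_moll_continuous:
  fixes g :: "'a::euclidean_space \<Rightarrow> real"
  assumes c: "continuous_on UNIV g" "bsupp g"
  shows "(\<lambda>n. l2norm lborel (\<lambda>x. conv g (moll n) x - g x)) \<longlonglongrightarrow> 0"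
proof (rule LIMSEQ_I)
  fix e :: real assume e: "0 < e"
  obtain R where R: "0 < R" "\<And>z. g z \<noteq> 0 \<Longrightarrow> norm z \<le> R" using c(2) unfolding bsupp_def by blast
  define A where "A = measure lborel (cball (0::'a) (R + 1))"
  have A: "0 < A" unfolding A_def using R by (intro content_cball_pos) auto
  \<comment> \<open>Chosen so that e'^2 times the volume \<open>A\<close> is e^2 / 4.\<close>
  define e' where "e' = e / (2 * sqrt A)"
  have e': "0 < e'" using e A by (simp add: e'_def)
  obtain d where d: "0 < d" "d \<le> 1" "\<And>z h. norm h < d \<Longrightarrow> \<bar>g (z + h) - g z\<bar> < e'"
    using bsupp_uniformly_continuous[OF c e'] by blast
  obtain N where N: "inverse (real (Suc N)) < d" using reals_Archimedean[OF d(1)] by blast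
  have gL: "g \<in> L2 lborel" using c by (rule L2_lborel_Cc)
  have "norm (l2norm lborel (\<lambda>x. conv g (moll n) x - g x) - 0) < e" if n: "N \<le> n" for n
  proof -
    let ?\<eta> = "moll n :: 'a \<Rightarrow> real"
    have \<eta>c: "continuous_on UNIV ?\<eta>" "bsupp ?\<eta>" using moll_Cck[of n 0] by (auto intro: Cck_continuous CckD)
    have sm: "norm z < d" if "?\<eta> z \<noteq> 0" for z
    proof -
      have "norm z < inverse (real (Suc n))" by (rule moll_support[OF that])
      also have "\<dots> \<le> inverse (real (Suc N))" using n by (intro le_imp_inverse_le) auto
      finally show ?thesis using N by simp
    qed
    have le: "\<bar>conv g ?\<eta> x - g x\<bar> \<le> e' * indicator (cball 0 (R + 1)) x" for x
    proof -
      have i\<eta>: "integrable lborel (\<lambda>y. ?\<eta> (x - y))"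
        by (subst integral_lborel_reflect(2)) (auto intro: Cck_measurable integrable_lborel_Cck moll_Cck)
      have i1: "integrable lborel (\<lambda>y. g x * ?\<eta> (x - y))" using i\<eta> by (rule integrable_mult_right)
      have one: "(\<integral>y. ?\<eta> (x - y) \<partial>lborel) = 1"
        by (subst integral_lborel_reflect(1)) (auto simp: moll_integral intro: Cck_measurable moll_Cck)
      have "conv g ?\<eta> x - g x = (\<integral>y. g y * ?\<eta> (x - y) \<partial>lborel) - (\<integral>y. g x * ?\<eta> (x - y) \<partial>lborel)"
        by (simp add: conv_def one)
      also have "\<dots> = (\<integral>y. (g y - g x) * ?\<eta> (x - y) \<partial>lborel)"
        using conv_integrable[OF gL \<eta>c] i1 by (subst Bochner_Integration.integral_diff[symmetric]) (auto simp: left_diff_distrib)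
      also have "\<bar>\<dots>\<bar> \<le> (\<integral>y. (e' * indicator (cball 0 (R + 1)) x) * ?\<eta> (x - y) \<partial>lborel)"
      proof (rule order_trans[OF integral_abs_bound], rule integral_mono)
        have "integrable lborel (\<lambda>y. g y * ?\<eta> (x - y) - g x * ?\<eta> (x - y))"
          using conv_integrable[OF gL \<eta>c] i1 by (rule Bochner_Integration.integrable_diff)
        then show "integrable lborel (\<lambda>y. \<bar>(g y - g x) * ?\<eta> (x - y)\<bar>)" by (simp add: left_diff_distrib)
        show "integrable lborel (\<lambda>y. (e' * indicator (cball 0 (R + 1)) x) * ?\<eta> (x - y))"
          using i\<eta> by (rule integrable_mult_right)
        fix y
        have "\<bar>g y - g x\<bar> \<le> e' * indicator (cball 0 (R + 1)) x" if nz: "?\<eta> (x - y) \<noteq> 0"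
        proof (cases "norm x \<le> R + 1")
          case True
          have "norm (y - x) < d" using sm[OF nz] by (simp add: norm_minus_commute)
          from d(3)[OF this, of x] True show ?thesis by simp
        next
          case False
          have "norm x \<le> norm y + norm (x - y)" by (metis norm_triangle_sub)
          then have "norm y > R" using False sm[OF nz] d(2) by auto
          then have "g y = 0" "g x = 0" using R(2)[of x] R(2)[of y] R(1) False by force+
          then show ?thesis using e' by simp
        qed
        then show "\<bar>(g y - g x) * ?\<eta> (x - y)\<bar> \<le> (e' * indicator (cball 0 (R + 1)) x) * ?\<eta> (x - y)"
          using moll_nonneg[of n "x - y"] by (cases "?\<eta> (x - y) = 0") (auto simp: abs_mult intro: mult_right_mono)
      qed
      also have "\<dots> = e' * indicator (cball 0 (R + 1)) x" using one by simp
      finally show ?thesis .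
    qed
    have "(\<integral>x. (conv g ?\<eta> x - g x)\<^sup>2 \<partial>lborel) \<le> (\<integral>x. e'\<^sup>2 * indicator (cball (0::'a) (R + 1)) x \<partial>lborel)"
    proof (rule integral_mono)
      show "integrable lborel (\<lambda>x. (conv g ?\<eta> x - g x)\<^sup>2)"
        by (intro L2_integrable_sq L2_diff gL conv_L2(1)) (auto simp: moll_nonneg moll_integral intro: moll_Cck)
      show "integrable lborel (\<lambda>x. e'\<^sup>2 * indicator (cball (0::'a) (R + 1)) x)"
        using emeasure_bounded_finite[OF bounded_cball, of "0::'a" "R + 1"]
        by (intro integrable_mult_right integrable_real_indicator) auto
      fix x :: 'a
      have "\<bar>conv g ?\<eta> x - g x\<bar>\<^sup>2 \<le> (e' * indicator (cball 0 (R + 1)) x)\<^sup>2" using le[of x] by (intro power_mono) auto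
      then show "(conv g ?\<eta> x - g x)\<^sup>2 \<le> e'\<^sup>2 * indicator (cball 0 (R + 1)) x"
        by (cases "norm x \<le> R + 1") auto
    qed
    also have "\<dots> = e'\<^sup>2 * A" by (simp add: A_def)
    also have "\<dots> < e\<^sup>2" using A e by (simp add: e'_def power_divide power_mult_distrib)
    finally have "l2norm lborel (\<lambda>x. conv g ?\<eta> x - g x) < e"
      unfolding l2norm_def using e by (intro real_less_lsqrt) auto
    then show ?thesis by simp
  qed
  then show "\<exists>no. \<forall>n\<ge>no. norm (l2norm lborel (\<lambda>x. conv g (moll n) x - g x) - 0) < e" by blast
qed

lemma conv_diff_left:
  assumes "u \<in> L2 lborel" "w \<in> L2 lborel" "continuous_on UNIV \<eta>" "bsupp \<eta>"
  shows "conv (\<lambda>x. u x - w x) \<eta> x = conv u \<eta> x - conv w \<eta> x"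
  unfolding conv_def using conv_integrable[OF assms(1,3,4)] conv_integrable[OF assms(2,3,4)]
  by (simp add: left_diff_distrib)

text \<open>Mollification contracts L2 uniformly in \<open>n\<close>, so convergence on the dense
  set of continuous functions of bounded support suffices.\<close>

lemma conv_moll_tendsto:
  fixes w :: "'a::euclidean_space \<Rightarrow> real"
  assumes w: "w \<in> L2 lborel"
  shows "L2_tendsto lborel (\<lambda>n. conv w (moll n)) w"
proof (rule L2_tendstoI[OF _ w])
  note m = moll_Cck[of _ 0] moll_nonneg moll_integral
  have mc: "continuous_on UNIV (moll n :: 'a \<Rightarrow> real)" "bsupp (moll n :: 'a \<Rightarrow> real)" for n
    using moll_Cck[of n 0] by (auto intro: Cck_continuous CckD)
  show cL: "conv w (moll n) \<in> L2 lborel" for n by (rule conv_L2(1)[OF w m])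
  show "(\<lambda>n. l2norm lborel (\<lambda>z. conv w (moll n) z - w z)) \<longlonglongrightarrow> 0"
  proof (rule LIMSEQ_I)
    fix e :: real assume e: "0 < e"
    obtain g where g: "continuous_on UNIV g" "bsupp g" "g \<in> L2 lborel" "l2norm lborel (\<lambda>x. w x - g x) < e / 3"
      using Cc_dense_L2[of lborel w "e/3"] emeasure_lborel_cball_finite' w e by auto
    from LIMSEQ_D[OF conv_moll_continuous[OF g(1,2)], of "e/3"] e obtain N where
      N: "\<And>n. N \<le> n \<Longrightarrow> l2norm lborel (\<lambda>x. conv g (moll n) x - g x) < e / 3" by auto
    have "norm (l2norm lborel (\<lambda>z. conv w (moll n) z - w z) - 0) < e" if n: "N \<le> n" for n
    proof -
      have gL: "conv g (moll n) \<in> L2 lborel" by (rule conv_L2(1)[OF g(3) m])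
      have "l2norm lborel (\<lambda>z. conv w (moll n) z - w z)
          \<le> l2norm lborel (\<lambda>z. conv w (moll n) z - conv g (moll n) z) + l2norm lborel (\<lambda>z. conv g (moll n) z - w z)"
        by (rule l2norm_triangle3[OF cL w gL])
      also have "l2norm lborel (\<lambda>z. conv w (moll n) z - conv g (moll n) z) = l2norm lborel (conv (\<lambda>x. w x - g x) (moll n))"
        by (simp add: conv_diff_left[OF w g(3) mc, abs_def])
      also have "\<dots> \<le> l2norm lborel (\<lambda>x. w x - g x)"
        by (rule conv_L2(2)[OF L2_diff[OF w g(3)] m])
      also have "l2norm lborel (\<lambda>z. conv g (moll n) z - w z)
          \<le> l2norm lborel (\<lambda>z. conv g (moll n) z - g z) + l2norm lborel (\<lambda>z. g z - w z)"
        by (rule l2norm_triangle3[OF gL w g(3)])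
      also have "l2norm lborel (\<lambda>z. g z - w z) = l2norm lborel (\<lambda>x. w x - g x)"
        by (rule l2norm_minus_commute)
      finally show ?thesis using g(4) N[OF n] by simp
    qed
    then show "\<exists>no. \<forall>n\<ge>no. norm (l2norm lborel (\<lambda>z. conv w (moll n) z - w z) - 0) < e" by blast
  qed
qed

section \<open>Smooth approximation of continuous functions of bounded support\<close>

lemma Ck_real_polynomial_function: "real_polynomial_function p \<Longrightarrow> Ck k p"
proof (induction rule: real_polynomial_function.induct)
  case (linear f)
  have id: "Ck k (\<lambda>z::real. z)" using Ck_inner[of k "1::real"] by simp
  show ?case using Ck_chain_lin[OF linear id, of 0] by simp
qed (auto intro: Ck_add Ck_mult)

text \<open>A continuous function of bounded support is a smooth bump times a continuous function, and
  the latter is uniformly approximated by polynomials.\<close>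

lemma Cc_infty_uniformly_dense:
  fixes g :: "'a::euclidean_space \<Rightarrow> real"
  assumes c: "continuous_on UNIV g" "bsupp g" and e: "0 < e"
  obtains \<phi> where "\<phi> \<in> Cc_infty" "\<And>x. \<bar>g x - \<phi> x\<bar> \<le> e"
proof -
  obtain R where R: "0 < R" "\<And>z. g z \<noteq> 0 \<Longrightarrow> norm z \<le> R" using c(2) unfolding bsupp_def by blast
  \<comment> \<open>The maximum keeps the denominator away from 0. On the ball of radius
    \<open>R\<close> the bump is at least \<open>exp (- 1)\<close>, so there the denominator is the
    bump itself; outside that ball \<open>g\<close> is 0.\<close>
  define q where "q x = g x / max (bump R x) (exp (- 1))" for x
  have "max (bump R x) (exp (- 1)) \<noteq> 0" for x :: 'a
    using exp_gt_zero[of "- 1 :: real"] by (metis less_max_iff_disj less_irrefl)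
  then have qc: "continuous_on UNIV q"
    unfolding q_def by (intro continuous_intros c Ck_continuous[OF Ck_bump[of 0 R]]) auto
  have gq: "g x = bump R x * q x" for x
  proof (cases "norm x \<le> R")
    case True
    then have "(norm x)\<^sup>2 / R\<^sup>2 \<le> 1" using R by (simp add: power_mono)
    then have 1: "1 \<le> 2 - (norm x)\<^sup>2 / R\<^sup>2" by simp
    then have "inverse (2 - (norm x)\<^sup>2 / R\<^sup>2) \<le> 1" by (simp add: inverse_le_1_iff)
    then have "exp (- 1) \<le> bump R x" using 1 by (simp add: bump_def flat_exp_def)
    moreover have "0 < bump R x" using bump_pos[OF True R(1)] .
    ultimately show ?thesis by (simp add: q_def max_def)
  next
    case False
    then have "g x = 0" using R(2)[of x] by blast
    then show ?thesis by (simp add: q_def)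
  qed
  obtain p where p: "real_polynomial_function p" "\<And>x. x \<in> cball 0 (2 * R) \<Longrightarrow> \<bar>q x - p x\<bar> < e"
    using Stone_Weierstrass_real_polynomial_function[of "cball 0 (2 * R)" q e] e continuous_on_subset[OF qc]
    by (auto simp: compact_cball)
  show ?thesis
  proof (rule that[of "\<lambda>x. bump R x * p x"])
    show "(\<lambda>x. bump R x * p x) \<in> Cc_infty"
      unfolding Cc_infty_iff by (intro allI Cck_mult1 bump_Cck R Ck_real_polynomial_function p)
    fix x
    show "\<bar>g x - bump R x * p x\<bar> \<le> e"
    proof (cases "bump R x = 0")
      case False
      then have "x \<in> cball 0 (2 * R)" using bump_support[of R x] R by simp
      then have "\<bar>q x - p x\<bar> \<le> e" using p(2) by (simp add: less_imp_le)
      then have "bump R x * \<bar>q x - p x\<bar> \<le> 1 * e" using bump_bounds[of R x] by (intro mult_mono) auto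
      then show ?thesis using bump_bounds[of R x] by (simp add: gq[of x] abs_mult right_diff_distrib[symmetric])
    qed (use gq e in auto)
  qed
qed

section \<open>Density of test functions in L2 of a Gibbs measure\<close>

context gibbs_weight
begin

lemma L2_Cck: "f \<in> Cck k \<Longrightarrow> f \<in> L2 (gm V)"
proof -
  assume f: "f \<in> Cck k"
  have "(\<lambda>z. f z * f z) \<in> Cck k" using f by (intro Cck_mult1) (auto simp: Cck_def)
  from integrable_Cck[OF this] show ?thesis
    using Cck_measurable[OF f] by (simp add: L2_def power2_eq_square)
qed

lemma L2_const: "(\<lambda>z. c) \<in> L2 (gm V)"
  by (simp add: L2_def)

lemma l2norm_const: "l2norm (gm V) (\<lambda>z. c) = \<bar>c\<bar>"
  by (simp add: l2norm_def prob_space[simplified])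

lemma l2norm_le_bound:
  assumes "f \<in> L2 (gm V)" "\<And>z. \<bar>f z\<bar> \<le> c" "0 \<le> c"
  shows "l2norm (gm V) f \<le> c"
proof -
  have "(\<integral>z. (f z)\<^sup>2 \<partial>gm V) \<le> (\<integral>z. c\<^sup>2 \<partial>gm V)"
    using assms power_mono[OF assms(2), of _ 2] by (intro integral_mono) (auto simp: L2_def)
  then show ?thesis
    unfolding l2norm_def using assms(3) by (intro real_le_lsqrt) (auto simp: prob_space[simplified])
qed

text \<open>The measure has mass 1, so uniform approximation of a continuous function implies L2
  approximation with the same error.\<close>

lemma Cc_infty_dense:
  assumes f: "f \<in> L2 (gm V)"
  shows "\<exists>\<phi>. (\<forall>n. \<phi> n \<in> Cc_infty) \<and> L2_tendsto (gm V) \<phi> f"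
proof -
  have "\<exists>\<phi>\<in>Cc_infty. l2norm (gm V) (\<lambda>x. \<phi> x - f x) \<le> inverse (real (Suc n))" for n
  proof -
    define e where "e = inverse (real (Suc n)) / 2"
    have e: "0 < e" by (simp add: e_def)
    obtain g where g: "continuous_on UNIV g" "bsupp g" "g \<in> L2 (gm V)" "l2norm (gm V) (\<lambda>x. f x - g x) < e"
      using Cc_dense_L2[OF _ _ _ f e] by (auto simp: AE_gm emeasure_eq_measure)
    obtain \<phi> where \<phi>: "\<phi> \<in> Cc_infty" "\<And>x. \<bar>g x - \<phi> x\<bar> \<le> e"
      using Cc_infty_uniformly_dense[OF g(1,2) e] by blast
    have \<phi>L: "\<phi> \<in> L2 (gm V)" using \<phi>(1) L2_Cck by (auto simp: Cc_infty_iff)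
    have "l2norm (gm V) (\<lambda>x. \<phi> x - f x) = l2norm (gm V) (\<lambda>x. f x - \<phi> x)" by (rule l2norm_minus_commute)
    also have "\<dots> \<le> l2norm (gm V) (\<lambda>x. f x - g x) + l2norm (gm V) (\<lambda>x. g x - \<phi> x)"
      by (rule l2norm_triangle3[OF f \<phi>L g(3)])
    also have "l2norm (gm V) (\<lambda>x. g x - \<phi> x) \<le> e"
      using \<phi>(2) e by (intro l2norm_le_bound L2_diff g \<phi>L) auto
    finally show ?thesis using g(4) \<phi>(1) by (intro bexI[of _ \<phi>]) (auto simp: e_def)
  qed
  then obtain \<phi> where \<phi>: "\<And>n. \<phi> n \<in> Cc_infty" "\<And>n. l2norm (gm V) (\<lambda>x. \<phi> n x - f x) \<le> inverse (real (Suc n))"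
    by metis
  have "(\<lambda>n. l2norm (gm V) (\<lambda>x. \<phi> n x - f x)) \<longlonglongrightarrow> 0"
    by (rule tendsto_sandwich[OF _ _ tendsto_const LIMSEQ_inverse_real_of_nat]) (use \<phi>(2) in auto)
  then show ?thesis using \<phi>(1) f L2_Cck by (intro exI[of _ \<phi>]) (auto simp: L2_tendsto_def Cc_infty_iff)
qed

end

lemma pd_support:
  assumes "\<And>z. f z \<noteq> 0 \<Longrightarrow> norm z \<le> R" and nz: "pd f e z \<noteq> 0"
  shows "norm z \<le> R"
proof (rule ccontr)
  assume z: "\<not> norm z \<le> R"
  have "(f has_derivative (\<lambda>h. 0)) (at z)"
  proof (rule has_derivative_transform_within_open[of "\<lambda>z. 0" "\<lambda>h. 0" z UNIV "- cball 0 R"])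
    show "open (- cball 0 R)" by (simp add: open_Compl)
  qed (use z assms(1) in \<open>force\<close>)+
  with nz show False using has_derivative_pd by blast
qed

lemma L2_tendsto_mult:
  assumes f: "L2_tendsto M f g" and a: "a \<in> borel_measurable M" "\<And>z. \<bar>a z\<bar> \<le> B"
  shows "L2_tendsto M (\<lambda>n z. a z * f n z) (\<lambda>z. a z * g z)"
proof (rule L2_tendstoI)
  have m: "f n \<in> L2 M" "g \<in> L2 M" for n using f by (auto simp: L2_tendsto_def)
  show aL: "(\<lambda>z. a z * f n z) \<in> L2 M" "(\<lambda>z. a z * g z) \<in> L2 M" for n
    by (rule L2_mult_bounded[OF _ a] m)+
  have B: "0 \<le> B" using a(2) abs_ge_zero order_trans by blast
  show "(\<lambda>n. l2norm M (\<lambda>z. a z * f n z - a z * g z)) \<longlonglongrightarrow> 0"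
  proof (rule Lim_null_comparison)
    have "(\<lambda>n. B * l2norm M (\<lambda>z. f n z - g z)) \<longlonglongrightarrow> B * 0"
      using f by (intro tendsto_mult tendsto_const) (simp add: L2_tendsto_def)
    then show "(\<lambda>n. B * l2norm M (\<lambda>z. f n z - g z)) \<longlonglongrightarrow> 0" by simp
    have "l2norm M (\<lambda>z. a z * f n z - a z * g z) \<le> B * l2norm M (\<lambda>z. f n z - g z)" for n
    proof -
      have "(\<integral>z. (a z * f n z - a z * g z)\<^sup>2 \<partial>M) \<le> (\<integral>z. B\<^sup>2 * (f n z - g z)\<^sup>2 \<partial>M)"
      proof (rule integral_mono)
        show "integrable M (\<lambda>z. (a z * f n z - a z * g z)\<^sup>2)" by (intro L2_integrable_sq L2_diff aL)
        show "integrable M (\<lambda>z. B\<^sup>2 * (f n z - g z)\<^sup>2)"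
          by (intro integrable_mult_right L2_integrable_sq L2_diff m)
        fix z
        have "(a z)\<^sup>2 \<le> B\<^sup>2" using power_mono[OF a(2)[of z], of 2] by simp
        then have "(a z)\<^sup>2 * (f n z - g z)\<^sup>2 \<le> B\<^sup>2 * (f n z - g z)\<^sup>2" by (intro mult_right_mono) auto
        then show "(a z * f n z - a z * g z)\<^sup>2 \<le> B\<^sup>2 * (f n z - g z)\<^sup>2"
          by (simp add: right_diff_distrib[symmetric] power_mult_distrib)
      qed
      then have "l2norm M (\<lambda>z. a z * f n z - a z * g z) \<le> sqrt (B\<^sup>2 * (\<integral>z. (f n z - g z)\<^sup>2 \<partial>M))"
        unfolding l2norm_def by (intro real_sqrt_le_mono) simp
      also have "\<dots> = B * l2norm M (\<lambda>z. f n z - g z)" using B by (simp add: l2norm_def real_sqrt_mult)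
      finally show ?thesis .
    qed
    then show "\<forall>\<^sub>F n in sequentially. norm (l2norm M (\<lambda>z. a z * f n z - a z * g z)) \<le> B * l2norm M (\<lambda>z. f n z - g z)"
      by simp
  qed
qed

lemma Ck_pd': "Ck k f \<Longrightarrow> j < k \<Longrightarrow> e \<in> Basis \<Longrightarrow> Ck j (pd f e)"
  using Ck_mono[of k f "Suc j"] by (auto intro: Ck_pd)

lemma Cck_pd': "f \<in> Cck k \<Longrightarrow> j < k \<Longrightarrow> e \<in> Basis \<Longrightarrow> pd f e \<in> Cck j"
  by (auto simp: Cck_def intro: Ck_pd' bsupp_pd)

lemma integral_lborel_by_parts:
  fixes F :: "'a::euclidean_space \<Rightarrow> real"
  assumes F: "Ck 1 F" and \<xi>: "\<xi> \<in> Cck 1" and e: "e \<in> Basis"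
  shows "(\<integral>x. pd F e x * \<xi> x \<partial>lborel) = - (\<integral>x. F x * pd \<xi> e x \<partial>lborel)"
proof -
  have "(\<lambda>x. F x * \<xi> x) \<in> Cck 1" using assms by (intro Cck_mult2)
  then have "(\<integral>x. pd (\<lambda>x. F x * \<xi> x) e x \<partial>lborel) = 0" using e by (rule integral_pd_Cck)
  also have "pd (\<lambda>x. F x * \<xi> x) e = (\<lambda>x. pd F e x * \<xi> x + F x * pd \<xi> e x)"
    using assms by (intro ext pd_mult) (auto simp: Cck_def intro: Ck_differentiable)
  finally have "(\<integral>x. pd F e x * \<xi> x + F x * pd \<xi> e x \<partial>lborel) = 0" .
  moreover have "integrable lborel (\<lambda>x. pd F e x * \<xi> x)" "integrable lborel (\<lambda>x. F x * pd \<xi> e x)"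
  proof -
    have "(\<lambda>x. pd F e x * \<xi> x) \<in> Cck 0" "(\<lambda>x. F x * pd \<xi> e x) \<in> Cck 0"
      using assms by (intro Cck_mult2; auto intro: Ck_pd' Cck_pd' Cck_mono Ck_mono)+
    then show "integrable lborel (\<lambda>x. pd F e x * \<xi> x)" "integrable lborel (\<lambda>x. F x * pd \<xi> e x)"
      by (auto intro: integrable_lborel_Cck)
  qed
  ultimately show ?thesis by simp
qed

context gibbs_weight
begin

section \<open>The overdamped operator\<close>

text \<open>Minus the overdamped Langevin generator: the gradient followed by its adjoint in L2 of
  \<open>gm V\<close>, as \<open>ip_H\<close> shows.\<close>

definition H :: "('a \<Rightarrow> real) \<Rightarrow> 'a \<Rightarrow> real" where
  "H \<phi> x = (\<Sum>i\<in>Basis. pd V i x * pd \<phi> i x - pd (pd \<phi> i) i x)"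

lemma pd_V_cont: "i \<in> Basis \<Longrightarrow> continuous_on UNIV (pd V i)"
  using Ck_pd'[OF V_C1, of 0 i] by (simp add: Ck_0)

lemma expV_Ck: "Ck 1 (\<lambda>x. exp (c * V x))" and pd_expV: "pd (\<lambda>x. exp (c * V x)) h x = exp (c * V x) * (c * pd V h x)"
proof -
  have dV: "V differentiable at x" for x using V_C1 by (auto intro: Ck_differentiable)
  have d: "((\<lambda>x. exp (c * V x)) has_derivative (\<lambda>h. exp (c * V x) * (c * pd V h x))) (at x)" for x
    using differentiable_has_derivative[OF dV] by (auto intro!: derivative_eq_intros)
  show p: "pd (\<lambda>x. exp (c * V x)) h x = exp (c * V x) * (c * pd V h x)" for h x
    by (rule has_derivative_pd[OF d])
  show "Ck 1 (\<lambda>x. exp (c * V x))"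
    unfolding One_nat_def Ck_Suc using d
    by (auto simp: Ck_0 p[abs_def] intro!: differentiableI continuous_intros V_cont pd_V_cont)
qed

text \<open>The weak equation \<open>c u + H u = 0\<close> reads \<open>c w - \<Delta> w - div (w \<nabla>V) = 0\<close> for
  \<open>w = u e\<^bsup>-V\<^esup>\<close>. It is mollified in this divergence form, so that no derivative falls on
  \<open>\<nabla>V\<close>, and tested with \<open>\<chi>\<^sup>2 e\<^bsup>V\<^esup> w\<^sub>n\<close>, where \<open>w\<^sub>n\<close> is the mollified function.\<close>

lemma weak_solution_cutoff:
  assumes w: "w \<in> L2 lborel" and c: "0 < c"
    and weak: "\<And>\<phi>. \<phi> \<in> Cck 3 \<Longrightarrow> (\<integral>x. w x * (c * \<phi> x + H \<phi> x) \<partial>lborel) = 0"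
    and R: "0 < R"
  shows "c * (l2norm lborel (\<lambda>x. exp (V x / 2) * bump R x * w x))\<^sup>2
    \<le> 2 * (\<Sum>i\<in>Basis. (l2norm lborel (\<lambda>x. exp (V x / 2) * pd (bump R) i x * w x))\<^sup>2)"
proof -
  let ?\<chi> = "bump R :: 'a \<Rightarrow> real"
  have \<chi>: "?\<chi> \<in> Cck k" for k by (rule bump_Cck[OF R])
  have \<chi>0: "norm x \<le> 2 * R" if "?\<chi> x \<noteq> 0" for x using bump_support[OF that R] by simp
  \<comment> \<open>The field \<open>pd V i\<close> may be unbounded, so its product with
    \<open>w\<close> is truncated. At points of norm at most \<open>2 * R\<close> a kernel of radius
    1 sees only the ball of radius \<open>2 * R + 1\<close>.\<close>
  define g where "g i y = (pd V i y * indicator (cball 0 (2 * R + 1)) y) * w y" for i y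
  have pVb: "\<exists>B. \<forall>y. \<bar>pd V i y * indicator (cball 0 (2 * R + 1)) y\<bar> \<le> B" if "i \<in> Basis" for i
  proof -
    have "compact (pd V i ` cball 0 (2 * R + 1))"
      by (rule compact_continuous_image) (use pd_V_cont[OF that] in \<open>auto intro: continuous_on_subset\<close>)
    then obtain B where B: "\<And>z. z \<in> cball 0 (2 * R + 1) \<Longrightarrow> \<bar>pd V i z\<bar> \<le> B"
      by (meson bounded_real compact_imp_bounded imageI)
    show ?thesis
    proof (intro exI[of _ "max B 0"] allI)
      fix y show "\<bar>pd V i y * indicator (cball 0 (2 * R + 1)) y\<bar> \<le> max B 0"
        using B[of y] by (cases "y \<in> cball 0 (2 * R + 1)") auto
    qed
  qed
  have pVm: "pd V i \<in> borel_measurable borel" if "i \<in> Basis" for i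
    using pd_V_cont[OF that] by (rule borel_measurable_continuous_onI)
  have gL: "g i \<in> L2 lborel" if i: "i \<in> Basis" for i
  proof -
    obtain B where "\<And>y. \<bar>pd V i y * indicator (cball 0 (2 * R + 1)) y\<bar> \<le> B" using pVb[OF i] by blast
    then show ?thesis unfolding g_def using pVm[OF i] by (intro L2_mult_bounded[OF w]) (auto intro!: borel_measurable_times borel_measurable_indicator)
  qed
  define a where "a x = exp (V x / 2) * ?\<chi> x" for x
  define b where "b i x = exp (V x / 2) * pd ?\<chi> i x" for i x
  have eC: "continuous_on UNIV (\<lambda>x. exp (V x / 2))" by (intro continuous_intros V_cont) auto
  have aC: "a \<in> Cck 0" unfolding a_def by (intro Cck_mult2 \<chi>) (simp add: Ck_0 eC)
  have bC: "b i \<in> Cck 0" if "i \<in> Basis" for i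
    unfolding b_def by (intro Cck_mult2 Cck_pd'[OF \<chi>[of 1]] that) (simp_all add: Ck_0 eC)
  have aVC: "(\<lambda>x. a x * pd V i x) \<in> Cck 0" if "i \<in> Basis" for i
    using pd_V_cont[OF that] by (intro Cck_mult1 aC) (simp add: Ck_0)
  \<comment> \<open>The last sum is the commutator of mollification with multiplication by
    \<open>pd V i\<close>. It is an error term that \<open>l3\<close> sends to 0.\<close>
  have ineq: "c * (l2norm lborel (\<lambda>x. a x * conv w (moll n) x))\<^sup>2
      \<le> 2 * (\<Sum>i\<in>Basis. (l2norm lborel (\<lambda>x. b i x * conv w (moll n) x))\<^sup>2)
        + (1/2) * (\<Sum>i\<in>Basis. (l2norm lborel (\<lambda>x. a x * conv (g i) (moll n) x + - 1 * (a x * pd V i x * conv w (moll n) x)))\<^sup>2)" for n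
  proof -
    let ?\<eta> = "moll n :: 'a \<Rightarrow> real"
    define wn where "wn = conv w ?\<eta>"
    define G where "G i = conv (g i) ?\<eta>" for i
    have \<eta>: "?\<eta> \<in> Cck k" for k by (rule moll_Cck)
    have wnC: "Ck k wn" for k unfolding wn_def by (rule Ck_conv[OF w \<eta>])
    have GC: "Ck k (G i)" if "i \<in> Basis" for k i unfolding G_def by (rule Ck_conv[OF gL[OF that] \<eta>])
    have \<eta>0: "norm z \<le> 1" if "?\<eta> z \<noteq> 0" for z
    proof -
      have "norm z < inverse (real (Suc n))" by (rule moll_support[OF that])
      also have "\<dots> \<le> 1" by (simp add: inverse_le_1_iff)
      finally show ?thesis by simp
    qed
    have eq: "c * wn x - (\<Sum>i\<in>Basis. pd (pd wn i) i x) - (\<Sum>i\<in>Basis. pd (G i) i x) = 0" if x: "norm x \<le> 2 * R" for x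
    proof -
      \<comment> \<open>The reflected kernel centred at \<open>x\<close> is an admissible test
        function, and testing with it yields the equation of the mollified function at the point
        \<open>x\<close>.\<close>
      define \<phi> where "\<phi> y = ?\<eta> (- y + x)" for y
      have lin: "bounded_linear (\<lambda>y::'a. - y)" by (rule bounded_linear_minus[OF bounded_linear_ident])
      have sh: "f \<in> Cck k \<Longrightarrow> (\<lambda>y. f (- y + x)) \<in> Cck k" for f :: "'a \<Rightarrow> real" and k
      proof -
        assume f: "f \<in> Cck k"
        obtain R' where R': "\<And>z. f z \<noteq> 0 \<Longrightarrow> norm z \<le> R'" using CckD(2)[OF f] unfolding bsupp_def by blast
        have "bsupp (\<lambda>y. f (- y + x))"
        proof (rule bsuppI[of _ "norm x + R'"])
          fix y assume "f (- y + x) \<noteq> 0"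
          from R'[OF this] norm_triangle_ineq4[of x "- y + x"]
          show "norm y \<le> norm x + R'" by simp
        qed
        then show ?thesis using Ck_chain_lin[OF lin CckD(1)[OF f], of x] by (simp add: Cck_def)
      qed
      have \<phi>C: "\<phi> \<in> Cck k" for k unfolding \<phi>_def by (rule sh[OF \<eta>])
      have p1: "pd \<phi> i y = - pd ?\<eta> i (x - y)" if "i \<in> Basis" for i y
      proof -
        have d: "?\<eta> differentiable at (- y + x)" using \<eta>[of 1] by (auto simp: Cck_def intro: Ck_differentiable)
        have "pd \<phi> i y = pd ?\<eta> (- i) (- y + x)" unfolding \<phi>_def by (rule pd_chain_lin(1)[OF lin d])
        also have "\<dots> = - pd ?\<eta> i (- y + x)"
          using differentiable_has_derivative[OF d] has_derivative_bounded_linear linear_simps(4) by blast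
        finally show ?thesis by simp
      qed
      have p2: "pd (pd \<phi> i) i y = pd (pd ?\<eta> i) i (x - y)" if i: "i \<in> Basis" for i y
      proof -
        have d: "pd ?\<eta> i differentiable at (- y + x)"
          using Cck_pd'[OF \<eta>[of 2], of 1 i] i by (auto simp: Cck_def intro: Ck_differentiable)
        have "pd \<phi> i = (\<lambda>y. - 1 * pd ?\<eta> i (- y + x))" using p1[OF i] by (auto simp: add.commute)
        then have "pd (pd \<phi> i) i y = - 1 * pd (\<lambda>y. pd ?\<eta> i (- y + x)) i y"
          using pd_chain_lin(2)[OF lin d] by (simp only: pd_cmult)
        also have "pd (\<lambda>y. pd ?\<eta> i (- y + x)) i y = pd (pd ?\<eta> i) (- i) (- y + x)"
          by (rule pd_chain_lin(1)[OF lin d])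
        also have "\<dots> = - pd (pd ?\<eta> i) i (- y + x)"
          using differentiable_has_derivative[OF d] has_derivative_bounded_linear linear_simps(4) by blast
        finally show ?thesis by simp
      qed
      have gi: "w y * (pd V i y * pd ?\<eta> i (x - y)) = g i y * pd ?\<eta> i (x - y)" if "i \<in> Basis" for i y
      proof (cases "pd ?\<eta> i (x - y) = 0")
        case False
        from pd_support[OF \<eta>0 False] have "norm (x - y) \<le> 1" .
        moreover have "norm y \<le> norm x + norm (x - y)" by (metis norm_minus_commute norm_triangle_sub)
        ultimately have "y \<in> cball 0 (2 * R + 1)" using x by simp
        then show ?thesis by (simp add: g_def)
      qed simp
      have i1: "integrable lborel (\<lambda>y. w y * ?\<eta> (x - y))"
        by (rule conv_integrable[OF w]) (use \<eta>[of 0] in \<open>auto intro: Cck_continuous CckD\<close>)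
      have i2: "integrable lborel (\<lambda>y. w y * pd (pd ?\<eta> i) i (x - y))" if "i \<in> Basis" for i
        by (rule conv_integrable[OF w]) (use Cck_pd'[OF Cck_pd'[OF \<eta>[of 2], of 1 i], of 0 i] that in \<open>auto intro: Cck_continuous CckD\<close>)
      have i3: "integrable lborel (\<lambda>y. g i y * pd ?\<eta> i (x - y))" if "i \<in> Basis" for i
        by (rule conv_integrable[OF gL[OF that]]) (use Cck_pd'[OF \<eta>[of 2], of 1 i] that in \<open>auto intro: Cck_continuous CckD\<close>)
      have "0 = (\<integral>y. w y * (c * \<phi> y + H \<phi> y) \<partial>lborel)" using weak[OF \<phi>C] by simp
      also have "\<dots> = (\<integral>y. c * (w y * ?\<eta> (x - y)) - (\<Sum>i\<in>Basis. g i y * pd ?\<eta> i (x - y) + w y * pd (pd ?\<eta> i) i (x - y)) \<partial>lborel)"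
      proof (rule Bochner_Integration.integral_cong[OF refl])
        fix y
        have "w y * H \<phi> y = (\<Sum>i\<in>Basis. - (g i y * pd ?\<eta> i (x - y) + w y * pd (pd ?\<eta> i) i (x - y)))"
          unfolding H_def sum_distrib_left
        proof (rule sum.cong[OF refl])
          fix i :: 'a assume i: "i \<in> Basis"
          show "w y * (pd V i y * pd \<phi> i y - pd (pd \<phi> i) i y) = - (g i y * pd ?\<eta> i (x - y) + w y * pd (pd ?\<eta> i) i (x - y))"
            unfolding gi[OF i, symmetric] p1[OF i] p2[OF i] by (simp add: algebra_simps)
        qed
        then have "w y * H \<phi> y = - (\<Sum>i\<in>Basis. g i y * pd ?\<eta> i (x - y) + w y * pd (pd ?\<eta> i) i (x - y))"
          unfolding sum_negf .
        moreover have "w y * (c * \<phi> y) = c * (w y * ?\<eta> (x - y))"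
          by (simp add: \<phi>_def add.commute[of "- y"])
        ultimately show "w y * (c * \<phi> y + H \<phi> y) = c * (w y * ?\<eta> (x - y)) - (\<Sum>i\<in>Basis. g i y * pd ?\<eta> i (x - y) + w y * pd (pd ?\<eta> i) i (x - y))"
          by (simp only: distrib_left diff_conv_add_uminus)
      qed
      also have "\<dots> = c * wn x - (\<Sum>i\<in>Basis. conv (g i) (pd ?\<eta> i) x + conv w (pd (pd ?\<eta> i) i) x)"
        unfolding wn_def conv_def using i1 i2 i3
        by (subst Bochner_Integration.integral_diff) (auto intro!: Bochner_Integration.integrable_sum)
      also have "(\<Sum>i\<in>Basis. conv (g i) (pd ?\<eta> i) x + conv w (pd (pd ?\<eta> i) i) x) = (\<Sum>i\<in>Basis. pd (G i) i x + pd (pd wn i) i x)"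
      proof (rule sum.cong[OF refl])
        fix i :: 'a assume i: "i \<in> Basis"
        have "pd (G i) i = conv (g i) (pd ?\<eta> i)" unfolding G_def by (rule pd_conv[OF gL[OF i] \<eta> i])
        moreover have "pd wn i = conv w (pd ?\<eta> i)" unfolding wn_def by (rule pd_conv[OF w \<eta> i])
        moreover have "pd (conv w (pd ?\<eta> i)) i = conv w (pd (pd ?\<eta> i) i)"
          by (rule pd_conv[OF w Cck_pd'[OF \<eta>[of 2]] i]) (use i in auto)
        ultimately show "conv (g i) (pd ?\<eta> i) x + conv w (pd (pd ?\<eta> i) i) x = pd (G i) i x + pd (pd wn i) i x" by simp
      qed
      finally show ?thesis by (simp add: sum.distrib)
    qed
    define u where "u x = exp (1 * V x) * wn x" for x
    define \<xi> where "\<xi> x = ?\<chi> x * (?\<chi> x * u x)" for x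
    have uC: "Ck 1 u" unfolding u_def by (intro Ck_mult expV_Ck wnC)
    have \<xi>C: "\<xi> \<in> Cck 1" unfolding \<xi>_def by (intro Cck_mult1 \<chi> Ck_mult uC Ck_bump)
    have pu: "pd u i x = exp (V x) * (pd wn i x + pd V i x * wn x)" for i x
    proof -
      have "pd u i x = pd (\<lambda>x. exp (1 * V x)) i x * wn x + exp (1 * V x) * pd wn i x"
        unfolding u_def
        by (rule pd_mult[OF Ck_differentiable[OF expV_Ck] Ck_differentiable[OF wnC[of 1]]]) simp_all
      then show ?thesis unfolding pd_expV by (simp add: algebra_simps)
    qed
    have p\<xi>: "pd \<xi> i x = 2 * ?\<chi> x * pd ?\<chi> i x * u x + ?\<chi> x * ?\<chi> x * pd u i x" for i x
    proof -
      have d: "?\<chi> differentiable at x" "u differentiable at x"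
        by (auto intro!: Ck_differentiable[of 1] Ck_bump uC)
      have "pd \<xi> i x = pd ?\<chi> i x * (?\<chi> x * u x) + ?\<chi> x * pd (\<lambda>x. ?\<chi> x * u x) i x"
        unfolding \<xi>_def by (rule pd_mult) (auto intro!: differentiable_mult d)
      also have "pd (\<lambda>x. ?\<chi> x * u x) i x = pd ?\<chi> i x * u x + ?\<chi> x * pd u i x"
        by (rule pd_mult[OF d])
      finally show ?thesis by (simp add: algebra_simps)
    qed
    have C0: "(\<lambda>x. f x * h x) \<in> Cck 0" if "Ck 0 f" "h \<in> Cck 0" for f h :: "'a \<Rightarrow> real"
      using that by (rule Cck_mult2)
    have pwC: "Ck 1 (pd wn i)" if "i \<in> Basis" for i using Ck_pd'[OF wnC[of 2]] that by auto
    have I: "integrable lborel f" if "f \<in> Cck 0" for f :: "'a \<Rightarrow> real" using that by (rule integrable_lborel_Cck)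
    have j1: "(\<lambda>x. wn x * \<xi> x) \<in> Cck 0" by (intro C0 wnC Cck_mono[OF \<xi>C]) simp
    have j2: "(\<lambda>x. pd (pd wn i) i x * \<xi> x) \<in> Cck 0" "(\<lambda>x. pd (G i) i x * \<xi> x) \<in> Cck 0"
      "(\<lambda>x. pd wn i x * pd \<xi> i x) \<in> Cck 0" "(\<lambda>x. G i x * pd \<xi> i x) \<in> Cck 0" if i: "i \<in> Basis" for i
      by (intro C0 Ck_pd'[OF pwC] Ck_pd'[OF GC[of _ 1]] Cck_mono[OF \<xi>C] GC Cck_pd'[OF \<xi>C] Ck_mono[OF pwC] i; simp)+
    have "0 = (\<integral>x. c * (wn x * \<xi> x) - (\<Sum>i\<in>Basis. pd (pd wn i) i x * \<xi> x + pd (G i) i x * \<xi> x) \<partial>lborel)"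
    proof -
      have "c * (wn x * \<xi> x) - (\<Sum>i\<in>Basis. pd (pd wn i) i x * \<xi> x + pd (G i) i x * \<xi> x) = 0" for x
      proof (cases "norm x \<le> 2 * R")
        case True
        have "c * (wn x * \<xi> x) - (\<Sum>i\<in>Basis. pd (pd wn i) i x * \<xi> x + pd (G i) i x * \<xi> x)
          = (c * wn x - (\<Sum>i\<in>Basis. pd (pd wn i) i x) - (\<Sum>i\<in>Basis. pd (G i) i x)) * \<xi> x"
          by (simp add: sum.distrib sum_distrib_right left_diff_distrib mult.assoc)
        then show ?thesis by (simp add: eq[OF True])
      next
        case False
        then have "\<xi> x = 0" using \<chi>0[of x] by (auto simp: \<xi>_def)
        then show ?thesis by simp
      qed
      then show ?thesis by simp
    qed
    also have "\<dots> = c * (\<integral>x. wn x * \<xi> x \<partial>lborel) - (\<Sum>i\<in>Basis. (\<integral>x. pd (pd wn i) i x * \<xi> x \<partial>lborel) + (\<integral>x. pd (G i) i x * \<xi> x \<partial>lborel))"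
      using I[OF j1] I[OF j2(1)] I[OF j2(2)]
      by (subst Bochner_Integration.integral_diff) (auto intro!: Bochner_Integration.integrable_sum)
    also have "\<dots> = c * (\<integral>x. wn x * \<xi> x \<partial>lborel) + (\<Sum>i\<in>Basis. (\<integral>x. pd wn i x * pd \<xi> i x \<partial>lborel) + (\<integral>x. G i x * pd \<xi> i x \<partial>lborel))"
    proof -
      have "(\<Sum>i\<in>Basis. (\<integral>x. pd (pd wn i) i x * \<xi> x \<partial>lborel) + (\<integral>x. pd (G i) i x * \<xi> x \<partial>lborel))
        = (\<Sum>i\<in>Basis. - ((\<integral>x. pd wn i x * pd \<xi> i x \<partial>lborel) + (\<integral>x. G i x * pd \<xi> i x \<partial>lborel)))"
        by (rule sum.cong[OF refl])
          (simp add: integral_lborel_by_parts[OF pwC \<xi>C] integral_lborel_by_parts[OF GC \<xi>C])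
      then show ?thesis unfolding sum_negf by simp
    qed
    also have "\<dots> = (\<integral>x. c * (wn x * \<xi> x) + (\<Sum>i\<in>Basis. pd wn i x * pd \<xi> i x + G i x * pd \<xi> i x) \<partial>lborel)"
      using I[OF j1] I[OF j2(3)] I[OF j2(4)]
      by (subst Bochner_Integration.integral_add) (auto intro!: Bochner_Integration.integrable_sum)
    also have "\<dots> \<ge> (\<integral>x. c * (a x * wn x)\<^sup>2 - (2 * (\<Sum>i\<in>Basis. (b i x * wn x)\<^sup>2)
        + (1/2) * (\<Sum>i\<in>Basis. (a x * G i x + - 1 * (a x * pd V i x * wn x))\<^sup>2)) \<partial>lborel)"
    proof (rule integral_mono)
      have k1: "(\<lambda>x. (a x * wn x)\<^sup>2) \<in> Cck 0"
        unfolding power2_eq_square by (intro Cck_mult1 aC Ck_mult wnC CckD)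
      have k2: "(\<lambda>x. (b i x * wn x)\<^sup>2) \<in> Cck 0" if "i \<in> Basis" for i
        unfolding power2_eq_square by (intro Cck_mult1 bC Ck_mult wnC CckD that)
      have k3: "(\<lambda>x. (a x * G i x + - 1 * (a x * pd V i x * wn x))\<^sup>2) \<in> Cck 0" if i: "i \<in> Basis" for i
      proof -
        have "(\<lambda>x. a x * G i x + - 1 * (a x * pd V i x * wn x)) \<in> Cck 0"
          by (intro Cck_add Cck_cmult Cck_mult1[OF aC] Cck_mult1[OF aVC] GC wnC i)
        then show ?thesis unfolding power2_eq_square by (intro Cck_mult1) (auto intro: CckD)
      qed
      show "integrable lborel (\<lambda>x. c * (a x * wn x)\<^sup>2 - (2 * (\<Sum>i\<in>Basis. (b i x * wn x)\<^sup>2)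
        + (1/2) * (\<Sum>i\<in>Basis. (a x * G i x + - 1 * (a x * pd V i x * wn x))\<^sup>2)))"
        by (intro I Cck_diff Cck_add Cck_cmult Cck_sum k1 k2 k3)
      show "integrable lborel (\<lambda>x. c * (wn x * \<xi> x) + (\<Sum>i\<in>Basis. pd wn i x * pd \<xi> i x + G i x * pd \<xi> i x))"
        by (intro I Cck_add Cck_cmult Cck_sum j1 j2)
      fix x
      define e where "e = exp (V x / 2)"
      have ee: "exp (V x) = e * e" unfolding e_def by (simp add: exp_add[symmetric])
      have A: "wn x * \<xi> x = (a x * wn x)\<^sup>2"
        unfolding \<xi>_def u_def a_def e_def[symmetric] by (simp add: ee power2_eq_square algebra_simps)
      have B: "- (2 * (b i x * wn x)\<^sup>2 + (1/2) * (a x * G i x + - 1 * (a x * pd V i x * wn x))\<^sup>2)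
          \<le> pd wn i x * pd \<xi> i x + G i x * pd \<xi> i x" for i
      proof -
        \<comment> \<open>\<open>S\<close> is the weighted gradient of \<open>u\<close>, over which
          there is no control. Completing squares absorbs it and leaves only the cutoff term
          \<open>\<beta>\<close> and the commutator \<open>\<epsilon>\<close>.\<close>
        define S where "S = e * ?\<chi> x * (pd wn i x + pd V i x * wn x)"
        define \<epsilon> where "\<epsilon> = a x * G i x + - 1 * (a x * pd V i x * wn x)"
        define \<beta> where "\<beta> = b i x * wn x"
        have "pd wn i x * pd \<xi> i x + G i x * pd \<xi> i x = (S + \<epsilon>) * (S + 2 * \<beta>)"
          unfolding p\<xi> pu u_def S_def \<epsilon>_def \<beta>_def a_def b_def e_def[symmetric]
          by (simp add: ee algebra_simps)
        also have "\<dots> + (2 * \<beta>\<^sup>2 + (1/2) * \<epsilon>\<^sup>2) = (S + \<beta> + \<epsilon> / 2)\<^sup>2 + (\<beta> + \<epsilon> / 2)\<^sup>2"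
          by (simp add: power2_eq_square field_simps)
        finally have "0 \<le> pd wn i x * pd \<xi> i x + G i x * pd \<xi> i x + (2 * \<beta>\<^sup>2 + (1/2) * \<epsilon>\<^sup>2)"
          by simp
        then show ?thesis unfolding \<beta>_def \<epsilon>_def by linarith
      qed
      have "(\<Sum>i\<in>Basis. - (2 * (b i x * wn x)\<^sup>2 + (1/2) * (a x * G i x + - 1 * (a x * pd V i x * wn x))\<^sup>2))
          \<le> (\<Sum>i\<in>Basis. pd wn i x * pd \<xi> i x + G i x * pd \<xi> i x)"
        by (rule sum_mono) (rule B)
      then have "- (2 * (\<Sum>i\<in>Basis. (b i x * wn x)\<^sup>2)
          + (1/2) * (\<Sum>i\<in>Basis. (a x * G i x + - 1 * (a x * pd V i x * wn x))\<^sup>2))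
          \<le> (\<Sum>i\<in>Basis. pd wn i x * pd \<xi> i x + G i x * pd \<xi> i x)"
        unfolding sum_negf by (simp only: sum.distrib sum_distrib_left)
      then show "c * (a x * wn x)\<^sup>2 - (2 * (\<Sum>i\<in>Basis. (b i x * wn x)\<^sup>2)
        + (1/2) * (\<Sum>i\<in>Basis. (a x * G i x + - 1 * (a x * pd V i x * wn x))\<^sup>2))
        \<le> c * (wn x * \<xi> x) + (\<Sum>i\<in>Basis. pd wn i x * pd \<xi> i x + G i x * pd \<xi> i x)"
        unfolding A by linarith
    qed
    finally have le: "(\<integral>x. c * (a x * wn x)\<^sup>2 - (2 * (\<Sum>i\<in>Basis. (b i x * wn x)\<^sup>2)
        + (1/2) * (\<Sum>i\<in>Basis. (a x * G i x + - 1 * (a x * pd V i x * wn x))\<^sup>2)) \<partial>lborel) \<le> 0" .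
    have k1: "integrable lborel (\<lambda>x. (a x * wn x)\<^sup>2)"
      unfolding power2_eq_square by (intro I Cck_mult1 aC Ck_mult wnC CckD)
    have k2: "integrable lborel (\<lambda>x. (b i x * wn x)\<^sup>2)" if "i \<in> Basis" for i
      unfolding power2_eq_square by (intro I Cck_mult1 bC Ck_mult wnC CckD that)
    have k3: "integrable lborel (\<lambda>x. (a x * G i x + - 1 * (a x * pd V i x * wn x))\<^sup>2)" if i: "i \<in> Basis" for i
    proof -
      have "(\<lambda>x. a x * G i x + - 1 * (a x * pd V i x * wn x)) \<in> Cck 0"
        by (intro Cck_add Cck_cmult Cck_mult1[OF aC] Cck_mult1[OF aVC] GC wnC i)
      then show ?thesis unfolding power2_eq_square by (intro I Cck_mult1) (auto intro: CckD)
    qed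
    have n2: "(l2norm lborel h)\<^sup>2 = (\<integral>x. (h x)\<^sup>2 \<partial>lborel)" for h :: "'a \<Rightarrow> real" by (simp add: l2norm_def)
    have "(\<integral>x. c * (a x * wn x)\<^sup>2 - (2 * (\<Sum>i\<in>Basis. (b i x * wn x)\<^sup>2)
        + (1/2) * (\<Sum>i\<in>Basis. (a x * G i x + - 1 * (a x * pd V i x * wn x))\<^sup>2)) \<partial>lborel)
      = c * (\<integral>x. (a x * wn x)\<^sup>2 \<partial>lborel) - (2 * (\<Sum>i\<in>Basis. \<integral>x. (b i x * wn x)\<^sup>2 \<partial>lborel)
        + (1/2) * (\<Sum>i\<in>Basis. \<integral>x. (a x * G i x + - 1 * (a x * pd V i x * wn x))\<^sup>2 \<partial>lborel))"
    proof -
      have s2: "integrable lborel (\<lambda>x. \<Sum>i\<in>Basis. (b i x * wn x)\<^sup>2)"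
        and s3: "integrable lborel (\<lambda>x. \<Sum>i\<in>Basis. (a x * G i x + - 1 * (a x * pd V i x * wn x))\<^sup>2)"
        using k2 k3 by (auto intro!: Bochner_Integration.integrable_sum)
      show ?thesis
        using k1 s2 s3
        by (simp only: Bochner_Integration.integral_diff Bochner_Integration.integral_add integrable_mult_right
            Bochner_Integration.integrable_add integral_mult_right_zero Bochner_Integration.integral_sum[OF k2] Bochner_Integration.integral_sum[OF k3])
    qed
    with le show ?thesis unfolding n2 wn_def G_def by linarith
  qed
  have Cb: "\<exists>B. \<forall>x. \<bar>f x\<bar> \<le> B" "f \<in> borel_measurable lborel" if "f \<in> Cck 0" for f :: "'a \<Rightarrow> real"
    using bounded_bsupp[of f] that Cck_measurable[OF that] by (auto intro: Cck_continuous dest: CckD)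
  have mul: "L2_tendsto lborel (\<lambda>n x. f x * s n x) (\<lambda>x. f x * t x)" if "f \<in> Cck 0" "L2_tendsto lborel s t" for f t :: "'a \<Rightarrow> real" and s
    using Cb[OF that(1)] L2_tendsto_mult[OF that(2)] by blast
  note tw = conv_moll_tendsto[OF w]
  have l1: "(\<lambda>n. l2norm lborel (\<lambda>x. a x * conv w (moll n) x)) \<longlonglongrightarrow> l2norm lborel (\<lambda>x. a x * w x)"
    by (rule L2_tendsto_norm[OF mul[OF aC tw]])
  have l2: "(\<lambda>n. l2norm lborel (\<lambda>x. b i x * conv w (moll n) x)) \<longlonglongrightarrow> l2norm lborel (\<lambda>x. b i x * w x)" if "i \<in> Basis" for i
    by (rule L2_tendsto_norm[OF mul[OF bC tw]]) (rule that)
  \<comment> \<open>On the support of the cutoff the truncated field \<open>g i\<close> coincides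
    with \<open>pd V i\<close> times \<open>w\<close>, so the two limits cancel.\<close>
  have l3: "(\<lambda>n. l2norm lborel (\<lambda>x. a x * conv (g i) (moll n) x + - 1 * (a x * pd V i x * conv w (moll n) x))) \<longlonglongrightarrow> 0" if i: "i \<in> Basis" for i
  proof -
    have "(\<lambda>n. l2norm lborel (\<lambda>x. a x * conv (g i) (moll n) x + - 1 * (a x * pd V i x * conv w (moll n) x)))
        \<longlonglongrightarrow> l2norm lborel (\<lambda>x. a x * g i x + - 1 * (a x * pd V i x * w x))"
      by (rule L2_tendsto_norm[OF L2_tendsto_lincomb[OF mul[OF aC conv_moll_tendsto[OF gL[OF i]]] mul[OF aVC[OF i] tw]]])
    also have "(\<lambda>x. a x * g i x + - 1 * (a x * pd V i x * w x)) = (\<lambda>x. 0)"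
    proof
      fix x show "a x * g i x + - 1 * (a x * pd V i x * w x) = 0"
        using \<chi>0[of x] by (cases "?\<chi> x = 0") (auto simp: a_def g_def)
    qed
    finally show ?thesis by simp
  qed
  have "c * (l2norm lborel (\<lambda>x. a x * w x))\<^sup>2 \<le> 2 * (\<Sum>i\<in>Basis. (l2norm lborel (\<lambda>x. b i x * w x))\<^sup>2) + (1/2) * (\<Sum>i\<in>(Basis :: 'a set). 0\<^sup>2)"
  proof (rule LIMSEQ_le)
    show "(\<lambda>n. c * (l2norm lborel (\<lambda>x. a x * conv w (moll n) x))\<^sup>2) \<longlonglongrightarrow> c * (l2norm lborel (\<lambda>x. a x * w x))\<^sup>2"
      by (intro tendsto_mult tendsto_const tendsto_power l1)
    show "(\<lambda>n. 2 * (\<Sum>i\<in>Basis. (l2norm lborel (\<lambda>x. b i x * conv w (moll n) x))\<^sup>2)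
        + (1/2) * (\<Sum>i\<in>Basis. (l2norm lborel (\<lambda>x. a x * conv (g i) (moll n) x + - 1 * (a x * pd V i x * conv w (moll n) x)))\<^sup>2))
      \<longlonglongrightarrow> 2 * (\<Sum>i\<in>Basis. (l2norm lborel (\<lambda>x. b i x * w x))\<^sup>2) + (1/2) * (\<Sum>i\<in>(Basis :: 'a set). 0\<^sup>2)"
      by (intro tendsto_add tendsto_mult tendsto_const tendsto_sum tendsto_power l2 l3)
  qed (use ineq in blast)
  then show ?thesis by (simp add: a_def b_def)
qed

end

section \<open>Density of the resolvent range, and Bochner's formula\<close>

context gibbs_weight
begin

text \<open>The lower bound on \<open>V\<close> puts \<open>exp (- V x) * u x\<close> into
  unweighted L2, so that it can be mollified; the factor \<open>exp (V x / 2)\<close> in the cutoff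
  estimate then restores the weighted norm of \<open>u\<close>. As \<open>R\<close> grows, the
  gradient of the cutoff contributes only C / R^2.\<close>

lemma weak_solution_zero:
  assumes u: "u \<in> L2 (gm V)" and c: "0 < c" and b: "\<And>x. - b \<le> V x"
    and weak: "\<And>\<phi>. \<phi> \<in> Cck 3 \<Longrightarrow> ip (gm V) u (\<lambda>x. c * \<phi> x + H \<phi> x) = 0"
  shows "l2norm (gm V) u = 0"
proof -
  have [measurable]: "u \<in> borel_measurable borel" using u by (simp add: L2_def measurable_cong_sets[OF sets_gm refl])
  have iu: "integrable (gm V) (\<lambda>x. (u x)\<^sup>2)" using u by (rule L2_integrable_sq)
  then have iu': "integrable lborel (\<lambda>x. exp (- V x) * (u x)\<^sup>2)" by (simp add: integral_gm(2))
  define w where "w x = exp (- V x) * u x" for x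
  have [measurable]: "w \<in> borel_measurable borel" unfolding w_def by measurable
  have w: "w \<in> L2 lborel"
  proof -
    have "integrable lborel (\<lambda>x. (w x)\<^sup>2)"
    proof (rule Bochner_Integration.integrable_bound)
      show "integrable lborel (\<lambda>x. exp b * (exp (- V x) * (u x)\<^sup>2))" using iu' by (rule integrable_mult_right)
      have "(w x)\<^sup>2 \<le> exp b * (exp (- V x) * (u x)\<^sup>2)" for x
      proof -
        have "(w x)\<^sup>2 = exp (- V x) * (exp (- V x) * (u x)\<^sup>2)" by (simp add: w_def power2_eq_square mult_ac)
        also have "\<dots> \<le> exp b * (exp (- V x) * (u x)\<^sup>2)"
          using b[of x] by (intro mult_right_mono) auto
        finally show ?thesis .
      qed
      then show "AE x in lborel. norm ((w x)\<^sup>2) \<le> norm (exp b * (exp (- V x) * (u x)\<^sup>2))" by simp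
    qed measurable
    then show ?thesis by (simp add: L2_def)
  qed
  have sq: "(l2norm lborel (\<lambda>x. exp (V x / 2) * f x * w x))\<^sup>2 = Z * (\<integral>x. (f x)\<^sup>2 * (u x)\<^sup>2 \<partial>gm V)"
    if [measurable]: "f \<in> borel_measurable borel" for f
  proof -
    have "(exp (V x / 2) * f x * w x)\<^sup>2 = exp (- V x) * ((f x)\<^sup>2 * (u x)\<^sup>2)" for x
    proof -
      have "exp (V x / 2) * exp (V x / 2) * exp (- V x) = 1" by (simp add: exp_add[symmetric])
      then have "(exp (V x / 2) * exp (V x / 2) * exp (- V x)) * (exp (- V x) * ((f x)\<^sup>2 * (u x)\<^sup>2)) = exp (- V x) * ((f x)\<^sup>2 * (u x)\<^sup>2)" by simp
      then show ?thesis by (simp add: w_def power2_eq_square mult_ac)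
    qed
    then show ?thesis using Z_pos by (simp add: l2norm_def integral_gm(1))
  qed
  have weak': "(\<integral>x. w x * (c * \<phi> x + H \<phi> x) \<partial>lborel) = 0" if \<phi>: "\<phi> \<in> Cck 3" for \<phi>
  proof -
    have "H \<phi> \<in> Cck 0"
      unfolding H_def using pd_V_cont
      by (intro Cck_sum Cck_diff Cck_mult2 Cck_pd'[OF \<phi>] Cck_pd'[OF Cck_pd'[OF \<phi>, of 2]]) (auto simp: Ck_0)
    then have [measurable]: "\<phi> \<in> borel_measurable borel" "H \<phi> \<in> borel_measurable borel"
      using \<phi> by (auto intro: Cck_measurable)
    have "ip (gm V) u (\<lambda>x. c * \<phi> x + H \<phi> x) = (\<integral>x. w x * (c * \<phi> x + H \<phi> x) \<partial>lborel) / Z"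
      unfolding ip_def by (subst integral_gm(1)) (auto simp: w_def mult.assoc)
    then show ?thesis using weak[OF \<phi>] Z_pos by simp
  qed
  obtain C where C: "C \<ge> 0" "\<And>R x::'a. R > 0 \<Longrightarrow> (\<Sum>i\<in>Basis. (pd (bump R) i x)\<^sup>2) \<le> C / R\<^sup>2"
    using bump_grad by blast
  define A where "A = (\<integral>x. (u x)\<^sup>2 \<partial>gm V)"
  have bm[measurable]: "bump R \<in> borel_measurable borel" for R :: real
    by (rule borel_measurable_continuous_onI[OF Ck_continuous[OF Ck_bump]])
  have key: "c * (\<integral>x. (bump R x)\<^sup>2 * (u x)\<^sup>2 \<partial>gm V) \<le> 2 * (C / R\<^sup>2) * A" if R: "0 < R" for R :: real
  proof -
    have pm: "pd (bump R) i \<in> borel_measurable borel" if "i \<in> Basis" for i :: 'a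
      by (rule borel_measurable_continuous_onI[OF Ck_continuous[OF Ck_pd'[OF Ck_bump[of 1] _ that, of 0]]]) simp
    have le: "(pd (bump R) i x)\<^sup>2 \<le> C / R\<^sup>2" if "i \<in> Basis" for i x :: 'a
      using C(2)[OF R, of x] member_le_sum[of i Basis "\<lambda>i. (pd (bump R) i x)\<^sup>2"] that by auto
    have ii: "integrable (gm V) (\<lambda>x. (pd (bump R) i x)\<^sup>2 * (u x)\<^sup>2)" if i: "i \<in> Basis" for i :: 'a
    proof (rule Bochner_Integration.integrable_bound)
      show "integrable (gm V) (\<lambda>x. (C / R\<^sup>2) * (u x)\<^sup>2)" using iu by (rule integrable_mult_right)
      show "(\<lambda>x. (pd (bump R) i x)\<^sup>2 * (u x)\<^sup>2) \<in> borel_measurable (gm V)" using pm[OF i] by measurable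
      show "AE x in gm V. norm ((pd (bump R) i x)\<^sup>2 * (u x)\<^sup>2) \<le> norm ((C / R\<^sup>2) * (u x)\<^sup>2)"
        using mult_right_mono[OF le[OF i] zero_le_power2] C(1) by (intro AE_I2) simp
    qed
    have "c * (Z * (\<integral>x. (bump R x)\<^sup>2 * (u x)\<^sup>2 \<partial>gm V)) \<le> 2 * (\<Sum>i\<in>Basis. Z * (\<integral>x. (pd (bump R) i x)\<^sup>2 * (u x)\<^sup>2 \<partial>gm V))"
      using weak_solution_cutoff[OF w c weak' R] by (simp add: sq pm)
    also have "\<dots> = Z * (2 * (\<integral>x. (\<Sum>i\<in>Basis. (pd (bump R) i x)\<^sup>2) * (u x)\<^sup>2 \<partial>gm V))"
      by (simp add: sum_distrib_left[symmetric] sum_distrib_right Bochner_Integration.integral_sum[OF ii])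
    also have "(\<integral>x. (\<Sum>i\<in>Basis. (pd (bump R) i x)\<^sup>2) * (u x)\<^sup>2 \<partial>gm V) \<le> (\<integral>x. (C / R\<^sup>2) * (u x)\<^sup>2 \<partial>gm V)"
    proof (rule integral_mono)
      show "integrable (gm V) (\<lambda>x. (\<Sum>i\<in>Basis. (pd (bump R) i x)\<^sup>2) * (u x)\<^sup>2)"
        unfolding sum_distrib_right using ii by (rule Bochner_Integration.integrable_sum)
      show "integrable (gm V) (\<lambda>x. (C / R\<^sup>2) * (u x)\<^sup>2)" using iu by (rule integrable_mult_right)
    qed (intro mult_right_mono C R; simp)
    finally have "Z * (c * (\<integral>x. (bump R x)\<^sup>2 * (u x)\<^sup>2 \<partial>gm V)) \<le> Z * (2 * (C / R\<^sup>2) * A)"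
      using Z_pos by (simp add: A_def mult_ac)
    then show ?thesis using Z_pos by (rule mult_left_le_imp_le)
  qed
  have l: "(\<lambda>n. \<integral>x. (bump (real (Suc n)) x)\<^sup>2 * (u x)\<^sup>2 \<partial>gm V) \<longlonglongrightarrow> (\<integral>x. (flat_exp 0 2)\<^sup>2 * (u x)\<^sup>2 \<partial>gm V)"
  proof (rule integral_dominated_convergence[where w="\<lambda>x. (u x)\<^sup>2"])
    show "(\<lambda>x. (bump (real (Suc n)) x)\<^sup>2 * (u x)\<^sup>2) \<in> borel_measurable (gm V)" for n by measurable
    show "AE x in gm V. (\<lambda>n. (bump (real (Suc n)) x)\<^sup>2 * (u x)\<^sup>2) \<longlonglongrightarrow> (flat_exp 0 2)\<^sup>2 * (u x)\<^sup>2"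
      by (intro AE_I2 tendsto_mult tendsto_power tendsto_const bump_tendsto)
    have "(bump R x)\<^sup>2 * (u x)\<^sup>2 \<le> (u x)\<^sup>2" for R and x :: 'a
      using bump_bounds[of R x] by (intro mult_left_le_one_le) (auto simp: power_le_one)
    then show "AE x in gm V. norm ((bump (real (Suc n)) x)\<^sup>2 * (u x)\<^sup>2) \<le> (u x)\<^sup>2" for n by simp
  qed (use iu in auto)
  have r: "(\<lambda>n. 2 * (C * (inverse (real (Suc n)))\<^sup>2) * A) \<longlonglongrightarrow> 2 * (C * 0\<^sup>2) * A"
    by (intro tendsto_mult tendsto_const tendsto_power LIMSEQ_inverse_real_of_nat)
  have "c * (\<integral>x. (flat_exp 0 2)\<^sup>2 * (u x)\<^sup>2 \<partial>gm V) \<le> 2 * (C * 0\<^sup>2) * A"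
    by (rule LIMSEQ_le[OF tendsto_mult[OF tendsto_const l] r])
      (use key[of "real (Suc n)" for n] in \<open>auto simp: divide_inverse power_inverse simp del: of_nat_Suc\<close>)
  then have "c * (flat_exp 0 2)\<^sup>2 * A \<le> 0" by (simp add: A_def)
  moreover have "0 < c * (flat_exp 0 2)\<^sup>2" using c by (simp add: flat_exp_def)
  moreover have "0 \<le> A" by (simp add: A_def)
  ultimately have "A = 0" by (smt (verit) mult_pos_pos)
  then show ?thesis by (simp add: l2norm_def A_def)
qed

lemma H_Cck: "\<phi> \<in> Cck 2 \<Longrightarrow> H \<phi> \<in> Cck 0"
  unfolding H_def[abs_def] using pd_V_cont
  by (intro Cck_sum Cck_diff Cck_mult2 Cck_pd' Cck_pd'[OF Cck_pd'[of \<phi> 2 1]]) (auto simp: Ck_0)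

lemma H_Cck1: "Ck 2 V \<Longrightarrow> \<phi> \<in> Cck 3 \<Longrightarrow> H \<phi> \<in> Cck 1"
  unfolding H_def[abs_def]
  by (intro Cck_sum Cck_diff Cck_mult2 Cck_pd' Ck_pd' Cck_pd'[OF Cck_pd'[of \<phi> 3 2]]) auto

lemma H_lincomb:
  assumes "\<phi> \<in> Cck 2" "\<psi> \<in> Cck 2"
  shows "H (\<lambda>x. \<phi> x + c * \<psi> x) = (\<lambda>x. H \<phi> x + c * H \<psi> x)"
proof -
  have d: "\<phi> differentiable at x" "\<psi> differentiable at x" for x
    using assms by (auto simp: Cck_def intro: Ck_differentiable)
  have d2: "pd \<phi> i differentiable at x" "pd \<psi> i differentiable at x" if "i \<in> Basis" for x i
    using Cck_pd'[OF assms(1), of 1 i] Cck_pd'[OF assms(2), of 1 i] that by (auto simp: Cck_def intro: Ck_differentiable)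
  have p: "pd (\<lambda>x. f x + c * g x) i x = pd f i x + c * pd g i x"
    if "f differentiable at x" "g differentiable at x" for f g :: "'a \<Rightarrow> real" and x i
    using that by (subst pd_add) (auto simp: pd_cmult intro: differentiable_mult)
  have pp: "pd (\<lambda>x. \<phi> x + c * \<psi> x) i = (\<lambda>x. pd \<phi> i x + c * pd \<psi> i x)" for i
    using d by (intro ext p) auto
  have "pd V i x * pd (\<lambda>x. \<phi> x + c * \<psi> x) i x - pd (pd (\<lambda>x. \<phi> x + c * \<psi> x) i) i x
      = (pd V i x * pd \<phi> i x - pd (pd \<phi> i) i x) + c * (pd V i x * pd \<psi> i x - pd (pd \<psi> i) i x)"
    if "i \<in> Basis" for i x
    unfolding pp p[OF d2[OF that]] by (simp add: algebra_simps)
  then show ?thesis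
    by (simp add: H_def[abs_def] sum_distrib_left sum.distrib)
qed

text \<open>The residual of projecting \<open>f\<close> onto the closure of the range is orthogonal
  to the range. This orthogonality is the weak homogeneous equation, so the residual is
  null.\<close>

lemma resolvent_range_dense:
  assumes f: "f \<in> L2 (gm V)" and c: "0 < c" and b: "\<And>x. - b \<le> V x"
  shows "\<exists>\<phi>. (\<forall>n. \<phi> n \<in> Cck 3) \<and> L2_tendsto (gm V) (\<lambda>n x. c * \<phi> n x + H (\<phi> n) x) f"
proof -
  define W where "W = (\<lambda>\<phi> x. c * \<phi> x + H \<phi> x) ` Cck 3"
  have W: "W \<subseteq> L2 (gm V)"
  proof -
    have "(\<lambda>x. c * \<phi> x + H \<phi> x) \<in> Cck 0" if "\<phi> \<in> Cck 3" for \<phi>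
      using that by (intro Cck_add Cck_cmult H_Cck) (auto intro: Cck_mono)
    then show ?thesis unfolding W_def by (auto intro: L2_Cck)
  qed
  have "(\<lambda>x. 0) \<in> Cck 3" by (simp add: Cck_def)
  then have W0: "W \<noteq> {}" by (auto simp: W_def)
  have lin: "(\<lambda>x. u x + k * v x) \<in> W" if uv: "u \<in> W" "v \<in> W" for u v k
  proof -
    obtain \<phi> where p1: "\<phi> \<in> Cck 3" "u = (\<lambda>x. c * \<phi> x + H \<phi> x)" using uv(1) by (auto simp: W_def)
    obtain \<psi> where p2: "\<psi> \<in> Cck 3" "v = (\<lambda>x. c * \<psi> x + H \<psi> x)" using uv(2) by (auto simp: W_def)
    note p = p1(1) p2(1) p1(2) p2(2)
    have "(\<lambda>x. \<phi> x + k * \<psi> x) \<in> Cck 3" by (intro Cck_add Cck_cmult p)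
    moreover have "(\<lambda>x. u x + k * v x) = (\<lambda>x. c * (\<phi> x + k * \<psi> x) + H (\<lambda>x. \<phi> x + k * \<psi> x) x)"
      using H_lincomb[of \<phi> \<psi> k] p by (auto simp: Cck_mono algebra_simps)
    ultimately show ?thesis
      unfolding W_def by (rule image_eqI[where x="\<lambda>x. \<phi> x + k * \<psi> x", rotated])
  qed
  obtain r w where r: "\<And>n. w n \<in> W" "L2_tendsto (gm V) (\<lambda>n x. f x - w n x) r" "\<And>v. v \<in> W \<Longrightarrow> ip (gm V) r v = 0"
    using L2_projection[OF prob_space_axioms W W0 lin f] by blast
  have rL: "r \<in> L2 (gm V)" using r(2) by (rule L2_tendsto_L2)
  have r0: "l2norm (gm V) r = 0"
    by (rule weak_solution_zero[OF rL c b]) (use r(3) in \<open>auto simp: W_def\<close>)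
  have "\<forall>n. \<exists>\<phi>\<in>Cck 3. w n = (\<lambda>x. c * \<phi> x + H \<phi> x)" using r(1) by (auto simp: W_def)
  then obtain \<phi> where \<phi>: "\<And>n. \<phi> n \<in> Cck 3" "\<And>n. w n = (\<lambda>x. c * \<phi> n x + H (\<phi> n) x)" by metis
  have "L2_tendsto (gm V) w f"
  proof (rule L2_tendstoI)
    show "w n \<in> L2 (gm V)" for n using r(1) W by auto
    have "(\<lambda>n. l2norm (gm V) (\<lambda>x. f x - w n x)) \<longlonglongrightarrow> l2norm (gm V) r" by (rule L2_tendsto_norm[OF r(2)])
    then show "(\<lambda>n. l2norm (gm V) (\<lambda>x. w n x - f x)) \<longlonglongrightarrow> 0" by (simp add: r0 l2norm_minus_commute)
  qed (rule f)
  then show ?thesis using \<phi> by (intro exI[of _ \<phi>]) (auto simp: \<phi>(2)[abs_def])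
qed

text \<open>Only \<open>\<phi>\<close> carries bounded support, so \<open>\<psi>\<close> may be
  constant; this shows that \<open>H \<phi>\<close> has mean zero.\<close>

lemma ip_H:
  assumes \<phi>: "\<phi> \<in> Cck 2" and \<psi>: "Ck 1 \<psi>"
  shows "ip (gm V) (H \<phi>) \<psi> = (\<Sum>i\<in>Basis. ip (gm V) (pd \<phi> i) (pd \<psi> i))"
proof -
  have C: "(\<lambda>x. pd V i x * pd \<phi> i x * \<psi> x) \<in> Cck 0" "(\<lambda>x. pd (pd \<phi> i) i x * \<psi> x) \<in> Cck 0"
    "(\<lambda>x. pd \<phi> i x * pd \<psi> i x) \<in> Cck 0" if i: "i \<in> Basis" for i
    using pd_V_cont[OF i] Cck_pd'[OF \<phi>, of 0 i] Cck_pd'[OF \<phi>, of 1 i] Cck_pd'[OF Cck_pd'[OF \<phi>, of 1 i], of 0 i] Ck_pd'[OF \<psi>, of 0 i] Ck_mono[OF \<psi>, of 0] i \<psi>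
    by (auto intro!: Cck_mult1[of _ 0 \<psi>] Cck_mult2[of 0 "pd V i"] Cck_mult1[of _ 0 "pd \<psi> i"] simp: Ck_0)
  have C4: "(\<lambda>x. pd \<phi> i x * \<psi> x) \<in> Cck 1" if "i \<in> Basis" for i
    by (rule Cck_mult1[OF Cck_pd'[OF \<phi>] \<psi>]) (use that in auto)
  have I: "integrable (gm V) f" if "f \<in> Cck k" for f k using that by (rule integrable_Cck)
  have "ip (gm V) (H \<phi>) \<psi> = (\<integral>x. (\<Sum>i\<in>Basis. pd V i x * pd \<phi> i x * \<psi> x - pd (pd \<phi> i) i x * \<psi> x) \<partial>gm V)"
    by (simp add: ip_def H_def sum_distrib_right left_diff_distrib)
  also have "\<dots> = (\<Sum>i\<in>Basis. (\<integral>x. pd V i x * pd \<phi> i x * \<psi> x \<partial>gm V) - (\<integral>x. pd (pd \<phi> i) i x * \<psi> x \<partial>gm V))"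
    using I[OF C(1)] I[OF C(2)] by (subst Bochner_Integration.integral_sum) auto
  also have "\<dots> = (\<Sum>i\<in>Basis. ip (gm V) (pd \<phi> i) (pd \<psi> i))"
  proof (rule sum.cong[OF refl])
    fix i :: 'a assume i: "i \<in> Basis"
    have "(\<integral>x. pd (\<lambda>x. pd \<phi> i x * \<psi> x) i x \<partial>gm V) = (\<integral>x. pd \<phi> i x * \<psi> x * pd V i x \<partial>gm V)"
      by (rule integral_by_parts[OF C4[OF i] i])
    moreover have "pd (\<lambda>x. pd \<phi> i x * \<psi> x) i = (\<lambda>x. pd (pd \<phi> i) i x * \<psi> x + pd \<phi> i x * pd \<psi> i x)"
      using Cck_pd'[OF \<phi>, of 1 i] \<psi> i by (intro ext pd_mult) (auto simp: Cck_def intro: Ck_differentiable)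
    ultimately have "(\<integral>x. pd (pd \<phi> i) i x * \<psi> x + pd \<phi> i x * pd \<psi> i x \<partial>gm V) = (\<integral>x. pd \<phi> i x * \<psi> x * pd V i x \<partial>gm V)"
      by simp
    then show "(\<integral>x. pd V i x * pd \<phi> i x * \<psi> x \<partial>gm V) - (\<integral>x. pd (pd \<phi> i) i x * \<psi> x \<partial>gm V) = ip (gm V) (pd \<phi> i) (pd \<psi> i)"
      using I[OF C(2)[OF i]] I[OF C(3)[OF i]] by (simp add: ip_def mult_ac)
  qed
  finally show ?thesis .
qed

text \<open>The commutator of \<open>H\<close> with a derivative is multiplication by the Hessian of
  \<open>V\<close>, which is how curvature enters.\<close>

lemma pd_H:
  assumes V: "Ck 2 V" and \<phi>: "\<phi> \<in> Cck 3" and j: "j \<in> Basis"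
  shows "pd (H \<phi>) j x = H (pd \<phi> j) x + (\<Sum>i\<in>Basis. pd (pd V i) j x * pd \<phi> i x)"
proof -
  have \<phi>': "Ck 3 \<phi>" using \<phi> by (rule CckD)
  have d: "pd V i differentiable at x" "pd \<phi> i differentiable at x" "pd (pd \<phi> i) i differentiable at x" if "i \<in> Basis" for i
    using Ck_pd'[OF V, of 1 i] Ck_pd'[OF \<phi>', of 1 i] Ck_pd'[OF Ck_pd'[OF \<phi>', of 2 i], of 1 i] that
    by (auto intro: Ck_differentiable)
  have c1: "pd (pd \<phi> i) j = pd (pd \<phi> j) i" if "i \<in> Basis" for i
    using pd_commute[of \<phi> i j] Ck_mono[OF \<phi>', of 2] that j by auto
  have c2: "pd (pd (pd \<phi> i) i) j x = pd (pd (pd \<phi> j) i) i x" if i: "i \<in> Basis" for i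
    using pd_commute[of "pd \<phi> i" i j x] Ck_pd'[OF \<phi>', of 2 i] i j c1[OF i] by simp
  have "pd (H \<phi>) j x = (\<Sum>i\<in>Basis. pd (\<lambda>x. pd V i x * pd \<phi> i x - pd (pd \<phi> i) i x) j x)"
    unfolding H_def[abs_def] using d by (intro pd_sum) (auto intro!: differentiable_diff differentiable_mult)
  also have "\<dots> = (\<Sum>i\<in>Basis. (pd V i x * pd (pd \<phi> j) i x - pd (pd (pd \<phi> j) i) i x) + pd (pd V i) j x * pd \<phi> i x)"
    using d by (intro sum.cong refl) (simp add: pd_diff pd_mult differentiable_mult c1 c2)
  finally show ?thesis by (simp add: H_def sum.distrib)
qed

text \<open>Apply \<open>ip_H\<close> with \<open>\<psi>\<close> equal to \<open>H \<phi>\<close>,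
  move the derivative past \<open>H\<close> by \<open>pd_H\<close>, and apply \<open>ip_H\<close>
  once more to each \<open>pd \<phi> j\<close>. The commutator is the Hessian form evaluated at the
  gradient, bounded below by \<open>hess\<close>.\<close>

lemma bochner:
  assumes V: "Ck 2 V" and \<phi>: "\<phi> \<in> Cck 3" and hess: "\<And>x w. pd (pd V w) w x \<ge> - K * (norm w)\<^sup>2"
  shows "(\<Sum>j\<in>Basis. \<Sum>i\<in>Basis. ip (gm V) (pd (pd \<phi> j) i) (pd (pd \<phi> j) i))
    \<le> ip (gm V) (H \<phi>) (H \<phi>) + K * (\<Sum>i\<in>Basis. ip (gm V) (pd \<phi> i) (pd \<phi> i))"
proof -
  have HC: "H \<phi> \<in> Cck 1" by (rule H_Cck1[OF V \<phi>])
  have pC: "pd \<phi> j \<in> Cck 2" if "j \<in> Basis" for j using Cck_pd'[OF \<phi>] that by auto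
  have L: "f \<in> L2 (gm V)" if "f \<in> Cck k" for f k using that by (rule L2_Cck)
  define S where "S j x = (\<Sum>i\<in>Basis. pd (pd V i) j x * pd \<phi> i x)" for j x
  have SC: "S j \<in> Cck 0" if j: "j \<in> Basis" for j
    unfolding S_def
    by (intro Cck_sum Cck_mult2 Ck_pd'[OF Ck_pd'[OF V, of 1]] Cck_pd'[OF \<phi>]) (use j in auto)
  have dV: "V differentiable at x" for x using V by (auto intro: Ck_differentiable)
  have d2V: "pd V i differentiable at x" if "i \<in> Basis" for x i
    using Ck_pd'[OF V, of 1 i] that by (auto intro: Ck_differentiable)
  have hs: "- K * (\<Sum>i\<in>Basis. pd \<phi> i x * pd \<phi> i x) \<le> (\<Sum>j\<in>Basis. pd \<phi> j x * S j x)" for x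
  proof -
    \<comment> \<open>The gradient of \<open>\<phi>\<close> at \<open>x\<close> as a vector, the
      direction in which the Hessian bound is used.\<close>
    define w where "w = (\<Sum>i\<in>Basis. pd \<phi> i x *\<^sub>R i)"
    have wi: "w \<bullet> i = pd \<phi> i x" if "i \<in> Basis" for i unfolding w_def using that by simp
    have pw: "pd V w = (\<lambda>y. \<Sum>i\<in>Basis. pd \<phi> i x * pd V i y)"
      using pd_expand[OF dV, of w] wi by (intro ext) simp
    have "pd (pd V w) w x = (\<Sum>i\<in>Basis. pd \<phi> i x * pd (pd V i) w x)"
      unfolding pw using d2V by (subst pd_sum) (auto simp: pd_cmult intro!: differentiable_mult)
    also have "\<dots> = (\<Sum>i\<in>Basis. \<Sum>j\<in>Basis. pd \<phi> i x * (pd \<phi> j x * pd (pd V i) j x))"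
      using pd_expand[OF d2V, of _ w x] wi by (simp add: sum_distrib_left)
    also have "\<dots> = (\<Sum>j\<in>Basis. pd \<phi> j x * S j x)"
      unfolding S_def sum_distrib_left by (subst sum.swap) (simp add: mult_ac)
    finally have "pd (pd V w) w x = (\<Sum>j\<in>Basis. pd \<phi> j x * S j x)" .
    moreover have "(norm w)\<^sup>2 = (\<Sum>i\<in>Basis. pd \<phi> i x * pd \<phi> i x)"
      by (subst power2_norm_eq_inner, subst euclidean_inner) (simp add: wi)
    ultimately show ?thesis using hess[of w x] by simp
  qed
  have "ip (gm V) (H \<phi>) (H \<phi>) = (\<Sum>j\<in>Basis. ip (gm V) (pd \<phi> j) (pd (H \<phi>) j))"
    by (rule ip_H) (use \<phi> HC in \<open>auto intro: Cck_mono CckD\<close>)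
  also have "\<dots> = (\<Sum>j\<in>Basis. ip (gm V) (pd \<phi> j) (H (pd \<phi> j)) + ip (gm V) (pd \<phi> j) (S j))"
  proof (rule sum.cong[OF refl])
    fix j :: 'a assume j: "j \<in> Basis"
    have "pd (H \<phi>) j = (\<lambda>x. H (pd \<phi> j) x + S j x)" using pd_H[OF V \<phi> j] by (auto simp: S_def)
    then show "ip (gm V) (pd \<phi> j) (pd (H \<phi>) j) = ip (gm V) (pd \<phi> j) (H (pd \<phi> j)) + ip (gm V) (pd \<phi> j) (S j)"
      using L[OF H_Cck[OF pC[OF j]]] L[OF pC[OF j]] L[OF SC[OF j]] by (simp add: ip_add_right)
  qed
  also have "\<dots> = (\<Sum>j\<in>Basis. \<Sum>i\<in>Basis. ip (gm V) (pd (pd \<phi> j) i) (pd (pd \<phi> j) i)) + (\<Sum>j\<in>Basis. ip (gm V) (pd \<phi> j) (S j))"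
    unfolding sum.distrib
    by (intro arg_cong2[of _ _ _ _ "(+)"] sum.cong refl)
      (use pC in \<open>auto simp: ip_commute[of _ "pd \<phi> _" "H _"] intro!: ip_H CckD(1)[OF Cck_mono[of _ 2]]\<close>)
  finally have e: "ip (gm V) (H \<phi>) (H \<phi>) = (\<Sum>j\<in>Basis. \<Sum>i\<in>Basis. ip (gm V) (pd (pd \<phi> j) i) (pd (pd \<phi> j) i)) + (\<Sum>j\<in>Basis. ip (gm V) (pd \<phi> j) (S j))" .
  have C: "(\<lambda>x. pd \<phi> j x * S j x) \<in> Cck 0" "(\<lambda>x. pd \<phi> j x * pd \<phi> j x) \<in> Cck 0" if "j \<in> Basis" for j
    using SC[OF that] pC[OF that] by (auto intro!: Cck_mult1 intro: CckD Cck_mono Ck_mono)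
  have "- K * (\<Sum>i\<in>Basis. ip (gm V) (pd \<phi> i) (pd \<phi> i)) = (\<integral>x. - K * (\<Sum>i\<in>Basis. pd \<phi> i x * pd \<phi> i x) \<partial>gm V)"
    using integrable_Cck[OF C(2)] by (simp add: ip_def)
  also have "\<dots> \<le> (\<integral>x. (\<Sum>j\<in>Basis. pd \<phi> j x * S j x) \<partial>gm V)"
    by (rule integral_mono) (use hs integrable_Cck[OF C(1)] integrable_Cck[OF C(2)] in auto)
  also have "\<dots> = (\<Sum>j\<in>Basis. ip (gm V) (pd \<phi> j) (S j))"
    using integrable_Cck[OF C(1)] by (simp add: ip_def)
  finally show ?thesis using e by simp
qed

end

section \<open>The Gaussian Poincare inequality\<close>

definition nsq :: "'a::euclidean_space \<Rightarrow> real" where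
  "nsq v = (norm v)\<^sup>2 / 2"

lemma Ck_nsq: "Ck k nsq"
  using Ck_cmult[OF Ck_norm_sq, of k "1/2"] by (simp add: nsq_def[abs_def])

lemma pd_nsq: "pd nsq h v = v \<bullet> h"
proof -
  have "(\<lambda>v::'a. (norm v)\<^sup>2) differentiable at v" by (rule Ck_differentiable[OF Ck_norm_sq[of 1]]) simp
  from pd_cmult[OF this, of "1/2" h] show ?thesis by (simp add: nsq_def[abs_def] pd_norm_sq)
qed

text \<open>The integrand factorises over the coordinates, which reduces the claim to the
  one-dimensional normal density.\<close>

lemma integrable_exp_norm_sq:
  assumes c: "0 < c"
  shows "integrable lborel (\<lambda>v::'a::euclidean_space. exp (- c * (norm v)\<^sup>2))"
proof (rule integrableI_bounded)
  define r where "r = (\<integral>x. exp (- c * x\<^sup>2) \<partial>(lborel :: real measure))"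
  have i: "integrable lborel (\<lambda>x::real. exp (- c * x\<^sup>2))"
  proof -
    \<comment> \<open>The standard deviation for which the normal density has exponent
      \<open>- c * x\<^sup>2\<close>.\<close>
    define \<sigma> where "\<sigma> = 1 / sqrt (2 * c)"
    have \<sigma>: "0 < \<sigma>" "2 * \<sigma>\<^sup>2 = 1 / c" using c by (auto simp: \<sigma>_def power_divide)
    have "integrable lborel (\<lambda>x. sqrt (2 * pi * \<sigma>\<^sup>2) * normal_density 0 \<sigma> x)"
      using integrable_normal_density[OF \<sigma>(1)] by (rule integrable_mult_right)
    also have "(\<lambda>x. sqrt (2 * pi * \<sigma>\<^sup>2) * normal_density 0 \<sigma> x) = (\<lambda>x. exp (- c * x\<^sup>2))"
      using \<sigma> c by (auto simp: normal_density_def fun_eq_iff)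
    finally show ?thesis .
  qed
  have "(\<integral>\<^sup>+v. ennreal (norm (exp (- c * (norm v)\<^sup>2))) \<partial>(lborel :: 'a measure)) = (\<integral>\<^sup>+v. (\<Prod>b\<in>Basis. ennreal (exp (- c * (v \<bullet> b)\<^sup>2))) \<partial>(lborel :: 'a measure))"
  proof (rule nn_integral_cong)
    fix v :: 'a
    have "(norm v)\<^sup>2 = (\<Sum>b\<in>Basis. (v \<bullet> b)\<^sup>2)"
      by (subst power2_norm_eq_inner, subst euclidean_inner) (simp add: power2_eq_square)
    then have "exp (- c * (norm v)\<^sup>2) = (\<Prod>b\<in>Basis. exp (- c * (v \<bullet> b)\<^sup>2))"
      by (simp add: sum_distrib_left exp_sum[symmetric] sum_negf)
    then show "ennreal (norm (exp (- c * (norm v)\<^sup>2))) = (\<Prod>b\<in>Basis. ennreal (exp (- c * (v \<bullet> b)\<^sup>2)))"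
      by (simp add: prod_ennreal prod_nonneg abs_of_nonneg)
  qed
  also have "\<dots> = (\<Prod>b\<in>(Basis::'a set). (\<integral>\<^sup>+x. ennreal (exp (- c * x\<^sup>2)) \<partial>lborel))"
    using nn_integral_lborel_prod[of "\<lambda>b::'a. \<lambda>x. exp (- c * x\<^sup>2)"] by simp
  also have "\<dots> = ennreal r ^ DIM('a)"
    unfolding r_def using i by (subst nn_integral_eq_integral) auto
  also have "\<dots> < \<infinity>" by (simp add: ennreal_power r_def)
  finally show "(\<integral>\<^sup>+v. ennreal (norm (exp (- c * (norm v)\<^sup>2))) \<partial>(lborel :: 'a measure)) < \<infinity>" .
qed measurable

interpretation gauss: gibbs_weight "nsq :: 'a::euclidean_space \<Rightarrow> real"
proof
  show "Ck 1 (nsq :: 'a \<Rightarrow> real)" by (rule Ck_nsq)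
  show "integrable lborel (\<lambda>x::'a. exp (- nsq x))"
    using integrable_exp_norm_sq[of "1/2", where 'a='a] by (simp add: nsq_def)
qed

lemma integrable_gauss_quadratic_growth:
  fixes f :: "'a::euclidean_space \<Rightarrow> real"
  assumes f: "continuous_on UNIV f" "\<And>v. \<bar>f v\<bar> \<le> C * (1 + (norm v)\<^sup>2)"
  shows "integrable (gm nsq) f"
proof -
  have [measurable]: "f \<in> borel_measurable borel" using f(1) by (rule borel_measurable_continuous_onI)
  have C: "0 \<le> C" using f(2)[of 0] by simp
  have "integrable lborel (\<lambda>v::'a. exp (- nsq v) * f v)"
  proof (rule Bochner_Integration.integrable_bound)
    \<comment> \<open>Half of the Gaussian exponent pays for the growth: with x = |v|^2 / 4 one has
      1 + 4 x <= 5 exp x.\<close>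
    show "integrable lborel (\<lambda>v::'a. (5 * C) * exp (- (1/4) * (norm v)\<^sup>2))"
      by (intro integrable_mult_right integrable_exp_norm_sq) simp
    show "(\<lambda>v. exp (- nsq v) * f v) \<in> borel_measurable lborel" by measurable
    have "exp (- nsq v) * \<bar>f v\<bar> \<le> (5 * C) * exp (- (1/4) * (norm v)\<^sup>2)" for v
    proof -
      define x where "x = (norm v)\<^sup>2 / 4"
      have x: "0 \<le> x" by (simp add: x_def)
      have 1: "1 + x \<le> exp x" by (rule exp_ge_add_one_self)
      have "(norm v)\<^sup>2 = 4 * x" by (simp add: x_def)
      then have 2: "1 + (norm v)\<^sup>2 \<le> 5 * exp x" using 1 x by linarith
      have "exp (- nsq v) * \<bar>f v\<bar> \<le> exp (- nsq v) * (C * (1 + (norm v)\<^sup>2))" using f(2) by (intro mult_left_mono) auto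
      also have "\<dots> \<le> exp (- nsq v) * (C * (5 * exp x))" using 2 C by (intro mult_left_mono) auto
      also have "\<dots> = (5 * C) * (exp (- nsq v) * exp x)" by simp
      also have "exp (- nsq v) * exp x = exp (- (1/4) * (norm v)\<^sup>2)"
        by (simp add: exp_add[symmetric] nsq_def x_def)
      finally show ?thesis .
    qed
    then show "AE v in lborel. norm (exp (- nsq v) * f v) \<le> norm ((5 * C) * exp (- (1/4) * (norm v)\<^sup>2))"
      using C by (simp add: abs_mult)
  qed
  then show ?thesis by (simp add: gauss.integral_gm(2))
qed

lemma inner_growth: "\<bar>v \<bullet> a\<bar> \<le> norm a * (1 + (norm v)\<^sup>2)" "\<bar>(v \<bullet> a) * (v \<bullet> b)\<bar> \<le> (norm a * norm b) * (1 + (norm v)\<^sup>2)"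
proof -
  have n: "norm v \<le> 1 + (norm v)\<^sup>2"
    using sum_squares_bound[of "norm v" 1] by (simp add: power2_eq_square) (smt (verit) norm_ge_zero mult_nonneg_nonneg)
  have "\<bar>v \<bullet> a\<bar> \<le> norm v * norm a" by (rule Cauchy_Schwarz_ineq2)
  also have "\<dots> \<le> (1 + (norm v)\<^sup>2) * norm a" using n by (intro mult_right_mono) auto
  finally show "\<bar>v \<bullet> a\<bar> \<le> norm a * (1 + (norm v)\<^sup>2)" by (simp add: mult.commute)
  have "\<bar>(v \<bullet> a) * (v \<bullet> b)\<bar> \<le> (norm v * norm a) * (norm v * norm b)"
    unfolding abs_mult by (intro mult_mono Cauchy_Schwarz_ineq2) auto
  also have "\<dots> = (norm a * norm b) * (norm v)\<^sup>2" by (simp add: power2_eq_square)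
  also have "\<dots> \<le> (norm a * norm b) * (1 + (norm v)\<^sup>2)" by (intro mult_left_mono) auto
  finally show "\<bar>(v \<bullet> a) * (v \<bullet> b)\<bar> \<le> (norm a * norm b) * (1 + (norm v)\<^sup>2)" .
qed

lemma gauss_integrable_inner: "integrable (gm nsq) (\<lambda>v. v \<bullet> a)" "integrable (gm nsq) (\<lambda>v. (v \<bullet> a) * (v \<bullet> b))"
  by (rule integrable_gauss_quadratic_growth, (auto intro!: continuous_intros)[1], rule inner_growth)+

text \<open>Stein's identity: integration by parts with the constant 1, and in the next lemma with a
  coordinate, turns moments into integrals of derivatives.\<close>

lemma gauss_moment1: "i \<in> Basis \<Longrightarrow> (\<integral>v. v \<bullet> i \<partial>gm nsq) = 0"
  using gauss.integral_pd_weight[of "\<lambda>v. 1" i] gauss_integrable_inner(1)[of i]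
  by (simp add: pd_nsq)

lemma gauss_moment2: "i \<in> Basis \<Longrightarrow> j \<in> Basis \<Longrightarrow> (\<integral>v. (v \<bullet> i) * (v \<bullet> j) \<partial>gm nsq) = (if i = j then 1 else 0)"
  using gauss.integral_pd_weight[of "\<lambda>v. v \<bullet> j" i] gauss_integrable_inner(1)[of j] gauss_integrable_inner(2)[of j i]
  by (simp add: pd_nsq inner_Basis gauss.prob_space[simplified] mult.commute)

text \<open>The constant 1 and the coordinates are orthonormal under the Gaussian. Later the
  coefficients depend on the position, and the integral is over the velocity at a fixed
  position.\<close>

lemma gauss_affine_sq:
  fixes c :: "'a::euclidean_space \<Rightarrow> real"
  shows "integrable (gm nsq) (\<lambda>v. ((\<Sum>i\<in>Basis. c i * (v \<bullet> i)) + k)\<^sup>2)"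
    and "(\<integral>v. ((\<Sum>i\<in>Basis. c i * (v \<bullet> i)) + k)\<^sup>2 \<partial>gm nsq) = (\<Sum>i\<in>Basis. (c i)\<^sup>2) + k\<^sup>2"
proof -
  have eq: "((\<Sum>i\<in>Basis. c i * (v \<bullet> i)) + k)\<^sup>2
      = (\<Sum>i\<in>Basis. \<Sum>j\<in>Basis. (c i * c j) * ((v \<bullet> i) * (v \<bullet> j))) + (\<Sum>i\<in>Basis. (2 * k * c i) * (v \<bullet> i)) + k\<^sup>2" for v
    by (simp add: power2_sum sum_product power2_eq_square[of "sum _ _"] sum_distrib_left sum_distrib_right mult_ac)
  have I2: "integrable (gm nsq) (\<lambda>v::'a. \<Sum>i\<in>Basis. \<Sum>j\<in>Basis. (c i * c j) * ((v \<bullet> i) * (v \<bullet> j)))"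
    by (intro Bochner_Integration.integrable_sum integrable_mult_right gauss_integrable_inner)
  have I1: "integrable (gm nsq) (\<lambda>v::'a. \<Sum>i\<in>Basis. (2 * k * c i) * (v \<bullet> i))"
    by (intro Bochner_Integration.integrable_sum integrable_mult_right gauss_integrable_inner)
  show "integrable (gm nsq) (\<lambda>v. ((\<Sum>i\<in>Basis. c i * (v \<bullet> i)) + k)\<^sup>2)"
    unfolding eq using I1 I2 by simp
  have e2: "(\<integral>v. (\<Sum>i\<in>Basis. \<Sum>j\<in>Basis. (c i * c j) * ((v \<bullet> i) * (v \<bullet> j))) \<partial>gm (nsq :: 'a \<Rightarrow> real)) = (\<Sum>i\<in>Basis. (c i)\<^sup>2)"
  proof -
    have "(\<integral>v. (\<Sum>i\<in>Basis. \<Sum>j\<in>Basis. (c i * c j) * ((v \<bullet> i) * (v \<bullet> j))) \<partial>gm (nsq :: 'a \<Rightarrow> real))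
        = (\<Sum>i\<in>Basis. \<Sum>j\<in>(Basis::'a set). (c i * c j) * (if i = j then 1 else 0))"
      by (subst Bochner_Integration.integral_sum, (intro Bochner_Integration.integrable_sum integrable_mult_right gauss_integrable_inner),
          intro sum.cong refl, subst Bochner_Integration.integral_sum, (intro integrable_mult_right gauss_integrable_inner),
          intro sum.cong refl) (simp add: gauss_moment2)
    also have "\<dots> = (\<Sum>i\<in>Basis. (c i)\<^sup>2)" by (simp add: power2_eq_square if_distrib cong: if_cong)
    finally show ?thesis .
  qed
  have e1: "(\<integral>v. (\<Sum>i\<in>Basis. (2 * k * c i) * (v \<bullet> i)) \<partial>gm (nsq :: 'a \<Rightarrow> real)) = 0"
    by (subst Bochner_Integration.integral_sum, (intro integrable_mult_right gauss_integrable_inner))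
      (simp add: gauss_moment1)
  show "(\<integral>v. ((\<Sum>i\<in>Basis. c i * (v \<bullet> i)) + k)\<^sup>2 \<partial>gm nsq) = (\<Sum>i\<in>Basis. (c i)\<^sup>2) + k\<^sup>2"
    unfolding eq using I1 I2 by (simp add: e1 e2 gauss.prob_space[simplified])
qed

section \<open>Rotation invariance of pairs of independent Gaussians\<close>

lemma nn_integral_lborel_affine:
  fixes f :: "'a::euclidean_space \<Rightarrow> ennreal"
  assumes [measurable]: "f \<in> borel_measurable borel" and c: "c \<noteq> 0"
  shows "(\<integral>\<^sup>+x. f x \<partial>lborel) = ennreal (\<bar>c\<bar> ^ DIM('a)) * (\<integral>\<^sup>+x. f (t + c *\<^sub>R x) \<partial>lborel)"
proof -
  have "(\<integral>\<^sup>+x. f x \<partial>lborel) = (\<integral>\<^sup>+x. f x \<partial>density (distr lborel borel (\<lambda>x. t + c *\<^sub>R x)) (\<lambda>_. \<bar>c\<bar> ^ DIM('a)))"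
    using lborel_affine[OF c, of t] by simp
  also have "\<dots> = ennreal (\<bar>c\<bar> ^ DIM('a)) * (\<integral>\<^sup>+x. f (t + c *\<^sub>R x) \<partial>lborel)"
    by (subst nn_integral_density) (auto simp: nn_integral_distr nn_integral_cmult)
  finally show ?thesis .
qed

text \<open>The substitutions \<open>x = s a + c b\<close> for fixed \<open>b\<close> and then \<open>y = (c x - b) / s\<close> for fixed \<open>x\<close>
  turn the rotation into two affine changes of variables.\<close>

lemma nn_integral_lborel_rotation:
  fixes G :: "'a::euclidean_space \<Rightarrow> 'a \<Rightarrow> ennreal"
  assumes m[measurable]: "(\<lambda>(x, y). G x y) \<in> borel_measurable (borel \<Otimes>\<^sub>M borel)" and sc: "s\<^sup>2 + c\<^sup>2 = 1" "s \<noteq> 0"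
  shows "(\<integral>\<^sup>+b. \<integral>\<^sup>+a. G (s *\<^sub>R a + c *\<^sub>R b) (c *\<^sub>R a - s *\<^sub>R b) \<partial>lborel \<partial>lborel) = (\<integral>\<^sup>+x. \<integral>\<^sup>+y. G x y \<partial>lborel \<partial>lborel)"
proof -
  let ?k = "ennreal (\<bar>s\<bar> ^ DIM('a))"
  have s': "inverse s \<noteq> 0" "- s \<noteq> 0" using sc by auto
  \<comment> \<open>The Jacobians of the two substitutions are reciprocal powers of \<open>s\<close>
    and cancel.\<close>
  have k: "?k * ennreal (\<bar>inverse s\<bar> ^ DIM('a)) = 1"
    using sc by (simp add: ennreal_mult[symmetric] power_mult_distrib[symmetric] abs_mult[symmetric])
  have A: "(\<integral>\<^sup>+a. G (s *\<^sub>R a + c *\<^sub>R b) (c *\<^sub>R a - s *\<^sub>R b) \<partial>lborel)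
      = ennreal (\<bar>inverse s\<bar> ^ DIM('a)) * (\<integral>\<^sup>+x. G x (inverse s *\<^sub>R (c *\<^sub>R x - b)) \<partial>lborel)" for b
  proof -
    have e1: "s *\<^sub>R (- (c / s) *\<^sub>R b + inverse s *\<^sub>R x) + c *\<^sub>R b = x" for x
      using sc by (simp add: scaleR_right_distrib scaleR_right_diff_distrib)
    have e2: "c *\<^sub>R (- (c / s) *\<^sub>R b + inverse s *\<^sub>R x) - s *\<^sub>R b = inverse s *\<^sub>R (c *\<^sub>R x - b)" for x
    proof -
      have r: "c * (c / s) + s = inverse s" using sc by (simp add: field_simps power2_eq_square)
      have "c *\<^sub>R (- (c / s) *\<^sub>R b + inverse s *\<^sub>R x) - s *\<^sub>R b = (c * inverse s) *\<^sub>R x - (c * (c / s) + s) *\<^sub>R b"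
        by (simp add: scaleR_right_distrib scaleR_left_distrib scaleR_right_diff_distrib)
      also have "\<dots> = inverse s *\<^sub>R (c *\<^sub>R x - b)"
        unfolding r by (simp add: scaleR_right_diff_distrib mult.commute)
      finally show ?thesis .
    qed
    show ?thesis
      by (subst nn_integral_lborel_affine[OF _ s'(1), of _ "- (c / s) *\<^sub>R b"]) (measurable, simp only: e1 e2)
  qed
  have B: "(\<integral>\<^sup>+b. G x (inverse s *\<^sub>R (c *\<^sub>R x - b)) \<partial>lborel) = ?k * (\<integral>\<^sup>+y. G x y \<partial>lborel)" for x
  proof -
    have e: "inverse s *\<^sub>R (c *\<^sub>R x - (c *\<^sub>R x + (- s) *\<^sub>R y)) = y" for y using sc by simp
    show ?thesis
      by (subst nn_integral_lborel_affine[OF _ s'(2), of _ "c *\<^sub>R x"]) (measurable, simp only: e abs_minus_cancel)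
  qed
  have "(\<integral>\<^sup>+b. \<integral>\<^sup>+a. G (s *\<^sub>R a + c *\<^sub>R b) (c *\<^sub>R a - s *\<^sub>R b) \<partial>lborel \<partial>lborel)
      = ennreal (\<bar>inverse s\<bar> ^ DIM('a)) * (\<integral>\<^sup>+b. \<integral>\<^sup>+x. G x (inverse s *\<^sub>R (c *\<^sub>R x - b)) \<partial>lborel \<partial>lborel)"
    unfolding A by (rule nn_integral_cmult) measurable
  also have "(\<integral>\<^sup>+b. \<integral>\<^sup>+x. G x (inverse s *\<^sub>R (c *\<^sub>R x - b)) \<partial>lborel \<partial>lborel)
      = (\<integral>\<^sup>+x. \<integral>\<^sup>+b. G x (inverse s *\<^sub>R (c *\<^sub>R x - b)) \<partial>lborel \<partial>lborel)"
    by (rule lborel_pair.Fubini') measurable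
  also have "\<dots> = ?k * (\<integral>\<^sup>+x. \<integral>\<^sup>+y. G x y \<partial>lborel \<partial>lborel)"
    unfolding B by (rule nn_integral_cmult) measurable
  also have "ennreal (\<bar>inverse s\<bar> ^ DIM('a)) * \<dots> = (\<integral>\<^sup>+x. \<integral>\<^sup>+y. G x y \<partial>lborel \<partial>lborel)"
    using k by (simp add: mult.assoc[symmetric] mult.commute)
  finally show ?thesis .
qed

text \<open>The product density depends only on the sum of the two squared norms, which the rotation
  preserves, so invariance of Lebesgue measure carries over.\<close>

lemma nn_integral_gauss_rotation:
  fixes G :: "'a::euclidean_space \<Rightarrow> 'a \<Rightarrow> ennreal"
  assumes [measurable]: "(\<lambda>(x, y). G x y) \<in> borel_measurable (borel \<Otimes>\<^sub>M borel)" and sc: "s\<^sup>2 + c\<^sup>2 = 1" "s \<noteq> 0"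
  shows "(\<integral>\<^sup>+b. \<integral>\<^sup>+a. G (s *\<^sub>R a + c *\<^sub>R b) (c *\<^sub>R a - s *\<^sub>R b) \<partial>gm nsq \<partial>gm nsq) = (\<integral>\<^sup>+x. \<integral>\<^sup>+y. G x y \<partial>gm nsq \<partial>gm nsq)"
proof -
  define n :: "'a \<Rightarrow> ennreal" where "n v = ennreal (exp (- nsq v) / gauss.Z TYPE('a))" for v
  have nm[measurable]: "n \<in> borel_measurable borel" unfolding n_def by measurable
  have d: "gm nsq = density lborel n" unfolding gauss.gm_eq n_def ..
  have nn: "(\<integral>\<^sup>+x. f x \<partial>gm nsq) = (\<integral>\<^sup>+x. n x * f x \<partial>lborel)" if "f \<in> borel_measurable borel" for f
    unfolding d using that by (subst nn_integral_density) auto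
  have rot: "n a * n b = n (s *\<^sub>R a + c *\<^sub>R b) * n (c *\<^sub>R a - s *\<^sub>R b)" for a b
  proof -
    have "(s *\<^sub>R a + c *\<^sub>R b) \<bullet> (s *\<^sub>R a + c *\<^sub>R b) + (c *\<^sub>R a - s *\<^sub>R b) \<bullet> (c *\<^sub>R a - s *\<^sub>R b)
       = (s\<^sup>2 + c\<^sup>2) * (a \<bullet> a) + (s\<^sup>2 + c\<^sup>2) * (b \<bullet> b)"
      by (simp add: inner_add_left inner_add_right inner_diff_left inner_diff_right power2_eq_square inner_commute algebra_simps)
    then have "nsq (s *\<^sub>R a + c *\<^sub>R b) + nsq (c *\<^sub>R a - s *\<^sub>R b) = nsq a + nsq b"
      by (simp add: nsq_def power2_norm_eq_inner sc add_divide_distrib[symmetric])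
    then have "exp (- nsq a) * exp (- nsq b) = exp (- nsq (s *\<^sub>R a + c *\<^sub>R b)) * exp (- nsq (c *\<^sub>R a - s *\<^sub>R b))"
      by (simp add: exp_add[symmetric])
    then show ?thesis unfolding n_def using gauss.Z_pos[where 'a='a]
      by (simp add: ennreal_mult[symmetric])
  qed
  have "(\<integral>\<^sup>+b. \<integral>\<^sup>+a. G (s *\<^sub>R a + c *\<^sub>R b) (c *\<^sub>R a - s *\<^sub>R b) \<partial>gm nsq \<partial>gm nsq)
      = (\<integral>\<^sup>+b. n b * (\<integral>\<^sup>+a. n a * G (s *\<^sub>R a + c *\<^sub>R b) (c *\<^sub>R a - s *\<^sub>R b) \<partial>lborel) \<partial>lborel)"
    by (subst nn, measurable, subst nn, measurable)
  also have "\<dots> = (\<integral>\<^sup>+b. \<integral>\<^sup>+a. n (s *\<^sub>R a + c *\<^sub>R b) * n (c *\<^sub>R a - s *\<^sub>R b) * G (s *\<^sub>R a + c *\<^sub>R b) (c *\<^sub>R a - s *\<^sub>R b) \<partial>lborel \<partial>lborel)"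
  proof (rule nn_integral_cong)
    fix b :: 'a
    have eq: "n b * (n a * g) = n (s *\<^sub>R a + c *\<^sub>R b) * n (c *\<^sub>R a - s *\<^sub>R b) * g" for a g
      unfolding rot[symmetric] by (simp add: mult_ac)
    show "n b * (\<integral>\<^sup>+a. n a * G (s *\<^sub>R a + c *\<^sub>R b) (c *\<^sub>R a - s *\<^sub>R b) \<partial>lborel)
      = (\<integral>\<^sup>+a. n (s *\<^sub>R a + c *\<^sub>R b) * n (c *\<^sub>R a - s *\<^sub>R b) * G (s *\<^sub>R a + c *\<^sub>R b) (c *\<^sub>R a - s *\<^sub>R b) \<partial>lborel)"
      by (subst nn_integral_cmult[symmetric]) (measurable, simp only: eq)
  qed
  also have "\<dots> = (\<integral>\<^sup>+x. \<integral>\<^sup>+y. n x * n y * G x y \<partial>lborel \<partial>lborel)"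
    by (rule nn_integral_lborel_rotation[OF _ sc, of "\<lambda>x y. n x * n y * G x y"]) measurable
  also have "\<dots> = (\<integral>\<^sup>+x. n x * (\<integral>\<^sup>+y. n y * G x y \<partial>lborel) \<partial>lborel)"
    by (simp add: nn_integral_cmult[symmetric] mult_ac)
  also have "\<dots> = (\<integral>\<^sup>+x. \<integral>\<^sup>+y. G x y \<partial>gm nsq \<partial>gm nsq)"
    by (subst nn, measurable, subst nn, measurable)
  finally show ?thesis .
qed

lemma integral_sq_le_interval:
  fixes f :: "real \<Rightarrow> real"
  assumes f: "continuous_on {0..r} f" and r: "0 \<le> r"
  shows "(\<integral>t. f t * indicator {0..r} t \<partial>lborel)\<^sup>2 \<le> r * (\<integral>t. (f t)\<^sup>2 * indicator {0..r} t \<partial>lborel)"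
    and "integrable lborel (\<lambda>t. (f t)\<^sup>2 * indicator {0..r} t)"
proof -
  have i: "integrable lborel (\<lambda>t. g t * indicator {0..r} t)" if "continuous_on {0..r} g" for g :: "real \<Rightarrow> real"
    using borel_integrable_atLeastAtMost'[OF that] by (simp add: set_integrable_def mult.commute)
  have sq: "(f t * indicator {0..r} t)\<^sup>2 = (f t)\<^sup>2 * indicator {0..r} t" "(indicator {0..r} t)\<^sup>2 = (indicator {0..r} t :: real)" for t
    by (auto simp: indicator_def)
  show i2: "integrable lborel (\<lambda>t. (f t)\<^sup>2 * indicator {0..r} t)" by (intro i continuous_intros f)
  have a: "(\<lambda>t. f t * indicator {0..r} t) \<in> L2 lborel"
    unfolding L2_def using i[OF f] i2 by (auto simp: sq)
  have b: "(indicator {0..r} :: real \<Rightarrow> real) \<in> L2 lborel"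
    unfolding L2_def using i[of "\<lambda>t. 1"] by (auto simp: sq)
  have "(\<integral>t. f t * indicator {0..r} t \<partial>lborel) = ip lborel (\<lambda>t. f t * indicator {0..r} t) (indicator {0..r})"
    unfolding ip_def by (intro Bochner_Integration.integral_cong) (auto simp: indicator_def)
  then have "\<bar>\<integral>t. f t * indicator {0..r} t \<partial>lborel\<bar>\<^sup>2 \<le> (l2norm lborel (\<lambda>t. f t * indicator {0..r} t) * l2norm lborel (indicator {0..r} :: real \<Rightarrow> real))\<^sup>2"
    using ip_CS[OF a b] by (intro power_mono) auto
  also have "\<dots> = (\<integral>t. (f t)\<^sup>2 * indicator {0..r} t \<partial>lborel) * r"
    using r by (simp add: l2norm_def power_mult_distrib sq)
  finally show "(\<integral>t. f t * indicator {0..r} t \<partial>lborel)\<^sup>2 \<le> r * (\<integral>t. (f t)\<^sup>2 * indicator {0..r} t \<partial>lborel)"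
    by (simp add: mult.commute)
qed

text \<open>Pisier's argument: \<open>h a - h b\<close> is integrated along the rotation
  \<open>\<theta> \<mapsto> a sin \<theta> + b cos \<theta>\<close>, which preserves the joint law of two independent Gaussians
  together with its derivative in \<open>\<theta>\<close>. The constant \<open>\<pi>\<^sup>2 / 8 \<le> 2\<close> is not optimal.\<close>

lemma gauss_poincare:
  fixes h :: "'a::euclidean_space \<Rightarrow> real"
  assumes h: "h \<in> Cck 1"
  shows "(\<integral>v. (h v - integral\<^sup>L (gm nsq) h)\<^sup>2 \<partial>gm nsq) \<le> 2 * (\<integral>v. (\<Sum>i\<in>Basis. (pd h i v)\<^sup>2) \<partial>gm nsq)"
proof -
  let ?N = "gm (nsq :: 'a \<Rightarrow> real)"
  interpret NB: pair_sigma_finite ?N "lborel :: real measure" by standard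
  have dh: "h differentiable at x" for x using h by (auto simp: Cck_def intro: Ck_differentiable)
  have hc: "continuous_on UNIV h" using h by (rule Cck_continuous)
  have pc: "continuous_on UNIV (pd h i)" if "i \<in> Basis" for i
    using Cck_pd'[OF h, of 0 i] that by (auto intro: Cck_continuous)
  have [measurable]: "h \<in> borel_measurable borel" using h by (rule Cck_measurable)
  have pm[measurable]: "pd h i \<in> borel_measurable borel" if "i \<in> Basis" for i
    using pc[OF that] by (rule borel_measurable_continuous_onI)
  define D where "D x y = (\<Sum>i\<in>Basis. (y \<bullet> i) * pd h i x)" for x y
  have Dm[measurable]: "(\<lambda>p. D (fst p) (snd p)) \<in> borel_measurable (borel \<Otimes>\<^sub>M borel)"
    unfolding D_def by measurable
  have Dpd: "pd h y x = D x y" for x y unfolding D_def by (rule pd_expand[OF dh])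
  define Q where "Q = (\<integral>v. (\<Sum>i\<in>Basis. (pd h i v)\<^sup>2) \<partial>?N)"
  have iQ: "integrable ?N (\<lambda>v. \<Sum>i\<in>Basis. (pd h i v)\<^sup>2)"
    unfolding power2_eq_square
    by (intro gauss.integrable_Cck[of _ 0] Cck_sum Cck_mult1 Cck_pd'[OF h] CckD(1)[OF Cck_pd'[OF h]]) auto
  have Q0: "0 \<le> Q" unfolding Q_def by (intro integral_nonneg_AE AE_I2 sum_nonneg) auto
  \<comment> \<open>For a standard Gaussian direction \<open>y\<close>, the mean square of the
    derivative of \<open>h\<close> along \<open>y\<close> is the squared gradient.\<close>
  have DQ: "(\<integral>\<^sup>+x. \<integral>\<^sup>+y. ennreal ((D x y)\<^sup>2) \<partial>?N \<partial>?N) = ennreal Q"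
  proof -
    have "(\<integral>\<^sup>+y. ennreal ((D x y)\<^sup>2) \<partial>?N) = ennreal (\<Sum>i\<in>Basis. (pd h i x)\<^sup>2)" for x
      using gauss_affine_sq[of "\<lambda>i. pd h i x" 0]
      by (subst nn_integral_eq_integral) (simp_all add: D_def mult.commute)
    then have "(\<integral>\<^sup>+x. \<integral>\<^sup>+y. ennreal ((D x y)\<^sup>2) \<partial>?N \<partial>?N) = (\<integral>\<^sup>+x. ennreal (\<Sum>i\<in>Basis. (pd h i x)\<^sup>2) \<partial>?N)"
      by simp
    also have "\<dots> = ennreal Q" unfolding Q_def using iQ by (intro nn_integral_eq_integral AE_I2 sum_nonneg) auto
    finally show ?thesis .
  qed
  define X where "X \<theta> a b = sin \<theta> *\<^sub>R a + cos \<theta> *\<^sub>R b" for \<theta> :: real and a b :: 'a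
  define Y where "Y \<theta> a b = cos \<theta> *\<^sub>R a - sin \<theta> *\<^sub>R b" for \<theta> :: real and a b :: 'a
  let ?r = "pi / 2"
  have path: "ennreal ((h a - h b)\<^sup>2) \<le> ennreal ?r * (\<integral>\<^sup>+\<theta>. ennreal ((D (X \<theta> a b) (Y \<theta> a b))\<^sup>2) * indicator {0..?r} \<theta> \<partial>lborel)" for a b
  proof -
    have Xd: "((\<lambda>\<theta>. X \<theta> a b) has_derivative (\<lambda>s. s *\<^sub>R Y \<theta> a b)) (at \<theta>)" for \<theta>
      unfolding X_def Y_def by (auto intro!: derivative_eq_intros simp: scaleR_right_diff_distrib mult.commute)
    have der: "((\<lambda>\<theta>. h (X \<theta> a b)) has_real_derivative D (X \<theta> a b) (Y \<theta> a b)) (at \<theta>)" for \<theta>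
    proof -
      have "((\<lambda>\<theta>. h (X \<theta> a b)) has_derivative (\<lambda>s. pd h (s *\<^sub>R Y \<theta> a b) (X \<theta> a b))) (at \<theta>)"
        by (rule has_derivative_compose[OF Xd differentiable_has_derivative[OF dh]])
      moreover have "(\<lambda>s. pd h (s *\<^sub>R Y \<theta> a b) (X \<theta> a b)) = (*) (D (X \<theta> a b) (Y \<theta> a b))"
        unfolding Dpd by (simp add: D_def fun_eq_iff sum_distrib_left sum_distrib_right mult_ac)
      ultimately show ?thesis by (simp add: has_field_derivative_def)
    qed
    have Xc: "continuous_on UNIV (\<lambda>\<theta>. X \<theta> a b)" "continuous_on UNIV (\<lambda>\<theta>. Y \<theta> a b)"
      unfolding X_def Y_def by (intro continuous_intros)+
    have Dc: "continuous_on UNIV (\<lambda>\<theta>. D (X \<theta> a b) (Y \<theta> a b))"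
      unfolding D_def by (intro continuous_on_sum continuous_on_mult continuous_on_inner Xc continuous_on_const continuous_on_compose2[OF pc Xc(1)]) auto
    have "(\<integral>\<theta>. D (X \<theta> a b) (Y \<theta> a b) * indicator {0..?r} \<theta> \<partial>lborel) = h (X ?r a b) - h (X 0 a b)"
      by (rule integral_FTC_Icc_real) (use der Dc in \<open>auto simp: continuous_on_eq_continuous_at\<close>)
    then have e: "h a - h b = (\<integral>\<theta>. D (X \<theta> a b) (Y \<theta> a b) * indicator {0..?r} \<theta> \<partial>lborel)" by (simp add: X_def)
    note I = integral_sq_le_interval[OF continuous_on_subset[OF Dc subset_UNIV], of ?r]
    have "ennreal ((h a - h b)\<^sup>2) \<le> ennreal (?r * (\<integral>\<theta>. (D (X \<theta> a b) (Y \<theta> a b))\<^sup>2 * indicator {0..?r} \<theta> \<partial>lborel))"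
      unfolding e using I(1) by (intro ennreal_leI) simp
    also have "\<dots> = ennreal ?r * ennreal (\<integral>\<theta>. (D (X \<theta> a b) (Y \<theta> a b))\<^sup>2 * indicator {0..?r} \<theta> \<partial>lborel)"
      by (rule ennreal_mult) (auto intro!: integral_nonneg_AE)
    also have "ennreal (\<integral>\<theta>. (D (X \<theta> a b) (Y \<theta> a b))\<^sup>2 * indicator {0..?r} \<theta> \<partial>lborel)
      = (\<integral>\<^sup>+\<theta>. ennreal ((D (X \<theta> a b) (Y \<theta> a b))\<^sup>2 * indicator {0..?r} \<theta>) \<partial>lborel)"
      using I(2) by (intro nn_integral_eq_integral[symmetric]) auto
    also have "\<dots> = (\<integral>\<^sup>+\<theta>. ennreal ((D (X \<theta> a b) (Y \<theta> a b))\<^sup>2) * indicator {0..?r} \<theta> \<partial>lborel)"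
      by (intro nn_integral_cong) (auto simp: indicator_def)
    finally show ?thesis .
  qed
  have DXYm[measurable]: "(\<lambda>p. D (X (f p) (g p) (k p)) (Y (f p) (g p) (k p))) \<in> borel_measurable M"
    if [measurable]: "f \<in> borel_measurable M" "g \<in> borel_measurable M" "k \<in> borel_measurable M" for M :: "'c measure" and f g k
    unfolding D_def X_def Y_def by measurable
  have rot: "(\<integral>\<^sup>+b. \<integral>\<^sup>+a. ennreal ((D (X \<theta> a b) (Y \<theta> a b))\<^sup>2) \<partial>?N \<partial>?N) = ennreal Q" if "sin \<theta> \<noteq> 0" for \<theta>
  proof -
    have "(\<integral>\<^sup>+b. \<integral>\<^sup>+a. ennreal ((D (X \<theta> a b) (Y \<theta> a b))\<^sup>2) \<partial>?N \<partial>?N) = (\<integral>\<^sup>+x. \<integral>\<^sup>+y. ennreal ((D x y)\<^sup>2) \<partial>?N \<partial>?N)"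
      unfolding X_def Y_def
      by (rule nn_integral_gauss_rotation[of "\<lambda>x y. ennreal ((D x y)\<^sup>2)" "sin \<theta>" "cos \<theta>"])
        (use that in \<open>auto simp: case_prod_beta\<close>)
    then show ?thesis by (simp add: DQ)
  qed
  have "(\<integral>\<^sup>+b. \<integral>\<^sup>+a. ennreal ((h a - h b)\<^sup>2) \<partial>?N \<partial>?N)
      \<le> (\<integral>\<^sup>+b. \<integral>\<^sup>+a. ennreal ?r * (\<integral>\<^sup>+\<theta>. ennreal ((D (X \<theta> a b) (Y \<theta> a b))\<^sup>2) * indicator {0..?r} \<theta> \<partial>lborel) \<partial>?N \<partial>?N)"
    by (intro nn_integral_mono path)
  also have "\<dots> = ennreal ?r * (\<integral>\<^sup>+b. \<integral>\<^sup>+a. \<integral>\<^sup>+\<theta>. ennreal ((D (X \<theta> a b) (Y \<theta> a b))\<^sup>2) * indicator {0..?r} \<theta> \<partial>lborel \<partial>?N \<partial>?N)"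
    by (subst nn_integral_cmult, measurable, subst nn_integral_cmult, measurable)
  also have "(\<integral>\<^sup>+b. \<integral>\<^sup>+a. \<integral>\<^sup>+\<theta>. ennreal ((D (X \<theta> a b) (Y \<theta> a b))\<^sup>2) * indicator {0..?r} \<theta> \<partial>lborel \<partial>?N \<partial>?N)
      = (\<integral>\<^sup>+b. \<integral>\<^sup>+\<theta>. \<integral>\<^sup>+a. ennreal ((D (X \<theta> a b) (Y \<theta> a b))\<^sup>2) * indicator {0..?r} \<theta> \<partial>?N \<partial>lborel \<partial>?N)"
    by (intro nn_integral_cong NB.Fubini'[symmetric]) measurable
  also have "\<dots> = (\<integral>\<^sup>+\<theta>. \<integral>\<^sup>+b. \<integral>\<^sup>+a. ennreal ((D (X \<theta> a b) (Y \<theta> a b))\<^sup>2) * indicator {0..?r} \<theta> \<partial>?N \<partial>?N \<partial>lborel)"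
    by (intro NB.Fubini'[symmetric]) measurable
  also have "\<dots> = (\<integral>\<^sup>+\<theta>. ennreal Q * indicator {0..?r} \<theta> \<partial>lborel)"
  \<comment> \<open>The substitution behind the rotation divides by the sine, which vanishes on the
    interval only at the endpoint 0.\<close>
  proof (rule nn_integral_cong_AE, use AE_lborel_singleton[of 0] in eventually_elim)
    fix \<theta> :: real assume "\<theta> \<noteq> 0"
    show "(\<integral>\<^sup>+b. \<integral>\<^sup>+a. ennreal ((D (X \<theta> a b) (Y \<theta> a b))\<^sup>2) * indicator {0..?r} \<theta> \<partial>?N \<partial>?N) = ennreal Q * indicator {0..?r} \<theta>"
    proof (cases "\<theta> \<in> {0..?r}")
      case True
      then have "0 < sin \<theta>" using \<open>\<theta> \<noteq> 0\<close> pi_gt_zero by (intro sin_gt_zero) auto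
      then show ?thesis using rot[of \<theta>] True by simp
    qed simp
  qed
  also have "\<dots> = ennreal Q * ennreal ?r" by (simp add: nn_integral_cmult_indicator)
  also have "ennreal ?r * (ennreal Q * ennreal ?r) = ennreal (?r * (Q * ?r))"
    using Q0 by (subst ennreal_mult[symmetric], simp, simp, subst ennreal_mult[symmetric]) auto
  finally have le: "(\<integral>\<^sup>+b. \<integral>\<^sup>+a. ennreal ((h a - h b)\<^sup>2) \<partial>?N \<partial>?N) \<le> ennreal (?r * (Q * ?r))" .
  define \<mu> where "\<mu> = integral\<^sup>L ?N h"
  have ih: "integrable ?N h" using h by (rule gauss.integrable_Cck)
  have ihh: "integrable ?N (\<lambda>v. (h v)\<^sup>2)" using gauss.L2_Cck[OF h] by (rule L2_integrable_sq)
  have inner: "(\<integral>\<^sup>+a. ennreal ((h a - h b)\<^sup>2) \<partial>?N) = ennreal ((\<integral>v. (h v)\<^sup>2 \<partial>?N) - 2 * \<mu> * h b + (h b)\<^sup>2)" for b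
  proof -
    have "integrable ?N (\<lambda>a. (h a - h b)\<^sup>2)" by (rule L2_integrable_sq[OF L2_diff[OF gauss.L2_Cck[OF h] gauss.L2_const]])
    moreover have "(\<integral>a. (h a - h b)\<^sup>2 \<partial>?N) = (\<integral>v. (h v)\<^sup>2 \<partial>?N) - 2 * \<mu> * h b + (h b)\<^sup>2"
      using ih ihh by (simp add: power2_diff gauss.prob_space[simplified] \<mu>_def)
    ultimately show ?thesis by (simp add: nn_integral_eq_integral)
  qed
  have var: "(\<integral>v. (h v - \<mu>)\<^sup>2 \<partial>?N) = (\<integral>v. (h v)\<^sup>2 \<partial>?N) - \<mu>\<^sup>2"
  proof -
    have "(\<integral>v. (h v - k)\<^sup>2 \<partial>?N) = (\<integral>v. (h v)\<^sup>2 \<partial>?N) - 2 * \<mu> * k + k\<^sup>2" for k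
      using ih ihh by (simp add: power2_diff gauss.prob_space[simplified] \<mu>_def)
    from this[of \<mu>] show ?thesis by (simp add: power2_eq_square)
  qed
  have nonneg: "0 \<le> (\<integral>v. (h v)\<^sup>2 \<partial>?N) - 2 * \<mu> * h b + (h b)\<^sup>2" for b
  proof -
    have "0 \<le> (\<integral>v. (h v - \<mu>)\<^sup>2 \<partial>?N) + (h b - \<mu>)\<^sup>2" by (intro add_nonneg_nonneg integral_nonneg_AE) auto
    then show ?thesis unfolding var by (simp add: power2_diff algebra_simps)
  qed
  \<comment> \<open>For two independent copies the mean square of the difference is twice the
    variance, which gains the factor 2 on the left.\<close>
  have "(\<integral>\<^sup>+b. \<integral>\<^sup>+a. ennreal ((h a - h b)\<^sup>2) \<partial>?N \<partial>?N) = ennreal (2 * ((\<integral>v. (h v)\<^sup>2 \<partial>?N) - \<mu>\<^sup>2))"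
    unfolding inner using ih ihh nonneg
    by (subst nn_integral_eq_integral) (auto simp: gauss.prob_space[simplified] \<mu>_def[symmetric] power2_eq_square mult.assoc)
  with le have "2 * (\<integral>v. (h v - \<mu>)\<^sup>2 \<partial>?N) \<le> ?r * (Q * ?r)"
    using Q0 by (simp add: var ennreal_le_iff)
  also have "\<dots> \<le> 2 * (Q * 2)" using Q0 pi_less_4 by (intro mult_mono) auto
  finally show ?thesis by (simp add: Q_def \<mu>_def)
qed

lemma Basis_prod_mem: "i \<in> Basis \<Longrightarrow> (i, 0) \<in> Basis" "i \<in> Basis \<Longrightarrow> (0, i) \<in> Basis"
  by (auto simp: Basis_prod_def)

text \<open>Coercivity enters as the lower bound \<open>- b\<close>. Friction is recorded by its
  square and its sign, the form in which the constants are computed.\<close>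

locale langevin =
  fixes U :: "'a::euclidean_space \<Rightarrow> real" and m K \<gamma> b :: real
  assumes U_C2: "Ck 2 U" and U_int: "integrable lborel (\<lambda>x. exp (- U x))"
    and m_pos: "0 < m" and K_nonneg: "0 \<le> K" and \<gamma>_sq: "\<gamma>\<^sup>2 = 16 * m + 2 * K" and \<gamma>_pos: "0 < \<gamma>"
    and hess: "\<And>x w. pd (pd U w) w x \<ge> - K * (norm w)\<^sup>2"
    and U_lower: "\<And>x. - b \<le> U x"
    and poincare: "\<And>g. g \<in> L2 (gm U) \<Longrightarrow> integral\<^sup>L (gm U) g = 0 \<Longrightarrow> Ck 1 g \<Longrightarrow>
        integrable (gm U) (\<lambda>x. \<Sum>i\<in>Basis. (pd g i x)\<^sup>2) \<Longrightarrow>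
        (\<integral>x. (g x)\<^sup>2 \<partial>gm U) \<le> (1 / m) * (\<integral>x. (\<Sum>i\<in>Basis. (pd g i x)\<^sup>2) \<partial>gm U)"
begin

section \<open>The underdamped generator\<close>

definition UU :: "'a \<times> 'a \<Rightarrow> real" where
  "UU z = U (fst z) + nsq (snd z)"

lemma U_C1: "Ck 1 U"
  using U_C2 by (rule Ck_mono) simp

sublocale X: gibbs_weight U
  by standard (rule U_C1 U_int)+

lemma exp_UU: "exp (- UU z) = exp (- U (fst z)) * exp (- nsq (snd z))"
  by (simp add: UU_def exp_add[symmetric])

lemma UU_int: "integrable lborel (\<lambda>z. exp (- UU z))"
  and UU_Z: "(\<integral>z. exp (- UU z) \<partial>lborel) = X.Z * gauss.Z TYPE('a)"
proof -
  have i: "integrable (lborel \<Otimes>\<^sub>M lborel) (\<lambda>(x, v). exp (- U x) * exp (- nsq (v :: 'a)))"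
  proof (rule lborel_pair.Fubini_integrable)
    show "(\<lambda>(x, v). exp (- U x) * exp (- nsq (v :: 'a))) \<in> borel_measurable (lborel \<Otimes>\<^sub>M lborel)"
      unfolding case_prod_beta by measurable
    show "integrable lborel (\<lambda>x. \<integral>v. norm (case (x, v) of (x, v) \<Rightarrow> exp (- U x) * exp (- nsq (v :: 'a))) \<partial>lborel)"
      using U_int by (simp add: abs_mult)
    show "AE x in lborel. integrable lborel (\<lambda>v. case (x, v) of (x, v) \<Rightarrow> exp (- U x) * exp (- nsq (v :: 'a)))"
      using gauss.V_int[where 'a='a] by simp
  qed
  then show "integrable lborel (\<lambda>z. exp (- UU z))"
    using i by (simp add: case_prod_unfold exp_UU lborel_prod)
  from lborel_pair.integral_fst'[OF i]
  show "(\<integral>z. exp (- UU z) \<partial>lborel) = X.Z * gauss.Z TYPE('a)"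
    unfolding lborel_prod by (simp add: case_prod_unfold exp_UU X.Z_def gauss.Z_def)
qed

lemma UU_C2: "Ck 2 UU"
  unfolding UU_def by (intro Ck_add Ck_fst Ck_snd U_C2 Ck_nsq)

lemma UU_C1: "Ck 1 UU"
  using UU_C2 by (rule Ck_mono) simp

sublocale M: gibbs_weight UU
  by standard (rule UU_C1 UU_int)+

abbreviation "\<mu> \<equiv> gm UU"
abbreviation "\<mu>x \<equiv> gm U"
abbreviation "\<nu> \<equiv> gm (nsq :: 'a \<Rightarrow> real)"

lemma \<mu>_product: "\<mu> = \<mu>x \<Otimes>\<^sub>M \<nu>"
proof -
  have "\<mu>x \<Otimes>\<^sub>M \<nu> = density (lborel \<Otimes>\<^sub>M lborel) (\<lambda>(x, v). ennreal (exp (- U x) / X.Z) * ennreal (exp (- nsq v) / gauss.Z TYPE('a)))"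
    unfolding X.gm_eq gauss.gm_eq
  proof (rule pair_measure_density)
    show "sigma_finite_measure (density lborel (\<lambda>z::'a. ennreal (exp (- nsq z) / gauss.Z TYPE('a))))"
      using gauss.sigma_finite_measure_axioms[where 'a='a] unfolding gauss.gm_eq .
  qed (auto intro: sigma_finite_lborel)
  also have "\<dots> = \<mu>"
    unfolding lborel_prod M.gm_eq M.Z_def UU_Z
    using X.Z_pos gauss.Z_pos[where 'a='a]
    by (intro arg_cong[where f="density lborel"])
      (auto simp: fun_eq_iff exp_UU ennreal_mult[symmetric] less_imp_le)
  finally show ?thesis by simp
qed

sublocale XN: pair_sigma_finite \<mu>x \<nu> ..

lemma integral_\<mu>: "integrable \<mu> f \<Longrightarrow> integral\<^sup>L \<mu> f = (\<integral>x. (\<integral>v. f (x, v) \<partial>\<nu>) \<partial>\<mu>x)"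
  for f :: "'a \<times> 'a \<Rightarrow> real"
  unfolding \<mu>_product by (rule XN.integral_fst'[symmetric])

lemma distr_fst: "distr \<mu> \<mu>x fst = \<mu>x"
  unfolding \<mu>_product by (rule gauss.distr_pair_fst)

lemma fst_measurable [measurable]: "fst \<in> \<mu> \<rightarrow>\<^sub>M \<mu>x"
  unfolding \<mu>_product by simp

lemma integral_fst:
  fixes g :: "'a \<Rightarrow> real"
  assumes "g \<in> borel_measurable borel"
  shows "(\<integral>z. g (fst z) \<partial>\<mu>) = (\<integral>x. g x \<partial>\<mu>x)" and "integrable \<mu> (\<lambda>z. g (fst z)) \<longleftrightarrow> integrable \<mu>x g"
proof -
  have g: "g \<in> borel_measurable \<mu>x" using assms by (simp add: measurable_cong_sets[OF sets_gm refl])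
  show "(\<integral>z. g (fst z) \<partial>\<mu>) = (\<integral>x. g x \<partial>\<mu>x)"
    using integral_distr[OF fst_measurable g] unfolding distr_fst by simp
  show "integrable \<mu> (\<lambda>z. g (fst z)) \<longleftrightarrow> integrable \<mu>x g"
    using integrable_distr_eq[OF fst_measurable g] unfolding distr_fst by simp
qed

lemma L2x_measurable: "g \<in> L2 \<mu>x \<Longrightarrow> g \<in> borel_measurable borel"
  by (simp add: L2_def measurable_cong_sets[OF sets_gm refl])

lemma L2\<mu>_measurable: "f \<in> L2 \<mu> \<Longrightarrow> f \<in> borel_measurable borel"
  by (simp add: L2_def measurable_cong_sets[OF sets_gm refl])

lemma L2_fst:
  assumes "g \<in> L2 \<mu>x" shows "(\<lambda>z. g (fst z)) \<in> L2 \<mu>"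
proof -
  have [measurable]: "g \<in> borel_measurable borel" by (rule L2x_measurable[OF assms])
  have "integrable \<mu> (\<lambda>z. (g (fst z))\<^sup>2)"
    using integral_fst(2)[of "\<lambda>x. (g x)\<^sup>2"] L2_integrable_sq[OF assms] by simp
  then show ?thesis
    using measurable_compose[OF fst_measurable L2_measurable[OF assms]] by (simp add: L2_def)
qed

lemma ip_fst:
  assumes "g \<in> borel_measurable borel" "h \<in> borel_measurable borel"
  shows "ip \<mu> (\<lambda>z. g (fst z)) (\<lambda>z. h (fst z)) = ip \<mu>x g h"
  unfolding ip_def using assms by (intro integral_fst(1)[of "\<lambda>x. g x * h x"] borel_measurable_times)

text \<open>The conditional expectation given the position, that is the orthogonal projection onto
  functions of the position.\<close>

definition marg :: "('a \<times> 'a \<Rightarrow> real) \<Rightarrow> 'a \<Rightarrow> real" where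
  "marg f x = (\<integral>v. f (x, v) \<partial>\<nu>)"

lemma marg_L2:
  assumes f: "f \<in> L2 \<mu>"
  shows "marg f \<in> L2 \<mu>x"
proof -
  have [measurable]: "f \<in> borel_measurable (\<mu>x \<Otimes>\<^sub>M \<nu>)" using f unfolding \<mu>_product[symmetric] by (rule L2_measurable)
  have i2: "integrable (\<mu>x \<Otimes>\<^sub>M \<nu>) (\<lambda>z. (f z)\<^sup>2)" using L2_integrable_sq[OF f] unfolding \<mu>_product .
  have [measurable]: "marg f \<in> borel_measurable \<mu>x" unfolding marg_def by measurable
  have "AE x in \<mu>x. (marg f x)\<^sup>2 \<le> (\<integral>v. (f (x, v))\<^sup>2 \<partial>\<nu>)"
    using XN.AE_integrable_fst'[OF i2]
  proof (eventually_elim)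
    fix x assume i: "integrable \<nu> (\<lambda>v. (f (x, v))\<^sup>2)"
    have "(\<lambda>v. f (x, v)) \<in> borel_measurable \<nu>" by measurable
    with i have L: "(\<lambda>v. f (x, v)) \<in> L2 \<nu>" by (simp add: L2_def)
    have "\<bar>marg f x\<bar>\<^sup>2 \<le> (l2norm \<nu> (\<lambda>v. f (x, v)) * l2norm \<nu> (\<lambda>v. 1))\<^sup>2"
      using ip_CS[OF L gauss.L2_const[of 1]] by (intro power_mono) (auto simp: ip_def marg_def)
    also have "l2norm \<nu> (\<lambda>v. 1) = 1" using gauss.l2norm_const[of 1, where 'a='a] by simp
    finally show "(marg f x)\<^sup>2 \<le> (\<integral>v. (f (x, v))\<^sup>2 \<partial>\<nu>)"
      by (simp add: l2norm_def)
  qed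
  then have "integrable \<mu>x (\<lambda>x. (marg f x)\<^sup>2)"
    by (intro Bochner_Integration.integrable_bound[OF XN.integrable_fst'[OF i2]]) (auto elim: eventually_mono)
  then show ?thesis by (simp add: L2_def)
qed

lemma ip_marg:
  assumes f: "f \<in> L2 \<mu>" and g: "g \<in> L2 \<mu>x"
  shows "ip \<mu> f (\<lambda>z. g (fst z)) = ip \<mu>x (marg f) g"
  unfolding ip_def
  by (subst integral_\<mu>[OF L2_integrable_mult[OF f L2_fst[OF g]]]) (simp add: marg_def)

text \<open>Such functions are unbounded in the velocity, so square integrability needs the Gaussian
  moments. \<open>T \<phi>\<close> and the second-order terms of \<open>ip_L_T\<close> have this
  form.\<close>

lemma affine_v_L2:
  assumes c: "\<And>i. i \<in> Basis \<Longrightarrow> c i \<in> Cck 0" and k: "k \<in> Cck 0"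
  shows "(\<lambda>z. (\<Sum>i\<in>Basis. c i (fst z) * (snd z \<bullet> i)) + k (fst z)) \<in> L2 \<mu>"
    and "ip \<mu> (\<lambda>z. (\<Sum>i\<in>Basis. c i (fst z) * (snd z \<bullet> i)) + k (fst z)) (\<lambda>z. (\<Sum>i\<in>Basis. c i (fst z) * (snd z \<bullet> i)) + k (fst z))
      = (\<Sum>i\<in>Basis. ip \<mu>x (c i) (c i)) + ip \<mu>x k k"
proof -
  define A where "A = (\<lambda>z::'a\<times>'a. (\<Sum>i\<in>Basis. c i (fst z) * (snd z \<bullet> i)) + k (fst z))"
  have cc: "continuous_on UNIV (c i)" if "i \<in> Basis" for i using c[OF that] by (rule Cck_continuous)
  have "continuous_on UNIV A"
    unfolding A_def by (intro continuous_intros continuous_on_compose2[OF cc] continuous_on_compose2[OF Cck_continuous[OF k]]) auto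
  then have [measurable]: "A \<in> borel_measurable borel" by (rule borel_measurable_continuous_onI)
  have AM[measurable]: "A \<in> borel_measurable \<mu>" by (simp add: measurable_cong_sets[OF sets_gm refl])
  have [measurable]: "A \<in> borel_measurable (\<mu>x \<Otimes>\<^sub>M \<nu>)" using AM unfolding \<mu>_product .
  have sq: "(\<integral>v. (A (x, v))\<^sup>2 \<partial>\<nu>) = (\<Sum>i\<in>Basis. (c i x)\<^sup>2) + (k x)\<^sup>2" for x
    using gauss_affine_sq(2)[of "\<lambda>i. c i x" "k x"] by (simp add: A_def)
  have i: "integrable \<mu>x (\<lambda>x. (c i x)\<^sup>2)" if "i \<in> Basis" for i using X.L2_Cck[OF c[OF that]] by (rule L2_integrable_sq)
  have ik: "integrable \<mu>x (\<lambda>x. (k x)\<^sup>2)" using X.L2_Cck[OF k] by (rule L2_integrable_sq)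
  have "integrable (\<mu>x \<Otimes>\<^sub>M \<nu>) (\<lambda>z. (A z)\<^sup>2)"
  proof (rule XN.Fubini_integrable)
    show "integrable \<mu>x (\<lambda>x. \<integral>v. norm ((A (x, v))\<^sup>2) \<partial>\<nu>)"
      using i ik by (simp add: sq)
    show "AE x in \<mu>x. integrable \<nu> (\<lambda>v. (A (x, v))\<^sup>2)"
      using gauss_affine_sq(1)[of "\<lambda>i. c i x" "k x" for x] by (simp add: A_def)
  qed measurable
  then have iA: "integrable \<mu> (\<lambda>z. (A z)\<^sup>2)" unfolding \<mu>_product .
  then show "(\<lambda>z. (\<Sum>i\<in>Basis. c i (fst z) * (snd z \<bullet> i)) + k (fst z)) \<in> L2 \<mu>"
    unfolding A_def[symmetric] by (simp add: L2_def)
  have "ip \<mu> A A = (\<integral>x. (\<Sum>i\<in>Basis. (c i x)\<^sup>2) + (k x)\<^sup>2 \<partial>\<mu>x)"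
    unfolding ip_def power2_eq_square[symmetric] by (simp add: integral_\<mu>[OF iA] sq)
  also have "\<dots> = (\<Sum>i\<in>Basis. ip \<mu>x (c i) (c i)) + ip \<mu>x k k"
    using i ik by (simp add: ip_def power2_eq_square)
  finally show "ip \<mu> (\<lambda>z. (\<Sum>i\<in>Basis. c i (fst z) * (snd z \<bullet> i)) + k (fst z)) (\<lambda>z. (\<Sum>i\<in>Basis. c i (fst z) * (snd z \<bullet> i)) + k (fst z))
      = (\<Sum>i\<in>Basis. ip \<mu>x (c i) (c i)) + ip \<mu>x k k"
    unfolding A_def .
qed

definition Dv :: "('a \<times> 'a \<Rightarrow> real) \<Rightarrow> real" where
  "Dv f = (\<Sum>i\<in>Basis. ip \<mu> (pd f (0, i)) (pd f (0, i)))"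

lemma Dv_nonneg: "0 \<le> Dv f"
  unfolding Dv_def by (intro sum_nonneg ip_self_nonneg)

text \<open>The Gaussian inequality is applied on the fibre over each fixed position, where
  \<open>marg f\<close> is the mean, and then integrated over positions.\<close>

lemma velocity_poincare:
  assumes f: "f \<in> Cck 1"
  shows "ip \<mu> (\<lambda>z. f z - marg f (fst z)) (\<lambda>z. f z - marg f (fst z)) \<le> 2 * Dv f"
proof -
  have fL: "f \<in> L2 \<mu>" using f by (rule M.L2_Cck)
  have qL: "(\<lambda>z. f z - marg f (fst z)) \<in> L2 \<mu>" by (intro L2_diff fL L2_fst marg_L2)
  have d: "f differentiable at z" for z using f by (auto simp: Cck_def intro: Ck_differentiable)
  have lin: "bounded_linear (\<lambda>v::'a. (0::'a, v))" by (intro bounded_linear_Pair bounded_linear_zero bounded_linear_ident)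
  have sec: "(\<lambda>v. f (x, v)) \<in> Cck 1" for x
  proof -
    have "Ck 1 (\<lambda>v. f (x, v))" using Ck_chain_lin[OF lin CckD(1)[OF f], of "(x, 0)"] by simp
    moreover obtain R where R: "\<And>z. f z \<noteq> 0 \<Longrightarrow> norm z \<le> R" using CckD(2)[OF f] unfolding bsupp_def by blast
    have "bsupp (\<lambda>v. f (x, v))"
    proof (rule bsuppI[of _ R])
      fix v assume "f (x, v) \<noteq> 0"
      then have "norm (x, v) \<le> R" by (rule R)
      then show "norm v \<le> R" using norm_snd_le[of v x] by linarith
    qed
    ultimately show ?thesis by (simp add: Cck_def)
  qed
  have psec: "pd (\<lambda>v. f (x, v)) i v = pd f (0, i) (x, v)" for x i v
    using pd_chain_lin(1)[OF lin, of f v "(x, 0)" i] d by simp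
  have pL: "pd f (0, i) \<in> L2 \<mu>" if "i \<in> Basis" for i
    using Cck_pd'[OF f, of 0 "(0, i)"] that by (auto intro: M.L2_Cck Basis_prod_mem)
  have iD: "integrable \<mu> (\<lambda>z. \<Sum>i\<in>Basis. (pd f (0, i) z)\<^sup>2)"
    by (intro Bochner_Integration.integrable_sum L2_integrable_sq pL)
  have iq: "integrable \<mu> (\<lambda>z. (f z - marg f (fst z))\<^sup>2)" by (rule L2_integrable_sq[OF qL])
  have "ip \<mu> (\<lambda>z. f z - marg f (fst z)) (\<lambda>z. f z - marg f (fst z)) = (\<integral>x. (\<integral>v. (f (x, v) - marg f x)\<^sup>2 \<partial>\<nu>) \<partial>\<mu>x)"
    unfolding ip_def power2_eq_square[symmetric] by (simp add: integral_\<mu>[OF iq])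
  also have "\<dots> \<le> (\<integral>x. 2 * (\<integral>v. (\<Sum>i\<in>Basis. (pd f (0, i) (x, v))\<^sup>2) \<partial>\<nu>) \<partial>\<mu>x)"
  proof (rule integral_mono)
    show "integrable \<mu>x (\<lambda>x. \<integral>v. (f (x, v) - marg f x)\<^sup>2 \<partial>\<nu>)"
      using XN.integrable_fst'[OF iq[unfolded \<mu>_product]] by simp
    show "integrable \<mu>x (\<lambda>x. 2 * (\<integral>v. (\<Sum>i\<in>Basis. (pd f (0, i) (x, v))\<^sup>2) \<partial>\<nu>))"
      using XN.integrable_fst'[OF iD[unfolded \<mu>_product]] by simp
    show "(\<integral>v. (f (x, v) - marg f x)\<^sup>2 \<partial>\<nu>) \<le> 2 * (\<integral>v. (\<Sum>i\<in>Basis. (pd f (0, i) (x, v))\<^sup>2) \<partial>\<nu>)" for x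
      using gauss_poincare[OF sec[of x]] by (simp add: psec marg_def)
  qed
  also have "\<dots> = 2 * (\<integral>z. (\<Sum>i\<in>Basis. (pd f (0, i) z)\<^sup>2) \<partial>\<mu>)"
    by (simp add: integral_\<mu>[OF iD])
  also have "(\<integral>z. (\<Sum>i\<in>Basis. (pd f (0, i) z)\<^sup>2) \<partial>\<mu>) = Dv f"
    unfolding Dv_def ip_def power2_eq_square[symmetric]
    by (rule Bochner_Integration.integral_sum) (rule L2_integrable_sq[OF pL])
  finally show ?thesis .
qed

lemma pythagoras:
  assumes f: "f \<in> L2 \<mu>"
  shows "ip \<mu> f f = ip \<mu>x (marg f) (marg f) + ip \<mu> (\<lambda>z. f z - marg f (fst z)) (\<lambda>z. f z - marg f (fst z))"
proof -
  have p: "(\<lambda>z. marg f (fst z)) \<in> L2 \<mu>" by (intro L2_fst marg_L2 f)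
  have [measurable]: "marg f \<in> borel_measurable borel" by (intro L2x_measurable marg_L2 f)
  have "ip \<mu> f (\<lambda>z. marg f (fst z)) = ip \<mu>x (marg f) (marg f)" by (intro ip_marg marg_L2 f)
  moreover have "ip \<mu> (\<lambda>z. marg f (fst z)) (\<lambda>z. marg f (fst z)) = ip \<mu>x (marg f) (marg f)" by (intro ip_fst) auto
  ultimately show ?thesis
    using f p by (simp add: ip_diff_left ip_diff_right L2_diff ip_commute[of \<mu> "\<lambda>z. marg f (fst z)" f])
qed

lemma marg_norm_le: "f \<in> L2 \<mu> \<Longrightarrow> ip \<mu>x (marg f) (marg f) \<le> ip \<mu> f f"
  using pythagoras[of f] ip_self_nonneg[of \<mu> "\<lambda>z. f z - marg f (fst z)"] by simp

lemma marg_mean: "f \<in> L2 \<mu> \<Longrightarrow> integral\<^sup>L \<mu>x (marg f) = integral\<^sup>L \<mu> f"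
  using ip_marg[of f "\<lambda>x. 1"] X.L2_const[of 1] by (simp add: ip_def)

text \<open>Linearity may fail at positions where a fibre integral diverges and takes the default
  value 0. Pairing the defect with itself through \<open>ip_marg\<close> shows that it is
  null.\<close>

lemma marg_lincomb:
  assumes f: "f \<in> L2 \<mu>" and g: "g \<in> L2 \<mu>"
  shows "l2norm \<mu>x (\<lambda>x. marg (\<lambda>z. f z + c * g z) x - (marg f x + c * marg g x)) = 0"
proof -
  define r where "r = (\<lambda>x. marg (\<lambda>z. f z + c * g z) x - (marg f x + c * marg g x))"
  have fg: "(\<lambda>z. f z + c * g z) \<in> L2 \<mu>" by (intro L2_add L2_cmult f g)
  note L = marg_L2[OF fg] marg_L2[OF f] marg_L2[OF g]
  have rL: "r \<in> L2 \<mu>x" unfolding r_def by (intro L2_diff L2_add L2_cmult L)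
  have "ip \<mu>x r r = ip \<mu>x (marg (\<lambda>z. f z + c * g z)) r - (ip \<mu>x (marg f) r + c * ip \<mu>x (marg g) r)"
    using L rL unfolding r_def
    by (subst ip_diff_left) (auto simp: ip_add_left ip_cmult_left L2_add L2_cmult)
  also have "\<dots> = 0"
    unfolding ip_marg[OF fg rL, symmetric] ip_marg[OF f rL, symmetric] ip_marg[OF g rL, symmetric]
    using f g L2_fst[OF rL] by (simp add: ip_add_left ip_cmult_left L2_cmult)
  finally show ?thesis unfolding r_def by (simp add: l2norm_eq_ip)
qed

end

lemma sum_Basis_prod:
  fixes f :: "'a::euclidean_space \<times> 'b::euclidean_space \<Rightarrow> real"
  shows "(\<Sum>b\<in>Basis. f b) = (\<Sum>i\<in>Basis. f (i, 0)) + (\<Sum>i\<in>Basis. f (0, i))"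
proof -
  have "inj_on (\<lambda>u. (u::'a, 0::'b)) Basis" "inj_on (\<lambda>u. (0::'a, u::'b)) Basis" by (auto intro: inj_onI)
  then show ?thesis
    unfolding Basis_prod_def by (subst sum.union_disjoint) (auto simp: sum.reindex)
qed

section \<open>The transport and friction parts of the generator\<close>

context langevin
begin

text \<open>The Hamiltonian transport part, antisymmetric in L2 of the Gibbs measure.\<close>

definition A :: "('a \<times> 'a \<Rightarrow> real) \<Rightarrow> 'a \<times> 'a \<Rightarrow> real" where
  "A f z = (\<Sum>i\<in>Basis. (snd z \<bullet> i) * pd f (i, 0) z - pd U i (fst z) * pd f (0, i) z)"

text \<open>The Ornstein-Uhlenbeck operator in the velocity, symmetric and negative.\<close>

definition S :: "('a \<times> 'a \<Rightarrow> real) \<Rightarrow> 'a \<times> 'a \<Rightarrow> real" where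
  "S f z = (\<Sum>i\<in>Basis. pd (pd f (0, i)) (0, i) z - (snd z \<bullet> i) * pd f (0, i) z)"

definition L :: "('a \<times> 'a \<Rightarrow> real) \<Rightarrow> 'a \<times> 'a \<Rightarrow> real" where
  "L f z = A f z + \<gamma> * S f z"

lemma L_eq_langevin_op:
  assumes f: "f \<in> Cck 2"
  shows "langevin_op U \<gamma> f = L f"
proof
  fix z :: "'a \<times> 'a"
  obtain x v where z: "z = (x, v)" by (cases z)
  have d: "f differentiable at z" using f by (auto simp: Cck_def intro: Ck_differentiable)
  have e1: "frechet_derivative f (at (x, v)) (v, 0) = (\<Sum>i\<in>Basis. (v \<bullet> i) * pd f (i, 0) z)"
    using pd_expand[OF d, of "(v, 0)"] unfolding z sum_Basis_prod by (simp add: pd_def)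
  have e2: "frechet_derivative f (at (x, v)) (0, v) = (\<Sum>i\<in>Basis. (v \<bullet> i) * pd f (0, i) z)"
    using pd_expand[OF d, of "(0, v)"] unfolding z sum_Basis_prod by (simp add: pd_def)
  have e3: "dderiv f [(0, i), (0, i)] (x, v) = pd (pd f (0, i)) (0, i) z" for i
    by (simp add: pd_def z)
  show "langevin_op U \<gamma> f z = L f z"
    unfolding langevin_op_def L_def A_def S_def z case_prod_conv e1[unfolded z] e2[unfolded z] e3[unfolded z]
    by (simp add: pd_def sum_subtractf right_diff_distrib)
qed

lemma pd_UU: "i \<in> Basis \<Longrightarrow> pd UU (i, 0) z = pd U i (fst z)" "i \<in> Basis \<Longrightarrow> pd UU (0, i) z = snd z \<bullet> i"
proof -
  have d1: "(\<lambda>z::'a\<times>'a. U (fst z)) differentiable at z" by (rule Ck_differentiable[OF Ck_fst[OF U_C1]]) simp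
  have d2: "(\<lambda>z::'a\<times>'a. nsq (snd z)) differentiable at z" by (rule Ck_differentiable[OF Ck_snd[OF Ck_nsq[of 1]]]) simp
  have dU: "U differentiable at (fst z)" by (rule Ck_differentiable[OF U_C1]) simp
  have dn: "nsq differentiable at (snd z)" by (rule Ck_differentiable[OF Ck_nsq[of 1]]) simp
  have "pd UU h z = pd U (fst h) (fst z) + snd z \<bullet> snd h" for h
    unfolding UU_def[abs_def] pd_add[OF d1 d2] pd_fst[OF dU] pd_snd[OF dn] pd_nsq ..
  then show "i \<in> Basis \<Longrightarrow> pd UU (i, 0) z = pd U i (fst z)" "i \<in> Basis \<Longrightarrow> pd UU (0, i) z = snd z \<bullet> i"
    using dU by auto
qed

lemma Ck_snd_inner: "Ck k (\<lambda>z::'a\<times>'a. snd z \<bullet> i)"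
  using Ck_snd[OF Ck_inner, of k i] .

lemma Ck_pdU_fst: "i \<in> Basis \<Longrightarrow> Ck 1 (\<lambda>z::'a\<times>'a. pd U i (fst z))"
  by (rule Ck_fst, rule Ck_pd'[OF U_C2]) auto

lemma pd_snd_inner: "pd (\<lambda>z::'a\<times>'a. snd z \<bullet> i) h z = snd h \<bullet> i"
  using pd_snd[of "\<lambda>v. v \<bullet> i" z h] Ck_differentiable[OF Ck_inner[of 1 i]] by simp

text \<open>Bounded support is carried by \<open>f\<close> alone, which leaves \<open>g\<close> free
  to grow linearly in the velocity as \<open>T \<phi>\<close> does.\<close>

lemma velocity_ibp:
  assumes f: "f \<in> Cck 1" and g: "Ck 1 g" and i: "i \<in> Basis"
  shows "(\<integral>z. f z * g z * (snd z \<bullet> i) \<partial>\<mu>) = (\<integral>z. pd f (0, i) z * g z \<partial>\<mu>) + (\<integral>z. f z * pd g (0, i) z \<partial>\<mu>)"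
proof -
  have b: "(0, i) \<in> Basis" using i by (rule Basis_prod_mem)
  have F: "(\<lambda>z. f z * g z) \<in> Cck 1" by (rule Cck_mult1[OF f g])
  have "(\<integral>z. f z * g z * (snd z \<bullet> i) \<partial>\<mu>) = (\<integral>z. pd (\<lambda>z. f z * g z) (0, i) z \<partial>\<mu>)"
    using M.integral_by_parts[OF F b] i by (simp add: pd_UU)
  also have "pd (\<lambda>z. f z * g z) (0, i) = (\<lambda>z. pd f (0, i) z * g z + f z * pd g (0, i) z)"
    using f g by (intro ext pd_mult) (auto simp: Cck_def intro: Ck_differentiable)
  also have "(\<integral>z. pd f (0, i) z * g z + f z * pd g (0, i) z \<partial>\<mu>) = (\<integral>z. pd f (0, i) z * g z \<partial>\<mu>) + (\<integral>z. f z * pd g (0, i) z \<partial>\<mu>)"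
  proof (rule Bochner_Integration.integral_add)
    show "integrable \<mu> (\<lambda>z. pd f (0, i) z * g z)"
      by (rule M.integrable_Cck[OF Cck_mult1[OF Cck_pd'[OF f, of 0] Ck_mono[OF g]]]) (use b in auto)
    show "integrable \<mu> (\<lambda>z. f z * pd g (0, i) z)"
      by (rule M.integrable_Cck[OF Cck_mult1[OF Cck_mono[OF f] Ck_pd'[OF g]]]) (use b in auto)
  qed
  finally show ?thesis .
qed

lemma position_ibp:
  assumes f: "f \<in> Cck 1" and g: "Ck 1 g" and i: "i \<in> Basis"
  shows "(\<integral>z. f z * g z * pd U i (fst z) \<partial>\<mu>) = (\<integral>z. pd f (i, 0) z * g z \<partial>\<mu>) + (\<integral>z. f z * pd g (i, 0) z \<partial>\<mu>)"
proof -
  have b: "(i, 0) \<in> Basis" using i by (rule Basis_prod_mem)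
  have F: "(\<lambda>z. f z * g z) \<in> Cck 1" by (rule Cck_mult1[OF f g])
  have "(\<integral>z. f z * g z * pd U i (fst z) \<partial>\<mu>) = (\<integral>z. pd (\<lambda>z. f z * g z) (i, 0) z \<partial>\<mu>)"
    using M.integral_by_parts[OF F b] i by (simp add: pd_UU)
  also have "pd (\<lambda>z. f z * g z) (i, 0) = (\<lambda>z. pd f (i, 0) z * g z + f z * pd g (i, 0) z)"
    using f g by (intro ext pd_mult) (auto simp: Cck_def intro: Ck_differentiable)
  also have "(\<integral>z. pd f (i, 0) z * g z + f z * pd g (i, 0) z \<partial>\<mu>) = (\<integral>z. pd f (i, 0) z * g z \<partial>\<mu>) + (\<integral>z. f z * pd g (i, 0) z \<partial>\<mu>)"
  proof (rule Bochner_Integration.integral_add)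
    show "integrable \<mu> (\<lambda>z. pd f (i, 0) z * g z)"
      by (rule M.integrable_Cck[OF Cck_mult1[OF Cck_pd'[OF f, of 0] Ck_mono[OF g]]]) (use b in auto)
    show "integrable \<mu> (\<lambda>z. f z * pd g (i, 0) z)"
      by (rule M.integrable_Cck[OF Cck_mult1[OF Cck_mono[OF f] Ck_pd'[OF g]]]) (use b in auto)
  qed
  finally show ?thesis .
qed

text \<open>Integrating the transport term by parts in the position and the force term by parts in
  the velocity produces the same zeroth-order integral of \<open>f z * g z\<close> times force times
  velocity, and the two copies cancel.\<close>

lemma A_antisym:
  assumes f: "f \<in> Cck 1" and g: "Ck 1 g"
  shows "ip \<mu> (A f) g = - ip \<mu> f (A g)"
proof -
  let ?v = "\<lambda>i (z :: 'a \<times> 'a). snd z \<bullet> i" and ?u = "\<lambda>i (z :: 'a \<times> 'a). pd U i (fst z)"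
  have I: "integrable \<mu> (\<lambda>z. pd f (i, 0) z * (?v i z * g z))" "integrable \<mu> (\<lambda>z. pd f (0, i) z * (?u i z * g z))"
      "integrable \<mu> (\<lambda>z. f z * (?v i z * pd g (i, 0) z))" "integrable \<mu> (\<lambda>z. f z * (?u i z * pd g (0, i) z))"
    if i: "i \<in> Basis" for i
  proof -
    have u: "Ck 0 (?u i)" using Ck_mono[OF Ck_pdU_fst[OF i], of 0] by simp
    note b = Basis_prod_mem[OF i]
    show "integrable \<mu> (\<lambda>z. pd f (i, 0) z * (?v i z * g z))" "integrable \<mu> (\<lambda>z. pd f (0, i) z * (?u i z * g z))"
      by (intro M.integrable_Cck[of _ 0] Cck_mult1 Cck_pd'[OF f] Ck_mult Ck_snd_inner u Ck_mono[OF g] b; simp)+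
    show "integrable \<mu> (\<lambda>z. f z * (?v i z * pd g (i, 0) z))" "integrable \<mu> (\<lambda>z. f z * (?u i z * pd g (0, i) z))"
      by (intro M.integrable_Cck[of _ 0] Cck_mult1 Cck_mono[OF f] Ck_mult Ck_snd_inner u Ck_pd'[OF g] b; simp)+
  qed
  have key: "(\<integral>z. pd f (i, 0) z * (?v i z * g z) \<partial>\<mu>) - (\<integral>z. pd f (0, i) z * (?u i z * g z) \<partial>\<mu>)
      = - ((\<integral>z. f z * (?v i z * pd g (i, 0) z) \<partial>\<mu>) - (\<integral>z. f z * (?u i z * pd g (0, i) z) \<partial>\<mu>))" if i: "i \<in> Basis" for i
  proof -
    have dg: "g differentiable at z" for z using g by (auto intro: Ck_differentiable)
    have dv: "?v i differentiable at z" for z by (rule Ck_differentiable[OF Ck_snd_inner[of 1]]) simp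
    have du: "?u i differentiable at z" for z by (rule Ck_differentiable[OF Ck_pdU_fst[OF i]]) simp
    have pv: "pd (\<lambda>z. ?v i z * g z) (i, 0) = (\<lambda>z. ?v i z * pd g (i, 0) z)"
      by (rule ext) (simp add: pd_mult[OF dv dg] pd_snd_inner)
    have pu: "pd (\<lambda>z. ?u i z * g z) (0, i) = (\<lambda>z. ?u i z * pd g (0, i) z)"
    proof
      fix z :: "'a \<times> 'a"
      have d: "pd U i differentiable at (fst z)" by (rule Ck_differentiable[OF Ck_pd'[OF U_C2, of 1]]) (use i in auto)
      show "pd (\<lambda>z. ?u i z * g z) (0, i) z = ?u i z * pd g (0, i) z"
        using d by (simp add: pd_mult[OF du dg] pd_fst[OF d])
    qed
    have "(\<integral>z. pd f (i, 0) z * (?v i z * g z) \<partial>\<mu>) + (\<integral>z. f z * (?v i z * pd g (i, 0) z) \<partial>\<mu>)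
        = (\<integral>z. f z * (?v i z * g z) * ?u i z \<partial>\<mu>)"
      using position_ibp[OF f Ck_mult[OF Ck_snd_inner g] i, of i] unfolding pv by simp
    also have "\<dots> = (\<integral>z. f z * (?u i z * g z) * ?v i z \<partial>\<mu>)" by (simp add: mult_ac)
    also have "\<dots> = (\<integral>z. pd f (0, i) z * (?u i z * g z) \<partial>\<mu>) + (\<integral>z. f z * (?u i z * pd g (0, i) z) \<partial>\<mu>)"
      using velocity_ibp[OF f Ck_mult[OF Ck_pdU_fst[OF i] g] i] unfolding pu .
    finally show ?thesis by simp
  qed
  have "ip \<mu> (A f) g = (\<integral>z. (\<Sum>i\<in>Basis. pd f (i, 0) z * (?v i z * g z) - pd f (0, i) z * (?u i z * g z)) \<partial>\<mu>)"
    unfolding ip_def A_def sum_distrib_right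
    by (intro Bochner_Integration.integral_cong refl sum.cong) (simp add: algebra_simps)
  also have "\<dots> = (\<Sum>i\<in>Basis. (\<integral>z. pd f (i, 0) z * (?v i z * g z) \<partial>\<mu>) - (\<integral>z. pd f (0, i) z * (?u i z * g z) \<partial>\<mu>))"
    using I by (subst Bochner_Integration.integral_sum) auto
  also have "\<dots> = (\<Sum>i\<in>Basis. - ((\<integral>z. f z * (?v i z * pd g (i, 0) z) \<partial>\<mu>) - (\<integral>z. f z * (?u i z * pd g (0, i) z) \<partial>\<mu>)))"
    by (rule sum.cong[OF refl]) (rule key)
  also have "\<dots> = - (\<integral>z. (\<Sum>i\<in>Basis. f z * (?v i z * pd g (i, 0) z) - f z * (?u i z * pd g (0, i) z)) \<partial>\<mu>)"
    unfolding sum_negf using I by (subst Bochner_Integration.integral_sum) auto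
  also have "\<dots> = - ip \<mu> f (A g)"
    by (simp add: ip_def A_def sum_distrib_left right_diff_distrib)
  finally show ?thesis .
qed

lemma S_sym:
  assumes f: "f \<in> Cck 2" and g: "Ck 1 g"
  shows "ip \<mu> (S f) g = - (\<Sum>i\<in>Basis. ip \<mu> (pd f (0, i)) (pd g (0, i)))"
proof -
  have p: "pd f (0, i) \<in> Cck 1" if "i \<in> Basis" for i
    by (rule Cck_pd'[OF f]) (use that in \<open>auto intro: Basis_prod_mem\<close>)
  have I: "integrable \<mu> (\<lambda>z. pd (pd f (0, i)) (0, i) z * g z)" "integrable \<mu> (\<lambda>z. pd f (0, i) z * g z * (snd z \<bullet> i))"
    if i: "i \<in> Basis" for i
    by (intro M.integrable_Cck[of _ 0] Cck_mult1 Cck_pd'[OF p] Cck_mono[OF p] Ck_mono[OF g] Ck_snd_inner Basis_prod_mem i; simp)+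
  have "ip \<mu> (S f) g = (\<integral>z. (\<Sum>i\<in>Basis. pd (pd f (0, i)) (0, i) z * g z - pd f (0, i) z * g z * (snd z \<bullet> i)) \<partial>\<mu>)"
    unfolding ip_def S_def sum_distrib_right
    by (intro Bochner_Integration.integral_cong refl sum.cong) (simp add: algebra_simps)
  also have "\<dots> = (\<Sum>i\<in>Basis. (\<integral>z. pd (pd f (0, i)) (0, i) z * g z \<partial>\<mu>) - (\<integral>z. pd f (0, i) z * g z * (snd z \<bullet> i) \<partial>\<mu>))"
    using I by (subst Bochner_Integration.integral_sum) auto
  also have "\<dots> = (\<Sum>i\<in>Basis. - ip \<mu> (pd f (0, i)) (pd g (0, i)))"
    by (rule sum.cong[OF refl]) (simp add: velocity_ibp[OF p g] ip_def)
  finally show ?thesis by (simp add: sum_negf)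
qed

lemma A_Cck:
  assumes f: "f \<in> Cck 2" shows "A f \<in> Cck 0"
proof -
  have "pd f (i, 0) \<in> Cck 0" "pd f (0, i) \<in> Cck 0" "Ck 0 (\<lambda>z::'a\<times>'a. pd U i (fst z))" if "i \<in> Basis" for i
    using Cck_pd'[OF f, of 0] Basis_prod_mem[OF that] Ck_mono[OF Ck_pdU_fst[OF that], of 0] by auto
  then show ?thesis
    unfolding A_def[abs_def] by (intro Cck_sum Cck_diff Cck_mult2 Ck_snd_inner)
qed

lemma S_Cck:
  assumes f: "f \<in> Cck 2" shows "S f \<in> Cck 0"
proof -
  have "pd f (0, i) \<in> Cck 0" "pd (pd f (0, i)) (0, i) \<in> Cck 0" if "i \<in> Basis" for i
  proof -
    have b: "(0, i) \<in> Basis" using that by (rule Basis_prod_mem)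
    have p: "pd f (0, i) \<in> Cck 1" by (rule Cck_pd'[OF f _ b]) simp
    then show "pd f (0, i) \<in> Cck 0" by (rule Cck_mono) simp
    show "pd (pd f (0, i)) (0, i) \<in> Cck 0" by (rule Cck_pd'[OF p _ b]) simp
  qed
  then show ?thesis
    unfolding S_def[abs_def] by (intro Cck_sum Cck_diff Cck_mult2 Ck_snd_inner)
qed

lemma L_Cck: "f \<in> Cck 2 \<Longrightarrow> L f \<in> Cck 0"
  unfolding L_def[abs_def] by (intro Cck_add Cck_cmult A_Cck S_Cck)

lemma ip_L:
  assumes f: "f \<in> Cck 2" and g: "Ck 1 g" "g \<in> L2 \<mu>"
  shows "ip \<mu> (L f) g = - ip \<mu> f (A g) - \<gamma> * (\<Sum>i\<in>Basis. ip \<mu> (pd f (0, i)) (pd g (0, i)))"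
proof -
  have "ip \<mu> (L f) g = ip \<mu> (A f) g + \<gamma> * ip \<mu> (S f) g"
    unfolding L_def[abs_def]
    using M.L2_Cck[OF A_Cck[OF f]] M.L2_Cck[OF S_Cck[OF f]] g by (simp add: ip_add_left ip_cmult_left L2_cmult)
  then show ?thesis
    using A_antisym[OF Cck_mono[OF f] g(1)] S_sym[OF f g(1)] by simp
qed

lemma dissipation:
  assumes f: "f \<in> Cck 2"
  shows "ip \<mu> (L f) f = - \<gamma> * Dv f"
proof -
  have f1: "f \<in> Cck 1" using f by (rule Cck_mono) simp
  have "ip \<mu> (A f) f = 0" using A_antisym[OF f1 CckD(1)[OF f1]] by (simp add: ip_commute)
  then have "ip \<mu> f (A f) = 0" by (simp add: ip_commute)
  then show ?thesis using ip_L[OF f CckD(1)[OF f1] M.L2_Cck[OF f]] by (simp add: Dv_def)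
qed

definition T :: "('a \<Rightarrow> real) \<Rightarrow> 'a \<times> 'a \<Rightarrow> real" where
  "T \<phi> z = (\<Sum>i\<in>Basis. pd \<phi> i (fst z) * (snd z \<bullet> i))"

lemma A_fst:
  assumes "\<phi> \<in> Cck 1" shows "A (\<lambda>z. \<phi> (fst z)) = T \<phi>"
proof -
  have d: "\<phi> differentiable at x" for x using assms by (auto simp: Cck_def intro: Ck_differentiable)
  show ?thesis by (rule ext) (simp add: A_def T_def pd_fst[OF d] d mult.commute)
qed

lemma T_C1: "\<phi> \<in> Cck 2 \<Longrightarrow> Ck 1 (T \<phi>)"
  unfolding T_def[abs_def]
  by (intro Ck_sum Ck_mult Ck_fst Ck_snd_inner CckD(1)[OF Cck_pd'[of \<phi> 2]]) auto

lemma T_L2: "\<phi> \<in> Cck 1 \<Longrightarrow> T \<phi> \<in> L2 \<mu>"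
  and T_norm: "\<phi> \<in> Cck 1 \<Longrightarrow> ip \<mu> (T \<phi>) (T \<phi>) = (\<Sum>i\<in>Basis. ip \<mu>x (pd \<phi> i) (pd \<phi> i))"
proof -
  assume \<phi>: "\<phi> \<in> Cck 1"
  have c: "pd \<phi> i \<in> Cck 0" if "i \<in> Basis" for i using Cck_pd'[OF \<phi>, of 0 i] that by auto
  have z: "(\<lambda>x. 0) \<in> Cck 0" by (simp add: Cck_def)
  show "T \<phi> \<in> L2 \<mu>" "ip \<mu> (T \<phi>) (T \<phi>) = (\<Sum>i\<in>Basis. ip \<mu>x (pd \<phi> i) (pd \<phi> i))"
    using affine_v_L2[of "pd \<phi>" "\<lambda>x. 0", OF c z] by (simp_all add: T_def[abs_def] ip_def[of _ "\<lambda>x. 0"])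
qed

text \<open>The factor \<open>v\<close> in \<open>T \<phi>\<close> is traded for a velocity
  derivative of \<open>f\<close>, which the friction controls.\<close>

lemma ip_T:
  assumes f: "f \<in> Cck 1" and \<phi>: "\<phi> \<in> Cck 2"
  shows "ip \<mu> f (T \<phi>) = (\<Sum>i\<in>Basis. ip \<mu> (pd f (0, i)) (\<lambda>z. pd \<phi> i (fst z)))"
proof -
  have c: "Ck 1 (\<lambda>z::'a\<times>'a. pd \<phi> i (fst z))" if "i \<in> Basis" for i
    by (rule Ck_fst, rule CckD(1)[OF Cck_pd'[OF \<phi>]]) (use that in auto)
  have d: "pd \<phi> i differentiable at x" if "i \<in> Basis" for i x
    by (rule Ck_differentiable[OF CckD(1)[OF Cck_pd'[OF \<phi>, of 1]]]) (use that in auto)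
  have "ip \<mu> f (T \<phi>) = (\<integral>z. (\<Sum>i\<in>Basis. f z * pd \<phi> i (fst z) * (snd z \<bullet> i)) \<partial>\<mu>)"
    by (simp add: ip_def T_def sum_distrib_left mult.assoc)
  also have "\<dots> = (\<Sum>i\<in>Basis. \<integral>z. f z * pd \<phi> i (fst z) * (snd z \<bullet> i) \<partial>\<mu>)"
    by (rule Bochner_Integration.integral_sum)
      (intro M.integrable_Cck[of _ 1] Cck_mult1 f c Ck_snd_inner)
  also have "\<dots> = (\<Sum>i\<in>Basis. ip \<mu> (pd f (0, i)) (\<lambda>z. pd \<phi> i (fst z)))"
    by (rule sum.cong[OF refl]) (simp add: velocity_ibp[OF f c] ip_def pd_fst[OF d] d)
  finally show ?thesis .
qed

text \<open>Second-order Hermite cancellation: integrating by parts in \<open>v\<close> trades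
  \<open>v \<cdot> \<nabla>\<^sup>2\<phi> v - \<Delta>\<phi>\<close> for \<open>\<nabla>\<^sub>v f \<cdot> \<nabla>\<^sup>2\<phi> v\<close>.\<close>

lemma ip_L_T:
  assumes f: "f \<in> Cck 2" and \<phi>: "\<phi> \<in> Cck 3"
  shows "ip \<mu> (L f) (T \<phi>) = ip \<mu> f (\<lambda>z. X.H \<phi> (fst z))
    - (\<Sum>j\<in>Basis. ip \<mu> (pd f (0, j)) (\<lambda>z. (\<Sum>i\<in>Basis. pd (pd \<phi> j) i (fst z) * (snd z \<bullet> i)) + \<gamma> * pd \<phi> j (fst z)))"
proof -
  have f1: "f \<in> Cck 1" using f by (rule Cck_mono) simp
  have \<phi>2: "\<phi> \<in> Cck 2" using \<phi> by (rule Cck_mono) simp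
  have \<phi>1: "\<phi> \<in> Cck 1" using \<phi> by (rule Cck_mono) simp
  have c1: "pd \<phi> j \<in> Cck 2" if "j \<in> Basis" for j by (rule Cck_pd'[OF \<phi>]) (use that in auto)
  have d1: "pd \<phi> j differentiable at x" if "j \<in> Basis" for j x
    by (rule Ck_differentiable[OF CckD(1)[OF c1[OF that]]]) simp
  have c2: "pd (pd \<phi> j) i \<in> Cck 1" if "j \<in> Basis" "i \<in> Basis" for i j
    by (rule Cck_pd'[OF c1]) (use that in auto)
  have d2: "pd (pd \<phi> j) i differentiable at x" if "j \<in> Basis" "i \<in> Basis" for i j x
    by (rule Ck_differentiable[OF CckD(1)[OF c2[OF that]]]) simp
  define B where "B j z = (\<Sum>i\<in>Basis. pd (pd \<phi> j) i (fst z) * (snd z \<bullet> i))" for j and z :: "'a \<times> 'a"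
  have BC: "Ck 1 (B j)" if j: "j \<in> Basis" for j
    unfolding B_def by (intro Ck_sum Ck_mult Ck_fst Ck_snd_inner CckD(1)[OF c2[OF j]])
  have pB: "pd (B j) (0, k) z = pd (pd \<phi> j) k (fst z)" if j: "j \<in> Basis" and k: "k \<in> Basis" for j k z
  proof -
    have df: "(\<lambda>z::'a\<times>'a. pd (pd \<phi> j) i (fst z)) differentiable at z" if "i \<in> Basis" for i z
      by (rule Ck_differentiable[OF Ck_fst[OF CckD(1)[OF c2[OF j that]]]]) simp
    have dv: "(\<lambda>z::'a\<times>'a. snd z \<bullet> i) differentiable at z" for i z
      by (rule Ck_differentiable[OF Ck_snd_inner[of 1]]) simp
    have "pd (B j) (0, k) z = (\<Sum>i\<in>Basis. pd (\<lambda>z. pd (pd \<phi> j) i (fst z) * (snd z \<bullet> i)) (0, k) z)"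
      unfolding B_def by (rule pd_sum) (intro differentiable_mult df dv)
    also have "\<dots> = (\<Sum>i\<in>Basis. pd (pd \<phi> j) i (fst z) * (k \<bullet> i))"
      by (rule sum.cong[OF refl]) (simp add: pd_mult[OF df dv] pd_fst[OF d2[OF j]] d2[OF j] pd_snd_inner)
    also have "\<dots> = (\<Sum>i\<in>Basis. if i = k then pd (pd \<phi> j) i (fst z) else 0)"
      using k by (intro sum.cong) (auto simp: inner_Basis)
    finally show ?thesis using k by simp
  qed
  have pT1: "pd (T \<phi>) (0, k) z = pd \<phi> k (fst z)" and pT2: "pd (T \<phi>) (k, 0) z = (\<Sum>j\<in>Basis. pd (pd \<phi> j) k (fst z) * (snd z \<bullet> j))"
    if k: "k \<in> Basis" for k z
  proof -
    have df: "(\<lambda>z::'a\<times>'a. pd \<phi> j (fst z)) differentiable at z" if "j \<in> Basis" for j z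
      by (rule Ck_differentiable[OF Ck_fst[OF CckD(1)[OF c1[OF that]]]]) simp
    have dv: "(\<lambda>z::'a\<times>'a. snd z \<bullet> i) differentiable at z" for i z
      by (rule Ck_differentiable[OF Ck_snd_inner[of 1]]) simp
    have e: "pd (T \<phi>) h z = (\<Sum>j\<in>Basis. pd (pd \<phi> j) (fst h) (fst z) * (snd z \<bullet> j) + pd \<phi> j (fst z) * (snd h \<bullet> j))" for h
    proof -
      have "pd (T \<phi>) h z = (\<Sum>j\<in>Basis. pd (\<lambda>z. pd \<phi> j (fst z) * (snd z \<bullet> j)) h z)"
        unfolding T_def[abs_def] by (rule pd_sum) (intro differentiable_mult df dv)
      also have "\<dots> = (\<Sum>j\<in>Basis. pd (pd \<phi> j) (fst h) (fst z) * (snd z \<bullet> j) + pd \<phi> j (fst z) * (snd h \<bullet> j))"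
        by (rule sum.cong[OF refl]) (simp add: pd_mult[OF df dv] pd_fst[OF d1] pd_snd_inner)
      finally show ?thesis .
    qed
    have "pd (T \<phi>) (0, k) z = (\<Sum>j\<in>Basis. pd \<phi> j (fst z) * (k \<bullet> j))"
      unfolding e by (rule sum.cong[OF refl]) (simp add: d1)
    also have "\<dots> = (\<Sum>j\<in>Basis. if j = k then pd \<phi> j (fst z) else 0)"
      using k by (intro sum.cong) (auto simp: inner_Basis)
    finally show "pd (T \<phi>) (0, k) z = pd \<phi> k (fst z)" using k by simp
    show "pd (T \<phi>) (k, 0) z = (\<Sum>j\<in>Basis. pd (pd \<phi> j) k (fst z) * (snd z \<bullet> j))"
      unfolding e by simp
  qed
  have AT: "A (T \<phi>) z = (\<Sum>j\<in>Basis. B j z * (snd z \<bullet> j) - pd U j (fst z) * pd \<phi> j (fst z))" for z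
  proof -
    have "A (T \<phi>) z = (\<Sum>i\<in>Basis. (\<Sum>j\<in>Basis. (snd z \<bullet> i) * (pd (pd \<phi> j) i (fst z) * (snd z \<bullet> j))) - pd U i (fst z) * pd \<phi> i (fst z))"
      unfolding A_def by (rule sum.cong[OF refl]) (simp add: pT1 pT2 sum_distrib_left)
    also have "\<dots> = (\<Sum>i\<in>Basis. (\<Sum>j\<in>Basis. (snd z \<bullet> i) * (pd (pd \<phi> j) i (fst z) * (snd z \<bullet> j)))) - (\<Sum>i\<in>Basis. pd U i (fst z) * pd \<phi> i (fst z))"
      by (rule sum_subtractf)
    also have "(\<Sum>i\<in>Basis. (\<Sum>j\<in>Basis. (snd z \<bullet> i) * (pd (pd \<phi> j) i (fst z) * (snd z \<bullet> j)))) = (\<Sum>j\<in>Basis. B j z * (snd z \<bullet> j))"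
      unfolding B_def sum_distrib_right by (subst sum.swap) (simp add: mult_ac)
    finally show ?thesis by (simp add: sum_subtractf)
  qed
  have I: "integrable \<mu> (\<lambda>z. f z * B j z * (snd z \<bullet> j))" "integrable \<mu> (\<lambda>z. f z * (pd U j (fst z) * pd \<phi> j (fst z)))"
     "integrable \<mu> (\<lambda>z. f z * pd (pd \<phi> j) j (fst z))" if j: "j \<in> Basis" for j
    by (intro M.integrable_Cck[of _ 1] Cck_mult1 f1 BC j Ck_mult Ck_snd_inner Ck_pdU_fst Ck_fst CckD(1)[OF Cck_mono[OF c1[OF j]]] CckD(1)[OF c2]; simp)+
  have "ip \<mu> f (A (T \<phi>)) = (\<integral>z. (\<Sum>j\<in>Basis. f z * B j z * (snd z \<bullet> j) - f z * (pd U j (fst z) * pd \<phi> j (fst z))) \<partial>\<mu>)"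
    unfolding ip_def AT by (simp add: sum_distrib_left right_diff_distrib mult.assoc)
  also have "\<dots> = (\<Sum>j\<in>Basis. (\<integral>z. f z * B j z * (snd z \<bullet> j) \<partial>\<mu>) - (\<integral>z. f z * (pd U j (fst z) * pd \<phi> j (fst z)) \<partial>\<mu>))"
    using I by (subst Bochner_Integration.integral_sum) auto
  also have "\<dots> = (\<Sum>j\<in>Basis. ip \<mu> (pd f (0, j)) (B j) - ((\<integral>z. f z * (pd U j (fst z) * pd \<phi> j (fst z)) \<partial>\<mu>) - (\<integral>z. f z * pd (pd \<phi> j) j (fst z) \<partial>\<mu>)))"
    by (rule sum.cong[OF refl]) (simp add: velocity_ibp[OF f1 BC] pB ip_def)
  also have "\<dots> = (\<Sum>j\<in>Basis. ip \<mu> (pd f (0, j)) (B j)) - (\<Sum>j\<in>Basis. (\<integral>z. f z * (pd U j (fst z) * pd \<phi> j (fst z)) \<partial>\<mu>) - (\<integral>z. f z * pd (pd \<phi> j) j (fst z) \<partial>\<mu>))"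
    by (rule sum_subtractf)
  also have "(\<Sum>j\<in>Basis. (\<integral>z. f z * (pd U j (fst z) * pd \<phi> j (fst z)) \<partial>\<mu>) - (\<integral>z. f z * pd (pd \<phi> j) j (fst z) \<partial>\<mu>))
      = (\<integral>z. (\<Sum>j\<in>Basis. f z * (pd U j (fst z) * pd \<phi> j (fst z)) - f z * pd (pd \<phi> j) j (fst z)) \<partial>\<mu>)"
    using I by (subst Bochner_Integration.integral_sum) auto
  also have "\<dots> = ip \<mu> f (\<lambda>z. X.H \<phi> (fst z))"
    by (simp add: ip_def X.H_def sum_distrib_left right_diff_distrib)
  finally have fAT: "ip \<mu> f (A (T \<phi>)) = (\<Sum>j\<in>Basis. ip \<mu> (pd f (0, j)) (B j)) - ip \<mu> f (\<lambda>z. X.H \<phi> (fst z))" .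
  have pfL: "pd f (0, j) \<in> L2 \<mu>" if "j \<in> Basis" for j
    using Cck_pd'[OF f1, of 0 "(0, j)"] that by (auto intro: M.L2_Cck Basis_prod_mem)
  have z0: "(\<lambda>x. 0) \<in> Cck 0" by (simp add: Cck_def)
  have BL: "B j \<in> L2 \<mu>" if j: "j \<in> Basis" for j
    using affine_v_L2(1)[of "pd (pd \<phi> j)" "\<lambda>x. 0", OF Cck_mono[OF c2[OF j]] z0] by (simp add: B_def[abs_def])
  have pL: "(\<lambda>z. pd \<phi> j (fst z)) \<in> L2 \<mu>" if j: "j \<in> Basis" for j
    by (intro L2_fst X.L2_Cck[OF c1[OF j]])
  have "ip \<mu> (L f) (T \<phi>) = - ip \<mu> f (A (T \<phi>)) - \<gamma> * (\<Sum>j\<in>Basis. ip \<mu> (pd f (0, j)) (\<lambda>z. pd \<phi> j (fst z)))"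
  proof -
    have "(\<Sum>j\<in>Basis. ip \<mu> (pd f (0, j)) (pd (T \<phi>) (0, j))) = (\<Sum>j\<in>Basis. ip \<mu> (pd f (0, j)) (\<lambda>z. pd \<phi> j (fst z)))"
      by (rule sum.cong[OF refl]) (simp add: pT1 ip_def)
    then show ?thesis using ip_L[OF f T_C1[OF \<phi>2] T_L2[OF \<phi>1]] by simp
  qed
  also have "\<dots> = ip \<mu> f (\<lambda>z. X.H \<phi> (fst z)) - (\<Sum>j\<in>Basis. ip \<mu> (pd f (0, j)) (B j) + \<gamma> * ip \<mu> (pd f (0, j)) (\<lambda>z. pd \<phi> j (fst z)))"
    unfolding fAT sum.distrib sum_distrib_left by simp
  also have "(\<Sum>j\<in>Basis. ip \<mu> (pd f (0, j)) (B j) + \<gamma> * ip \<mu> (pd f (0, j)) (\<lambda>z. pd \<phi> j (fst z)))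
      = (\<Sum>j\<in>Basis. ip \<mu> (pd f (0, j)) (\<lambda>z. B j z + \<gamma> * pd \<phi> j (fst z)))"
    by (rule sum.cong[OF refl]) (simp add: ip_add_right pfL BL pL L2_cmult ip_cmult_right)
  finally show ?thesis unfolding B_def .
qed

end

lemma ip_amgm:
  assumes "f \<in> L2 M" "g \<in> L2 M" and t: "0 < t"
  shows "2 * ip M f g \<le> t * ip M f f + ip M g g / t"
proof -
  have "0 \<le> ip M f f + 2 * (- (1 / t)) * ip M f g + (- (1 / t))\<^sup>2 * ip M g g"
    using ip_quad[OF assms(1,2), of "- (1 / t)"] ip_self_nonneg by metis
  then have "0 \<le> t * (ip M f f + 2 * (- (1 / t)) * ip M f g + (- (1 / t))\<^sup>2 * ip M g g)"
    using t by simp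
  also have "\<dots> = t * ip M f f - 2 * ip M f g + ip M g g / t"
    using t by (simp add: distrib_left right_diff_distrib power2_eq_square)
  finally show ?thesis by simp
qed

section \<open>A priori bounds for the resolvent equation\<close>

context langevin
begin

text \<open>The shift equals the spectral gap, so on mean zero functions \<open>R\<close> is at most
  twice \<open>X.H\<close> while staying invertible on constants.\<close>

definition R :: "('a \<Rightarrow> real) \<Rightarrow> 'a \<Rightarrow> real" where
  "R \<phi> x = m * \<phi> x + X.H \<phi> x"

definition grad_sq :: "('a \<Rightarrow> real) \<Rightarrow> real" where
  "grad_sq \<phi> = (\<Sum>i\<in>Basis. ip \<mu>x (pd \<phi> i) (pd \<phi> i))"

text \<open>Solves K + \<gamma>^2 = (2 \<kappa> - 1) m after K has been replaced by \<gamma>^2 / 2 -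
  8 m.\<close>

definition \<kappa> :: real where
  "\<kappa> = 3 / 4 * \<gamma>\<^sup>2 / m - 7 / 2"

lemma grad_sq_nonneg: "0 \<le> grad_sq \<phi>"
  unfolding grad_sq_def by (intro sum_nonneg ip_self_nonneg)

lemma H_L2: "\<phi> \<in> Cck 2 \<Longrightarrow> X.H \<phi> \<in> L2 \<mu>x"
  by (intro X.L2_Cck[OF X.H_Cck])

lemma R_L2: "\<phi> \<in> Cck 2 \<Longrightarrow> R \<phi> \<in> L2 \<mu>x"
  unfolding R_def[abs_def] by (intro L2_add L2_cmult H_L2 X.L2_Cck)

lemma ip_H_self: "\<phi> \<in> Cck 2 \<Longrightarrow> ip \<mu>x (X.H \<phi>) \<phi> = grad_sq \<phi>"
  unfolding grad_sq_def by (intro X.ip_H CckD(1)[OF Cck_mono[of \<phi> 2]]) auto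

lemma R_expand:
  assumes \<phi>: "\<phi> \<in> Cck 2"
  shows "ip \<mu>x (R \<phi>) (R \<phi>) = m\<^sup>2 * ip \<mu>x \<phi> \<phi> + 2 * (m * grad_sq \<phi>) + ip \<mu>x (X.H \<phi>) (X.H \<phi>)"
    and "ip \<mu>x (R \<phi>) (X.H \<phi>) = m * grad_sq \<phi> + ip \<mu>x (X.H \<phi>) (X.H \<phi>)"
    and "ip \<mu>x (R \<phi>) \<phi> = m * ip \<mu>x \<phi> \<phi> + grad_sq \<phi>"
  using X.L2_Cck[OF \<phi>] H_L2[OF \<phi>] ip_H_self[OF \<phi>] ip_H_self[OF \<phi>, unfolded ip_commute[of _ "X.H \<phi>"]]
  by (simp_all add: R_def[abs_def] ip_add_left ip_add_right ip_cmult_left ip_cmult_right L2_cmult L2_add power2_eq_square)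
    (simp_all add: algebra_simps)

text \<open>In terms of a spectral value s >= 0 of \<open>X.H\<close> these are 4 m s <= (m + s)^2,
  s^2 <= (m + s)^2 and m^2 <= (m + s)^2; the first is proved by the arithmetic-geometric mean
  inequality instead of a spectral decomposition.\<close>

lemma R_bounds:
  assumes \<phi>: "\<phi> \<in> Cck 2"
  shows "4 * (m * grad_sq \<phi>) \<le> ip \<mu>x (R \<phi>) (R \<phi>)"
    and "ip \<mu>x (X.H \<phi>) (X.H \<phi>) \<le> ip \<mu>x (R \<phi>) (R \<phi>)"
    and "m\<^sup>2 * ip \<mu>x \<phi> \<phi> \<le> ip \<mu>x (R \<phi>) (R \<phi>)"
proof -
  have "2 * ip \<mu>x \<phi> (X.H \<phi>) \<le> m * ip \<mu>x \<phi> \<phi> + ip \<mu>x (X.H \<phi>) (X.H \<phi>) / m"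
    using X.L2_Cck[OF \<phi>] H_L2[OF \<phi>] m_pos by (rule ip_amgm)
  then have "2 * grad_sq \<phi> \<le> m * ip \<mu>x \<phi> \<phi> + ip \<mu>x (X.H \<phi>) (X.H \<phi>) / m"
    using ip_H_self[OF \<phi>] by (simp add: ip_commute)
  then have "m * (2 * grad_sq \<phi>) \<le> m * (m * ip \<mu>x \<phi> \<phi> + ip \<mu>x (X.H \<phi>) (X.H \<phi>) / m)"
    using m_pos by (intro mult_left_mono) auto
  then have "2 * (m * grad_sq \<phi>) \<le> m\<^sup>2 * ip \<mu>x \<phi> \<phi> + ip \<mu>x (X.H \<phi>) (X.H \<phi>)"
    using m_pos by (simp add: distrib_left power2_eq_square)
  then show "4 * (m * grad_sq \<phi>) \<le> ip \<mu>x (R \<phi>) (R \<phi>)"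
    unfolding R_expand(1)[OF \<phi>] by linarith
  have "0 \<le> m\<^sup>2 * ip \<mu>x \<phi> \<phi>" by (intro mult_nonneg_nonneg ip_self_nonneg) simp
  moreover have "0 \<le> m * grad_sq \<phi>" using m_pos grad_sq_nonneg by (intro mult_nonneg_nonneg) auto
  moreover have "0 \<le> ip \<mu>x (X.H \<phi>) (X.H \<phi>)" by (rule ip_self_nonneg)
  ultimately show "ip \<mu>x (X.H \<phi>) (X.H \<phi>) \<le> ip \<mu>x (R \<phi>) (R \<phi>)" "m\<^sup>2 * ip \<mu>x \<phi> \<phi> \<le> ip \<mu>x (R \<phi>) (R \<phi>)"
    unfolding R_expand(1)[OF \<phi>] by linarith+
qed

text \<open>Spectrally, m s <= s^2 and (m + s)^2 <= 2 s (m + s) for s >= m, the constants (s = 0)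
  being removed by subtracting the squared mean. The Poincare inequality is used only for
  \<open>\<phi>\<close> minus its mean.\<close>

lemma spectral_gap:
  assumes \<phi>: "\<phi> \<in> Cck 2"
  shows "m * grad_sq \<phi> \<le> ip \<mu>x (X.H \<phi>) (X.H \<phi>)"
    and "ip \<mu>x (R \<phi>) (R \<phi>) - (integral\<^sup>L \<mu>x (R \<phi>))\<^sup>2 \<le> 2 * (m * grad_sq \<phi> + ip \<mu>x (X.H \<phi>) (X.H \<phi>))"
proof -
  define c where "c = integral\<^sup>L \<mu>x \<phi>"
  define g where "g x = \<phi> x - c" for x
  have \<phi>L: "\<phi> \<in> L2 \<mu>x" using \<phi> by (rule X.L2_Cck)
  have i\<phi>: "integrable \<mu>x \<phi>" using \<phi> by (rule X.integrable_Cck)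
  have gL: "g \<in> L2 \<mu>x" unfolding g_def by (intro L2_diff \<phi>L X.L2_const)
  have d: "\<phi> differentiable at x" for x using \<phi> by (auto simp: Cck_def intro: Ck_differentiable)
  have pg: "pd g i = pd \<phi> i" for i by (rule ext) (simp add: g_def[abs_def] pd_diff d)
  have pC: "pd \<phi> i \<in> Cck 1" if "i \<in> Basis" for i using Cck_pd'[OF \<phi>, of 1 i] that by auto
  have ip2: "integrable \<mu>x (\<lambda>x. (pd \<phi> i x)\<^sup>2)" if "i \<in> Basis" for i
    by (rule L2_integrable_sq[OF X.L2_Cck[OF pC[OF that]]])
  have "(\<integral>x. (g x)\<^sup>2 \<partial>\<mu>x) \<le> (1 / m) * (\<integral>x. (\<Sum>i\<in>Basis. (pd g i x)\<^sup>2) \<partial>\<mu>x)"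
  proof (rule poincare[OF gL])
    show "integral\<^sup>L \<mu>x g = 0" unfolding g_def using i\<phi> by (simp add: c_def X.prob_space[simplified])
    show "Ck 1 g" unfolding g_def using \<phi> by (intro Ck_diff Ck_const CckD(1)[OF Cck_mono[OF \<phi>]]) auto
    show "integrable \<mu>x (\<lambda>x. \<Sum>i\<in>Basis. (pd g i x)\<^sup>2)" unfolding pg using ip2 by (rule Bochner_Integration.integrable_sum)
  qed
  also have "(\<integral>x. (\<Sum>i\<in>Basis. (pd g i x)\<^sup>2) \<partial>\<mu>x) = grad_sq \<phi>"
    unfolding pg grad_sq_def ip_def power2_eq_square[symmetric] using ip2 by (rule Bochner_Integration.integral_sum)
  finally have P: "m * ip \<mu>x g g \<le> grad_sq \<phi>"
    using m_pos by (simp add: ip_def power2_eq_square field_simps)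
  have H1: "ip \<mu>x (X.H \<phi>) (\<lambda>x. c) = 0"
    using X.ip_H[OF \<phi> Ck_const, of c] by (simp add: ip_def)
  have cL: "(\<lambda>x. c) \<in> L2 \<mu>x" by (rule X.L2_const)
  have Hg: "ip \<mu>x (X.H \<phi>) g = grad_sq \<phi>"
    using H1 ip_H_self[OF \<phi>] \<phi>L cL H_L2[OF \<phi>] by (simp add: g_def[abs_def] ip_diff_right)
  show S: "m * grad_sq \<phi> \<le> ip \<mu>x (X.H \<phi>) (X.H \<phi>)"
  proof -
    have "2 * ip \<mu>x g (X.H \<phi>) \<le> m * ip \<mu>x g g + ip \<mu>x (X.H \<phi>) (X.H \<phi>) / m"
      using gL H_L2[OF \<phi>] m_pos by (rule ip_amgm)
    then have "grad_sq \<phi> \<le> ip \<mu>x (X.H \<phi>) (X.H \<phi>) / m"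
      using Hg P by (simp add: ip_commute)
    then show ?thesis using m_pos by (simp add: field_simps)
  qed
  \<comment> \<open>\<open>X.H \<phi>\<close> has mean zero, so only the shift contributes to the
    mean of \<open>R \<phi>\<close>.\<close>
  have mean: "integral\<^sup>L \<mu>x (R \<phi>) = m * c"
  proof -
    have "(\<integral>x. X.H \<phi> x \<partial>\<mu>x) = 0"
      using X.ip_H[OF \<phi> Ck_const, of 1] by (simp add: ip_def)
    moreover have "integrable \<mu>x (X.H \<phi>)" by (rule X.integrable_Cck[OF X.H_Cck[OF \<phi>]])
    ultimately show ?thesis using i\<phi> by (simp add: R_def[abs_def] c_def)
  qed
  have gg: "ip \<mu>x g g = ip \<mu>x \<phi> \<phi> - c\<^sup>2"
  proof -
    have "ip \<mu>x \<phi> (\<lambda>x. c) = c * c" "ip \<mu>x (\<lambda>x. c) (\<lambda>x. c) = c * c"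
      using i\<phi> by (simp_all add: ip_def c_def X.prob_space[simplified] mult.commute)
    then show ?thesis
      using \<phi>L cL gL by (simp add: g_def[abs_def] ip_diff_left ip_diff_right L2_diff ip_commute[of _ "\<lambda>x. c" \<phi>] power2_eq_square)
  qed
  have "m\<^sup>2 * ip \<mu>x \<phi> \<phi> - (m * c)\<^sup>2 = m * (m * ip \<mu>x g g)"
    unfolding gg by (simp add: power2_eq_square algebra_simps)
  also have "\<dots> \<le> m * grad_sq \<phi>" using P m_pos by (intro mult_left_mono) auto
  finally have fin: "m\<^sup>2 * ip \<mu>x \<phi> \<phi> - (m * c)\<^sup>2 \<le> m * grad_sq \<phi>" .
  show "ip \<mu>x (R \<phi>) (R \<phi>) - (integral\<^sup>L \<mu>x (R \<phi>))\<^sup>2 \<le> 2 * (m * grad_sq \<phi> + ip \<mu>x (X.H \<phi>) (X.H \<phi>))"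
    unfolding R_expand(1)[OF \<phi>] mean
  proof -
    have "a + 2 * g + h - k \<le> 2 * (g + h)" if "a - k \<le> g" "g \<le> h" for a k g h :: real using that by simp
    from this[OF fin S]
    show "m\<^sup>2 * ip \<mu>x \<phi> \<phi> + 2 * (m * grad_sq \<phi>) + ip \<mu>x (X.H \<phi>) (X.H \<phi>) - (m * c)\<^sup>2
        \<le> 2 * (m * grad_sq \<phi> + ip \<mu>x (X.H \<phi>) (X.H \<phi>))" .
  qed
qed

lemma \<kappa>_pos: "0 < \<kappa>" and \<kappa>_ge: "1 \<le> \<kappa>"
proof -
  have "12 \<le> 3 / 4 * \<gamma>\<^sup>2 / m" using m_pos K_nonneg by (simp add: \<gamma>_sq field_simps)
  then show "0 < \<kappa>" "1 \<le> \<kappa>" by (simp_all add: \<kappa>_def)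
qed

text \<open>Bochner's formula leaves \<open>K + \<gamma>\<^sup>2\<close> times the squared gradient.
  Writing this factor as \<kappa> m + (\<kappa> - 1) m, the excess is moved onto
  \<open>X.H \<phi>\<close> by the spectral gap.\<close>

lemma second_order_bound:
  assumes \<phi>: "\<phi> \<in> Cck 3"
  shows "(\<Sum>j\<in>Basis. (\<Sum>i\<in>Basis. ip \<mu>x (pd (pd \<phi> j) i) (pd (pd \<phi> j) i)) + \<gamma>\<^sup>2 * ip \<mu>x (pd \<phi> j) (pd \<phi> j))
    \<le> \<kappa> * (m * grad_sq \<phi> + ip \<mu>x (X.H \<phi>) (X.H \<phi>))"
proof -
  have \<phi>2: "\<phi> \<in> Cck 2" using \<phi> by (rule Cck_mono) simp
  have "(\<Sum>j\<in>Basis. (\<Sum>i\<in>Basis. ip \<mu>x (pd (pd \<phi> j) i) (pd (pd \<phi> j) i)) + \<gamma>\<^sup>2 * ip \<mu>x (pd \<phi> j) (pd \<phi> j))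
      \<le> ip \<mu>x (X.H \<phi>) (X.H \<phi>) + (K + \<gamma>\<^sup>2) * grad_sq \<phi>"
    using X.bochner[OF U_C2 \<phi> hess] by (simp add: sum.distrib sum_distrib_left[symmetric] grad_sq_def algebra_simps)
  also have "\<dots> \<le> \<kappa> * (m * grad_sq \<phi> + ip \<mu>x (X.H \<phi>) (X.H \<phi>))"
  proof -
    have k: "K + \<gamma>\<^sup>2 = \<kappa> * m + (\<kappa> - 1) * m"
      using m_pos by (simp add: \<kappa>_def \<gamma>_sq field_simps)
    have "\<kappa> * (m * grad_sq \<phi> + ip \<mu>x (X.H \<phi>) (X.H \<phi>)) - (ip \<mu>x (X.H \<phi>) (X.H \<phi>) + (K + \<gamma>\<^sup>2) * grad_sq \<phi>)
       = (\<kappa> - 1) * (ip \<mu>x (X.H \<phi>) (X.H \<phi>) - m * grad_sq \<phi>)"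
      unfolding k by (simp add: algebra_simps)
    moreover have "0 \<le> (\<kappa> - 1) * (ip \<mu>x (X.H \<phi>) (X.H \<phi>) - m * grad_sq \<phi>)"
      using spectral_gap(1)[OF \<phi>2] \<kappa>_ge by (intro mult_nonneg_nonneg) auto
    ultimately show ?thesis by linarith
  qed
  finally show ?thesis .
qed

lemma T_bound:
  assumes \<phi>: "\<phi> \<in> Cck 2"
  shows "l2norm \<mu> (T \<phi>) \<le> l2norm \<mu>x (R \<phi>) / (2 * sqrt m)"
proof -
  have "ip \<mu> (T \<phi>) (T \<phi>) = grad_sq \<phi>"
    unfolding grad_sq_def by (intro T_norm Cck_mono[OF \<phi>]) auto
  then have "(2 * sqrt m * l2norm \<mu> (T \<phi>))\<^sup>2 \<le> (l2norm \<mu>x (R \<phi>))\<^sup>2"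
    using R_bounds(1)[OF \<phi>] m_pos by (simp add: power_mult_distrib l2norm_sq mult.assoc)
  then have "2 * sqrt m * l2norm \<mu> (T \<phi>) \<le> l2norm \<mu>x (R \<phi>)" by (rule power2_le_imp_le) simp
  then show ?thesis using m_pos by (simp add: field_simps)
qed

lemma R_lincomb: "\<phi> \<in> Cck 2 \<Longrightarrow> \<psi> \<in> Cck 2 \<Longrightarrow> R (\<lambda>x. \<phi> x + c * \<psi> x) = (\<lambda>x. R \<phi> x + c * R \<psi> x)"
  unfolding R_def[abs_def] by (simp add: X.H_lincomb algebra_simps)

lemma T_lincomb:
  assumes "\<phi> \<in> Cck 2" "\<psi> \<in> Cck 2"
  shows "T (\<lambda>x. \<phi> x + c * \<psi> x) = (\<lambda>z. T \<phi> z + c * T \<psi> z)"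
proof -
  have d: "\<phi> differentiable at x" "\<psi> differentiable at x" for x
    using assms by (auto simp: Cck_def intro: Ck_differentiable)
  have "pd (\<lambda>x. \<phi> x + c * \<psi> x) i x = pd \<phi> i x + c * pd \<psi> i x" for i x
    using d by (subst pd_add) (auto simp: pd_cmult intro: differentiable_mult)
  then show ?thesis
    by (simp add: T_def[abs_def] sum_distrib_left sum.distrib[symmetric] algebra_simps)
qed

text \<open>\<open>G f\<close> stands for \<open>v \<cdot> \<nabla>(m + \<nabla>\<^sup>*\<nabla>)\<^sup>-\<^sup>1 marg f\<close>, defined as the limit of \<open>T \<phi>\<^sub>n\<close> along smooth
  approximate solutions \<open>\<phi>\<^sub>n\<close> of the resolvent equation.\<close>

definition approx :: "(nat \<Rightarrow> 'a \<Rightarrow> real) \<Rightarrow> ('a \<times> 'a \<Rightarrow> real) \<Rightarrow> bool" where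
  "approx \<phi> f \<longleftrightarrow> (\<forall>n. \<phi> n \<in> Cck 3) \<and> L2_tendsto \<mu>x (\<lambda>n. R (\<phi> n)) (marg f)"

definition G :: "('a \<times> 'a \<Rightarrow> real) \<Rightarrow> 'a \<times> 'a \<Rightarrow> real" where
  "G f = (SOME g. \<exists>\<phi>. approx \<phi> f \<and> L2_tendsto \<mu> (\<lambda>n. T (\<phi> n)) g)"

lemma approx_exists: "f \<in> L2 \<mu> \<Longrightarrow> \<exists>\<phi>. approx \<phi> f"
  using X.resolvent_range_dense[OF marg_L2 m_pos U_lower, of f] unfolding approx_def R_def[abs_def] by blast

lemma Cck32: "\<phi> \<in> Cck 3 \<Longrightarrow> \<phi> \<in> Cck 2" and Cck31: "\<phi> \<in> Cck 3 \<Longrightarrow> \<phi> \<in> Cck 1"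
  by (auto intro: Cck_mono)

lemma T_diff_bound:
  assumes "\<phi> \<in> Cck 3" "\<psi> \<in> Cck 3"
  shows "l2norm \<mu> (\<lambda>z. T \<phi> z - T \<psi> z) \<le> l2norm \<mu>x (\<lambda>x. R \<phi> x - R \<psi> x) / (2 * sqrt m)"
  using T_bound[of "\<lambda>x. \<phi> x + - 1 * \<psi> x"] assms Cck_add[of \<phi> 2 "\<lambda>x. - 1 * \<psi> x"] Cck_cmult[of \<psi> 2 "- 1"]
    R_lincomb[of \<phi> \<psi> "- 1"] T_lincomb[of \<phi> \<psi> "- 1"] by (simp add: Cck32)

lemma approx_T_convergent:
  assumes a: "approx \<phi> f"
  shows "\<exists>g. L2_tendsto \<mu> (\<lambda>n. T (\<phi> n)) g"
proof (rule L2_Cauchy_convergent[OF M.prob_space_axioms])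
  have \<phi>: "\<phi> n \<in> Cck 3" for n using a by (simp add: approx_def)
  show "T (\<phi> n) \<in> L2 \<mu>" for n by (rule T_L2[OF Cck31[OF \<phi>]])
  have t: "L2_tendsto \<mu>x (\<lambda>n. R (\<phi> n)) (marg f)" using a by (simp add: approx_def)
  note tL = L2_tendsto_L2[OF t]
  fix e :: real assume e: "0 < e"
  then have e': "0 < e * sqrt m" using m_pos by simp
  have "(\<lambda>n. l2norm \<mu>x (\<lambda>x. R (\<phi> n) x - marg f x)) \<longlonglongrightarrow> 0" using t by (simp add: L2_tendsto_def)
  from LIMSEQ_D[OF this e'] obtain N where N: "\<And>n. N \<le> n \<Longrightarrow> l2norm \<mu>x (\<lambda>x. R (\<phi> n) x - marg f x) < e * sqrt m" by auto
  show "\<exists>N. \<forall>i\<ge>N. \<forall>j\<ge>N. l2norm \<mu> (\<lambda>z. T (\<phi> i) z - T (\<phi> j) z) < e"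
  proof (intro exI allI impI)
    fix i j assume ij: "N \<le> i" "N \<le> j"
    have "l2norm \<mu>x (\<lambda>x. R (\<phi> i) x - R (\<phi> j) x) \<le> l2norm \<mu>x (\<lambda>x. R (\<phi> i) x - marg f x) + l2norm \<mu>x (\<lambda>x. marg f x - R (\<phi> j) x)"
      by (rule l2norm_triangle3[OF tL(1) tL(1) tL(2)])
    also have "\<dots> < 2 * (e * sqrt m)"
      using N[OF ij(1)] N[OF ij(2)] l2norm_minus_commute[of \<mu>x "marg f" "R (\<phi> j)"] by simp
    finally have "l2norm \<mu>x (\<lambda>x. R (\<phi> i) x - R (\<phi> j) x) / (2 * sqrt m) < e" using m_pos by (simp add: field_simps)
    then show "l2norm \<mu> (\<lambda>z. T (\<phi> i) z - T (\<phi> j) z) < e"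
      using T_diff_bound[OF \<phi> \<phi>, of i j] by simp
  qed
qed

text \<open>\<open>G f\<close> was chosen along one approximating sequence. Any other has residuals
  with the same limit, and \<open>T_diff_bound\<close> carries this over to the images under
  \<open>T\<close>, so the limit does not depend on the choice.\<close>

lemma G_lim:
  assumes a: "approx \<phi> f"
  shows "L2_tendsto \<mu> (\<lambda>n. T (\<phi> n)) (G f)"
proof -
  obtain g where "L2_tendsto \<mu> (\<lambda>n. T (\<phi> n)) g" using approx_T_convergent[OF a] by blast
  then have "\<exists>g \<phi>. approx \<phi> f \<and> L2_tendsto \<mu> (\<lambda>n. T (\<phi> n)) g" using a by blast
  then have "\<exists>\<psi>. approx \<psi> f \<and> L2_tendsto \<mu> (\<lambda>n. T (\<psi> n)) (G f)"
    unfolding G_def by (rule someI_ex)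
  then obtain \<psi> where \<psi>: "approx \<psi> f" "L2_tendsto \<mu> (\<lambda>n. T (\<psi> n)) (G f)" by blast
  have C: "\<phi> n \<in> Cck 3" "\<psi> n \<in> Cck 3" for n using a \<psi>(1) by (auto simp: approx_def)
  have TL: "T (\<phi> n) \<in> L2 \<mu>" "T (\<psi> n) \<in> L2 \<mu>" for n by (intro T_L2 Cck31 C)+
  note GL = L2_tendsto_L2(2)[OF \<psi>(2)]
  have "L2_tendsto \<mu>x (\<lambda>n x. R (\<phi> n) x + - 1 * R (\<psi> n) x) (\<lambda>x. marg f x + - 1 * marg f x)"
    using a \<psi>(1) by (intro L2_tendsto_lincomb) (auto simp: approx_def)
  from L2_tendsto_norm[OF this]
  have r: "(\<lambda>n. l2norm \<mu>x (\<lambda>x. R (\<phi> n) x - R (\<psi> n) x)) \<longlonglongrightarrow> 0" by simp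
  show ?thesis
  proof (rule L2_tendstoI[OF TL(1) GL], rule Lim_null_comparison)
    show "(\<lambda>n. l2norm \<mu>x (\<lambda>x. R (\<phi> n) x - R (\<psi> n) x) / (2 * sqrt m) + l2norm \<mu> (\<lambda>z. T (\<psi> n) z - G f z)) \<longlonglongrightarrow> 0"
      using tendsto_add[OF tendsto_divide[OF r tendsto_const[of "2 * sqrt m"]], of "\<lambda>n. l2norm \<mu> (\<lambda>z. T (\<psi> n) z - G f z)" 0] \<psi>(2) m_pos
      by (simp add: L2_tendsto_def)
    show "\<forall>\<^sub>F n in sequentially. norm (l2norm \<mu> (\<lambda>z. T (\<phi> n) z - G f z))
        \<le> l2norm \<mu>x (\<lambda>x. R (\<phi> n) x - R (\<psi> n) x) / (2 * sqrt m) + l2norm \<mu> (\<lambda>z. T (\<psi> n) z - G f z)"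
    proof (rule always_eventually, rule allI)
      fix n
      show "norm (l2norm \<mu> (\<lambda>z. T (\<phi> n) z - G f z))
        \<le> l2norm \<mu>x (\<lambda>x. R (\<phi> n) x - R (\<psi> n) x) / (2 * sqrt m) + l2norm \<mu> (\<lambda>z. T (\<psi> n) z - G f z)"
        using l2norm_triangle3[OF TL(1) GL TL(2), of n n] T_diff_bound[OF C(1) C(2), of n n] by simp
    qed
  qed
qed

lemma G_L2: "f \<in> L2 \<mu> \<Longrightarrow> G f \<in> L2 \<mu>"
  using approx_exists[of f] G_lim L2_tendsto_L2(2) by blast

lemma G_norm:
  assumes f: "f \<in> L2 \<mu>"
  shows "l2norm \<mu> (G f) \<le> l2norm \<mu> f / (2 * sqrt m)"
proof -
  obtain \<phi> where \<phi>: "approx \<phi> f" using approx_exists[OF f] by blast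
  have "l2norm \<mu> (G f) \<le> l2norm \<mu>x (marg f) / (2 * sqrt m)"
  proof (rule LIMSEQ_le)
    show "(\<lambda>n. l2norm \<mu> (T (\<phi> n))) \<longlonglongrightarrow> l2norm \<mu> (G f)" by (rule L2_tendsto_norm[OF G_lim[OF \<phi>]])
    show "(\<lambda>n. l2norm \<mu>x (R (\<phi> n)) / (2 * sqrt m)) \<longlonglongrightarrow> l2norm \<mu>x (marg f) / (2 * sqrt m)"
      using \<phi> m_pos by (intro tendsto_divide tendsto_const L2_tendsto_norm) (auto simp: approx_def)
    show "\<exists>N. \<forall>n\<ge>N. l2norm \<mu> (T (\<phi> n)) \<le> l2norm \<mu>x (R (\<phi> n)) / (2 * sqrt m)"
      using \<phi> by (auto simp: approx_def intro!: T_bound Cck32)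
  qed
  also have "\<dots> \<le> l2norm \<mu> f / (2 * sqrt m)"
    using marg_norm_le[OF f] m_pos by (intro divide_right_mono) (auto simp: l2norm_eq_ip)
  finally show ?thesis .
qed

text \<open>The choice in \<open>G\<close> fixes values only up to null sets, so linearity is stated
  after pairing with \<open>h\<close>, as the energy needs it.\<close>

lemma G_lincomb:
  assumes f: "f \<in> L2 \<mu>" and g: "g \<in> L2 \<mu>" and h: "h \<in> L2 \<mu>"
  shows "ip \<mu> h (G (\<lambda>z. f z + c * g z)) = ip \<mu> h (G f) + c * ip \<mu> h (G g)"
proof -
  obtain \<phi> \<psi> where \<phi>: "approx \<phi> f" and \<psi>: "approx \<psi> g" using approx_exists f g by blast
  have C: "\<phi> n \<in> Cck 3" "\<psi> n \<in> Cck 3" for n using \<phi> \<psi> by (auto simp: approx_def)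
  have fg: "(\<lambda>z. f z + c * g z) \<in> L2 \<mu>" by (intro L2_add L2_cmult f g)
  have t: "L2_tendsto \<mu>x (\<lambda>n x. R (\<phi> n) x + c * R (\<psi> n) x) (\<lambda>x. marg f x + c * marg g x)"
    using \<phi> \<psi> by (intro L2_tendsto_lincomb) (auto simp: approx_def)
  note mL = marg_L2[OF fg] L2_tendsto_L2[OF t]
  have "L2_tendsto \<mu>x (\<lambda>n x. R (\<phi> n) x + c * R (\<psi> n) x) (marg (\<lambda>z. f z + c * g z))"
  proof (rule L2_tendstoI[OF mL(2,1)], rule Lim_null_comparison)
    show "(\<lambda>n. l2norm \<mu>x (\<lambda>x. R (\<phi> n) x + c * R (\<psi> n) x - (marg f x + c * marg g x))) \<longlonglongrightarrow> 0"
      using t by (simp add: L2_tendsto_def)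
    show "\<forall>\<^sub>F n in sequentially. norm (l2norm \<mu>x (\<lambda>x. R (\<phi> n) x + c * R (\<psi> n) x - marg (\<lambda>z. f z + c * g z) x))
        \<le> l2norm \<mu>x (\<lambda>x. R (\<phi> n) x + c * R (\<psi> n) x - (marg f x + c * marg g x))"
      using l2norm_triangle3[OF mL(2) mL(1) mL(3)] marg_lincomb[OF f g, of c]
      by (intro always_eventually allI) (simp add: l2norm_minus_commute[of \<mu>x "\<lambda>x. marg f x + c * marg g x"])
  qed
  then have "approx (\<lambda>n x. \<phi> n x + c * \<psi> n x) (\<lambda>z. f z + c * g z)"
    using C by (auto simp: approx_def R_lincomb Cck32 intro!: Cck_add Cck_cmult)
  from L2_tendsto_ip[OF L2_tendsto_const[OF h] G_lim[OF this]]
  have "(\<lambda>n. ip \<mu> h (T (\<lambda>x. \<phi> n x + c * \<psi> n x))) \<longlonglongrightarrow> ip \<mu> h (G (\<lambda>z. f z + c * g z))" .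
  moreover have "ip \<mu> h (T (\<lambda>x. \<phi> n x + c * \<psi> n x)) = ip \<mu> h (T (\<phi> n)) + c * ip \<mu> h (T (\<psi> n))" for n
    using h T_L2[OF Cck31[OF C(1)], of n] T_L2[OF Cck31[OF C(2)], of n] C
    by (simp add: T_lincomb Cck32 ip_add_right L2_cmult ip_cmult_right)
  moreover have "(\<lambda>n. ip \<mu> h (T (\<phi> n)) + c * ip \<mu> h (T (\<psi> n))) \<longlonglongrightarrow> ip \<mu> h (G f) + c * ip \<mu> h (G g)"
    by (intro tendsto_add tendsto_mult tendsto_const L2_tendsto_ip[OF L2_tendsto_const[OF h]] G_lim \<phi> \<psi>)
  ultimately show ?thesis by (simp add: LIMSEQ_unique)
qed

text \<open>If \<open>R \<psi>\<close> is the marginal of \<open>L f\<close>, pairing with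
  \<open>\<psi>\<close> gives m |\<psi>|^2 + |grad \<psi>|^2 = - <f, T \<psi>>. The right side is at
  most half of \<open>Dv f\<close> plus half of |grad \<psi>|^2, so the unknown gradient is
  absorbed.\<close>

lemma G_generator_lower:
  assumes f: "f \<in> Cck 2"
  shows "- Dv f \<le> ip \<mu> f (G (L f))"
proof -
  have f1: "f \<in> Cck 1" using f by (rule Cck_mono) simp
  have fL: "f \<in> L2 \<mu>" using f by (rule M.L2_Cck)
  have LL: "L f \<in> L2 \<mu>" by (rule M.L2_Cck[OF L_Cck[OF f]])
  obtain \<psi> where \<psi>: "approx \<psi> (L f)" using approx_exists[OF LL] by blast
  have C: "\<psi> n \<in> Cck 3" for n using \<psi> by (simp add: approx_def)
  have t: "L2_tendsto \<mu>x (\<lambda>n. R (\<psi> n)) (marg (L f))" using \<psi> by (simp add: approx_def)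
  \<comment> \<open>The residual of the approximate equation paired with \<open>\<psi> n\<close>,
    whose norm is at most that of \<open>R (\<psi> n)\<close> divided by \<open>m\<close>.\<close>
  define e where "e n = l2norm \<mu>x (\<lambda>x. R (\<psi> n) x - marg (L f) x) * (l2norm \<mu>x (R (\<psi> n)) / m)" for n
  have e0: "e \<longlonglongrightarrow> 0"
  proof -
    have "e \<longlonglongrightarrow> 0 * (l2norm \<mu>x (marg (L f)) / m)"
      unfolding e_def using t m_pos
      by (intro tendsto_mult tendsto_divide tendsto_const L2_tendsto_norm) (auto simp: L2_tendsto_def)
    then show ?thesis by simp
  qed
  have low: "- Dv f - e n \<le> ip \<mu> f (T (\<psi> n))" for n
  proof -
    note C' = C[of n] Cck32[OF C[of n]] Cck31[OF C[of n]]
    have \<psi>L: "\<psi> n \<in> L2 \<mu>x" by (rule X.L2_Cck[OF C'(1)])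
    have TL: "T (\<psi> n) \<in> L2 \<mu>" by (rule T_L2[OF C'(3)])
    have RL: "R (\<psi> n) \<in> L2 \<mu>x" by (rule R_L2[OF C'(2)])
    have dc: "\<psi> n differentiable at x" for x using C'(3) by (auto simp: Cck_def intro: Ck_differentiable)
    have p0: "pd (\<lambda>z::'a\<times>'a. \<psi> n (fst z)) (0, i) = (\<lambda>z. 0)" for i
      by (rule ext) (simp add: pd_fst[OF dc] dc)
    have "ip \<mu> (L f) (\<lambda>z. \<psi> n (fst z)) = - ip \<mu> f (T (\<psi> n))"
      using ip_L[OF f Ck_fst[OF CckD(1)[OF C'(3)]] L2_fst[OF \<psi>L]]
      by (simp add: A_fst[OF C'(3)] p0 ip_def[of _ _ "\<lambda>z. 0"])
    then have 1: "ip \<mu>x (marg (L f)) (\<psi> n) = - ip \<mu> f (T (\<psi> n))"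
      using ip_marg[OF LL \<psi>L] by simp
    have "ip \<mu>x (R (\<psi> n)) (\<psi> n) - ip \<mu>x (marg (L f)) (\<psi> n) = ip \<mu>x (\<lambda>x. R (\<psi> n) x - marg (L f) x) (\<psi> n)"
      using RL marg_L2[OF LL] \<psi>L by (simp add: ip_diff_left)
    also have "\<dots> \<le> l2norm \<mu>x (\<lambda>x. R (\<psi> n) x - marg (L f) x) * l2norm \<mu>x (\<psi> n)"
      by (intro ip_le L2_diff RL marg_L2 LL \<psi>L)
    also have "\<dots> \<le> e n"
    proof -
      have "(m * l2norm \<mu>x (\<psi> n))\<^sup>2 \<le> (l2norm \<mu>x (R (\<psi> n)))\<^sup>2"
        using R_bounds(3)[OF C'(2)] by (simp add: power_mult_distrib l2norm_sq)
      then have "m * l2norm \<mu>x (\<psi> n) \<le> l2norm \<mu>x (R (\<psi> n))" by (rule power2_le_imp_le) simp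
      then have "l2norm \<mu>x (\<psi> n) \<le> l2norm \<mu>x (R (\<psi> n)) / m" using m_pos by (simp add: field_simps)
      then show ?thesis unfolding e_def by (intro mult_left_mono) auto
    qed
    finally have "m * ip \<mu>x (\<psi> n) (\<psi> n) + grad_sq (\<psi> n) + ip \<mu> f (T (\<psi> n)) \<le> e n"
      using 1 R_expand(3)[OF C'(2)] by simp
    moreover have "0 \<le> m * ip \<mu>x (\<psi> n) (\<psi> n)" using m_pos by (intro mult_nonneg_nonneg ip_self_nonneg) simp
    ultimately have 2: "grad_sq (\<psi> n) + ip \<mu> f (T (\<psi> n)) \<le> e n" by linarith
    have pL: "pd f (0, i) \<in> L2 \<mu>" if "i \<in> Basis" for i
      using Cck_pd'[OF f1, of 0 "(0, i)"] that by (auto intro: M.L2_Cck Basis_prod_mem)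
    have c: "pd (\<psi> n) i \<in> Cck 2" if "i \<in> Basis" for i using Cck_pd'[OF C'(1), of 2 i] that by auto
    \<comment> \<open>Young's inequality with weight 1, so that exactly one copy of
      \<open>grad_sq (\<psi> n)\<close> appears, to be eliminated with fact
      \<open>2\<close>.\<close>
    have "- 2 * ip \<mu> f (T (\<psi> n)) = (\<Sum>i\<in>Basis. 2 * ip \<mu> (\<lambda>z. - 1 * pd f (0, i) z) (\<lambda>z. pd (\<psi> n) i (fst z)))"
      unfolding ip_T[OF f1 C'(2)] ip_cmult_left by (simp add: sum_distrib_left)
    also have "\<dots> \<le> (\<Sum>i\<in>Basis. ip \<mu> (pd f (0, i)) (pd f (0, i)) + ip \<mu>x (pd (\<psi> n) i) (pd (\<psi> n) i))"
    proof (rule sum_mono)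
      fix i :: 'a assume i: "i \<in> Basis"
      have "2 * ip \<mu> (\<lambda>z. - 1 * pd f (0, i) z) (\<lambda>z. pd (\<psi> n) i (fst z))
          \<le> 1 * ip \<mu> (\<lambda>z. - 1 * pd f (0, i) z) (\<lambda>z. - 1 * pd f (0, i) z) + ip \<mu> (\<lambda>z. pd (\<psi> n) i (fst z)) (\<lambda>z. pd (\<psi> n) i (fst z)) / 1"
        by (intro ip_amgm L2_cmult pL i L2_fst X.L2_Cck[OF c[OF i]]) simp
      also have "ip \<mu> (\<lambda>z. pd (\<psi> n) i (fst z)) (\<lambda>z. pd (\<psi> n) i (fst z)) = ip \<mu>x (pd (\<psi> n) i) (pd (\<psi> n) i)"
        by (intro ip_fst Cck_measurable[OF c[OF i]])
      finally show "2 * ip \<mu> (\<lambda>z. - 1 * pd f (0, i) z) (\<lambda>z. pd (\<psi> n) i (fst z)) \<le> ip \<mu> (pd f (0, i)) (pd f (0, i)) + ip \<mu>x (pd (\<psi> n) i) (pd (\<psi> n) i)"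
        by (simp only: ip_cmult_left ip_cmult_right)
    qed
    also have "\<dots> = Dv f + grad_sq (\<psi> n)" by (simp add: Dv_def grad_sq_def sum.distrib)
    finally show ?thesis using 2 by linarith
  qed
  show ?thesis
  proof (rule LIMSEQ_le[OF _ L2_tendsto_ip[OF L2_tendsto_const[OF fL] G_lim[OF \<psi>]]])
    show "(\<lambda>n. - Dv f - e n) \<longlonglongrightarrow> - Dv f" using tendsto_diff[OF tendsto_const[of "- Dv f"] e0] by simp
  qed (use low in blast)
qed

text \<open>By \<open>ip_L_T\<close> the pairing splits into <f, H \<phi>>, close to <R \<phi>, H
  \<phi>>, and a second-order term. Half of the first absorbs the second at the price of velocity
  dissipation; the other half is at least a quarter of the squared marginal by the spectral
  gap.\<close>

lemma generator_G_lower: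
  assumes f: "f \<in> Cck 2" and mean: "integral\<^sup>L \<mu> f = 0"
  shows "ip \<mu>x (marg f) (marg f) / 4 - \<kappa> * Dv f / 2 \<le> ip \<mu> (L f) (G f)"
proof -
  have f1: "f \<in> Cck 1" using f by (rule Cck_mono) simp
  have fL: "f \<in> L2 \<mu>" using f by (rule M.L2_Cck)
  have LL: "L f \<in> L2 \<mu>" by (rule M.L2_Cck[OF L_Cck[OF f]])
  have mL: "marg f \<in> L2 \<mu>x" by (rule marg_L2[OF fL])
  obtain \<phi> where \<phi>: "approx \<phi> f" using approx_exists[OF fL] by blast
  have C: "\<phi> n \<in> Cck 3" for n using \<phi> by (simp add: approx_def)
  have t: "L2_tendsto \<mu>x (\<lambda>n. R (\<phi> n)) (marg f)" using \<phi> by (simp add: approx_def)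
  define e where "e n = l2norm \<mu>x (\<lambda>x. marg f x - R (\<phi> n) x) * l2norm \<mu>x (R (\<phi> n))" for n
  have e0: "e \<longlonglongrightarrow> 0"
  proof -
    have "e \<longlonglongrightarrow> 0 * l2norm \<mu>x (marg f)"
      unfolding e_def using t
      by (intro tendsto_mult L2_tendsto_norm) (auto simp: L2_tendsto_def l2norm_minus_commute[of \<mu>x "marg f"])
    then show ?thesis by simp
  qed
  \<comment> \<open>Although \<open>f\<close> has mean zero, \<open>R (\<phi> n)\<close> need not;
    its mean is kept here and disappears in the limit.\<close>
  have low: "(ip \<mu>x (R (\<phi> n)) (R (\<phi> n)) - (ip \<mu>x (R (\<phi> n)) (\<lambda>x. 1))\<^sup>2) / 4 - \<kappa> * Dv f / 2 - e n \<le> ip \<mu> (L f) (T (\<phi> n))" for n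
  proof -
    note C' = C[of n] Cck32[OF C[of n]] Cck31[OF C[of n]]
    \<comment> \<open>This is the pairing of \<open>R (\<phi> n)\<close> with
      \<open>X.H (\<phi> n)\<close>, the quantity that \<open>spectral_gap\<close> compares with the
      squared marginal.\<close>
    define Gn where "Gn = m * grad_sq (\<phi> n) + ip \<mu>x (X.H (\<phi> n)) (X.H (\<phi> n))"
    have HL: "X.H (\<phi> n) \<in> L2 \<mu>x" by (rule H_L2[OF C'(2)])
    have RL: "R (\<phi> n) \<in> L2 \<mu>x" by (rule R_L2[OF C'(2)])
    have "ip \<mu> f (\<lambda>z. X.H (\<phi> n) (fst z)) = ip \<mu>x (marg f) (X.H (\<phi> n))" by (rule ip_marg[OF fL HL])
    also have "\<dots> = Gn + ip \<mu>x (\<lambda>x. marg f x - R (\<phi> n) x) (X.H (\<phi> n))"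
      using mL RL HL R_expand(2)[OF C'(2)] by (simp add: ip_diff_left Gn_def)
    also have "\<dots> \<ge> Gn - e n"
    proof -
      have "\<bar>ip \<mu>x (\<lambda>x. marg f x - R (\<phi> n) x) (X.H (\<phi> n))\<bar> \<le> l2norm \<mu>x (\<lambda>x. marg f x - R (\<phi> n) x) * l2norm \<mu>x (X.H (\<phi> n))"
        by (intro ip_CS L2_diff mL RL HL)
      also have "l2norm \<mu>x (X.H (\<phi> n)) \<le> l2norm \<mu>x (R (\<phi> n))"
        using R_bounds(2)[OF C'(2)] by (simp add: l2norm_eq_ip)
      finally have "\<bar>ip \<mu>x (\<lambda>x. marg f x - R (\<phi> n) x) (X.H (\<phi> n))\<bar> \<le> e n" unfolding e_def by (simp add: mult_left_mono)
      then show ?thesis by linarith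
    qed
    finally have 1: "Gn - e n \<le> ip \<mu> f (\<lambda>z. X.H (\<phi> n) (fst z))" .
    define B where "B j z = (\<Sum>i\<in>Basis. pd (pd (\<phi> n) j) i (fst z) * (snd z \<bullet> i)) + \<gamma> * pd (\<phi> n) j (fst z)" for j and z :: "'a \<times> 'a"
    have pL: "pd f (0, i) \<in> L2 \<mu>" if "i \<in> Basis" for i
      using Cck_pd'[OF f1, of 0 "(0, i)"] that by (auto intro: M.L2_Cck Basis_prod_mem)
    have c1: "pd (\<phi> n) j \<in> Cck 2" if "j \<in> Basis" for j using Cck_pd'[OF C'(1), of 2 j] that by auto
    have c2: "pd (pd (\<phi> n) j) i \<in> Cck 0" if "j \<in> Basis" "i \<in> Basis" for i j using Cck_pd'[OF c1[OF that(1)], of 0 i] that by auto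
    have BL: "B j \<in> L2 \<mu>" and BB: "ip \<mu> (B j) (B j) = (\<Sum>i\<in>Basis. ip \<mu>x (pd (pd (\<phi> n) j) i) (pd (pd (\<phi> n) j) i)) + \<gamma>\<^sup>2 * ip \<mu>x (pd (\<phi> n) j) (pd (\<phi> n) j)"
      if j: "j \<in> Basis" for j
    proof -
      have k: "(\<lambda>x. \<gamma> * pd (\<phi> n) j x) \<in> Cck 0" by (intro Cck_cmult Cck_mono[OF c1[OF j]]) simp
      show "B j \<in> L2 \<mu>" "ip \<mu> (B j) (B j) = (\<Sum>i\<in>Basis. ip \<mu>x (pd (pd (\<phi> n) j) i) (pd (pd (\<phi> n) j) i)) + \<gamma>\<^sup>2 * ip \<mu>x (pd (\<phi> n) j) (pd (\<phi> n) j)"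
        using affine_v_L2[of "pd (pd (\<phi> n) j)", OF c2[OF j] k] unfolding B_def[abs_def]
        by (simp_all add: ip_cmult_left ip_cmult_right power2_eq_square mult.assoc)
    qed
    \<comment> \<open>The weight \<open>\<kappa>\<close> is dictated by
      \<open>second_order_bound\<close>: the squares of the \<open>B j\<close> sum to at most
      \<kappa> Gn, so exactly one \<open>Gn\<close> remains.\<close>
    have "2 * (\<Sum>j\<in>Basis. ip \<mu> (pd f (0, j)) (B j)) \<le> (\<Sum>j\<in>Basis. \<kappa> * ip \<mu> (pd f (0, j)) (pd f (0, j)) + ip \<mu> (B j) (B j) / \<kappa>)"
      unfolding sum_distrib_left by (intro sum_mono ip_amgm pL BL \<kappa>_pos)
    also have "\<dots> = \<kappa> * Dv f + (\<Sum>j\<in>Basis. ip \<mu> (B j) (B j)) / \<kappa>"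
      by (simp add: sum.distrib Dv_def sum_distrib_left sum_divide_distrib)
    also have "(\<Sum>j\<in>Basis. ip \<mu> (B j) (B j)) \<le> \<kappa> * Gn"
      using second_order_bound[OF C'(1)] by (simp add: BB Gn_def)
    finally have 2: "2 * (\<Sum>j\<in>Basis. ip \<mu> (pd f (0, j)) (B j)) \<le> \<kappa> * Dv f + Gn"
      using \<kappa>_pos by (simp add: divide_right_mono)
    have "ip \<mu>x (R (\<phi> n)) (R (\<phi> n)) - (ip \<mu>x (R (\<phi> n)) (\<lambda>x. 1))\<^sup>2 \<le> 2 * Gn"
      using spectral_gap(2)[OF C'(2)] by (simp add: Gn_def ip_def[of _ _ "\<lambda>x. 1"])
    moreover have "ip \<mu> (L f) (T (\<phi> n)) = ip \<mu> f (\<lambda>z. X.H (\<phi> n) (fst z)) - (\<Sum>j\<in>Basis. ip \<mu> (pd f (0, j)) (B j))"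
      using ip_L_T[OF f C'(1)] by (simp add: B_def[abs_def])
    moreover have "(r - k) / 4 - d / 2 - e' \<le> l" if "r - k \<le> 2 * g" "l = a - s" "g - e' \<le> a" "2 * s \<le> d + g" for r k d e' l g a s :: real
    proof -
      have "(r - k) / 4 \<le> g / 2" "s \<le> d / 2 + g / 2" using that by simp_all
      then show ?thesis using that by linarith
    qed
    ultimately show ?thesis using 1 2 by blast
  qed
  have one: "(\<lambda>x. 1) \<in> L2 \<mu>x" by (rule X.L2_const)
  have "ip \<mu>x (marg f) (\<lambda>x. 1) = 0" using marg_mean[OF fL] mean by (simp add: ip_def)
  then have mean': "(\<lambda>n. ip \<mu>x (R (\<phi> n)) (\<lambda>x. 1)) \<longlonglongrightarrow> 0"
    using L2_tendsto_ip[OF t L2_tendsto_const[OF one]] by simp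
  have "(ip \<mu>x (marg f) (marg f) - 0\<^sup>2) / 4 - \<kappa> * Dv f / 2 - 0 \<le> ip \<mu> (L f) (G f)"
  proof (rule LIMSEQ_le[OF _ L2_tendsto_ip[OF L2_tendsto_const[OF LL] G_lim[OF \<phi>]]])
    show "(\<lambda>n. (ip \<mu>x (R (\<phi> n)) (R (\<phi> n)) - (ip \<mu>x (R (\<phi> n)) (\<lambda>x. 1))\<^sup>2) / 4 - \<kappa> * Dv f / 2 - e n)
      \<longlonglongrightarrow> (ip \<mu>x (marg f) (marg f) - 0\<^sup>2) / 4 - \<kappa> * Dv f / 2 - 0"
      by (intro tendsto_diff tendsto_divide tendsto_const tendsto_power mean' e0 L2_tendsto_ip[OF t t]) simp
  qed (use low in blast)
  then show ?thesis by simp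
qed

section \<open>The modified energy\<close>

text \<open>With this value \<epsilon> \<kappa> / 2 = 3 \<gamma> / 4 - 7 m / (2 \<gamma>), so a
  quarter of the friction survives the second-order cost, while the marginal is dissipated with
  factor m / (2 \<gamma>).\<close>

definition \<epsilon> :: real where
  "\<epsilon> = 2 * m / \<gamma>"

text \<open>Polarised so that the rate of change of the quadratic energy along the flow is twice
  \<open>E f (L f)\<close>; a bounded bilinear form also passes directly to L2 limits.\<close>

definition E :: "('a \<times> 'a \<Rightarrow> real) \<Rightarrow> ('a \<times> 'a \<Rightarrow> real) \<Rightarrow> real" where
  "E f g = ip \<mu> f g / 2 - \<epsilon> / 2 * (ip \<mu> f (G g) + ip \<mu> g (G f))"

lemma E_commute: "E f g = E g f"
  by (simp add: E_def ip_commute[of \<mu> f g])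

lemma E_lincomb:
  assumes "f \<in> L2 \<mu>" "g \<in> L2 \<mu>" "h \<in> L2 \<mu>"
  shows "E (\<lambda>z. f z + c * g z) h = E f h + c * E g h"
  using assms G_L2[OF assms(3)]
  by (simp add: E_def G_lincomb ip_add_left ip_cmult_left L2_cmult) (simp add: field_simps)

text \<open>Since \<gamma> >= 4 sqrt m, the product is sqrt m / \<gamma> <= 1/4. Together with
  \<open>G_norm\<close> the correction changes half the squared norm by at most a quarter of
  it.\<close>

lemma \<epsilon>_bound: "0 < \<epsilon>" "\<epsilon> * (1 / (2 * sqrt m)) \<le> 1 / 4"
proof -
  show "0 < \<epsilon>" using m_pos \<gamma>_pos by (simp add: \<epsilon>_def)
  have "(4 * sqrt m)\<^sup>2 \<le> \<gamma>\<^sup>2" using m_pos K_nonneg by (simp add: \<gamma>_sq power_mult_distrib)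
  then have g: "4 * sqrt m \<le> \<gamma>" by (rule power2_le_imp_le) (use \<gamma>_pos in simp)
  have "\<epsilon> * (1 / (2 * sqrt m)) = (sqrt m * sqrt m) / (\<gamma> * sqrt m)" using m_pos by (simp add: \<epsilon>_def)
  also have "\<dots> = sqrt m / \<gamma>" using m_pos by (intro nonzero_mult_divide_mult_cancel_right) simp
  also have "\<dots> \<le> 1 / 4" using g \<gamma>_pos by (simp add: field_simps)
  finally show "\<epsilon> * (1 / (2 * sqrt m)) \<le> 1 / 4" .
qed

lemma G_ip_bound:
  assumes "f \<in> L2 \<mu>" "g \<in> L2 \<mu>"
  shows "\<epsilon> * \<bar>ip \<mu> f (G g)\<bar> \<le> l2norm \<mu> f * l2norm \<mu> g / 4"
proof -
  have "\<bar>ip \<mu> f (G g)\<bar> \<le> l2norm \<mu> f * l2norm \<mu> (G g)" by (intro ip_CS G_L2 assms)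
  also have "\<dots> \<le> l2norm \<mu> f * (l2norm \<mu> g / (2 * sqrt m))" by (intro mult_left_mono G_norm assms) simp
  finally have "\<epsilon> * \<bar>ip \<mu> f (G g)\<bar> \<le> \<epsilon> * (l2norm \<mu> f * (l2norm \<mu> g / (2 * sqrt m)))"
    using \<epsilon>_bound(1) by (intro mult_left_mono) auto
  also have "\<dots> = (\<epsilon> * (1 / (2 * sqrt m))) * (l2norm \<mu> f * l2norm \<mu> g)" by simp
  also have "\<dots> \<le> (1 / 4) * (l2norm \<mu> f * l2norm \<mu> g)" by (intro mult_right_mono \<epsilon>_bound) simp
  finally show ?thesis by simp
qed

lemma E_bounded:
  assumes "f \<in> L2 \<mu>" "g \<in> L2 \<mu>"
  shows "\<bar>E f g\<bar> \<le> 3 / 4 * (l2norm \<mu> f * l2norm \<mu> g)"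
proof -
  have "\<epsilon> * \<bar>ip \<mu> f (G g)\<bar> = \<bar>\<epsilon> * ip \<mu> f (G g)\<bar>" "\<epsilon> * \<bar>ip \<mu> g (G f)\<bar> = \<bar>\<epsilon> * ip \<mu> g (G f)\<bar>"
    using \<epsilon>_bound(1) by (simp_all add: abs_mult)
  moreover have "E f g = ip \<mu> f g / 2 - (\<epsilon> * ip \<mu> f (G g)) / 2 - (\<epsilon> * ip \<mu> g (G f)) / 2"
    by (simp add: E_def algebra_simps)
  moreover have "l2norm \<mu> g * l2norm \<mu> f = l2norm \<mu> f * l2norm \<mu> g" by simp
  ultimately show ?thesis
    using G_ip_bound[OF assms] G_ip_bound[OF assms(2,1)] ip_CS[OF assms] by linarith
qed

lemma E_lower:
  assumes "f \<in> L2 \<mu>"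
  shows "(l2norm \<mu> f)\<^sup>2 / 4 \<le> E f f"
proof -
  have "\<epsilon> * ip \<mu> f (G f) \<le> \<epsilon> * \<bar>ip \<mu> f (G f)\<bar>" using \<epsilon>_bound(1) by (intro mult_left_mono) auto
  moreover have "E f f = (l2norm \<mu> f)\<^sup>2 / 2 - \<epsilon> * ip \<mu> f (G f)" by (simp add: E_def l2norm_sq)
  ultimately show ?thesis
    using G_ip_bound[OF assms assms] by (simp add: power2_eq_square)
qed

theorem E_dissipation:
  assumes f: "f \<in> Cck 2" and mean: "integral\<^sup>L \<mu> f = 0"
  shows "E f (L f) \<le> - (m / (3 * \<gamma>)) * E f f"
proof -
  have fL: "f \<in> L2 \<mu>" using f by (rule M.L2_Cck)
  define D where "D = Dv f"
  define P where "P = ip \<mu>x (marg f) (marg f)"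
  have D0: "0 \<le> D" unfolding D_def by (rule Dv_nonneg)
  have nf: "ip \<mu> f f \<le> P + 2 * D"
    unfolding pythagoras[OF fL] P_def D_def using velocity_poincare[OF Cck_mono[OF f]] by simp
  have "2 * E f (L f) = - \<gamma> * D - \<epsilon> * ip \<mu> f (G (L f)) - \<epsilon> * ip \<mu> (L f) (G f)"
    using dissipation[OF f] by (simp add: E_def D_def ip_commute[of \<mu> f "L f"] algebra_simps)
  also have "\<dots> \<le> - \<gamma> * D + \<epsilon> * D - \<epsilon> * (P / 4 - \<kappa> * D / 2)"
  proof -
    have "\<epsilon> * (- D) \<le> \<epsilon> * ip \<mu> f (G (L f))" "\<epsilon> * (P / 4 - \<kappa> * D / 2) \<le> \<epsilon> * ip \<mu> (L f) (G f)"
      using \<epsilon>_bound(1) G_generator_lower[OF f] generator_G_lower[OF f mean] unfolding D_def P_def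
      by (intro mult_left_mono; simp)+
    then show ?thesis by linarith
  qed
  \<comment> \<open>The coefficient of \<open>D\<close> is - \<gamma> + 2 m / \<gamma> + (3 \<gamma>
    / 4 - 7 m / (2 \<gamma>)).\<close>
  also have "\<dots> = - (\<gamma> / 4 + 3 * m / (2 * \<gamma>)) * D - m / (2 * \<gamma>) * P"
    using m_pos \<gamma>_pos by (simp add: \<epsilon>_def \<kappa>_def field_simps power2_eq_square)
  \<comment> \<open>The coefficient of \<open>D\<close> exceeds m / \<gamma>, which leaves room for
    the constant 2 in the velocity inequality.\<close>
  also have "\<dots> \<le> - (m / (2 * \<gamma>)) * (P + 2 * D)"
  proof -
    define a where "a = \<gamma> / 4 + 3 * m / (2 * \<gamma>)"
    define b' where "b' = m / (2 * \<gamma>)"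
    have "b' * 2 \<le> a" using m_pos \<gamma>_pos by (simp add: a_def b'_def field_simps)
    from mult_right_mono[OF this D0] have "- a * D - b' * P \<le> - b' * (P + 2 * D)"
      by (simp add: algebra_simps)
    then show ?thesis by (simp add: a_def b'_def)
  qed
  also have "\<dots> \<le> - (m / (2 * \<gamma>)) * ip \<mu> f f"
  proof -
    have "m / (2 * \<gamma>) * ip \<mu> f f \<le> m / (2 * \<gamma>) * (P + 2 * D)"
      using nf m_pos \<gamma>_pos by (intro mult_left_mono) auto
    then show ?thesis by simp
  qed
  \<comment> \<open>The upper bound of the energy by three quarters of the squared norm converts the
    estimate into a closed inequality for the energy.\<close>
  also have "\<dots> \<le> - (m / (2 * \<gamma>)) * (4 / 3 * E f f)"
  proof -
    have "4 / 3 * E f f \<le> ip \<mu> f f"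
      using E_bounded[OF fL fL] by (simp add: l2norm_sq[symmetric] power2_eq_square)
    then have "m / (2 * \<gamma>) * (4 / 3 * E f f) \<le> m / (2 * \<gamma>) * ip \<mu> f f"
      using m_pos \<gamma>_pos by (intro mult_left_mono) auto
    then show ?thesis by simp
  qed
  also have "- (m / (2 * \<gamma>)) * (4 / 3 * E f f) = 2 * (- (m / (3 * \<gamma>)) * E f f)" by simp
  finally show ?thesis by linarith
qed

end

section \<open>Exponential decay along a contraction semigroup\<close>

lemma L2_0D: "f \<in> L2_0 M \<Longrightarrow> f \<in> L2 M" "f \<in> L2_0 M \<Longrightarrow> integral\<^sup>L M f = 0"
  by (auto simp: L2_0_def)

locale L2_semigroup = prob_space M for M :: "'b measure" +
  fixes T :: "real \<Rightarrow> ('b \<Rightarrow> real) \<Rightarrow> 'b \<Rightarrow> real"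
  assumes sg: "contraction_semigroup_L2_0 M T"
begin

lemma T_L2_0: "0 \<le> t \<Longrightarrow> f \<in> L2_0 M \<Longrightarrow> T t f \<in> L2_0 M"
  and T_0: "f \<in> L2_0 M \<Longrightarrow> l2norm M (\<lambda>z. T 0 f z - f z) = 0"
  and T_plus: "0 \<le> s \<Longrightarrow> 0 \<le> t \<Longrightarrow> f \<in> L2_0 M \<Longrightarrow> l2norm M (\<lambda>z. T (s + t) f z - T s (T t f) z) = 0"
  and T_lin: "0 \<le> t \<Longrightarrow> f \<in> L2_0 M \<Longrightarrow> g \<in> L2_0 M \<Longrightarrow>
         l2norm M (\<lambda>z. T t (\<lambda>y. a * f y + b * g y) z - (a * T t f z + b * T t g z)) = 0"
  and T_contr: "0 \<le> t \<Longrightarrow> f \<in> L2_0 M \<Longrightarrow> l2norm M (T t f) \<le> l2norm M f"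
  using sg unfolding contraction_semigroup_L2_0_def by blast+

lemma L2_integrable: "f \<in> L2 M \<Longrightarrow> integrable M f"
  using L2_integrable_mult[of f M "\<lambda>z. 1"] by (simp add: L2_def)

lemma L2_0_lincomb: "f \<in> L2_0 M \<Longrightarrow> g \<in> L2_0 M \<Longrightarrow> (\<lambda>z. a * f z + b * g z) \<in> L2_0 M"
  using L2_integrable[of f] L2_integrable[of g] by (auto simp: L2_0_def intro!: L2_add L2_cmult)

text \<open>The semigroup acts on functions, so its laws hold only up to null sets; chaining them
  replaces rewriting by equations.\<close>

lemma norm_null_trans:
  assumes "f \<in> L2 M" "g \<in> L2 M" "h \<in> L2 M" "l2norm M (\<lambda>z. f z - g z) = 0" "l2norm M (\<lambda>z. g z - h z) = 0"
  shows "l2norm M (\<lambda>z. f z - h z) = 0"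
  using l2norm_triangle3[OF assms(1,3,2)] assms(4,5) l2norm_nonneg[of M "\<lambda>z. f z - h z"] by linarith

text \<open>The generator relation is transported along the flow, with the same modulus of convergence.\<close>

lemma T_increment:
  assumes f: "f \<in> L2_0 M" and g: "g \<in> L2_0 M" and s: "0 \<le> s" and h: "0 < h"
  defines "r \<equiv> \<lambda>z. (T h f z - f z) / h - g z"
  shows "r \<in> L2_0 M"
    and "l2norm M (\<lambda>z. T (s + h) f z - (T s f z + h * (T s g z + T s r z))) = 0"
proof -
  have Th: "T h f \<in> L2_0 M" using f h by (intro T_L2_0) auto
  have "r = (\<lambda>z. 1 * ((1 / h) * T h f z + (- 1 / h) * f z) + (- 1) * g z)"
    using h by (auto simp: r_def field_simps)
  also have "\<dots> \<in> L2_0 M" by (intro L2_0_lincomb Th f g)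
  finally show r: "r \<in> L2_0 M" .
  have gr: "(\<lambda>z. 1 * g z + 1 * r z) \<in> L2_0 M" by (intro L2_0_lincomb g r)
  have eq: "T h f = (\<lambda>z. 1 * f z + h * (1 * g z + 1 * r z))" using h by (auto simp: r_def field_simps)
  note L = L2_0D(1)[OF T_L2_0[OF s f]] L2_0D(1)[OF T_L2_0[OF s g]] L2_0D(1)[OF T_L2_0[OF s r]] L2_0D(1)[OF T_L2_0[OF s gr]]
  have 1: "l2norm M (\<lambda>z. T (s + h) f z - T s (T h f) z) = 0" using s h f by (intro T_plus) auto
  have 2: "l2norm M (\<lambda>z. T s (T h f) z - (1 * T s f z + h * T s (\<lambda>z. 1 * g z + 1 * r z) z)) = 0"
    unfolding eq by (rule T_lin[OF s f gr])
  have 3: "l2norm M (\<lambda>z. (1 * T s f z + h * T s (\<lambda>z. 1 * g z + 1 * r z) z) - (T s f z + h * (T s g z + T s r z))) = 0"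
  proof -
    have "l2norm M (\<lambda>z. (1 * T s f z + h * T s (\<lambda>z. 1 * g z + 1 * r z) z) - (T s f z + h * (T s g z + T s r z)))
      = l2norm M (\<lambda>z. h * (T s (\<lambda>z. 1 * g z + 1 * r z) z - (1 * T s g z + 1 * T s r z)))"
      by (simp add: algebra_simps)
    also have "\<dots> = 0" unfolding l2norm_cmult T_lin[OF s g r] by simp
    finally show ?thesis .
  qed
  have a: "T (s + h) f \<in> L2 M" "T s (T h f) \<in> L2 M"
    using T_L2_0 s h f Th by (auto intro!: L2_0D(1))
  have b: "(\<lambda>z. 1 * T s f z + h * T s (\<lambda>z. 1 * g z + 1 * r z) z) \<in> L2 M" by (intro L2_add L2_cmult L)
  have c: "(\<lambda>z. T s f z + h * (T s g z + T s r z)) \<in> L2 M" by (intro L2_add L2_cmult L)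
  show "l2norm M (\<lambda>z. T (s + h) f z - (T s f z + h * (T s g z + T s r z))) = 0"
    by (rule norm_null_trans[OF a(1) b c norm_null_trans[OF a b 1 2] 3])
qed

lemma generator_flow:
  assumes fg: "sg_generator_graph M T f g" and t: "0 \<le> t"
  shows "sg_generator_graph M T (T t f) (T t g)"
proof -
  have f: "f \<in> L2_0 M" and g: "g \<in> L2_0 M"
    and lim: "((\<lambda>h. l2norm M (\<lambda>z. (T h f z - f z) / h - g z)) \<longlongrightarrow> 0) (at_right 0)"
    using fg by (auto simp: sg_generator_graph_def)
  have Tf: "T t f \<in> L2_0 M" and Tg: "T t g \<in> L2_0 M" using t f g by (auto intro: T_L2_0)
  have "((\<lambda>h. l2norm M (\<lambda>z. (T h (T t f) z - T t f z) / h - T t g z)) \<longlongrightarrow> 0) (at_right 0)"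
  proof (rule Lim_null_comparison[OF _ lim])
    have "norm (l2norm M (\<lambda>z. (T h (T t f) z - T t f z) / h - T t g z)) \<le> l2norm M (\<lambda>z. (T h f z - f z) / h - g z)" if h: "0 < h" for h
    proof -
      define r where "r = (\<lambda>z. (T h f z - f z) / h - g z)"
      have r: "r \<in> L2_0 M" unfolding r_def by (rule T_increment(1)[OF f g t h])
      have Tr: "T t r \<in> L2_0 M" by (rule T_L2_0[OF t r])
      note L = L2_0D(1)[OF Tf] L2_0D(1)[OF Tg] L2_0D(1)[OF Tr]
      have A: "T h (T t f) \<in> L2 M" "T (t + h) f \<in> L2 M"
        using t h f Tf by (auto intro!: L2_0D(1) T_L2_0)
      have c: "(\<lambda>z. T t f z + h * (T t g z + T t r z)) \<in> L2 M" by (intro L2_add L2_cmult L)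
      have "l2norm M (\<lambda>z. T (t + h) f z - T h (T t f) z) = 0"
        using T_plus[of h t f] t h f by (simp add: add.commute)
      then have "l2norm M (\<lambda>z. T h (T t f) z - T (t + h) f z) = 0" by (subst l2norm_minus_commute)
      then have z: "l2norm M (\<lambda>z. T h (T t f) z - (T t f z + h * (T t g z + T t r z))) = 0"
        using T_increment(2)[OF f g t h] unfolding r_def[symmetric] by (rule norm_null_trans[OF A c])
      have "(\<lambda>z. (T h (T t f) z - T t f z) / h - T t g z)
          = (\<lambda>z. (1 / h) * (T h (T t f) z - (T t f z + h * (T t g z + T t r z))) + T t r z)"
        using h by (auto simp: field_simps)
      then have "l2norm M (\<lambda>z. (T h (T t f) z - T t f z) / h - T t g z)
          \<le> l2norm M (\<lambda>z. (1 / h) * (T h (T t f) z - (T t f z + h * (T t g z + T t r z)))) + l2norm M (T t r)"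
        using l2norm_triangle[OF L2_cmult[OF L2_diff[OF A(1) c]] L(3), of "1 / h"] by simp
      also have "\<dots> = l2norm M (T t r)" unfolding l2norm_cmult z by simp
      also have "\<dots> \<le> l2norm M r" by (rule T_contr[OF t r])
      finally show ?thesis by (simp add: r_def)
    qed
    then show "\<forall>\<^sub>F h in at_right 0. norm (l2norm M (\<lambda>z. (T h (T t f) z - T t f z) / h - T t g z)) \<le> l2norm M (\<lambda>z. (T h f z - f z) / h - g z)"
      by (auto simp: eventually_at_right_field intro: exI[of _ 1])
  qed
  then show ?thesis using Tf Tg by (simp add: sg_generator_graph_def)
qed

text \<open>A bounded, equivalent quadratic form that is dissipated on a core decays exponentially along
  the semigroup. The decay is obtained from the explicit Euler scheme, whose consistency error is
  uniform in time because the semigroup is contractive.\<close>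

lemma form_decay:
  fixes e :: "('b \<Rightarrow> real) \<Rightarrow> ('b \<Rightarrow> real) \<Rightarrow> real"
  assumes gen: "\<And>f g. sg_generator_graph M T f g \<longleftrightarrow> closure_graph M D A f g"
    and D: "D \<subseteq> L2_0 M" and A: "\<And>f. f \<in> D \<Longrightarrow> A f \<in> L2_0 M"
    and dense: "\<And>f. f \<in> L2_0 M \<Longrightarrow> \<exists>\<phi>. (\<forall>n. \<phi> n \<in> D) \<and> L2_tendsto M \<phi> f"
    and e_lin: "\<And>f g h c. f \<in> L2 M \<Longrightarrow> g \<in> L2 M \<Longrightarrow> h \<in> L2 M \<Longrightarrow> e (\<lambda>z. f z + c * g z) h = e f h + c * e g h"
    and e_sym: "\<And>f g. e f g = e g f"
    and e_bd: "\<And>f g. f \<in> L2 M \<Longrightarrow> g \<in> L2 M \<Longrightarrow> \<bar>e f g\<bar> \<le> C * (l2norm M f * l2norm M g)"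
    and e_pos: "\<And>f. f \<in> L2 M \<Longrightarrow> 0 \<le> e f f"
    and e_diss: "\<And>f. f \<in> D \<Longrightarrow> e f (A f) \<le> - \<Lambda> * e f f"
    and C: "0 \<le> C" and \<Lambda>: "0 \<le> \<Lambda>"
    and f0: "f0 \<in> L2_0 M" and t: "0 \<le> t"
  shows "e (T t f0) (T t f0) \<le> exp (- 2 * \<Lambda> * t) * e f0 f0"
proof -
  have e_diff: "e (\<lambda>z. f z - g z) h = e f h - e g h" if "f \<in> L2 M" "g \<in> L2 M" "h \<in> L2 M" for f g h
    using e_lin[OF that, of "- 1"] by simp
  have e_diff2: "e h (\<lambda>z. f z - g z) = e h f - e h g" if "f \<in> L2 M" "g \<in> L2 M" "h \<in> L2 M" for f g h
    using e_diff[OF that] by (simp add: e_sym[of h])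
  have e_tendsto: "(\<lambda>n. e (f n) (g n)) \<longlonglongrightarrow> e f' g'" if f: "L2_tendsto M f f'" and g: "L2_tendsto M g g'" for f f' g g'
  proof -
    note L = L2_tendsto_L2[OF f] L2_tendsto_L2[OF g]
    have "(\<lambda>n. e (f n) (g n) - e f' g') \<longlonglongrightarrow> 0"
    proof (rule Lim_null_comparison)
      have "(\<lambda>n. C * (l2norm M (\<lambda>z. f n z - f' z) * l2norm M (g n)) + C * (l2norm M f' * l2norm M (\<lambda>z. g n z - g' z)))
          \<longlonglongrightarrow> C * (0 * l2norm M g') + C * (l2norm M f' * 0)"
        using f g by (intro tendsto_add tendsto_mult tendsto_const L2_tendsto_norm) (auto simp: L2_tendsto_def)
      then show "(\<lambda>n. C * (l2norm M (\<lambda>z. f n z - f' z) * l2norm M (g n)) + C * (l2norm M f' * l2norm M (\<lambda>z. g n z - g' z))) \<longlonglongrightarrow> 0"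
        by simp
      have "\<bar>e (f n) (g n) - e f' g'\<bar> \<le> C * (l2norm M (\<lambda>z. f n z - f' z) * l2norm M (g n)) + C * (l2norm M f' * l2norm M (\<lambda>z. g n z - g' z))" for n
      proof -
        have "e (f n) (g n) - e f' g' = e (\<lambda>z. f n z - f' z) (g n) + e f' (\<lambda>z. g n z - g' z)"
          using L by (simp add: e_diff e_diff2)
        then show ?thesis
          using e_bd[OF L2_diff[OF L(1,2)] L(3), of n n] e_bd[OF L(2) L2_diff[OF L(3,4)], of n] by linarith
      qed
      then show "\<forall>\<^sub>F n in sequentially. norm (e (f n) (g n) - e f' g')
          \<le> C * (l2norm M (\<lambda>z. f n z - f' z) * l2norm M (g n)) + C * (l2norm M f' * l2norm M (\<lambda>z. g n z - g' z))" by simp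
    qed
    then show ?thesis by (simp add: LIM_zero_iff)
  qed
  have e_null: "e f f = e g g" if f: "f \<in> L2 M" and g: "g \<in> L2 M" and n: "l2norm M (\<lambda>z. f z - g z) = 0" for f g
  proof -
    have "L2_tendsto M (\<lambda>_. f) g" using f g n by (simp add: L2_tendsto_def)
    from e_tendsto[OF this this] show ?thesis by (simp add: LIMSEQ_const_iff)
  qed
  \<comment> \<open>Continuity of the form carries the dissipation from the core to the whole domain
    of the generator, which the flow preserves by \<open>generator_flow\<close>, while it need not
    preserve the core.\<close>
  have diss: "e f g \<le> - \<Lambda> * e f f" if cl: "closure_graph M D A f g" for f g
  proof -
    obtain \<phi> where \<phi>: "\<And>n. \<phi> n \<in> D" "(\<lambda>n. l2norm M (\<lambda>z. \<phi> n z - f z)) \<longlonglongrightarrow> 0" "(\<lambda>n. l2norm M (\<lambda>z. A (\<phi> n) z - g z)) \<longlonglongrightarrow> 0"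
      and fg: "f \<in> L2_0 M" "g \<in> L2_0 M"
      using cl unfolding closure_graph_def by blast
    have 1: "L2_tendsto M \<phi> f" "L2_tendsto M (\<lambda>n. A (\<phi> n)) g"
      using \<phi> fg D A by (auto simp: L2_tendsto_def intro: L2_0D(1))
    show ?thesis
    proof (rule LIMSEQ_le)
      show "(\<lambda>n. e (\<phi> n) (A (\<phi> n))) \<longlonglongrightarrow> e f g" by (rule e_tendsto[OF 1])
      show "(\<lambda>n. - \<Lambda> * e (\<phi> n) (\<phi> n)) \<longlonglongrightarrow> - \<Lambda> * e f f"
        by (intro tendsto_mult tendsto_const e_tendsto 1)
    qed (use e_diss \<phi>(1) in blast)
  qed
  have core: "e (T t \<phi>) (T t \<phi>) \<le> exp (- 2 * \<Lambda> * t) * e \<phi> \<phi>" if \<phi>D: "\<phi> \<in> D" and t: "0 < t" for \<phi> t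
  proof -
    define g where "g = A \<phi>"
    have \<phi>: "\<phi> \<in> L2_0 M" and g: "g \<in> L2_0 M" using \<phi>D D A by (auto simp: g_def)
    have "closure_graph M D A \<phi> g"
      unfolding closure_graph_def using \<phi> g \<phi>D by (intro conjI exI[of _ "\<lambda>_. \<phi>"]) (auto simp: g_def)
    then have gg: "sg_generator_graph M T \<phi> g" by (simp add: gen)
    define r where "r h = (\<lambda>z. (T h \<phi> z - \<phi> z) / h - g z)" for h
    define \<rho> where "\<rho> h = l2norm M (r h)" for h
    have \<rho>0: "(\<rho> \<longlongrightarrow> 0) (at_right 0)" using gg unfolding sg_generator_graph_def \<rho>_def r_def by simp
    define y where "y s = e (T s \<phi>) (T s \<phi>)" for s
    \<comment> \<open>The consistency error of one Euler step divided by its length. It depends on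
      \<open>\<phi>\<close> and the step only, not on the time at which the step is taken.\<close>
    define \<delta> where "\<delta> h = 2 * C * (l2norm M \<phi> * \<rho> h) + h * (C * (l2norm M g + \<rho> h)\<^sup>2)" for h
    have y0: "0 \<le> y s" if "0 \<le> s" for s
      unfolding y_def by (intro e_pos L2_0D(1) T_L2_0 that \<phi>)
    have step: "y (s + h) \<le> exp (- 2 * \<Lambda> * h) * y s + h * \<delta> h" if s: "0 \<le> s" and h: "0 < h" for s h
    proof -
      have r: "r h \<in> L2_0 M" unfolding r_def by (rule T_increment(1)[OF \<phi> g s h])
      note L = L2_0D(1)[OF T_L2_0[OF s \<phi>]] L2_0D(1)[OF T_L2_0[OF s g]] L2_0D(1)[OF T_L2_0[OF s r]]
      define k where "k = (\<lambda>z. T s g z + T s (r h) z)"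
      have kL: "k \<in> L2 M" unfolding k_def by (intro L2_add L)
      have F: "(\<lambda>z. T s \<phi> z + h * k z) \<in> L2 M" by (intro L2_add L2_cmult L kL)
      have "y (s + h) = e (\<lambda>z. T s \<phi> z + h * k z) (\<lambda>z. T s \<phi> z + h * k z)"
        unfolding y_def
      proof (rule e_null[OF _ F])
        show "T (s + h) \<phi> \<in> L2 M" using s h \<phi> by (intro L2_0D(1) T_L2_0) auto
        show "l2norm M (\<lambda>z. T (s + h) \<phi> z - (T s \<phi> z + h * k z)) = 0"
          unfolding k_def r_def by (rule T_increment(2)[OF \<phi> g s h])
      qed
      also have "\<dots> = y s + 2 * h * e (T s \<phi>) k + h\<^sup>2 * e k k"
      proof -
        have "e (T s \<phi>) (\<lambda>z. T s \<phi> z + h * k z) = y s + h * e (T s \<phi>) k"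
          using e_lin[OF L(1) kL L(1), of h] by (simp only: y_def e_sym[of "T s \<phi>" "\<lambda>z. T s \<phi> z + h * k z"] e_sym[of k "T s \<phi>"])
        moreover have "e k (\<lambda>z. T s \<phi> z + h * k z) = e (T s \<phi>) k + h * e k k"
          using e_lin[OF L(1) kL kL, of h] by (simp only: e_sym[of k "\<lambda>z. T s \<phi> z + h * k z"])
        ultimately show ?thesis
          unfolding e_lin[OF L(1) kL F] by (simp add: power2_eq_square algebra_simps)
      qed
      also have "e (T s \<phi>) k = e (T s \<phi>) (T s g) + e (T s \<phi>) (T s (r h))"
        using e_lin[OF L(2,3,1), of 1] by (simp add: k_def e_sym[of "T s \<phi>"])
      also have "y s + 2 * h * (e (T s \<phi>) (T s g) + e (T s \<phi>) (T s (r h))) + h\<^sup>2 * e k k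
          \<le> y s + 2 * h * (- \<Lambda> * y s + C * (l2norm M \<phi> * \<rho> h)) + h\<^sup>2 * (C * (l2norm M g + \<rho> h)\<^sup>2)"
      proof -
        have n1: "l2norm M (T s \<phi>) \<le> l2norm M \<phi>" "l2norm M (T s g) \<le> l2norm M g" "l2norm M (T s (r h)) \<le> \<rho> h"
          unfolding \<rho>_def by (intro T_contr s \<phi> g r)+
        have a: "e (T s \<phi>) (T s g) \<le> - \<Lambda> * y s"
          unfolding y_def by (rule diss) (use generator_flow[OF gg s] in \<open>simp add: gen\<close>)
        have "e (T s \<phi>) (T s (r h)) \<le> C * (l2norm M (T s \<phi>) * l2norm M (T s (r h)))"
          using e_bd[OF L(1,3)] by linarith
        also have "\<dots> \<le> C * (l2norm M \<phi> * \<rho> h)" using n1 C by (intro mult_left_mono mult_mono) auto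
        finally have b: "e (T s \<phi>) (T s (r h)) \<le> C * (l2norm M \<phi> * \<rho> h)" .
        have nk: "l2norm M k \<le> l2norm M g + \<rho> h"
          using l2norm_triangle[OF L(2,3)] n1 unfolding k_def by linarith
        have "e k k \<le> C * (l2norm M k * l2norm M k)" using e_bd[OF kL kL] by linarith
        also have "\<dots> \<le> C * (l2norm M g + \<rho> h)\<^sup>2"
          unfolding power2_eq_square using nk C by (intro mult_left_mono mult_mono) (auto intro: order_trans[OF l2norm_nonneg])
        finally have c: "e k k \<le> C * (l2norm M g + \<rho> h)\<^sup>2" .
        have "2 * h * (e (T s \<phi>) (T s g) + e (T s \<phi>) (T s (r h))) \<le> 2 * h * (- \<Lambda> * y s + C * (l2norm M \<phi> * \<rho> h))"
          using a b h by (intro mult_left_mono) auto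
        moreover have "h\<^sup>2 * e k k \<le> h\<^sup>2 * (C * (l2norm M g + \<rho> h)\<^sup>2)" using c by (intro mult_left_mono) auto
        ultimately show ?thesis by linarith
      qed
      also have "\<dots> = (1 + (- 2 * \<Lambda> * h)) * y s + h * \<delta> h"
        by (simp add: \<delta>_def power2_eq_square algebra_simps)
      also have "\<dots> \<le> exp (- 2 * \<Lambda> * h) * y s + h * \<delta> h"
        using y0[OF s] exp_ge_add_one_self[of "- 2 * \<Lambda> * h"] by (intro add_right_mono mult_right_mono) auto
      finally show ?thesis .
    qed
    have \<delta>0: "0 \<le> \<delta> h" if "0 < h" for h
      unfolding \<delta>_def \<rho>_def using C that by (intro add_nonneg_nonneg mult_nonneg_nonneg) auto
    \<comment> \<open>The decay factors are at most 1, so earlier errors do not grow and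
      \<open>k\<close> steps accumulate at most k h \<delta>(h).\<close>
    have iter: "y (real k * h) \<le> exp (- 2 * \<Lambda> * (real k * h)) * y 0 + real k * h * \<delta> h" if h: "0 < h" for k h
    proof (induction k)
      case (Suc k)
      have "y (real (Suc k) * h) = y (real k * h + h)" by (simp add: algebra_simps)
      also have "\<dots> \<le> exp (- 2 * \<Lambda> * h) * y (real k * h) + h * \<delta> h" using h by (intro step) auto
      also have "\<dots> \<le> exp (- 2 * \<Lambda> * h) * (exp (- 2 * \<Lambda> * (real k * h)) * y 0 + real k * h * \<delta> h) + h * \<delta> h"
        using Suc by (intro add_right_mono mult_left_mono) auto
      also have "\<dots> \<le> exp (- 2 * \<Lambda> * h) * (exp (- 2 * \<Lambda> * (real k * h)) * y 0) + real k * h * \<delta> h + h * \<delta> h"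
      proof -
        have "exp (- 2 * \<Lambda> * h) * (real k * h * \<delta> h) \<le> 1 * (real k * h * \<delta> h)"
          using h \<Lambda> \<delta>0[OF h] by (intro mult_right_mono) auto
        then show ?thesis by (simp add: distrib_left)
      qed
      also have "exp (- 2 * \<Lambda> * h) * (exp (- 2 * \<Lambda> * (real k * h)) * y 0) = exp (- 2 * \<Lambda> * (real (Suc k) * h)) * y 0"
        by (simp add: exp_add[symmetric] mult.assoc[symmetric]) (simp add: algebra_simps)
      finally show ?case by (simp add: algebra_simps)
    qed simp
    \<comment> \<open>The step length is such that \<open>Suc n\<close> steps arrive exactly at
      \<open>t\<close>; the successor avoids division by 0.\<close>
    define h where "h n = t * inverse (real (Suc n))" for n
    have hp: "0 < h n" for n using t by (simp add: h_def)
    have h0: "h \<longlonglongrightarrow> 0" unfolding h_def using tendsto_mult[OF tendsto_const[of t] LIMSEQ_inverse_real_of_nat] by simp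
    have hr: "filterlim h (at_right 0) sequentially"
      using h0 hp by (auto simp: filterlim_at less_imp_neq[symmetric] intro!: always_eventually)
    have \<rho>h: "(\<lambda>n. \<rho> (h n)) \<longlonglongrightarrow> 0" by (rule filterlim_compose[OF \<rho>0 hr])
    have \<delta>h: "(\<lambda>n. \<delta> (h n)) \<longlonglongrightarrow> 2 * C * (l2norm M \<phi> * 0) + 0 * (C * (l2norm M g + 0)\<^sup>2)"
      unfolding \<delta>_def by (intro tendsto_add tendsto_mult tendsto_const tendsto_power \<rho>h h0)
    have hn: "real (Suc n) * h n = t" for n
      unfolding h_def by (simp add: field_simps del: of_nat_Suc)
    have "y t \<le> exp (- 2 * \<Lambda> * t) * y 0 + t * \<delta> (h n)" for n
      using iter[OF hp[of n], of "Suc n"] unfolding hn .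
    moreover have "(\<lambda>n. exp (- 2 * \<Lambda> * t) * y 0 + t * \<delta> (h n)) \<longlonglongrightarrow> exp (- 2 * \<Lambda> * t) * y 0 + t * 0"
      using \<delta>h by (intro tendsto_add tendsto_mult tendsto_const) simp
    ultimately have "y t \<le> exp (- 2 * \<Lambda> * t) * y 0 + t * 0"
      by (intro LIMSEQ_le_const) auto
    moreover have "y 0 = e \<phi> \<phi>"
      unfolding y_def using T_0[OF \<phi>] \<phi> by (intro e_null L2_0D(1) T_L2_0) auto
    ultimately show ?thesis by (simp add: y_def)
  qed
  show ?thesis
  proof (cases "t = 0")
    case True
    have "e (T 0 f0) (T 0 f0) = e f0 f0"
      using T_0[OF f0] f0 by (intro e_null L2_0D(1) T_L2_0) auto
    then show ?thesis using True by simp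
  next
    case False
    then have t': "0 < t" using t by simp
    obtain \<phi> where \<phi>: "\<And>n. \<phi> n \<in> D" "L2_tendsto M \<phi> f0" using dense[OF f0] by blast
    have \<phi>0: "\<phi> n \<in> L2_0 M" for n using \<phi>(1) D by auto
    have Tt: "L2_tendsto M (\<lambda>n. T t (\<phi> n)) (T t f0)"
    proof (rule L2_tendstoI, goal_cases)
      case 1 show ?case by (intro L2_0D(1) T_L2_0 t \<phi>0)
    next
      case 2 show ?case by (intro L2_0D(1) T_L2_0 t f0)
    next
      case 3 show ?case
      proof (rule Lim_null_comparison)
        show "(\<lambda>n. l2norm M (\<lambda>z. \<phi> n z - f0 z)) \<longlonglongrightarrow> 0" using \<phi>(2) by (simp add: L2_tendsto_def)
        have "l2norm M (\<lambda>z. T t (\<phi> n) z - T t f0 z) \<le> l2norm M (\<lambda>z. \<phi> n z - f0 z)" for n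
        proof -
          have d: "(\<lambda>z. 1 * \<phi> n z + (- 1) * f0 z) \<in> L2_0 M" by (intro L2_0_lincomb \<phi>0 f0)
          have dT: "(\<lambda>z. 1 * T t (\<phi> n) z + (- 1) * T t f0 z) \<in> L2_0 M" by (intro L2_0_lincomb T_L2_0 t \<phi>0 f0)
          have "l2norm M (\<lambda>z. 1 * T t (\<phi> n) z + (- 1) * T t f0 z) \<le> l2norm M (T t (\<lambda>z. 1 * \<phi> n z + (- 1) * f0 z))"
            using l2norm_diff_le[OF L2_0D(1)[OF T_L2_0[OF t d]] L2_0D(1)[OF dT]] T_lin[OF t \<phi>0[of n] f0, of 1 "- 1"] by linarith
          also have "\<dots> \<le> l2norm M (\<lambda>z. 1 * \<phi> n z + (- 1) * f0 z)" by (rule T_contr[OF t d])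
          finally show ?thesis by simp
        qed
        then show "\<forall>\<^sub>F n in sequentially. norm (l2norm M (\<lambda>z. T t (\<phi> n) z - T t f0 z)) \<le> l2norm M (\<lambda>z. \<phi> n z - f0 z)" by simp
      qed
    qed
    show ?thesis
    proof (rule LIMSEQ_le)
      show "(\<lambda>n. e (T t (\<phi> n)) (T t (\<phi> n))) \<longlonglongrightarrow> e (T t f0) (T t f0)" by (rule e_tendsto[OF Tt Tt])
      show "(\<lambda>n. exp (- 2 * \<Lambda> * t) * e (\<phi> n) (\<phi> n)) \<longlonglongrightarrow> exp (- 2 * \<Lambda> * t) * e f0 f0"
        by (intro tendsto_mult tendsto_const e_tendsto \<phi>)
    qed (use core[OF \<phi>(1) t'] in blast)
  qed
qed

end

section \<open>Application to the Langevin semigroup\<close>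

lemma coercive_bounded_below:
  fixes U :: "'a::euclidean_space \<Rightarrow> real"
  assumes c: "continuous_on UNIV U" and lim: "filterlim U at_top at_infinity"
  obtains b where "\<And>x. - b \<le> U x"
proof -
  have "eventually (\<lambda>x. 0 \<le> U x) at_infinity" using lim by (simp add: filterlim_at_top)
  then obtain R where R: "\<And>x. R \<le> norm x \<Longrightarrow> 0 \<le> U x" by (auto simp: eventually_at_infinity)
  have "compact (U ` cball 0 R)"
    by (rule compact_continuous_image) (auto intro: continuous_on_subset[OF c])
  then obtain B where B: "\<And>x. x \<in> cball 0 R \<Longrightarrow> \<bar>U x\<bar> \<le> B"
    by (meson bounded_real compact_imp_bounded imageI)
  show ?thesis
  proof (rule that[of "max B 0"])
    fix x
    show "- max B 0 \<le> U x" using B[of x] R[of x] by (cases "norm x \<le> R") auto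
  qed
qed

context langevin
begin

lemma gibbs_eq: "gibbs U = \<mu>"
proof -
  have "- UU z = - U (fst z) - (norm (snd z))\<^sup>2 / 2" for z by (simp add: UU_def nsq_def)
  then show ?thesis unfolding gibbs_def gm_def by (simp add: case_prod_unfold)
qed

text \<open>Density without the mean constraint is corrected by a multiple of one fixed test
  function of nonzero mean. The means of the approximations tend to 0, hence so do the
  multiples.\<close>

lemma core_dense:
  assumes f: "f \<in> L2_0 \<mu>"
  shows "\<exists>\<phi>. (\<forall>n. \<phi> n \<in> Cc_infty \<inter> L2_0 \<mu>) \<and> L2_tendsto \<mu> \<phi> f"
proof -
  have one: "(\<lambda>z. 1) \<in> L2 \<mu>" by (rule M.L2_const)
  obtain \<psi> where \<psi>: "\<And>n. \<psi> n \<in> Cc_infty" "L2_tendsto \<mu> \<psi> (\<lambda>z. 1)" using M.Cc_infty_dense[OF one] by blast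
  have "(\<lambda>n. ip \<mu> (\<psi> n) (\<lambda>z. 1)) \<longlonglongrightarrow> ip \<mu> (\<lambda>z. 1) (\<lambda>z. 1)"
    by (rule L2_tendsto_ip[OF \<psi>(2) L2_tendsto_const[OF one]])
  then have "(\<lambda>n. integral\<^sup>L \<mu> (\<psi> n)) \<longlonglongrightarrow> 1" by (simp add: ip_def M.prob_space[simplified])
  from LIMSEQ_D[OF this, of 1] obtain n where "\<bar>integral\<^sup>L \<mu> (\<psi> n) - 1\<bar> < 1" by auto
  then have k: "integral\<^sup>L \<mu> (\<psi> n) \<noteq> 0" by auto
  define \<eta> where "\<eta> = \<psi> n"
  have CL: "g \<in> L2 \<mu>" "integrable \<mu> g" if "g \<in> Cc_infty" for g
    using that M.L2_Cck[of g 0] M.integrable_Cck[of g 0] by (auto simp: Cc_infty_iff)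
  obtain \<phi> where \<phi>: "\<And>n. \<phi> n \<in> Cc_infty" "L2_tendsto \<mu> \<phi> f"
    using M.Cc_infty_dense[OF L2_0D(1)[OF f]] by blast
  define c where "c n = - (integral\<^sup>L \<mu> (\<phi> n) / integral\<^sup>L \<mu> \<eta>)" for n
  have "(\<lambda>n. ip \<mu> (\<phi> n) (\<lambda>z. 1)) \<longlonglongrightarrow> ip \<mu> f (\<lambda>z. 1)"
    by (rule L2_tendsto_ip[OF \<phi>(2) L2_tendsto_const[OF one]])
  then have "(\<lambda>n. integral\<^sup>L \<mu> (\<phi> n)) \<longlonglongrightarrow> 0" using L2_0D(2)[OF f] by (simp add: ip_def)
  then have "(\<lambda>n. - (integral\<^sup>L \<mu> (\<phi> n) / integral\<^sup>L \<mu> \<eta>)) \<longlonglongrightarrow> - (0 / integral\<^sup>L \<mu> \<eta>)"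
    using k by (intro tendsto_minus tendsto_divide tendsto_const) (auto simp: \<eta>_def)
  then have c0: "c \<longlonglongrightarrow> 0" by (simp add: c_def[abs_def])
  have \<eta>: "\<eta> \<in> Cc_infty" using \<psi>(1) by (simp add: \<eta>_def)
  define \<theta> where "\<theta> n z = \<phi> n z + c n * \<eta> z" for n z
  have \<theta>C: "\<theta> n \<in> Cc_infty" for n
    using \<phi>(1)[of n] \<eta> unfolding \<theta>_def Cc_infty_iff by (auto intro!: Cck_add Cck_cmult)
  have "integral\<^sup>L \<mu> (\<theta> n) = 0" for n
    using CL(2)[OF \<phi>(1)[of n]] CL(2)[OF \<eta>] k by (simp add: \<theta>_def[abs_def] c_def \<eta>_def)
  then have \<theta>D: "\<theta> n \<in> Cc_infty \<inter> L2_0 \<mu>" for n using \<theta>C CL(1) by (simp add: L2_0_def)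
  have "L2_tendsto \<mu> \<theta> f"
  proof (rule L2_tendstoI)
    show "\<theta> n \<in> L2 \<mu>" for n by (rule CL(1)[OF \<theta>C])
    show "f \<in> L2 \<mu>" by (rule L2_0D(1)[OF f])
    show "(\<lambda>n. l2norm \<mu> (\<lambda>z. \<theta> n z - f z)) \<longlonglongrightarrow> 0"
    proof (rule Lim_null_comparison)
      have "(\<lambda>n. l2norm \<mu> (\<lambda>z. \<phi> n z - f z) + \<bar>c n\<bar> * l2norm \<mu> \<eta>) \<longlonglongrightarrow> 0 + \<bar>0\<bar> * l2norm \<mu> \<eta>"
        using \<phi>(2) by (intro tendsto_add tendsto_mult tendsto_rabs tendsto_const c0) (simp add: L2_tendsto_def)
      then show "(\<lambda>n. l2norm \<mu> (\<lambda>z. \<phi> n z - f z) + \<bar>c n\<bar> * l2norm \<mu> \<eta>) \<longlonglongrightarrow> 0" by simp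
      have "l2norm \<mu> (\<lambda>z. \<theta> n z - f z) \<le> l2norm \<mu> (\<lambda>z. \<phi> n z - f z) + \<bar>c n\<bar> * l2norm \<mu> \<eta>" for n
      proof -
        have "(\<lambda>z. \<theta> n z - f z) = (\<lambda>z. (\<phi> n z - f z) + c n * \<eta> z)" by (auto simp: \<theta>_def)
        then show ?thesis
          using l2norm_triangle[OF L2_diff[OF CL(1)[OF \<phi>(1)[of n]] L2_0D(1)[OF f]] L2_cmult[OF CL(1)[OF \<eta>], of "c n"]]
          by (simp add: l2norm_cmult)
      qed
      then show "\<forall>\<^sub>F n in sequentially. norm (l2norm \<mu> (\<lambda>z. \<theta> n z - f z)) \<le> l2norm \<mu> (\<lambda>z. \<phi> n z - f z) + \<bar>c n\<bar> * l2norm \<mu> \<eta>"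
        by simp
    qed
  qed
  with \<theta>D show ?thesis by blast
qed

text \<open>Invariance of the Gibbs measure: the constant 1 is annihilated by transport and has no
  velocity derivative.\<close>

lemma L_L2_0:
  assumes f: "f \<in> Cck 2" shows "L f \<in> L2_0 \<mu>"
proof -
  have "ip \<mu> (L f) (\<lambda>z. 1) = 0"
    unfolding ip_L[OF f Ck_const M.L2_const] by (simp add: A_def ip_def)
  then show ?thesis using M.L2_Cck[OF L_Cck[OF f]] by (simp add: L2_0_def ip_def)
qed

lemma semigroup_decay:
  assumes T_sg: "contraction_semigroup_L2_0 \<mu> P"
    and T_gen: "\<And>f g. sg_generator_graph \<mu> P f g \<longleftrightarrow> closure_graph \<mu> (Cc_infty \<inter> L2_0 \<mu>) (langevin_op U \<gamma>) f g"
    and f: "f \<in> L2_0 \<mu>" and t: "0 \<le> t"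
  shows "l2norm \<mu> (P t f) \<le> sqrt 3 * exp (- (m / (3 * \<gamma>)) * t) * l2norm \<mu> f"
proof -
  interpret sg: L2_semigroup \<mu> P by unfold_locales (rule T_sg)
  have "E (P t f) (P t f) \<le> exp (- 2 * (m / (3 * \<gamma>)) * t) * E f f"
  proof (rule sg.form_decay[where e = E and C = "3 / 4", OF T_gen])
    fix g assume g: "g \<in> Cc_infty \<inter> L2_0 \<mu>"
    then have g2: "g \<in> Cck 2" by (simp add: Cc_infty_iff)
    show "langevin_op U \<gamma> g \<in> L2_0 \<mu>" unfolding L_eq_langevin_op[OF g2] by (rule L_L2_0[OF g2])
    show "E g (langevin_op U \<gamma> g) \<le> - (m / (3 * \<gamma>)) * E g g"
      unfolding L_eq_langevin_op[OF g2] by (rule E_dissipation[OF g2]) (use g in \<open>simp add: L2_0_def\<close>)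
  next
    fix g assume "g \<in> L2 \<mu>"
    then show "0 \<le> E g g" using E_lower[of g] zero_le_power2[of "l2norm \<mu> g"] by linarith
  qed (use core_dense E_lincomb E_commute E_bounded f t m_pos \<gamma>_pos in auto)
  moreover have "(l2norm \<mu> (P t f))\<^sup>2 / 4 \<le> E (P t f) (P t f)"
    by (intro E_lower L2_0D(1) sg.T_L2_0 t f)
  moreover have "exp (- 2 * (m / (3 * \<gamma>)) * t) * E f f \<le> exp (- 2 * (m / (3 * \<gamma>)) * t) * (3 / 4 * (l2norm \<mu> f)\<^sup>2)"
    using E_bounded[OF L2_0D(1)[OF f] L2_0D(1)[OF f]] by (intro mult_left_mono) (auto simp: power2_eq_square)
  ultimately have "(l2norm \<mu> (P t f))\<^sup>2 \<le> 3 * exp (- 2 * (m / (3 * \<gamma>)) * t) * (l2norm \<mu> f)\<^sup>2" by linarith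
  also have "exp (- 2 * (m / (3 * \<gamma>)) * t) = (exp (- (m / (3 * \<gamma>)) * t))\<^sup>2"
    by (simp add: exp_double[symmetric] mult.assoc)
  also have "3 * (exp (- (m / (3 * \<gamma>)) * t))\<^sup>2 * (l2norm \<mu> f)\<^sup>2 = (sqrt 3 * exp (- (m / (3 * \<gamma>)) * t) * l2norm \<mu> f)\<^sup>2"
    by (simp add: power_mult_distrib)
  finally show ?thesis by (rule power2_le_imp_le) simp
qed

end

theorem theorem1p1:
  fixes U :: "'a::euclidean_space \<Rightarrow> real"
    and m K \<gamma> :: real
    and T :: "real \<Rightarrow> ('a \<times> 'a \<Rightarrow> real) \<Rightarrow> ('a \<times> 'a \<Rightarrow> real)"
  assumes U_C2: "Ck 2 U"
    and U_coercive: "filterlim U at_top at_infinity"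
    and U_normalizable: "integrable lborel (\<lambda>x. exp (- U x))"
    and m_pos: "m > 0"
    and poincare: "\<And>g. g \<in> L2 (gibbs_x U) \<Longrightarrow> integral\<^sup>L (gibbs_x U) g = 0 \<Longrightarrow>
        (\<forall>x. g differentiable (at x)) \<Longrightarrow>
        (\<forall>i\<in>Basis. continuous_on UNIV (\<lambda>x. frechet_derivative g (at x) i)) \<Longrightarrow>
        integrable (gibbs_x U) (\<lambda>x. \<Sum>i\<in>Basis. (frechet_derivative g (at x) i)\<^sup>2) \<Longrightarrow>
        (\<integral>x. (g x)\<^sup>2 \<partial>gibbs_x U)
          \<le> (1 / m) * (\<integral>x. (\<Sum>i\<in>Basis. (frechet_derivative g (at x) i)\<^sup>2) \<partial>gibbs_x U)"
    and K_nonneg: "K \<ge> 0"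
    and hessian_lb: "\<And>x w. frechet_derivative (\<lambda>y. frechet_derivative U (at y) w) (at x) w
                             \<ge> - K * (norm w)\<^sup>2"
    and gamma_def: "\<gamma> = sqrt (16 * m + 2 * K)"
    and T_sg: "contraction_semigroup_L2_0 (gibbs U) T"
    and T_gen: "\<And>f g. sg_generator_graph (gibbs U) T f g \<longleftrightarrow>
        closure_graph (gibbs U) (Cc_infty \<inter> L2_0 (gibbs U)) (langevin_op U \<gamma>) f g"
  shows "let \<Lambda> = (1 / 6) * sqrt m / (sqrt (2 + K / (2 * m)) + sqrt (4 + K / (2 * m)))
         in (\<forall>f0 \<in> L2_0 (gibbs U). \<forall>t\<ge>0.
               l2norm (gibbs U) (T t f0) \<le> sqrt 3 * exp (- \<Lambda> * t) * l2norm (gibbs U) f0)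
            \<and> (K = 0 \<longrightarrow> \<Lambda> = (2 - sqrt 2) / 12 * sqrt m)"
proof -
  obtain b where b: "\<And>x. - b \<le> U x"
    using coercive_bounded_below[OF Ck_continuous[OF U_C2] U_coercive] by blast
  have pos: "0 < 16 * m + 2 * K" using m_pos K_nonneg by simp
  interpret lv: langevin U m K \<gamma> b
  proof
    show "\<gamma>\<^sup>2 = 16 * m + 2 * K" "0 < \<gamma>" using pos by (simp_all add: gamma_def)
    show "- K * (norm w)\<^sup>2 \<le> pd (pd U w) w x" for x w using hessian_lb[where x=x and w=w] by (simp add: pd_def)
    fix g assume g: "g \<in> L2 (gm U)" "integral\<^sup>L (gm U) g = 0" "Ck 1 g"
      "integrable (gm U) (\<lambda>x. \<Sum>i\<in>Basis. (pd g i x)\<^sup>2)"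
    have gx: "gibbs_x U = gm U" by (simp add: gibbs_x_def gm_def)
    have "g differentiable at x" for x using g(3) by (auto intro: Ck_differentiable)
    moreover have "continuous_on UNIV (\<lambda>x. frechet_derivative g (at x) i)" if "i \<in> Basis" for i
      using Ck_pd'[OF g(3), of 0 i] that by (simp add: Ck_0 pd_def)
    ultimately show "(\<integral>x. (g x)\<^sup>2 \<partial>gm U) \<le> (1 / m) * (\<integral>x. (\<Sum>i\<in>Basis. (pd g i x)\<^sup>2) \<partial>gm U)"
      using poincare[of g] g by (simp add: gx pd_def)
  qed (use U_C2 U_normalizable m_pos K_nonneg b in auto)
  define \<Lambda> where "\<Lambda> = (1 / 6) * sqrt m / (sqrt (2 + K / (2 * m)) + sqrt (4 + K / (2 * m)))"
  \<comment> \<open>Since \<gamma> = 2 sqrt m s, the proved rate equals sqrt m / (6 s). The claimed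
    one has the additional positive summand \<open>sqrt (2 + K / (2 * m))\<close> in its
    denominator.\<close>
  have rate: "\<Lambda> \<le> m / (3 * \<gamma>)"
  proof -
    define s where "s = sqrt (4 + K / (2 * m))"
    have s: "0 < s" using m_pos K_nonneg by (simp add: s_def add_pos_nonneg)
    have "16 * m + 2 * K = (4 * m) * (4 + K / (2 * m))" using m_pos by (simp add: field_simps)
    then have "\<gamma> = 2 * sqrt m * s" by (simp add: gamma_def s_def real_sqrt_mult)
    then have "m / (3 * \<gamma>) = (sqrt m * sqrt m) / ((6 * s) * sqrt m)" using m_pos by simp
    also have "\<dots> = sqrt m / (6 * s)" using m_pos by (intro nonzero_mult_divide_mult_cancel_right) simp
    finally have e: "m / (3 * \<gamma>) = sqrt m / (6 * s)" .
    have "\<Lambda> = sqrt m / (6 * (sqrt (2 + K / (2 * m)) + s))" by (simp add: \<Lambda>_def s_def)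
    also have "\<dots> \<le> sqrt m / (6 * s)"
      using s m_pos K_nonneg by (intro divide_left_mono mult_pos_pos) (auto intro: add_nonneg_pos)
    finally show ?thesis unfolding e .
  qed
  have "l2norm (gibbs U) (T t f0) \<le> sqrt 3 * exp (- \<Lambda> * t) * l2norm (gibbs U) f0"
    if f0: "f0 \<in> L2_0 (gibbs U)" and t: "0 \<le> t" for f0 t
  proof -
    have "l2norm (gibbs U) (T t f0) \<le> sqrt 3 * exp (- (m / (3 * \<gamma>)) * t) * l2norm (gibbs U) f0"
      using lv.semigroup_decay[OF T_sg[unfolded lv.gibbs_eq] T_gen[unfolded lv.gibbs_eq] f0[unfolded lv.gibbs_eq] t]
      unfolding lv.gibbs_eq .
    also have "\<dots> \<le> sqrt 3 * exp (- \<Lambda> * t) * l2norm (gibbs U) f0"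
      using mult_right_mono[OF rate t] by (intro mult_right_mono mult_left_mono) auto
    finally show ?thesis .
  qed
  moreover have "\<Lambda> = (2 - sqrt 2) / 12 * sqrt m" if "K = 0"
  proof -
    have "(2 - sqrt 2) * (sqrt 2 + 2) = 2" by (simp add: algebra_simps)
    moreover have "0 < sqrt 2 + (2 :: real)" by (simp add: add_nonneg_pos)
    ultimately have inv: "1 / (sqrt 2 + 2) = (2 - sqrt 2) / 2" by (simp add: divide_simps)
    have "\<Lambda> = sqrt m / 6 * (1 / (sqrt 2 + 2))" using that by (simp add: \<Lambda>_def)
    then show ?thesis unfolding inv by simp
  qed
  ultimately show ?thesis unfolding Let_def \<Lambda>_def[symmetric] by blast
qed

end
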